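(* Let $G$ be the group of M\"obius transformations preserving the unit disk $D$, and let $K\subset G$ be the subgroup of rotations. There is a one-to-one correspondence between bounded non-constant harmonic functions $h$ on $D$ and nontrivial irreducible affine subsystems $(Q,G)$ of $L^\infty(G)$, namely $$h\longleftrightarrow Q=Q_h,$$ where $\tilde h$, the lift of $h$ to $G$, is the unique $K$-invariant function in $Q$. That is, for every bounded non-constant harmonic $h$ the system $(Q_h,G)$ is a nontrivial irreducible affine system whose unique $K$-invariant element is $\tilde h$, and the map $h\mapsto Q_h$ is a bijection from the set of bounded non-constant harmonic functions on $D$ onto the set of nontrivial irreducible affine subsystems of $L^\infty(G)$. Moreover, all the affine systems $(Q_h,G)$ are isomorphic (by $G$-equivariant affine homeomorphisms) to the universal irreducible affine system $(M(S^1),G)=(M(\Pi_s(G)),G)$.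
   Context: $D=\{z\in\mathbb{C}:|z|<1\}$, $S^1=\{\zeta\in\mathbb{C}:|\zeta|=1\}$, and $G=\{z\mapsto \frac{az+\bar c}{cz+\bar a} : a,c\in\mathbb{C},\ a\bar a-c\bar c=1\}$, a locally compact unimodular group with Haar measure $dg$. $K$ is the subgroup of rotations $z\mapsto \zeta z$, $|\zeta|=1$. $D$ is identified with $G/K$ via $g\mapsto g(0)$. A real valued (continuous) function $h$ on $D$ is harmonic if for every $z\in D$, $h(z)=\int_{S^1}h(z+r\zeta)\,d\zeta$ for every sufficiently small $r>0$, where $d\zeta$ is normalized arc length measure. $L^\infty(G)$ is the (real) dual of $L^1(G)$, equipped with the weak$^*$ topology. $G$ acts on $L^\infty(G)$ by $f\mapsto {}^{g'}\!f$, ${}^{g'}\!f(g)=f(gg')$ for $g,g'\in G$; this action preserves each ball $B_R$ of radius $R$ centered at the origin, which is weak$^*$ compact and metrizable. An affine subsystem of $L^\infty(G)$ is a nonempty weak$^*$ compact (equivalently, norm-bounded and weak$^*$ closed) convex $G$-invariant subset $Q\subset L^\infty(G)$ with this action. It is irreducible if the only nonempty weak$^*$ closed convex $G$-invariant subset of $Q$ is $Q$ itself, and nontrivial if it has more than one point. An element $F\in L^\infty(G)$ is $K$-invariant if ${}^{k}F=F$ for all $k\in K$. For bounded harmonic $h$ on $D$, its lift $\tilde h\in L^\infty(G)$ is $\tilde h(g)=h(g(0))$, and $Q_h$ is the weak$^*$ closed convex hull of $\{{}^{g}\tilde h: g\in G\}$ in $L^\infty(G)$. $M(S^1)$ is the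 space of Borel probability measures on $S^1$ with the weak$^*$ topology and the push-forward action of $G$. $\Pi_s(G)$ denotes the universal minimal strongly proximal $G$-system (the minimal strongly proximal $G$-system having all minimal strongly proximal $G$-systems as factors; a system $(X,G)$ is strongly proximal if every $\mu\in M(X)$ has a point mass in the closure of its $G$-orbit); it is a known theorem of Furstenberg that $\Pi_s(G)=S^1$ for this group. That $(M(S^1),G)$ is the universal irreducible affine system means that it is irreducible and every irreducible affine $G$-system is an image of it under a continuous affine equivariant surjection. *)

theory Defs
  imports "HOL-Probability.Probability"
begin

section \<open>The group of Moebius transformations of the disk\<close>

abbreviation disk :: "complex set" where
  "disk \<equiv> ball 0 1"

abbreviation circle :: "complex set" where
  "circle \<equiv> sphere 0 1"

definition SU11 :: "(complex \<times> complex) set" where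
  "SU11 = {(a, c). a * cnj a - c * cnj c = 1}"

text \<open>Transformations are recorded by their restriction to the closed disk, where the denominator
  does not vanish, so that equality and composition are those of maps of the closed disk.\<close>

definition moebius_map :: "complex \<times> complex \<Rightarrow> complex \<Rightarrow> complex" where
  "moebius_map = (\<lambda>(a, c). \<lambda>z\<in>cball 0 1. (a * z + cnj c) / (c * z + cnj a))"

typedef moebius = "moebius_map ` SU11"
  morphisms moebius_apply Abs_moebius
proof -
  have "(1, 0) \<in> SU11" by (simp add: SU11_def)
  then show ?thesis by blast
qed

lemma SU11_norm: "(a, c) \<in> SU11 \<longleftrightarrow> (norm a)\<^sup>2 = 1 + (norm c)\<^sup>2"
proof -
  have "(a, c) \<in> SU11 \<longleftrightarrow> complex_of_real ((norm a)\<^sup>2 - (norm c)\<^sup>2) = complex_of_real 1"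
    by (simp add: SU11_def complex_mult_cnj cmod_power2 flip: of_real_power)
  also have "\<dots> \<longleftrightarrow> (norm a)\<^sup>2 = 1 + (norm c)\<^sup>2"
    unfolding of_real_eq_iff by linarith
  finally show ?thesis .
qed

lemma SU11_denominator:
  assumes "(a, c) \<in> SU11" "norm z \<le> 1"
  shows "c * z + cnj a \<noteq> 0"
proof
  assume "c * z + cnj a = 0"
  then have "cnj a = - (c * z)" by (simp add: add_eq_0_iff)
  then have "norm a = norm c * norm z"
    by (metis complex_mod_cnj norm_minus_cancel norm_mult)
  also have "\<dots> \<le> norm c" using assms(2) by (simp add: mult_left_le)
  finally have "(norm a)\<^sup>2 \<le> (norm c)\<^sup>2" by (simp add: power_mono)
  then show False using assms(1) unfolding SU11_norm by linarith
qed

lemma SU11_norm_identity: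
  assumes "(a, c) \<in> SU11"
  shows "(norm (c * z + cnj a))\<^sup>2 - (norm (a * z + cnj c))\<^sup>2 = 1 - (norm z)\<^sup>2"
proof -
  have "complex_of_real ((norm (c * z + cnj a))\<^sup>2 - (norm (a * z + cnj c))\<^sup>2)
      = (c * z + cnj a) * cnj (c * z + cnj a) - (a * z + cnj c) * cnj (a * z + cnj c)"
    by (simp only: complex_norm_square of_real_diff)
  also have "\<dots> = (a * cnj a - c * cnj c) * (1 - z * cnj z)"
    by (simp add: algebra_simps)
  also have "\<dots> = complex_of_real (1 - (norm z)\<^sup>2)"
    using assms by (simp add: SU11_def complex_norm_square del: of_real_power)
  finally show ?thesis unfolding of_real_eq_iff .
qed

lemma moebius_map_cball:
  assumes "p \<in> SU11" "z \<in> cball 0 1"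
  shows "moebius_map p z \<in> cball 0 1"
proof -
  obtain a c where p: "p = (a, c)" by force
  have ac: "(a, c) \<in> SU11" using assms p by simp
  have z: "norm z \<le> 1" using assms by simp
  have "(norm z)\<^sup>2 \<le> 1" using z by (simp add: power_le_one)
  then have "(norm (a * z + cnj c))\<^sup>2 \<le> (norm (c * z + cnj a))\<^sup>2"
    using SU11_norm_identity[OF ac, of z] by linarith
  then have "norm (a * z + cnj c) \<le> norm (c * z + cnj a)"
    using power2_le_imp_le norm_ge_zero by blast
  then show ?thesis
    using z SU11_denominator[OF ac z] by (simp add: p moebius_map_def norm_divide)
qed

definition SU11_mult :: "complex \<times> complex \<Rightarrow> complex \<times> complex \<Rightarrow> complex \<times> complex" where
  "SU11_mult = (\<lambda>(a, c) (a', c'). (a * a' + cnj c * c', c * a' + cnj a * c'))"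

lemma SU11_mult_closed:
  assumes "p \<in> SU11" "q \<in> SU11"
  shows "SU11_mult p q \<in> SU11"
proof -
  obtain a c a' c' where pq: "p = (a, c)" "q = (a', c')" by force
  have "(a * a' + cnj c * c') * cnj (a * a' + cnj c * c')
      - (c * a' + cnj a * c') * cnj (c * a' + cnj a * c')
      = (a * cnj a - c * cnj c) * (a' * cnj a' - c' * cnj c')"
    by (simp add: algebra_simps)
  also have "\<dots> = 1" using assms by (simp add: pq SU11_def)
  finally show ?thesis by (simp add: pq SU11_def SU11_mult_def)
qed

lemma moebius_map_mult:
  assumes "p \<in> SU11" "q \<in> SU11"
  shows "compose (cball 0 1) (moebius_map p) (moebius_map q) = moebius_map (SU11_mult p q)"
proof
  fix z
  obtain a c a' c' where pq: "p = (a, c)" "q = (a', c')" by force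
  show "compose (cball 0 1) (moebius_map p) (moebius_map q) z = moebius_map (SU11_mult p q) z"
  proof (cases "z \<in> cball 0 1")
    case False
    then show ?thesis by (simp add: compose_def moebius_map_def SU11_mult_def pq)
  next
    case True
    let ?w = "moebius_map q z" and ?d = "c' * z + cnj a'"
    have w: "?w \<in> cball 0 1" using moebius_map_cball[OF assms(2) True] .
    have wd: "?w * ?d = a' * z + cnj c'" and d: "?d \<noteq> 0"
      using SU11_denominator[of a' c' z] assms True by (auto simp: moebius_map_def pq)
    have "moebius_map p ?w = (a * ?w + cnj c) / (c * ?w + cnj a)"
      using w by (simp add: moebius_map_def pq)
    also have "\<dots> = ((a * ?w + cnj c) * ?d) / ((c * ?w + cnj a) * ?d)"
      using d by simp
    also have "(a * ?w + cnj c) * ?d = a * (?w * ?d) + cnj c * ?d"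
      by (simp add: algebra_simps)
    also have "(c * ?w + cnj a) * ?d = c * (?w * ?d) + cnj a * ?d"
      by (simp add: algebra_simps)
    also have "(a * (?w * ?d) + cnj c * ?d) / (c * (?w * ?d) + cnj a * ?d)
        = moebius_map (SU11_mult p q) z"
      unfolding wd using True by (simp add: moebius_map_def SU11_mult_def pq algebra_simps)
    finally show ?thesis using True by (simp add: compose_def)
  qed
qed

instantiation moebius :: monoid_mult
begin

definition one_moebius :: moebius where
  "1 = Abs_moebius (\<lambda>z\<in>cball 0 1. z)"

definition times_moebius :: "moebius \<Rightarrow> moebius \<Rightarrow> moebius" where
  "g * h = Abs_moebius (compose (cball 0 1) (moebius_apply g) (moebius_apply h))"

lemma moebius_apply_one: "moebius_apply 1 = (\<lambda>z\<in>cball 0 1. z)"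
proof -
  have "(\<lambda>z\<in>cball 0 1. z) = moebius_map (1, 0)" "(1, 0) \<in> SU11"
    by (auto simp: moebius_map_def SU11_def)
  then show ?thesis by (simp add: one_moebius_def Abs_moebius_inverse)
qed

lemma moebius_apply_mult:
  "moebius_apply (g * h) = compose (cball 0 1) (moebius_apply g) (moebius_apply h)"
proof -
  obtain p q where "p \<in> SU11" "q \<in> SU11" "moebius_apply g = moebius_map p"
      "moebius_apply h = moebius_map q"
    using moebius_apply by (metis imageE)
  then have "compose (cball 0 1) (moebius_apply g) (moebius_apply h) \<in> moebius_map ` SU11"
    by (simp add: moebius_map_mult SU11_mult_closed)
  then show ?thesis by (simp add: times_moebius_def Abs_moebius_inverse)
qed

lemma moebius_apply_cball: "z \<in> cball 0 1 \<Longrightarrow> moebius_apply g z \<in> cball 0 1"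
  using moebius_apply[of g] moebius_map_cball by auto

lemma moebius_apply_extensional: "moebius_apply g \<in> extensional (cball 0 1)"
  using moebius_apply[of g] by (auto simp: moebius_map_def)

instance
proof
  fix f g h :: moebius
  have "moebius_apply (f * g * h) = moebius_apply (f * (g * h))"
    unfolding moebius_apply_mult using moebius_apply_cball
    by (intro compose_assoc[symmetric]) auto
  then show "f * g * h = f * (g * h)" by (simp add: moebius_apply_inject)
  have "moebius_apply (1 * f) = moebius_apply f"
    unfolding moebius_apply_mult moebius_apply_one
    by (rule Id_compose) (use moebius_apply_cball moebius_apply_extensional in auto)
  then show "1 * f = f" by (simp add: moebius_apply_inject)
  have "moebius_apply (f * 1) = moebius_apply f"
    unfolding moebius_apply_mult moebius_apply_one
    by (rule compose_Id) (use moebius_apply_cball moebius_apply_extensional in auto)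
  then show "f * 1 = f" by (simp add: moebius_apply_inject)
qed

end

lemma moebius_inverse_exists: "\<exists>g'. g' * g = 1 \<and> g * g' = (1 :: moebius)"
proof -
  obtain a c where ac: "(a, c) \<in> SU11" and g: "moebius_apply g = moebius_map (a, c)"
    using moebius_apply[of g] by auto
  have ac': "(cnj a, - c) \<in> SU11" using ac by (simp add: SU11_norm)
  have g': "moebius_apply (Abs_moebius (moebius_map (cnj a, - c))) = moebius_map (cnj a, - c)"
    using ac' by (simp add: Abs_moebius_inverse)
  have one: "moebius_apply 1 = moebius_map (1, 0)"
    by (auto simp: moebius_apply_one moebius_map_def)
  have "SU11_mult (cnj a, - c) (a, c) = (1, 0)" "SU11_mult (a, c) (cnj a, - c) = (1, 0)"
    using ac by (auto simp: SU11_mult_def SU11_def algebra_simps)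
  then have "Abs_moebius (moebius_map (cnj a, - c)) * g = 1"
      "g * Abs_moebius (moebius_map (cnj a, - c)) = 1"
    using ac ac' by (simp_all flip: moebius_apply_inject
        add: moebius_apply_mult g g' one moebius_map_mult)
  then show ?thesis by blast
qed

text \<open>The topology of the group is the quotient topology from the parameters \<^term>\<open>(a, c)\<close>.\<close>

instantiation moebius :: topological_space
begin

definition open_moebius :: "moebius set \<Rightarrow> bool" where
  "open U \<longleftrightarrow> openin (top_of_set SU11) {p \<in> SU11. Abs_moebius (moebius_map p) \<in> U}"

instance
proof
  show "open (UNIV :: moebius set)" by (simp add: open_moebius_def)
  fix S T :: "moebius set" assume "open S" "open T"
  moreover have "{p \<in> SU11. Abs_moebius (moebius_map p) \<in> S \<inter> T}
      = {p \<in> SU11. Abs_moebius (moebius_map p) \<in> S} \<inter> {p \<in> SU11. Abs_moebius (moebius_map p) \<in> T}"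
    by blast
  ultimately show "open (S \<inter> T)" by (simp add: open_moebius_def openin_Int)
next
  fix \<U> :: "moebius set set" assume "\<forall>S\<in>\<U>. open S"
  moreover have "{p \<in> SU11. Abs_moebius (moebius_map p) \<in> \<Union>\<U>}
      = (\<Union>S\<in>\<U>. {p \<in> SU11. Abs_moebius (moebius_map p) \<in> S})"
    by blast
  ultimately show "open (\<Union>\<U>)" by (auto simp: open_moebius_def intro!: openin_Union)
qed

end

definition rotations :: "moebius set" where
  "rotations = {k. \<exists>\<zeta>\<in>circle. \<forall>z\<in>cball 0 1. moebius_apply k z = \<zeta> * z}"

text \<open>Regularity of the measure is automatic, the group being locally compact and second countable;
  right invariance is automatic by unimodularity.\<close>

definition haar_measure :: "moebius measure \<Rightarrow> bool" where
  "haar_measure m \<longleftrightarrow> sets m = sets borel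
     \<and> (\<forall>g. distr m borel (\<lambda>x. g * x) = m)
     \<and> (\<forall>C. compact C \<longrightarrow> emeasure m C < \<infinity>)
     \<and> emeasure m UNIV \<noteq> 0"

text \<open>Haar measures exist and are unique up to a positive factor, which affects neither the space
  \<open>L\<^sup>\<infinity>\<close> below nor its topology.\<close>

definition haar :: "moebius measure" where
  "haar = (SOME m. haar_measure m)"


section \<open>The space \<open>L\<^sup>\<infinity>\<close> with its weak* topology\<close>

definition linf_rel :: "(moebius \<Rightarrow> real) \<Rightarrow> (moebius \<Rightarrow> real) \<Rightarrow> bool" where
  "linf_rel f f' \<longleftrightarrow> f \<in> borel_measurable haar \<and> f' \<in> borel_measurable haar
     \<and> (\<exists>B. AE x in haar. \<bar>f x\<bar> \<le> B) \<and> (AE x in haar. f x = f' x)"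

quotient_type linf = "moebius \<Rightarrow> real" / partial: linf_rel
proof (rule part_equivpI)
  show "\<exists>f. linf_rel f f"
    by (rule exI[of _ "\<lambda>_. 0"]) (auto simp: linf_rel_def)
  show "symp linf_rel"
  proof (rule sympI)
    fix f g assume a: "linf_rel f g"
    then obtain B where "AE x in haar. \<bar>f x\<bar> \<le> B" "AE x in haar. f x = g x"
      by (auto simp: linf_rel_def)
    then have "AE x in haar. \<bar>g x\<bar> \<le> B" "AE x in haar. g x = f x"
      by (eventually_elim, simp)+
    then show "linf_rel g f" using a by (auto simp: linf_rel_def)
  qed
  show "transp linf_rel"
    by (rule transpI) (auto simp: linf_rel_def elim: AE_mp)
qed

lemma linf_rel_ext: "linf_rel f f \<Longrightarrow> (\<And>x. f x = g x) \<Longrightarrow> linf_rel f g"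
  by (metis ext)

lemma linf_rel_zero: "linf_rel (\<lambda>_. 0) (\<lambda>_. 0)"
  by (auto simp: linf_rel_def)

lemma linf_rel_add:
  assumes "linf_rel f f'" "linf_rel g g'"
  shows "linf_rel (\<lambda>x. f x + g x) (\<lambda>x. f' x + g' x)"
proof -
  obtain B C where "AE x in haar. \<bar>f x\<bar> \<le> B" "AE x in haar. \<bar>g x\<bar> \<le> C"
    using assms by (auto simp: linf_rel_def)
  then have "AE x in haar. \<bar>f x + g x\<bar> \<le> B + C" by eventually_elim linarith
  then show ?thesis using assms by (auto simp: linf_rel_def)
qed

lemma linf_rel_scale:
  assumes "linf_rel f f'"
  shows "linf_rel (\<lambda>x. r * f x) (\<lambda>x. r * f' x)"
proof -
  obtain B where "AE x in haar. \<bar>f x\<bar> \<le> B" using assms by (auto simp: linf_rel_def)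
  then have "AE x in haar. \<bar>r * f x\<bar> \<le> \<bar>r\<bar> * B"
    by eventually_elim (simp add: abs_mult mult_left_mono)
  then show ?thesis using assms by (auto simp: linf_rel_def)
qed

instantiation linf :: real_vector
begin

lift_definition zero_linf :: linf is "\<lambda>_. 0"
  by (rule linf_rel_zero)

lift_definition plus_linf :: "linf \<Rightarrow> linf \<Rightarrow> linf" is "\<lambda>f g x. f x + g x"
  by (rule linf_rel_add)

lift_definition scaleR_linf :: "real \<Rightarrow> linf \<Rightarrow> linf" is "\<lambda>r f x. r * f x"
  by (rule linf_rel_scale)

definition uminus_linf :: "linf \<Rightarrow> linf" where "uminus_linf F = (-1) *\<^sub>R F"

definition minus_linf :: "linf \<Rightarrow> linf \<Rightarrow> linf" where "minus_linf F F' = F + (-1) *\<^sub>R F'"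

instance
proof
  fix F F' F'' :: linf and r s :: real
  show "F + F' + F'' = F + (F' + F'')"
    by transfer (rule linf_rel_ext, intro linf_rel_add, auto)
  show "F + F' = F' + F"
    by transfer (rule linf_rel_ext, intro linf_rel_add, auto)
  show "0 + F = F"
    by transfer (rule linf_rel_ext, intro linf_rel_add linf_rel_zero, auto)
  show "- F + F = 0" unfolding uminus_linf_def
    by transfer (rule linf_rel_ext, intro linf_rel_add linf_rel_scale, auto)
  show "F - F' = F + - F'" by (simp add: minus_linf_def uminus_linf_def)
  show "r *\<^sub>R (F + F') = r *\<^sub>R F + r *\<^sub>R F'"
    by transfer (rule linf_rel_ext, intro linf_rel_scale linf_rel_add, auto simp: algebra_simps)
  show "(r + s) *\<^sub>R F = r *\<^sub>R F + s *\<^sub>R F"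
    by transfer (rule linf_rel_ext, intro linf_rel_scale, auto simp: algebra_simps)
  show "r *\<^sub>R s *\<^sub>R F = (r * s) *\<^sub>R F"
    by transfer (rule linf_rel_ext, intro linf_rel_scale, auto)
  show "1 *\<^sub>R F = F"
    by transfer (rule linf_rel_ext, intro linf_rel_scale, auto)
qed

end

definition linf_pairing :: "linf \<Rightarrow> (moebius \<Rightarrow> real) \<Rightarrow> real" where
  "linf_pairing F \<phi> = (LINT g|haar. rep_linf F g * \<phi> g)"

definition weak_star :: "linf topology" where
  "weak_star = topology_generated_by
     {{F. linf_pairing F \<phi> \<in> U} | \<phi> U. integrable haar \<phi> \<and> open U}"

text \<open>The choice of representative is immaterial: right translation preserves null sets.\<close>

definition linf_act :: "moebius \<Rightarrow> linf \<Rightarrow> linf" where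
  "linf_act g' F = abs_linf (\<lambda>g. rep_linf F (g * g'))"


section \<open>\<open>G\<close>-systems and affine \<open>G\<close>-systems\<close>

definition G_system :: "'x topology \<Rightarrow> (moebius \<Rightarrow> 'x \<Rightarrow> 'x) \<Rightarrow> bool" where
  "G_system X \<alpha> \<longleftrightarrow> topspace X \<noteq> {} \<and> compact_space X \<and> Hausdorff_space X
     \<and> continuous_map (prod_topology euclidean X) X (\<lambda>(g, x). \<alpha> g x)
     \<and> (\<forall>x\<in>topspace X. \<alpha> 1 x = x)
     \<and> (\<forall>g h. \<forall>x\<in>topspace X. \<alpha> (g * h) x = \<alpha> g (\<alpha> h x))"

text \<open>To treat the probability measures on a space and the convex subsets of a vector space alike,
  an affine structure consists of a topology whose space is the underlying set, the formation of
  convex combinations \<open>(1 - t) x + t y\<close>, and the action.\<close>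

record 'q affine_structure =
  top_of :: "'q topology"
  mix_of :: "real \<Rightarrow> 'q \<Rightarrow> 'q \<Rightarrow> 'q"
  act_of :: "moebius \<Rightarrow> 'q \<Rightarrow> 'q"

definition affine_action :: "'q affine_structure \<Rightarrow> bool" where
  "affine_action S \<longleftrightarrow> (\<forall>t\<in>{0..1}. \<forall>x\<in>topspace (top_of S). \<forall>y\<in>topspace (top_of S).
     mix_of S t x y \<in> topspace (top_of S)
     \<and> (\<forall>g. act_of S g (mix_of S t x y) = mix_of S t (act_of S g x) (act_of S g y)))"

definition irreducible_affine :: "'q affine_structure \<Rightarrow> bool" where
  "irreducible_affine S \<longleftrightarrow> (\<forall>C. C \<noteq> {} \<and> closedin (top_of S) C
     \<and> (\<forall>t\<in>{0..1}. \<forall>x\<in>C. \<forall>y\<in>C. mix_of S t x y \<in> C)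
     \<and> (\<forall>g. \<forall>x\<in>C. act_of S g x \<in> C)
     \<longrightarrow> C = topspace (top_of S))"

definition affine_hom :: "'q affine_structure \<Rightarrow> 'r affine_structure \<Rightarrow> ('q \<Rightarrow> 'r) \<Rightarrow> bool" where
  "affine_hom S S' \<Phi> \<longleftrightarrow> continuous_map (top_of S) (top_of S') \<Phi>
     \<and> (\<forall>g. \<forall>x\<in>topspace (top_of S). \<Phi> (act_of S g x) = act_of S' g (\<Phi> x))
     \<and> (\<forall>t\<in>{0..1}. \<forall>x\<in>topspace (top_of S). \<forall>y\<in>topspace (top_of S).
          \<Phi> (mix_of S t x y) = mix_of S' t (\<Phi> x) (\<Phi> y))"

definition affine_image :: "'q affine_structure \<Rightarrow> 'r affine_structure \<Rightarrow> bool" where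
  "affine_image S S' \<longleftrightarrow> (\<exists>\<Phi>. affine_hom S S' \<Phi>
     \<and> \<Phi> ` topspace (top_of S) = topspace (top_of S'))"

definition affine_isomorphic :: "'q affine_structure \<Rightarrow> 'r affine_structure \<Rightarrow> bool" where
  "affine_isomorphic S S' \<longleftrightarrow> (\<exists>\<Phi>. affine_hom S S' \<Phi>
     \<and> homeomorphic_map (top_of S) (top_of S') \<Phi>)"

definition vector_system ::
    "'v::real_vector topology \<Rightarrow> 'v set \<Rightarrow> (moebius \<Rightarrow> 'v \<Rightarrow> 'v) \<Rightarrow> 'v affine_structure" where
  "vector_system T Q \<alpha> = \<lparr>top_of = subtopology T Q,
     mix_of = (\<lambda>t x y. (1 - t) *\<^sub>R x + t *\<^sub>R y), act_of = \<alpha>\<rparr>"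

definition locally_convex_topology :: "'v::real_vector topology \<Rightarrow> bool" where
  "locally_convex_topology T \<longleftrightarrow> topspace T = UNIV \<and> Hausdorff_space T
     \<and> continuous_map (prod_topology T T) T (\<lambda>(x, y). x + y)
     \<and> continuous_map (prod_topology euclideanreal T) T (\<lambda>(r, x). r *\<^sub>R x)
     \<and> (\<forall>U. openin T U \<and> 0 \<in> U \<longrightarrow> (\<exists>V. openin T V \<and> 0 \<in> V \<and> convex V \<and> V \<subseteq> U))"

text \<open>An affine \<open>G\<close>-system is a compact convex subset of a locally convex Hausdorff space with a
  jointly continuous action by affine maps.\<close>

definition affine_G_system ::
    "'v::real_vector topology \<Rightarrow> 'v set \<Rightarrow> (moebius \<Rightarrow> 'v \<Rightarrow> 'v) \<Rightarrow> bool" where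
  "affine_G_system T Q \<alpha> \<longleftrightarrow> locally_convex_topology T \<and> convex Q
     \<and> G_system (subtopology T Q) \<alpha> \<and> affine_action (vector_system T Q \<alpha>)"

text \<open>Universality is relative to the vector spaces on the type \<open>'v\<close>.\<close>

definition universal_irreducible_affine ::
    "'v::real_vector itself \<Rightarrow> 'q affine_structure \<Rightarrow> bool" where
  "universal_irreducible_affine _ S \<longleftrightarrow>
     G_system (top_of S) (act_of S) \<and> affine_action S \<and> irreducible_affine S
     \<and> (\<forall>(T :: 'v topology) Q \<alpha>. affine_G_system T Q \<alpha> \<and> irreducible_affine (vector_system T Q \<alpha>)
          \<longrightarrow> affine_image S (vector_system T Q \<alpha>))"


section \<open>Probability measures on a compact space\<close>

definition borel_of :: "'x topology \<Rightarrow> 'x measure" where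
  "borel_of X = sigma (topspace X) {U. openin X U}"

text \<open>Regularity is automatic if \<open>X\<close> is metrizable, in particular for the circle.\<close>

definition prob_measures :: "'x topology \<Rightarrow> 'x measure set" where
  "prob_measures X = {\<mu>. prob_space \<mu> \<and> space \<mu> = topspace X \<and> sets \<mu> = sets (borel_of X)
     \<and> (\<forall>A\<in>sets \<mu>. \<forall>e>0. \<exists>C\<subseteq>A. compactin X C \<and> measure \<mu> (A - C) < e)}"

definition prob_topology :: "'x topology \<Rightarrow> 'x measure topology" where
  "prob_topology X = topology_generated_by
     {{\<mu> \<in> prob_measures X. (LINT x|\<mu>. f x) \<in> U} | f U. continuous_map X euclideanreal f \<and> open U}"

definition mix_measure :: "real \<Rightarrow> 'x measure \<Rightarrow> 'x measure \<Rightarrow> 'x measure" where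
  "mix_measure t \<mu> \<nu> = measure_of (space \<mu>) (sets \<mu>)
     (\<lambda>A. ennreal (1 - t) * emeasure \<mu> A + ennreal t * emeasure \<nu> A)"

definition push_forward ::
    "'x topology \<Rightarrow> (moebius \<Rightarrow> 'x \<Rightarrow> 'x) \<Rightarrow> moebius \<Rightarrow> 'x measure \<Rightarrow> 'x measure" where
  "push_forward X \<alpha> g \<mu> = distr \<mu> (borel_of X) (\<alpha> g)"

definition prob_system ::
    "'x topology \<Rightarrow> (moebius \<Rightarrow> 'x \<Rightarrow> 'x) \<Rightarrow> 'x measure affine_structure" where
  "prob_system X \<alpha> = \<lparr>top_of = prob_topology X, mix_of = mix_measure,
     act_of = push_forward X \<alpha>\<rparr>"


section \<open>Strongly proximal systems\<close>

definition minimal_system :: "'x topology \<Rightarrow> (moebius \<Rightarrow> 'x \<Rightarrow> 'x) \<Rightarrow> bool" where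
  "minimal_system X \<alpha> \<longleftrightarrow> G_system X \<alpha>
     \<and> (\<forall>C. C \<noteq> {} \<and> closedin X C \<and> (\<forall>g. \<forall>x\<in>C. \<alpha> g x \<in> C) \<longrightarrow> C = topspace X)"

definition strongly_proximal :: "'x topology \<Rightarrow> (moebius \<Rightarrow> 'x \<Rightarrow> 'x) \<Rightarrow> bool" where
  "strongly_proximal X \<alpha> \<longleftrightarrow> G_system X \<alpha>
     \<and> (\<forall>\<mu>\<in>prob_measures X. \<exists>x\<in>topspace X.
          return (borel_of X) x \<in> prob_topology X closure_of range (\<lambda>g. push_forward X \<alpha> g \<mu>))"

definition factor_of ::
    "'y topology \<Rightarrow> (moebius \<Rightarrow> 'y \<Rightarrow> 'y) \<Rightarrow> 'x topology \<Rightarrow> (moebius \<Rightarrow> 'x \<Rightarrow> 'x) \<Rightarrow> bool" where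
  "factor_of Y \<beta> X \<alpha> \<longleftrightarrow> (\<exists>\<pi>. continuous_map X Y \<pi> \<and> \<pi> ` topspace X = topspace Y
     \<and> (\<forall>g. \<forall>x\<in>topspace X. \<pi> (\<alpha> g x) = \<beta> g (\<pi> x)))"

text \<open>Universality is relative to the systems on the type \<open>'y\<close>.\<close>

definition universal_minimal_strongly_proximal ::
    "'y itself \<Rightarrow> 'x topology \<Rightarrow> (moebius \<Rightarrow> 'x \<Rightarrow> 'x) \<Rightarrow> bool" where
  "universal_minimal_strongly_proximal _ X \<alpha> \<longleftrightarrow> minimal_system X \<alpha> \<and> strongly_proximal X \<alpha>
     \<and> (\<forall>(Y :: 'y topology) \<beta>. minimal_system Y \<beta> \<and> strongly_proximal Y \<beta>
          \<longrightarrow> factor_of Y \<beta> X \<alpha>)"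


section \<open>Affine subsystems of \<open>L\<^sup>\<infinity>\<close> and harmonic functions\<close>

definition affine_subsystem :: "linf set \<Rightarrow> bool" where
  "affine_subsystem Q \<longleftrightarrow> Q \<noteq> {} \<and> compactin weak_star Q \<and> convex Q
     \<and> (\<forall>g. \<forall>F\<in>Q. linf_act g F \<in> Q)"

abbreviation linf_system :: "linf set \<Rightarrow> linf affine_structure" where
  "linf_system Q \<equiv> vector_system weak_star Q linf_act"

definition nontrivial_irreducible_subsystem :: "linf set \<Rightarrow> bool" where
  "nontrivial_irreducible_subsystem Q \<longleftrightarrow> affine_subsystem Q \<and> irreducible_affine (linf_system Q)
     \<and> (\<exists>F\<in>Q. \<exists>F'\<in>Q. F \<noteq> F')"

definition K_invariant :: "linf \<Rightarrow> bool" where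
  "K_invariant F \<longleftrightarrow> (\<forall>k\<in>rotations. linf_act k F = F)"

definition harmonic_on_disk :: "(complex \<Rightarrow> real) \<Rightarrow> bool" where
  "harmonic_on_disk h \<longleftrightarrow> continuous_on disk h
     \<and> (\<forall>z\<in>disk. \<forall>\<^sub>F r in at_right 0.
          h z = 1 / (2 * pi) * integral {0..2 * pi} (\<lambda>t. h (z + of_real r * cis t)))"

text \<open>Functions on the disk are represented by extensional functions, so that equality of
  representatives is equality on the disk.\<close>

definition bounded_nonconstant_harmonic :: "(complex \<Rightarrow> real) set" where
  "bounded_nonconstant_harmonic = {h \<in> extensional disk. harmonic_on_disk h
     \<and> bounded (h ` disk) \<and> \<not> h constant_on disk}"

definition lift_to_G :: "(complex \<Rightarrow> real) \<Rightarrow> linf" where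
  "lift_to_G h = abs_linf (\<lambda>g. h (moebius_apply g 0))"

definition Q_of :: "(complex \<Rightarrow> real) \<Rightarrow> linf set" where
  "Q_of h = weak_star closure_of (convex hull (range (\<lambda>g. linf_act g (lift_to_G h))))"

definition circle_measures_system :: "complex measure affine_structure" where
  "circle_measures_system = prob_system (top_of_set circle) moebius_apply"

end

theory Submission
 imports Defs "HOL-Library.Function_Algebras" "HOL-Complex_Analysis.Complex_Analysis"
begin

text \<open>A bounded harmonic function is the Poisson integral \<open>h(g(0)) = \<integral> u(g x) dx\<close> of a bounded boundary
 function \<open>u\<close>, so its lift is the image of the arc measure under the affine equivariant map sending a
 measure \<open>m\<close> on the circle to the function \<open>g \<mapsto> \<integral> u(g x) dm(x)\<close>. This map is weak* continuous, and it is
 injective unless \<open>u\<close> is constant: averaging over rotations isolates one nonzero Fourier coefficient of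
 \<open>u\<close> and hence one moment of \<open>m\<close> along the whole orbit, and differentiating in \<open>g\<close> reaches the
 neighbouring moments. Hence \<open>Q_h\<close> is a copy of the irreducible system of measures, and its only rotation
 invariant point comes from the arc measure. Conversely, the stabilizer of a boundary point is
 solvable, so by Markov and Kakutani it fixes a point of any affine subsystem; such a point is a
 function of \<open>g(1)\<close> alone and supplies \<open>u\<close>. The fixed point argument, applied to an irreducible affine
 system and to the means on a strongly proximal one, also gives both universality statements.\<close>

section \<open>Coordinates on the Moebius group\<close>

text \<open>\<open>haar\<close> is only a chosen object, so nothing is known about it until a Haar
  measure has been built and uniqueness proved. The construction uses that multiplication by
  SU(1,1), on either side, preserves Lebesgue measure on pairs of complex numbers; the multiples of
  SU(1,1) by factors in (0, 1) form an invariant open set, whose Lebesgue measure projects to a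
  bi-invariant measure.

  Two obstacles shape the rest. The boundary function is merely measurable, so continuity in the
  boundary point appears only after integrating over g; it rests on the fact that Haar measure on a
  rotation invariant ball is carried to arc length by g |-> g(z). Elements of \<open>linf\<close>
  are classes modulo null sets, so injectivity is argued for almost every g, with a countable family
  of shifts and Fubini for the rotations, and a single g is picked only when all moments agree.

  Fixed points are sought in vector spaces, which measures on a general compact space do not form
  here; the argument runs over positive normalised functionals, and the Riesz theorem turns the
  fixed one into a measure.\<close>

abbreviation ap :: "moebius => complex => complex" where "ap \<equiv> moebius_apply"

definition mob :: "complex \<times> complex => moebius" where
 "mob p = Abs_moebius (moebius_map p)"

definition moebius_of :: "complex \<times> complex => moebius" where
 "moebius_of = (%(om, w). Abs_moebius (\<lambda>z\<in>cball 0 1. om * (z + w) / (1 + cnj w * z)))"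

abbreviation coord_space :: "(complex \<times> complex) set" where
 "coord_space \<equiv> circle \<times> disk"

text \<open>The pair (om, w) in z |-> om * (z + w) / (1 + cnj w * z). It does not change when (a, c)
  is multiplied by a nonzero real number, so the same formula serves on all real multiples of
  SU(1,1).\<close>

definition cone_coords :: "complex \<times> complex => complex \<times> complex" where
 "cone_coords = (%(a, c). (a / cnj a, cnj c / a))"

text \<open>The pairs (a, c) and (-a, -c) give the same map, so going back from (om, w) to a matrix
  requires a square root \<open>s\<close> of om. The factor 1 / sqrt (1 - |w|^2) makes the
  determinant 1.\<close>

definition cone_lift :: "complex => complex => complex \<times> complex" where
 "cone_lift s w = (s / of_real (sqrt (1 - (norm w)\<^sup>2)), cnj (s * w) / of_real (sqrt (1 - (norm w)\<^sup>2)))"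

lemma apply_mob: "p \<in> SU11 ==> ap (mob p) = moebius_map p"
 by (simp add: mob_def Abs_moebius_inverse)

lemma mob_surj: "\<exists>p\<in>SU11. g = mob p"
proof -
 obtain p where "p \<in> SU11" "ap g = moebius_map p"
  using moebius_apply[of g] by auto
 then show ?thesis by (metis mob_def moebius_apply_inverse)
qed

lemma mob_mult: "p \<in> SU11 ==> q \<in> SU11 ==> mob (SU11_mult p q) = mob p * mob q"
 by (simp flip: moebius_apply_inject
   add: moebius_apply_mult apply_mob SU11_mult_closed moebius_map_mult)

lemma moebius_eqI: "(\<And>z. norm z \<le> 1 ==> ap g z = ap h z) ==> g = h"
 using moebius_apply_extensional[of g] moebius_apply_extensional[of h]
 by (auto simp flip: moebius_apply_inject intro!: extensionalityI)

lemma SU11_norm_less: "(a, c) \<in> SU11 ==> norm c < norm a"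
 unfolding SU11_norm by (rule power2_less_imp_less) auto

lemma cone_coords_in: "norm c < norm a ==> cone_coords (a, c) \<in> coord_space"
 by (auto simp: cone_coords_def norm_divide)

lemma moebius_map_cone_coords:
 assumes "(a, c) \<in> SU11"
 shows "moebius_map (a, c) = (\<lambda>z\<in>cball 0 1. (a / cnj a) * (z + cnj c / a) / (1 + cnj (cnj c / a) * z))"
proof
 fix z
 have a: "a \<noteq> 0" using SU11_norm_less[OF assms] by auto
 show "moebius_map (a, c) z = (\<lambda>z\<in>cball 0 1. (a / cnj a) * (z + cnj c / a) / (1 + cnj (cnj c / a) * z)) z"
 proof (cases "z \<in> cball 0 1")
  case True
  then have d: "c * z + cnj a \<noteq> 0" using SU11_denominator[OF assms] by auto
  have "1 + c * z / cnj a = (c * z + cnj a) / cnj a" using a by (simp add: field_simps)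
  then have e: "1 + cnj (cnj c / a) * z = (c * z + cnj a) / cnj a" by simp
  have "(a / cnj a) * (z + cnj c / a) = (a * z + cnj c) / cnj a" using a by (simp add: field_simps)
  then have "(a / cnj a) * (z + cnj c / a) / (1 + cnj (cnj c / a) * z) = (a * z + cnj c) / (c * z + cnj a)"
   unfolding e using a by simp
  then show ?thesis using True by (simp add: moebius_map_def)
 qed (auto simp: moebius_map_def)
qed

lemma mob_eq_moebius_of: "p \<in> SU11 ==> mob p = moebius_of (cone_coords p)"
 by (cases p) (simp add: mob_def moebius_of_def cone_coords_def moebius_map_cone_coords)

lemma cone_lift:
 assumes "norm s = 1" "norm w < 1"
 shows "cone_lift s w \<in> SU11" "cone_coords (cone_lift s w) = (s\<^sup>2, w)"
proof -
 let ?r = "sqrt (1 - (norm w)\<^sup>2)"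
 have r: "?r > 0" "?r\<^sup>2 = 1 - (norm w)\<^sup>2" using assms(2) by (simp_all add: abs_square_less_1 power_le_one)
 have s: "s \<noteq> 0" "s * cnj s = 1" using assms(1) by (auto simp: complex_norm_square[symmetric])
 have n: "(norm (s / of_real ?r))\<^sup>2 = 1 / ?r\<^sup>2" "(norm (cnj (s * w) / of_real ?r))\<^sup>2 = (norm w)\<^sup>2 / ?r\<^sup>2"
  using assms r(1) by (simp_all add: norm_divide norm_mult power_divide)
 show "cone_lift s w \<in> SU11"
  unfolding cone_lift_def SU11_norm n using r by (simp add: field_simps)
 have q: "s / cnj s = s\<^sup>2" using s by (simp add: field_simps power2_eq_square)
 show "cone_coords (cone_lift s w) = (s\<^sup>2, w)"
  using r(1) s(1) q by (simp add: cone_coords_def cone_lift_def)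
qed

lemma csqrt_circle: "norm om = 1 ==> norm (csqrt om) = 1"
 by (simp add: norm_csqrt)

lemma moebius_of_eq_mob:
 assumes "norm s = 1" "norm w < 1"
 shows "moebius_of (s\<^sup>2, w) = mob (cone_lift s w)"
 using mob_eq_moebius_of[OF cone_lift(1)[OF assms]] cone_lift(2)[OF assms] by simp

lemma apply_moebius_of:
 assumes "norm om = 1" "norm w < 1" "norm z \<le> 1"
 shows "ap (moebius_of (om, w)) z = om * (z + w) / (1 + cnj w * z)"
proof -
 define s where "s = csqrt om"
 have s: "norm s = 1" "s\<^sup>2 = om" by (simp_all add: s_def csqrt_circle assms)
 obtain a c where ac: "cone_lift s w = (a, c)" by force
 have "moebius_of (om, w) = mob (a, c)" using moebius_of_eq_mob[OF s(1) assms(2)] s ac by simp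
 moreover have "(a, c) \<in> SU11" "cone_coords (a, c) = (om, w)" using cone_lift[OF s(1) assms(2)] s ac by auto
 ultimately show ?thesis
  using assms(3) by (simp add: apply_mob moebius_map_cone_coords cone_coords_def)
qed

lemma moebius_of_surj: "\<exists>q\<in>coord_space. g = moebius_of q"
proof -
 obtain p where "p \<in> SU11" "g = mob p" using mob_surj by blast
 then show ?thesis using mob_eq_moebius_of cone_coords_in SU11_norm_less by (cases p) metis
qed

text \<open>The only zero of the map is - w, so the map determines w; its value at 1 then determines
  the rotation factor.\<close>

lemma moebius_of_inj:
 assumes "q \<in> coord_space" "q' \<in> coord_space" "moebius_of q = moebius_of q'"
 shows "q = q'"
proof -
 obtain om w et v where q: "q = (om, w)" "q' = (et, v)" by force
 have b: "norm om = 1" "norm w < 1" "norm et = 1" "norm v < 1" using assms q by auto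
 have e: "om * (z + w) / (1 + cnj w * z) = et * (z + v) / (1 + cnj v * z)" if "norm z \<le> 1" for z
  using assms(3) that b by (metis apply_moebius_of q)
 have nz: "1 + cnj x * z \<noteq> 0" if "norm x < 1" "norm z \<le> 1" for x z
 proof
  assume "1 + cnj x * z = 0"
  then have "cnj x * z = - 1" by (simp add: add_eq_0_iff)
  then have "norm x * norm z = 1" by (metis complex_mod_cnj norm_minus_cancel norm_mult norm_one)
  moreover have "norm x * norm z \<le> norm x" using that by (simp add: mult_left_le)
  ultimately show False using that by linarith
 qed
 have "et * (- w + v) = 0" using e[of "- w"] b nz[of v "- w"] by (auto simp: norm_minus_cancel)
 then have wv: "w = v" using b by auto
 have "1 + w \<noteq> 0" using b by (metis add.commute add_eq_0_iff norm_minus_cancel norm_one less_irrefl)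
 then have "om = et" using e[of 1] nz[of w 1] b wv by (simp add: add.commute)
 with wv q show ?thesis by simp
qed

section \<open>Rotation and shift as functions on the group, and its topology in these
  coordinates\<close>

definition coords :: "moebius => complex \<times> complex" where
 "coords g = the_inv_into coord_space moebius_of g"

definition rotp :: "moebius => complex" where "rotp g = fst (coords g)"

definition shiftp :: "moebius => complex" where "shiftp g = snd (coords g)"

lemma inj_on_moebius_of: "inj_on moebius_of coord_space"
 by (rule inj_onI) (rule moebius_of_inj)

lemma coords_moebius_of: "q \<in> coord_space ==> coords (moebius_of q) = q"
 by (simp add: coords_def the_inv_into_f_f inj_on_moebius_of)

lemma moebius_of_coords: "moebius_of (coords g) = g"
 using moebius_of_surj[of g] coords_moebius_of by auto

lemma coords_in: "coords g \<in> coord_space"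
 using moebius_of_surj[of g] coords_moebius_of by auto

lemma norm_rotp [simp]: "norm (rotp g) = 1"
 using coords_in[of g] by (auto simp: rotp_def)

lemma norm_shiftp [simp]: "norm (shiftp g) < 1"
 using coords_in[of g] by (auto simp: shiftp_def)

lemma coords_mob: "p \<in> SU11 ==> coords (mob p) = cone_coords p"
 by (cases p) (simp add: mob_eq_moebius_of coords_moebius_of cone_coords_in SU11_norm_less)

lemma denominator_nonzero:
 fixes w z :: complex
 assumes "norm w < 1" "norm z \<le> 1"
 shows "1 + w * z \<noteq> 0"
proof
 assume "1 + w * z = 0"
 then have "w * z = - 1" by (simp add: add_eq_0_iff)
 then have "norm w * norm z = 1" by (metis norm_minus_cancel norm_mult norm_one)
 moreover have "norm w * norm z \<le> norm w" using assms by (simp add: mult_left_le)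
 ultimately show False using assms by linarith
qed

lemma apply_coords:
 "norm z \<le> 1 ==> ap g z = rotp g * (z + shiftp g) / (1 + cnj (shiftp g) * z)"
 using apply_moebius_of[of "rotp g" "shiftp g" z] moebius_of_coords[of g]
  norm_rotp[of g] norm_shiftp[of g]
 unfolding rotp_def shiftp_def by (metis prod.collapse)

text \<open>From right to left this is continuity of \<open>cone_coords\<close>. From left to right
  \<open>cone_lift\<close> has to be continuous, hence a continuous square root is needed; the
  circle has one only locally, so openness is checked on two overlapping arcs.\<close>

lemma open_moebius_iff:
 "open U \<longleftrightarrow> openin (top_of_set coord_space) {q \<in> coord_space. moebius_of q \<in> U}" (is "_ \<longleftrightarrow> openin _ ?V")
proof
 assume "openin (top_of_set coord_space) ?V"
 then obtain W where W: "open W" "?V = coord_space \<inter> W" by (auto simp: openin_open)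
 have "continuous_on SU11 cone_coords"
  unfolding cone_coords_def case_prod_beta
  by (intro continuous_intros) (use SU11_norm_less in force)+
 then have "openin (top_of_set SU11) (SU11 \<inter> cone_coords -` W)"
  using W(1) continuous_openin_preimage_gen by blast
 moreover have "{p \<in> SU11. mob p \<in> U} = SU11 \<inter> cone_coords -` W"
 proof (rule set_eqI)
  fix p
  have "mob p \<in> U \<longleftrightarrow> cone_coords p \<in> W" if "p \<in> SU11"
  proof -
   have "cone_coords p \<in> coord_space" using that cone_coords_in SU11_norm_less by (cases p) metis
   then show ?thesis using W(2) mob_eq_moebius_of[OF that] by auto
  qed
  then show "p \<in> {p \<in> SU11. mob p \<in> U} \<longleftrightarrow> p \<in> SU11 \<inter> cone_coords -` W" by auto
 qed
 ultimately show "open U" by (simp add: open_moebius_def mob_def)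
next
 assume "open U"
 then obtain W where W: "open W" "{p \<in> SU11. mob p \<in> U} = SU11 \<inter> W"
  by (auto simp: open_moebius_def mob_def openin_open)
 \<comment> \<open>Two branches of the square root: \<open>csqrt\<close> is continuous off the
   nonpositive reals, and \<i> * csqrt (- om) is continuous off the nonnegative ones. No point of
   the circle is excluded by both.\<close>
 let ?s1 = "%q. csqrt (fst q)" and ?s2 = "%q. \<i> * csqrt (- fst q)"
 let ?A1 = "{q :: complex \<times> complex. fst q \<notin> \<real>\<^sub>\<le>\<^sub>0}" and ?A2 = "{q :: complex \<times> complex. - fst q \<notin> \<real>\<^sub>\<le>\<^sub>0}"
 have oA: "open ?A1" "open ?A2"
 proof -
  have o: "open (- (\<real>\<^sub>\<le>\<^sub>0 :: complex set))" using closed_nonpos_Reals_complex by (simp add: open_Compl)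
  have "open ((fst :: complex \<times> complex => _) -` (- (\<real>\<^sub>\<le>\<^sub>0 :: complex set)))" "open ((%q :: complex \<times> complex. - fst q) -` (- (\<real>\<^sub>\<le>\<^sub>0 :: complex set)))"
   using o by (intro open_vimage continuous_intros; simp)+
  then show "open ?A1" "open ?A2" by (simp_all only: vimage_def Compl_iff)
 qed
 have sw: "1 - (norm w)\<^sup>2 > 0" if "norm w < 1" for w :: complex
  using that by (simp add: abs_square_less_1)
 have piece: "openin (top_of_set coord_space) (?V \<inter> A)"
  if A: "open A" and s: "continuous_on A s" "\<And>q. q \<in> coord_space ==> norm (s q) = 1 \<and> (s q)\<^sup>2 = fst q"
  for A :: "(complex \<times> complex) set" and s :: "complex \<times> complex => complex"
 proof -
  have sc: "continuous_on (coord_space \<inter> A) s" using s(1) continuous_on_subset by blast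
  have "continuous_on (coord_space \<inter> A) (%q. cone_lift (s q) (snd q))"
   unfolding cone_lift_def using sw by (intro continuous_intros sc) force+
  then have "openin (top_of_set (coord_space \<inter> A)) ((coord_space \<inter> A) \<inter> (%q. cone_lift (s q) (snd q)) -` W)"
   using W(1) continuous_openin_preimage_gen by blast
  moreover have "openin (top_of_set coord_space) (coord_space \<inter> A)" using A by (simp add: openin_open_Int)
  ultimately have "openin (top_of_set coord_space) ((coord_space \<inter> A) \<inter> (%q. cone_lift (s q) (snd q)) -` W)"
   using openin_trans by blast
  moreover have "(coord_space \<inter> A) \<inter> (%q. cone_lift (s q) (snd q)) -` W = ?V \<inter> A"
  proof -
   have "cone_lift (s q) (snd q) \<in> W \<longleftrightarrow> moebius_of q \<in> U" if q: "q \<in> coord_space" for q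
   proof -
    have b: "norm (s q) = 1" "(s q)\<^sup>2 = fst q" "norm (snd q) < 1" using s(2)[OF q] q by auto
    have "moebius_of q = mob (cone_lift (s q) (snd q))"
     using moebius_of_eq_mob[OF b(1,3)] b(2) by simp
    moreover have "cone_lift (s q) (snd q) \<in> SU11" using cone_lift(1)[OF b(1,3)] .
    ultimately show ?thesis using W(2) by auto
   qed
   then show ?thesis by (intro set_eqI) (simp only: Int_iff vimage_eq mem_Collect_eq, blast)
  qed
  ultimately show ?thesis by simp
 qed
 have "openin (top_of_set coord_space) (?V \<inter> ?A1)"
  by (rule piece[OF oA(1), of ?s1])
   (auto intro!: continuous_on_compose2[OF continuous_on_csqrt continuous_on_fst[OF continuous_on_id]]
    simp: csqrt_circle)
 moreover have "openin (top_of_set coord_space) (?V \<inter> ?A2)"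
  by (rule piece[OF oA(2), of ?s2])
   (auto intro!: continuous_on_mult_left
    continuous_on_compose2[OF continuous_on_csqrt continuous_on_minus[OF continuous_on_fst[OF continuous_on_id]]]
    simp: csqrt_circle norm_mult power_mult_distrib)
 moreover have "?V = (?V \<inter> ?A1) \<union> (?V \<inter> ?A2)"
 proof -
  have "om \<notin> \<real>\<^sub>\<le>\<^sub>0 \<or> - om \<notin> \<real>\<^sub>\<le>\<^sub>0" if "norm om = 1" for om :: complex
   using that by (auto simp: complex_nonpos_Reals_iff complex_eq_iff norm_complex_def)
  then show ?thesis by auto
 qed
 ultimately show "openin (top_of_set coord_space) ?V" by (metis (no_types, lifting) openin_Un)
qed

lemma continuous_on_coords: "continuous_on UNIV coords"
 unfolding continuous_on_open_vimage[OF open_UNIV]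
proof (intro allI impI)
 fix W :: "(complex \<times> complex) set" assume W: "open W"
 have "{q \<in> coord_space. moebius_of q \<in> coords -` W \<inter> UNIV} = coord_space \<inter> W"
  using coords_moebius_of by auto
 then show "open (coords -` W \<inter> UNIV)"
  unfolding open_moebius_iff using W by (simp add: openin_open_Int)
qed

lemma continuous_on_moebius_of: "continuous_on coord_space moebius_of"
 unfolding continuous_on_open_invariant
proof (intro allI impI)
 fix U :: "moebius set" assume "open U"
 then obtain W where "open W" "{q \<in> coord_space. moebius_of q \<in> U} = coord_space \<inter> W"
  by (auto simp: open_moebius_iff openin_open)
 then show "\<exists>A. open A \<and> A \<inter> coord_space = moebius_of -` U \<inter> coord_space"
  by (intro exI[of _ W]) auto
qed

lemma continuous_on_rotp [continuous_intros]:
 "continuous_on A f ==> continuous_on A (%x. rotp (f x))"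
 unfolding rotp_def
 using continuous_on_compose2[OF continuous_on_coords, of A f] by (intro continuous_on_fst) auto

lemma continuous_on_shiftp [continuous_intros]:
 "continuous_on A f ==> continuous_on A (%x. shiftp (f x))"
 unfolding shiftp_def
 using continuous_on_compose2[OF continuous_on_coords, of A f] by (intro continuous_on_snd) auto

lemma continuous_on_into_moebius:
 assumes "continuous_on A (%x. rotp (f x))" "continuous_on A (%x. shiftp (f x))"
 shows "continuous_on A f"
proof -
 have "continuous_on A (%x. moebius_of (rotp (f x), shiftp (f x)))"
  by (intro continuous_on_compose2[OF continuous_on_moebius_of] continuous_on_Pair assms) auto
 then show ?thesis by (simp add: rotp_def shiftp_def moebius_of_coords prod.collapse)
qed

text \<open>With a countable base the Borel sets of a product are generated by rectangles, which is
  what measurability of the group multiplication on product spaces rests on.\<close>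

instance moebius :: second_countable_topology
proof
 obtain B :: "(complex \<times> complex) set set" where B: "countable B" "topological_basis B"
  using ex_countable_basis by blast
 let ?B = "(%V. coords -` V) ` B"
 have op: "open (coords -` V)" if "V \<in> B" for V
  using open_vimage[OF topological_basis_open[OF B(2) that] continuous_on_coords] .
 have "topological_basis ?B"
 proof (rule topological_basisI)
  show "open V" if "V \<in> ?B" for V using op that by auto
 next
  fix U :: "moebius set" and g assume U: "open U" "g \<in> U"
  obtain W where W: "open W" "{q \<in> coord_space. moebius_of q \<in> U} = coord_space \<inter> W"
   using U(1) by (auto simp: open_moebius_iff openin_open)
  have "coords g \<in> {q \<in> coord_space. moebius_of q \<in> U}"
   using coords_in[of g] U(2) by (simp add: moebius_of_coords)
  then have "coords g \<in> W" unfolding W(2) by blast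
  then obtain V where V: "V \<in> B" "coords g \<in> V" "V \<subseteq> W"
   by (rule topological_basisE[OF B(2) W(1)])
  have "coords -` V \<subseteq> U"
  proof
   fix x assume "x \<in> coords -` V"
   then have "coords x \<in> coord_space \<inter> W" using V(3) coords_in by auto
   then have "coords x \<in> {q \<in> coord_space. moebius_of q \<in> U}" by (simp only: W(2))
   then show "x \<in> U" by (simp add: moebius_of_coords)
  qed
  then show "\<exists>B'\<in>?B. g \<in> B' \<and> B' \<subseteq> U" using V by auto
 qed
 then show "\<exists>B::moebius set set. countable B \<and> open = generate_topology B"
  using B(1) topological_basis_imp_subbasis by blast
qed

section \<open>The group operations\<close>

text \<open>The type is an instance of \<open>monoid_mult\<close>, so the inverse is a chosen
  element; \<open>ginv_unique\<close> makes the choice harmless.\<close>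

definition ginv :: "moebius => moebius" where
 "ginv g = (SOME g'. g' * g = 1 \<and> g * g' = 1)"

lemma ginv: "ginv g * g = 1" "g * ginv g = 1"
 using someI_ex[OF moebius_inverse_exists[of g]] by (simp_all add: ginv_def)

lemma ginv_unique: "h * g = 1 ==> ginv g = h"
 by (metis ginv(2) mult.assoc mult.left_neutral mult.right_neutral)

lemma ginv_ginv [simp]: "ginv (ginv g) = g"
 by (rule ginv_unique) (rule ginv)

lemma ginv_mult: "ginv (g * h) = ginv h * ginv g"
 by (rule ginv_unique) (metis ginv(1) mult.assoc mult.left_neutral)

lemma ginv_cancel [simp]: "ginv g * (g * h) = h" "g * (ginv g * h) = h" "h * g * ginv g = h" "h * ginv g * g = h"
proof -
 show "ginv g * (g * h) = h" "g * (ginv g * h) = h" by (metis ginv mult.assoc mult_1)+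
 show "h * g * ginv g = h" "h * ginv g * g = h" by (metis ginv mult.assoc mult_1_right)+
qed

lemma apply_mult: "norm z \<le> 1 ==> ap (g * h) z = ap g (ap h z)"
 by (simp add: moebius_apply_mult compose_def)

lemma apply_one: "norm z \<le> 1 ==> ap 1 z = z"
 by (simp add: moebius_apply_one)

lemma norm_apply_le: "norm z \<le> 1 ==> norm (ap g z) \<le> 1"
 using moebius_apply_cball[of z g] by simp

text \<open>The entries of the matrix product are divided by a * a' or its conjugate. Apart from the
  unimodular \<open>rotp h\<close>, the denominators then have the shape 1 + w * z with |w| < 1 and
  |z| \<le> 1, so continuity of multiplication can be read off.\<close>

lemma coords_mult:
 "rotp (g * h) = rotp g * rotp h * (1 + shiftp g * cnj (shiftp h) / rotp h)
   / (1 + cnj (shiftp g) * shiftp h * rotp h)" (is ?r)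
 "shiftp (g * h) = (shiftp g + shiftp h * rotp h) / rotp h
   / (1 + shiftp g * cnj (shiftp h) / rotp h)" (is ?s)
proof -
 obtain p q where pq: "p \<in> SU11" "q \<in> SU11" "g = mob p" "h = mob q" using mob_surj by metis
 obtain a c a' c' where ac: "p = (a, c)" "q = (a', c')" by force
 have nz: "a \<noteq> 0" "a' \<noteq> 0" using SU11_norm_less pq ac by fastforce+
 have g: "rotp g = a / cnj a" "shiftp g = cnj c / a" "rotp h = a' / cnj a'" "shiftp h = cnj c' / a'"
  by (simp_all add: rotp_def shiftp_def pq coords_mob) (simp_all add: ac cone_coords_def)
 have m: "SU11_mult p q = (a * a' + cnj c * c', c * a' + cnj a * c')" by (simp add: ac SU11_mult_def)
 have mm: "SU11_mult p q \<in> SU11" using pq SU11_mult_closed by blast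
 then have nz2: "a * a' + cnj c * c' \<noteq> 0" using SU11_norm_less m by fastforce
 have gh: "rotp (g * h) = (a * a' + cnj c * c') / cnj (a * a' + cnj c * c')"
  "shiftp (g * h) = cnj (c * a' + cnj a * c') / (a * a' + cnj c * c')"
  by (simp_all add: rotp_def shiftp_def pq mob_mult[symmetric] coords_mob mm) (simp_all add: m cone_coords_def)
 have d1: "1 + shiftp g * cnj (shiftp h) / rotp h = (a * a' + cnj c * c') / (a * a')"
  using nz by (simp add: g field_simps)
 have d2: "1 + cnj (shiftp g) * shiftp h * rotp h = cnj (a * a' + cnj c * c') / (cnj a * cnj a')"
  using nz by (simp add: g field_simps)
 have d3: "(shiftp g + shiftp h * rotp h) / rotp h = cnj (c * a' + cnj a * c') / (a * a')"
  using nz by (simp add: g field_simps)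
 have "cnj (a * a' + cnj c * c') \<noteq> 0" using nz2 complex_cnj_zero_iff by blast
 then show ?r unfolding d1 d2 gh using nz nz2 unfolding g by (simp add: divide_simps)
 show ?s unfolding d1 d3 gh using nz nz2 by (simp add: divide_simps)
qed

lemma coords_ginv: "rotp (ginv g) = cnj (rotp g)" "shiftp (ginv g) = - (rotp g * shiftp g)"
proof -
 obtain a c where ac: "(a, c) \<in> SU11" "g = mob (a, c)" using mob_surj by (metis surj_pair)
 have ac': "(cnj a, - c) \<in> SU11" using ac by (simp add: SU11_norm)
 have "SU11_mult (cnj a, - c) (a, c) = (1, 0)" using ac by (simp add: SU11_mult_def SU11_def algebra_simps)
 then have "mob (cnj a, - c) * g = mob (1, 0)" using ac ac' by (simp flip: mob_mult)
 also have "mob (1, 0) = 1"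
  by (rule moebius_eqI) (simp add: apply_mob SU11_def moebius_map_def apply_one)
 finally have i: "ginv g = mob (cnj a, - c)" by (rule ginv_unique)
 have nz: "a \<noteq> 0" using SU11_norm_less[OF ac(1)] by auto
 show "rotp (ginv g) = cnj (rotp g)" "shiftp (ginv g) = - (rotp g * shiftp g)"
  unfolding i rotp_def shiftp_def using nz ac ac' by (simp_all add: coords_mob cone_coords_def)
qed

lemma denominator_coords_nonzero: "1 + shiftp g * cnj (shiftp h) / rotp h \<noteq> 0"
 "1 + cnj (shiftp g) * shiftp h * rotp h \<noteq> 0" "rotp h \<noteq> 0"
 using denominator_nonzero[of "shiftp g" "cnj (shiftp h) / rotp h"]
  denominator_nonzero[of "cnj (shiftp g)" "shiftp h * rotp h"]
  norm_rotp[of h] norm_shiftp[of h] norm_shiftp[of g]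
 by (auto simp: norm_mult norm_divide less_imp_le mult.assoc simp del: norm_rotp)

lemma continuous_on_mult_moebius [continuous_intros]:
 fixes f f' :: "_ => moebius"
 assumes "continuous_on A f" "continuous_on A f'"
 shows "continuous_on A (%x. f x * f' x)"
 by (rule continuous_on_into_moebius; unfold coords_mult; intro continuous_intros assms ballI)
  (auto simp: denominator_coords_nonzero)

lemma continuous_on_ginv [continuous_intros]:
 "continuous_on A f ==> continuous_on A (%x. ginv (f x))"
 by (rule continuous_on_into_moebius; unfold coords_ginv; intro continuous_intros) auto

lemma continuous_on_apply [continuous_intros]:
 assumes "continuous_on A f" "continuous_on A f'" "\<And>x. x \<in> A ==> norm (f' x) \<le> 1"
 shows "continuous_on A (%x. ap (f x) (f' x))"
proof -
 have "continuous_on A (%x. rotp (f x) * (f' x + shiftp (f x)) / (1 + cnj (shiftp (f x)) * f' x))"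
  by (intro continuous_intros assms(1,2) ballI denominator_nonzero assms(3)) auto
 then show ?thesis by (simp add: apply_coords assms(3) cong: continuous_on_cong)
qed

lemma apply_zero: "ap g 0 = rotp g * shiftp g"
 by (simp add: apply_coords)

lemma norm_apply_zero: "norm (ap g 0) = norm (shiftp g)"
 by (simp add: apply_zero norm_mult)

lemma norm_apply_zero_less [simp]: "norm (ap g 0) < 1"
 by (simp add: norm_apply_zero)

lemma norm_apply_circle:
 assumes "norm z = 1" shows "norm (ap g z) = 1"
proof -
 have z: "cnj z * z = 1" "z \<noteq> 0" using assms by (auto simp: complex_norm_square[symmetric] mult.commute)
 \<comment> \<open>On the circle cnj z is the inverse of z, so numerator and denominator of the map
   have the same modulus.\<close>
 have "1 + cnj (shiftp g) * z = z * cnj (z + shiftp g)"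
  using z by (simp add: algebra_simps)
 then have e: "norm (1 + cnj (shiftp g) * z) = norm (z + shiftp g)"
  using assms by (metis complex_mod_cnj mult_1 norm_mult)
 moreover have "1 + cnj (shiftp g) * z \<noteq> 0" using denominator_nonzero assms by simp
 ultimately have "z + shiftp g \<noteq> 0" by (metis norm_eq_zero)
 with e show ?thesis using assms by (simp add: apply_coords norm_divide norm_mult)
qed

section \<open>Rotations as group elements\<close>

definition rot :: "complex => moebius" where "rot om = moebius_of (om, 0)"

lemma apply_rot: "norm om = 1 ==> norm z \<le> 1 ==> ap (rot om) z = om * z"
 by (simp add: rot_def apply_moebius_of)

lemma continuous_on_rot: "continuous_on circle rot"
 unfolding rot_def by (intro continuous_on_compose2[OF continuous_on_moebius_of] continuous_intros) auto

lemma rot_mult: "norm om = 1 ==> norm et = 1 ==> rot (om * et) = rot om * rot et"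
 by (rule moebius_eqI) (simp add: apply_rot apply_mult norm_mult)

lemma rot_one: "rot 1 = 1"
 by (rule moebius_eqI) (simp add: apply_rot apply_one)

lemma ginv_rot: "norm om = 1 ==> ginv (rot om) = rot (cnj om)"
 by (rule ginv_unique) (simp add: rot_mult[symmetric] rot_one complex_norm_square[symmetric] mult.commute)

lemma rotations_eq: "rotations = rot ` circle"
proof (intro set_eqI iffI)
 fix k assume "k \<in> rotations"
 then obtain ze where "norm ze = 1" "\<forall>z\<in>cball 0 1. ap k z = ze * z" by (auto simp: rotations_def)
 then have "k = rot ze" by (intro moebius_eqI) (simp add: apply_rot)
 then show "k \<in> rot ` circle" using \<open>norm ze = 1\<close> by auto
qed (auto simp: rotations_def apply_rot intro!: bexI)

lemma ex_apply_zero: "norm z < 1 ==> \<exists>g. ap g 0 = z"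
 by (rule exI[of _ "moebius_of (1, z)"]) (simp add: apply_moebius_of)

lemma measurable_moebius_apply [measurable]:
 "(%(g, z). ap g z) \<in> borel_measurable (borel \<Otimes>\<^sub>M borel)"
proof -
 have [measurable]: "rotp \<in> borel_measurable borel" "shiftp \<in> borel_measurable borel"
  using continuous_on_rotp[of UNIV "%x. x"] continuous_on_shiftp[of UNIV "%x. x"]
  by (auto intro!: borel_measurable_continuous_onI)
 have [measurable]: "cnj \<in> borel_measurable borel"
  by (intro borel_measurable_continuous_onI continuous_intros)
 \<comment> \<open>Transformations are extensional, so off the closed disk the value is the constant
   \<open>undefined\<close>.\<close>
 have "(%(g, z). ap g z) = (%(g, z). if norm z \<le> 1
   then rotp g * (z + shiftp g) / (1 + cnj (shiftp g) * z) else undefined)"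
  using moebius_apply_extensional by (auto simp: fun_eq_iff apply_coords extensional_def)
 also have "\<dots> \<in> borel_measurable (borel \<Otimes>\<^sub>M borel)" by measurable
 finally show ?thesis .
qed

lemma measurable_mult_moebius [measurable]:
 assumes [measurable]: "f \<in> borel_measurable M" "f' \<in> borel_measurable M"
 shows "(%x. f x * f' x :: moebius) \<in> borel_measurable M"
proof -
 have "(%q. fst q * snd q :: moebius) \<in> borel_measurable borel"
  by (intro borel_measurable_continuous_onI continuous_intros)
 then have [measurable]: "(%q. fst q * snd q :: moebius) \<in> borel_measurable (borel \<Otimes>\<^sub>M borel)"
  by (simp add: borel_prod)
 have "(%x. (%q. fst q * snd q) (f x, f' x)) \<in> borel_measurable M" by measurable
 then show ?thesis by simp
qed

lemma measurable_ginv [measurable]: "ginv \<in> borel_measurable borel"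
 by (intro borel_measurable_continuous_onI continuous_on_ginv continuous_intros)

section \<open>Haar measure\<close>

lemma distr_lborel_pairI:
 fixes T :: "complex \<times> complex => complex \<times> complex"
 assumes T: "T \<in> borel \<Otimes>\<^sub>M borel \<rightarrow>\<^sub>M borel \<Otimes>\<^sub>M borel"
  and *: "\<And>F. F \<in> borel_measurable (borel \<Otimes>\<^sub>M borel) ==>
   (\<integral>\<^sup>+p. F (T p) \<partial>(lborel \<Otimes>\<^sub>M lborel)) = (\<integral>\<^sup>+p. F p \<partial>(lborel \<Otimes>\<^sub>M lborel))"
 shows "distr lborel borel T = lborel"
proof (rule measure_eqI)
 fix A assume "A \<in> sets (distr lborel borel T)"
 then have A: "A \<in> sets borel" by simp
 then have A': "A \<in> sets (borel \<Otimes>\<^sub>M borel)" unfolding borel_prod .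
 have T': "T \<in> borel_measurable borel" using T unfolding borel_prod .
 have TA: "T -` A \<in> sets borel" using measurable_sets[OF T' A] by simp
 have "emeasure (distr lborel borel T) A = emeasure lborel (T -` A)"
  using A T' by (subst emeasure_distr) auto
 also have "\<dots> = (\<integral>\<^sup>+p. indicator (T -` A) p \<partial>lborel)" using TA by simp
 also have "\<dots> = (\<integral>\<^sup>+p. indicator A (T p) \<partial>lborel)" by (simp add: indicator_def vimage_def)
 also have "\<dots> = (\<integral>\<^sup>+p. indicator A p \<partial>lborel)"
  using *[OF borel_measurable_indicator[OF A']] unfolding lborel_prod .
 also have "\<dots> = emeasure lborel A" using A by simp
 finally show "emeasure (distr lborel borel T) A = emeasure lborel A" .
qed simp

text \<open>By Fubini: with the other variable held fixed, a shear is a translation.\<close>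

lemma lborel_shear:
 fixes f :: "complex => complex"
 assumes [measurable]: "f \<in> borel_measurable borel"
 shows "distr lborel borel (%p. (fst p + f (snd p), snd p)) = (lborel :: (complex \<times> complex) measure)"
  and "distr lborel borel (%p. (fst p, snd p + f (fst p))) = (lborel :: (complex \<times> complex) measure)"
proof -
 have tr: "(\<integral>\<^sup>+x. G (x + t) \<partial>lborel) = (\<integral>\<^sup>+x. G x \<partial>lborel)"
  if [measurable]: "G \<in> borel_measurable borel" for G :: "complex => ennreal" and t
 proof -
  have "(\<integral>\<^sup>+x. G x \<partial>lborel) = (\<integral>\<^sup>+x. G x \<partial>distr lborel borel ((+) t))" by (simp only: lborel_distr_plus)
  also have "\<dots> = (\<integral>\<^sup>+x. G (t + x) \<partial>lborel)" by (rule nn_integral_distr) measurable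
  finally show ?thesis by (simp add: add.commute)
 qed
 show "distr lborel borel (%p. (fst p + f (snd p), snd p)) = (lborel :: (complex \<times> complex) measure)"
 proof (rule distr_lborel_pairI)
  fix F :: "complex \<times> complex => ennreal" assume [measurable]: "F \<in> borel_measurable (borel \<Otimes>\<^sub>M borel)"
  have "(\<integral>\<^sup>+p. F (fst p + f (snd p), snd p) \<partial>(lborel \<Otimes>\<^sub>M lborel))
    = (\<integral>\<^sup>+y. \<integral>\<^sup>+x. F (x + f y, y) \<partial>lborel \<partial>lborel)"
   by (subst lborel_pair.nn_integral_snd[symmetric]) auto
  also have "\<dots> = (\<integral>\<^sup>+y. \<integral>\<^sup>+x. F (x, y) \<partial>lborel \<partial>lborel)"
   by (intro nn_integral_cong tr) measurable
  also have "\<dots> = (\<integral>\<^sup>+p. F p \<partial>(lborel \<Otimes>\<^sub>M lborel))"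
   by (subst lborel_pair.nn_integral_snd[symmetric]) auto
  finally show "(\<integral>\<^sup>+p. F (fst p + f (snd p), snd p) \<partial>(lborel \<Otimes>\<^sub>M lborel)) = (\<integral>\<^sup>+p. F p \<partial>(lborel \<Otimes>\<^sub>M lborel))" .
 qed measurable
 show "distr lborel borel (%p. (fst p, snd p + f (fst p))) = (lborel :: (complex \<times> complex) measure)"
 proof (rule distr_lborel_pairI)
  fix F :: "complex \<times> complex => ennreal" assume [measurable]: "F \<in> borel_measurable (borel \<Otimes>\<^sub>M borel)"
  have "(\<integral>\<^sup>+p. F (fst p, snd p + f (fst p)) \<partial>(lborel \<Otimes>\<^sub>M lborel))
    = (\<integral>\<^sup>+x. \<integral>\<^sup>+y. F (x, y + f x) \<partial>lborel \<partial>lborel)"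
   by (subst lborel.nn_integral_fst[symmetric]) auto
  also have "\<dots> = (\<integral>\<^sup>+x. \<integral>\<^sup>+y. F (x, y) \<partial>lborel \<partial>lborel)"
   by (intro nn_integral_cong tr) measurable
  also have "\<dots> = (\<integral>\<^sup>+p. F p \<partial>(lborel \<Otimes>\<^sub>M lborel))"
   by (subst lborel.nn_integral_fst[symmetric]) auto
  finally show "(\<integral>\<^sup>+p. F (fst p, snd p + f (fst p)) \<partial>(lborel \<Otimes>\<^sub>M lborel)) = (\<integral>\<^sup>+p. F p \<partial>(lborel \<Otimes>\<^sub>M lborel))" .
 qed measurable
qed

lemma measurable_cnj [measurable]: "cnj \<in> borel_measurable borel"
 by (intro borel_measurable_continuous_onI continuous_intros)

lemma distr_lborel_comp:
 assumes "distr lborel borel S = (lborel :: (complex \<times> complex) measure)"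
  "distr lborel borel T = (lborel :: (complex \<times> complex) measure)"
  and [measurable]: "S \<in> borel_measurable borel" "T \<in> borel_measurable borel"
 shows "distr lborel borel (%p. S (T p)) = (lborel :: (complex \<times> complex) measure)"
proof -
 have "distr lborel borel (%p. S (T p)) = distr (distr lborel borel T) borel S"
  by (subst distr_distr) (auto simp: comp_def)
 then show ?thesis using assms by simp
qed

lemma measurable_SU11_mult [measurable]:
 "SU11_mult q \<in> borel_measurable borel" "(%p. SU11_mult p q) \<in> borel_measurable borel"
 unfolding SU11_mult_def case_prod_beta
 by (intro borel_measurable_continuous_onI continuous_intros)+

text \<open>A matrix in \<open>SU(1,1)\<close> with nonzero lower left entry is a product of three shears.\<close>

lemma distr_lborel_SU11_mult:
 assumes q: "q \<in> SU11" and nz: "snd q \<noteq> 0"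
 shows "distr lborel borel (SU11_mult q) = lborel"
  and "distr lborel borel (%p. SU11_mult p q) = lborel"
proof -
 obtain a c where ac: "q = (a, c)" by force
 have c: "c \<noteq> 0" "cnj c \<noteq> 0" and det: "a * cnj a = 1 + c * cnj c"
  using q nz by (auto simp: ac SU11_def algebra_simps)
 \<comment> \<open>Multiplying out \<open>U\<close>, \<open>V\<close>, \<open>W\<close> gives the
   entries 1 + x * c, c and 1 + c * y, which forces these values of x and y; the fourth entry is
   then cnj c because the determinant is 1.\<close>
 let ?x = "(a - 1) / c" and ?y = "(cnj a - 1) / c"
 have yx: "?y + ?x * cnj a = cnj c"
  using c det by (simp add: field_simps)
 define U where "U = (%p :: complex \<times> complex. (fst p + ?x * snd p, snd p))"
 define V where "V = (%p :: complex \<times> complex. (fst p, snd p + c * fst p))"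
 define W where "W = (%p :: complex \<times> complex. (fst p + ?y * snd p, snd p))"
 have eq: "SU11_mult q p = U (V (W p))" for p :: "complex \<times> complex"
 proof -
  obtain u v where p: "p = (u, v)" by force
  have 1: "v + c * (u + ?y * v) = c * u + cnj a * v" using c by (simp add: field_simps)
  have "u + ?y * v + ?x * (c * u + cnj a * v) = (1 + ?x * c) * u + (?y + ?x * cnj a) * v"
   by (simp add: algebra_simps)
  also have "\<dots> = a * u + cnj c * v" unfolding yx using c by simp
  finally show ?thesis by (simp only: p ac SU11_mult_def U_def V_def W_def prod.case fst_conv snd_conv 1)
 qed
 have M: "U \<in> borel_measurable borel" "V \<in> borel_measurable borel" "W \<in> borel_measurable borel"
  unfolding U_def V_def W_def by (intro borel_measurable_continuous_onI continuous_intros)+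
 have D: "distr lborel borel U = lborel" "distr lborel borel V = lborel" "distr lborel borel W = lborel"
  unfolding U_def V_def W_def
  using lborel_shear(1)[of "%z. ?x * z"] lborel_shear(2)[of "%z. c * z"] lborel_shear(1)[of "%z. ?y * z"] by auto
 have "distr lborel borel (%p. U (V (W p))) = lborel"
  using distr_lborel_comp[OF D(1) distr_lborel_comp[OF D(2,3) M(2,3)] M(1)] M by simp
 then show "distr lborel borel (SU11_mult q) = lborel" by (simp only: eq[symmetric])
next
 obtain a c where ac: "q = (a, c)" by force
 have c: "c \<noteq> 0" "cnj c \<noteq> 0" and det: "a * cnj a = 1 + c * cnj c"
  using q nz by (auto simp: ac SU11_def algebra_simps)
 \<comment> \<open>Right multiplication is only real-linear in the pair. It becomes a matrix product
   once the second component is conjugated, hence the shears through \<open>cnj\<close>.\<close>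
 let ?x = "(a - 1) / cnj c" and ?y = "(cnj a - 1) / cnj c"
 have yx: "?y + ?x * cnj a = c"
  using c det by (simp add: field_simps)
 define U where "U = (%p :: complex \<times> complex. (fst p + ?x * cnj (snd p), snd p))"
 define V where "V = (%p :: complex \<times> complex. (fst p, snd p + c * cnj (fst p)))"
 define W where "W = (%p :: complex \<times> complex. (fst p + ?y * cnj (snd p), snd p))"
 have eq: "SU11_mult p q = U (V (W p))" for p :: "complex \<times> complex"
 proof -
  obtain u v where p: "p = (u, v)" by force
  have 1: "v + c * cnj (u + ?y * cnj v) = v * a + cnj u * c" using c by (simp add: field_simps)
  have "u + ?y * cnj v + ?x * cnj (v * a + cnj u * c) = (1 + ?x * cnj c) * u + (?y + ?x * cnj a) * cnj v"
   by (simp add: algebra_simps)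
  also have "\<dots> = u * a + cnj v * c" unfolding yx using c by simp
  finally show ?thesis by (simp only: p ac SU11_mult_def U_def V_def W_def prod.case fst_conv snd_conv 1)
 qed
 have M: "U \<in> borel_measurable borel" "V \<in> borel_measurable borel" "W \<in> borel_measurable borel"
  unfolding U_def V_def W_def by (intro borel_measurable_continuous_onI continuous_intros)+
 have D: "distr lborel borel U = lborel" "distr lborel borel V = lborel" "distr lborel borel W = lborel"
  unfolding U_def V_def W_def
  using lborel_shear(1)[of "%z. ?x * cnj z"] lborel_shear(2)[of "%z. c * cnj z"] lborel_shear(1)[of "%z. ?y * cnj z"] by auto
 have "distr lborel borel (%p. U (V (W p))) = lborel"
  using distr_lborel_comp[OF D(1) distr_lborel_comp[OF D(2,3) M(2,3)] M(1)] M by simp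
 then show "distr lborel borel (%p. SU11_mult p q) = lborel" by (simp only: eq[symmetric])
qed

text \<open>A factor s multiplies |a|^2 - |c|^2 by s^2, so these are the multiples of SU(1,1) by
  factors strictly between 0 and 1. The set is open and both multiplications by SU(1,1) map it to
  itself.\<close>

definition cone_slab :: "(complex \<times> complex) set" where
 "cone_slab = {p. 0 < (norm (fst p))\<^sup>2 - (norm (snd p))\<^sup>2 \<and> (norm (fst p))\<^sup>2 - (norm (snd p))\<^sup>2 < 1}"

lemma cone_norm_less: "p \<in> cone_slab ==> norm (snd p) < norm (fst p)"
 unfolding cone_slab_def mem_Collect_eq by (rule power2_less_imp_less[OF _ norm_ge_zero]) linarith

lemma open_cone: "open cone_slab"
proof -
 have "open {p :: complex \<times> complex. 0 < (norm (fst p))\<^sup>2 - (norm (snd p))\<^sup>2}"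
  "open {p :: complex \<times> complex. (norm (fst p))\<^sup>2 - (norm (snd p))\<^sup>2 < 1}"
  by (intro open_Collect_less continuous_intros)+
 then show ?thesis unfolding cone_slab_def by (rule open_Collect_conj)
qed

lemma cone_slab_eq: "p \<in> cone_slab \<longleftrightarrow> (\<exists>s q. 0 < s \<and> s < 1 \<and> q \<in> SU11 \<and> p = s *\<^sub>R q)"
proof
 assume p: "p \<in> cone_slab"
 define s where "s = sqrt ((norm (fst p))\<^sup>2 - (norm (snd p))\<^sup>2)"
 have s: "0 < s" "s < 1" "s\<^sup>2 = (norm (fst p))\<^sup>2 - (norm (snd p))\<^sup>2"
  using p unfolding s_def cone_slab_def mem_Collect_eq
  by (simp_all only: real_sqrt_gt_0_iff real_sqrt_lt_1_iff real_sqrt_pow2 less_imp_le)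
 have "(fst p /\<^sub>R s, snd p /\<^sub>R s) \<in> SU11"
  using s unfolding SU11_norm by (simp add: power_mult_distrib power_inverse field_simps)
 moreover have "p = s *\<^sub>R (fst p /\<^sub>R s, snd p /\<^sub>R s)" using s(1) by (simp add: prod_eq_iff)
 ultimately show "\<exists>s q. 0 < s \<and> s < 1 \<and> q \<in> SU11 \<and> p = s *\<^sub>R q" using s by blast
next
 assume "\<exists>s q. 0 < s \<and> s < 1 \<and> q \<in> SU11 \<and> p = s *\<^sub>R q"
 then obtain s a c where s: "0 < s" "s < 1" "(a, c) \<in> SU11" "p = s *\<^sub>R (a, c)" by auto
 have "(norm (fst p))\<^sup>2 - (norm (snd p))\<^sup>2 = s\<^sup>2"
  using s(3) unfolding SU11_norm s(4) by (simp add: power_mult_distrib algebra_simps)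
 moreover have "0 < s\<^sup>2" "s\<^sup>2 < 1" using s(1,2) by (auto simp: abs_square_less_1)
 ultimately show "p \<in> cone_slab" unfolding cone_slab_def mem_Collect_eq by presburger
qed

lemma SU11_mult_scaleR: "SU11_mult q (s *\<^sub>R p) = s *\<^sub>R SU11_mult q p" "SU11_mult (s *\<^sub>R p) q = s *\<^sub>R SU11_mult p q"
 by (simp_all add: SU11_mult_def case_prod_beta scaleR_conv_of_real algebra_simps prod_eq_iff)

lemma cone_coords_scaleR: "s \<noteq> 0 ==> cone_coords (s *\<^sub>R p) = cone_coords p"
 by (simp add: cone_coords_def case_prod_beta scaleR_conv_of_real)

definition cone_proj :: "complex \<times> complex => moebius" where
 "cone_proj p = moebius_of (cone_coords p)"

lemma cone_proj_scaleR: "s > 0 ==> q \<in> SU11 ==> cone_proj (s *\<^sub>R q) = mob q"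
 by (simp add: cone_proj_def cone_coords_scaleR mob_eq_moebius_of)

lemma cone_mult:
 assumes "q \<in> SU11" "p \<in> cone_slab"
 shows "SU11_mult q p \<in> cone_slab" "SU11_mult p q \<in> cone_slab"
  "cone_proj (SU11_mult q p) = mob q * cone_proj p" "cone_proj (SU11_mult p q) = cone_proj p * mob q"
proof -
 obtain s p' where p: "0 < s" "s < 1" "p' \<in> SU11" "p = s *\<^sub>R p'" using assms(2) unfolding cone_slab_eq by blast
 have m: "SU11_mult q p' \<in> SU11" "SU11_mult p' q \<in> SU11" using p assms SU11_mult_closed by auto
 then show "SU11_mult q p \<in> cone_slab" "SU11_mult p q \<in> cone_slab"
  unfolding p(4) SU11_mult_scaleR cone_slab_eq using p by blast+
 show "cone_proj (SU11_mult q p) = mob q * cone_proj p" "cone_proj (SU11_mult p q) = cone_proj p * mob q"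
  unfolding p(4) SU11_mult_scaleR using m p assms(1) by (simp_all add: cone_proj_scaleR mob_mult)
qed

lemma SU11_inverse:
 assumes "(a, c) \<in> SU11"
 shows "(cnj a, - c) \<in> SU11" "SU11_mult (cnj a, - c) (SU11_mult (a, c) p) = p"
  "SU11_mult (SU11_mult p (a, c)) (cnj a, - c) = p"
proof -
 have d: "a * cnj a = 1 + c * cnj c" using assms by (simp add: SU11_def algebra_simps)
 show "(cnj a, - c) \<in> SU11" using assms by (simp add: SU11_norm)
 obtain u v where p: "p = (u, v)" by force
 have "cnj a * (a * u + cnj c * v) + cnj (- c) * (c * u + cnj a * v) = (a * cnj a - c * cnj c) * u"
  "- c * (a * u + cnj c * v) + a * (c * u + cnj a * v) = (a * cnj a - c * cnj c) * v"
  "(u * a + cnj v * c) * cnj a + cnj (v * a + cnj u * c) * (- c) = (a * cnj a - c * cnj c) * u"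
  "(v * a + cnj u * c) * cnj a + cnj (u * a + cnj v * c) * (- c) = (a * cnj a - c * cnj c) * v"
  by (simp_all add: algebra_simps)
 then show "SU11_mult (cnj a, - c) (SU11_mult (a, c) p) = p" "SU11_mult (SU11_mult p (a, c)) (cnj a, - c) = p"
  by (simp_all add: SU11_mult_def p d)
qed

lemma continuous_on_cone_proj: "continuous_on cone_slab cone_proj"
 unfolding cone_proj_def
proof (rule continuous_on_compose2[OF continuous_on_moebius_of])
 show "cone_coords ` cone_slab \<subseteq> coord_space" using cone_coords_in cone_norm_less by force
 show "continuous_on cone_slab cone_coords"
  unfolding cone_coords_def case_prod_beta by (intro continuous_intros) (use cone_norm_less in force)+
qed

text \<open>Radial projection of Lebesgue measure. Bounding the scale by 1 keeps the mass of compact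
  sets finite, and since scaling commutes with multiplication on either side, the image is invariant
  on both sides.\<close>

definition conem :: "moebius measure" where
 "conem = distr (restrict_space lborel cone_slab) borel cone_proj"

lemma sets_conem [measurable_cong]: "sets conem = sets borel"
 by (simp add: conem_def)

lemma space_conem: "space conem = UNIV"
 by (simp add: conem_def)

lemma measurable_cone_proj: "cone_proj \<in> measurable (restrict_space lborel cone_slab) borel"
proof -
 have "cone_proj \<in> borel_measurable (restrict_space borel cone_slab)"
  by (rule borel_measurable_continuous_on_restrict[OF continuous_on_cone_proj])
 moreover have "sets (restrict_space lborel cone_slab) = sets (restrict_space borel cone_slab)"
  by (rule sets_restrict_space_cong) simp
 ultimately show ?thesis using measurable_cong_sets by blast
qed

lemma cone_sets: "A \<in> sets borel ==> cone_proj -` A \<inter> cone_slab \<in> sets borel"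
 using measurable_sets[OF measurable_cone_proj, of A] open_cone
 by (simp add: space_restrict_space sets_restrict_space_iff)

lemma emeasure_conem:
 "A \<in> sets borel ==> emeasure conem A = emeasure lborel (cone_proj -` A \<inter> cone_slab)"
 using open_cone by (simp add: conem_def emeasure_distr[OF measurable_cone_proj]
   emeasure_restrict_space space_restrict_space)

text \<open>The two ways round the square formed by \<open>T\<close>, \<open>f\<close> and
  \<open>cone_proj\<close> give the same preimage of a set, and \<open>T\<close> preserves Lebesgue
  measure.\<close>

lemma conem_invariant:
 assumes T: "distr lborel borel T = lborel" and [measurable]: "T \<in> borel_measurable borel" "f \<in> borel_measurable borel"
  and c: "\<And>p. T p \<in> cone_slab \<longleftrightarrow> p \<in> cone_slab" and f: "\<And>p. p \<in> cone_slab ==> cone_proj (T p) = f (cone_proj p)"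
 shows "distr conem borel f = conem"
proof (rule measure_eqI)
 fix A assume "A \<in> sets (distr conem borel f)"
 then have A: "A \<in> sets borel" by simp
 have fA: "f -` A \<in> sets borel" using measurable_sets[OF assms(3) A] by simp
 have "emeasure (distr conem borel f) A = emeasure conem (f -` A)"
  using A by (subst emeasure_distr) (auto simp: space_conem)
 also have "\<dots> = emeasure lborel (cone_proj -` (f -` A) \<inter> cone_slab)" by (rule emeasure_conem[OF fA])
 also have "cone_proj -` (f -` A) \<inter> cone_slab = T -` (cone_proj -` A \<inter> cone_slab)"
  by (intro set_eqI) (use c f in \<open>simp add: conj_commute cong: conj_cong\<close>)
 also have "emeasure lborel \<dots> = emeasure (distr lborel borel T) (cone_proj -` A \<inter> cone_slab)"
  using cone_sets[OF A] by (subst emeasure_distr) auto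
 also have "\<dots> = emeasure conem A" using A by (simp add: T emeasure_conem)
 finally show "emeasure (distr conem borel f) A = emeasure conem A" .
qed (simp add: sets_conem)

text \<open>The shear factorisation needs a nonzero lower left entry, which rotations do not have; a
  rotation is therefore written as a product of two elements that have one.\<close>

lemma conem_translate:
 "distr conem borel (%x. g * x) = conem" "distr conem borel (%x. x * g) = conem"
proof -
 have nz: "distr conem borel (%x. mob q * x) = conem"
  "distr conem borel (%x. x * mob q) = conem" if q: "q \<in> SU11" "snd q \<noteq> 0" for q
 proof -
  obtain a c where ac: "q = (a, c)" by force
  note inv = SU11_inverse[OF q(1)[unfolded ac]]
  have "SU11_mult q p \<in> cone_slab \<longleftrightarrow> p \<in> cone_slab" "SU11_mult p q \<in> cone_slab \<longleftrightarrow> p \<in> cone_slab" for p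
   using cone_mult[OF q(1)] cone_mult[OF inv(1)] inv(2,3)[of p] ac by metis+
  then show "distr conem borel (%x. mob q * x) = conem"
   "distr conem borel (%x. x * mob q) = conem"
   using distr_lborel_SU11_mult[OF q] cone_mult(3,4)[OF q(1)]
   by (auto intro: conem_invariant[of "SU11_mult q"] conem_invariant[of "%p. SU11_mult p q"])
 qed
 have comp: "distr conem borel (%x. f (f' x)) = conem"
  if "distr conem borel f = conem" "distr conem borel f' = conem"
   and [measurable]: "f \<in> borel_measurable borel" "f' \<in> borel_measurable borel" for f f' :: "moebius => moebius"
 proof -
  have "distr (distr conem borel f') borel f = distr conem borel (%x. f (f' x))"
   by (subst distr_distr) (auto simp: comp_def)
  then show ?thesis using that by simp
 qed
 obtain q where q: "q \<in> SU11" "g = mob q" using mob_surj by blast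
 have "distr conem borel (%x. g * x) = conem \<and> distr conem borel (%x. x * g) = conem"
 proof (cases "snd q = 0")
  case True
  obtain a where a: "q = (a, 0)" using True by (metis prod.collapse)
  \<comment> \<open>\<open>?h\<close> lies in SU(1,1) because 2 - 1 = 1, and \<open>?k\<close> is
    \<open>q\<close> times the inverse of \<open>?h\<close>, whose lower left entry comes out as -
    cnj a.\<close>
  let ?h = "(complex_of_real (sqrt 2), 1 :: complex)"
  let ?k = "SU11_mult q (cnj (complex_of_real (sqrt 2)), - 1)"
  have h: "?h \<in> SU11" by (simp add: SU11_norm)
  note inv = SU11_inverse[OF h]
  have k: "?k \<in> SU11" using SU11_mult_closed[OF q(1) inv(1)] by simp
  have "a \<noteq> 0" using SU11_norm_less q a by fastforce
  then have k0: "snd ?k \<noteq> 0" by (simp add: SU11_mult_def a)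
  have "mob (SU11_mult ?k ?h) = g"
   using SU11_inverse(3)[OF inv(1), of q] q(2) by simp
  then have g: "g = mob ?k * mob ?h" using mob_mult[OF k h] by simp
  show ?thesis
   using comp[OF nz(1)[OF k k0] nz(1)[OF h]] comp[OF nz(2)[OF h] nz(2)[OF k k0]]
   by (simp add: g mult.assoc)
 qed (use nz q in auto)
 then show "distr conem borel (%x. g * x) = conem" "distr conem borel (%x. x * g) = conem"
  by auto
qed

text \<open>For radii below 1 these are compact and exhaust the group. The number |g(0)| is
  unchanged by inversion and by a rotation composed on the left, and both symmetries are
  exploited.\<close>

definition mball :: "real => moebius set" where
 "mball rho = {g. norm (ap g 0) \<le> rho}"

lemma compact_mball: "rho < 1 ==> compact (mball rho)"
proof -
 assume rho: "rho < 1"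
 have "mball rho = moebius_of ` (circle \<times> cball 0 rho)"
 proof (intro set_eqI iffI)
  fix g assume "g \<in> mball rho"
  then have "coords g \<in> circle \<times> cball 0 rho"
   using norm_rotp[of g] by (auto simp: mball_def norm_apply_zero rotp_def shiftp_def mem_Times_iff)
  then show "g \<in> moebius_of ` (circle \<times> cball 0 rho)" using moebius_of_coords[of g] by (metis imageI)
 next
  fix g assume "g \<in> moebius_of ` (circle \<times> cball 0 rho)"
  then show "g \<in> mball rho" using rho by (auto simp: mball_def apply_moebius_of norm_mult)
 qed
 moreover have "compact (moebius_of ` (circle \<times> cball 0 rho))"
  using rho by (intro compact_continuous_image continuous_on_subset[OF continuous_on_moebius_of] compact_Times) auto
 ultimately show ?thesis by simp
qed

lemma mball_sets [measurable]: "mball rho \<in> sets borel"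
proof -
 have [measurable]: "(%g. ap g 0) \<in> borel_measurable borel"
  by (intro borel_measurable_continuous_onI continuous_intros) auto
 show ?thesis unfolding mball_def by measurable
qed

lemma ginv_mball: "ginv g \<in> mball rho \<longleftrightarrow> g \<in> mball rho"
 by (simp add: mball_def norm_apply_zero coords_ginv norm_mult)

lemma rot_mball: "norm om = 1 ==> rot om * g \<in> mball rho \<longleftrightarrow> g \<in> mball rho"
 by (simp add: mball_def apply_mult apply_rot norm_mult less_imp_le)

lemma compact_subset_mball:
 assumes "compact C"
 obtains rho where "rho < 1" "0 < rho" "C \<subseteq> mball rho"
proof (cases "C = {}")
 case False
 have "continuous_on C (%g. norm (ap g 0))" by (intro continuous_intros) auto
 then obtain g where g: "\<And>h. h \<in> C ==> norm (ap h 0) \<le> norm (ap g 0)"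
  using continuous_attains_sup[OF assms False] by metis
 have half: "a \<le> (b + 1) / 2" if "a \<le> b" "b \<le> 1" for a b :: real using that by simp
 show ?thesis
 proof (rule that[of "(norm (ap g 0) + 1) / 2"])
  show "C \<subseteq> mball ((norm (ap g 0) + 1) / 2)"
  proof
   fix h assume "h \<in> C"
   then show "h \<in> mball ((norm (ap g 0) + 1) / 2)"
    using half[OF g[OF \<open>h \<in> C\<close>] less_imp_le[OF norm_apply_zero_less[of g]]] by (simp add: mball_def)
  qed
 qed (use norm_apply_zero_less[of g] in auto, use norm_ge_zero[of "ap g 0"] in linarith)
qed (rule that[of "1/2"], auto)

lemma cone_proj_apply:
 assumes "p \<in> cone_slab"
 shows "norm (ap (cone_proj p) 0) = norm (snd p) / norm (fst p)"
proof -
 have "cone_coords p \<in> coord_space" using cone_coords_in cone_norm_less[OF assms] by (metis prod.collapse)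
 then show ?thesis
  by (simp add: norm_apply_zero shiftp_def cone_proj_def coords_moebius_of)
   (simp add: cone_coords_def case_prod_beta norm_divide)
qed

text \<open>On the preimage |c| \<le> r * |a|, while |a|^2 - |c|^2 < 1 in the slab. Hence |a|^2 * (1
  - r^2) < 1 and the preimage is bounded.\<close>

lemma conem_ball_finite:
 assumes "rho < 1" shows "emeasure conem (mball rho) < \<infinity>"
proof -
 define r where "r = max rho 0"
 have r: "0 \<le> r" "r < 1" "rho \<le> r" using assms by (auto simp: r_def)
 have "cone_proj -` mball rho \<inter> cone_slab \<subseteq> ball 0 (1 / sqrt (1 - r\<^sup>2)) \<times> ball 0 (1 / sqrt (1 - r\<^sup>2))"
 proof
  fix p assume "p \<in> cone_proj -` mball rho \<inter> cone_slab"
  then have p: "p \<in> cone_slab" and "norm (snd p) / norm (fst p) \<le> rho"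
   using cone_proj_apply[of p] by (auto simp: mball_def)
  then have le: "norm (snd p) / norm (fst p) \<le> r" using r by linarith
  have lt: "norm (snd p) < norm (fst p)" using cone_norm_less[OF p] .
  then have f: "norm (fst p) > 0" using norm_ge_zero[of "snd p"] by linarith
  have "norm (snd p) \<le> r * norm (fst p)" using le f by (simp add: divide_le_eq)
  then have "(norm (snd p))\<^sup>2 \<le> r\<^sup>2 * (norm (fst p))\<^sup>2" by (metis norm_ge_zero power_mono power_mult_distrib)
  moreover have "(norm (fst p))\<^sup>2 - (norm (snd p))\<^sup>2 < 1" using p by (simp add: cone_slab_def)
  ultimately have "(norm (fst p))\<^sup>2 * (1 - r\<^sup>2) < 1" by (simp add: algebra_simps)
  moreover have r1: "1 - r\<^sup>2 > 0" using r by (simp add: abs_square_less_1)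
  ultimately have "(norm (fst p))\<^sup>2 < 1 / (1 - r\<^sup>2)" by (simp only: pos_less_divide_eq)
  then have "sqrt ((norm (fst p))\<^sup>2) < sqrt (1 / (1 - r\<^sup>2))" by (rule real_sqrt_less_mono)
  then have "norm (fst p) < 1 / sqrt (1 - r\<^sup>2)" by (simp add: real_sqrt_divide)
  then show "p \<in> ball 0 (1 / sqrt (1 - r\<^sup>2)) \<times> ball 0 (1 / sqrt (1 - r\<^sup>2))"
   using lt by (simp add: mem_Times_iff)
 qed
 then have "bounded (cone_proj -` mball rho \<inter> cone_slab)"
  using bounded_subset bounded_Times bounded_ball by metis
 then have "emeasure lborel (cone_proj -` mball rho \<inter> cone_slab) < \<infinity>" by (rule emeasure_bounded_finite)
 then show ?thesis by (simp only: emeasure_conem[OF mball_sets])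
qed

lemma conem_open_pos:
 assumes "open U" "U \<noteq> {}"
 shows "emeasure conem U > 0"
proof -
 have "open (cone_proj -` U \<inter> cone_slab)"
  using continuous_open_preimage[OF continuous_on_cone_proj open_cone assms(1)] by (simp add: Int_commute)
 moreover have "cone_proj -` U \<inter> cone_slab \<noteq> {}"
 proof -
  obtain g q where g: "g \<in> U" "q \<in> SU11" "g = mob q" using assms(2) mob_surj by blast
  have "(1/2) *\<^sub>R q \<in> cone_slab" unfolding cone_slab_eq using g(2) by (intro exI[of _ "1/2 :: real"] exI[of _ q]) auto
  moreover have "cone_proj ((1/2) *\<^sub>R q) = g" using g by (simp add: cone_proj_scaleR)
  ultimately show ?thesis using g(1) by auto
 qed
 ultimately have "\<not> negligible (cone_proj -` U \<inter> cone_slab)" by (rule open_not_negligible)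
 moreover have "cone_proj -` U \<inter> cone_slab \<in> sets lborel" using cone_sets[of U] assms(1) by simp
 ultimately have "emeasure lborel (cone_proj -` U \<inter> cone_slab) \<noteq> 0"
  by (metis negligible_iff_null_sets null_setsI null_sets_completionI)
 then show ?thesis using assms by (simp add: emeasure_conem zero_less_iff_neq_zero)
qed

lemma conem_haar: "haar_measure conem"
 unfolding haar_measure_def
proof (intro conjI allI impI)
 fix C :: "moebius set" assume "compact C"
 then obtain rho where rho: "rho < 1" "0 < rho" "C \<subseteq> mball rho" using compact_subset_mball by blast
 have "emeasure conem C \<le> emeasure conem (mball rho)"
  using rho(3) by (intro emeasure_mono) (auto simp: sets_conem)
 then show "emeasure conem C < \<infinity>" using conem_ball_finite[OF rho(1)] by simp
qed (use conem_open_pos[of UNIV] in \<open>auto simp: sets_conem conem_translate\<close>)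

lemma haar_measure_sigma_finite:
 assumes "haar_measure m" shows "sigma_finite_measure m"
proof
 have sp: "space m = UNIV" using assms by (metis haar_measure_def sets_eq_imp_space_eq space_borel)
 let ?A = "range (%k::nat. mball (1 - 1 / (real k + 1)))"
 have "\<exists>k::nat. x \<in> mball (1 - 1 / (real k + 1))" for x
 proof -
  have "0 < 1 - norm (ap x 0)" by simp
  then obtain k where "1 / (real k + 1) < 1 - norm (ap x 0)" using nat_approx_posE by (metis of_nat_Suc add.commute)
  then show ?thesis by (intro exI[of _ k]) (simp add: mball_def)
 qed
 then have "\<Union>?A = space m" unfolding sp by blast
 moreover have "emeasure m a \<noteq> \<infinity>" if "a \<in> ?A" for a
 proof -
  have "compact a" using that by (auto intro!: compact_mball)
  then show ?thesis using assms by (auto simp: haar_measure_def less_top)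
 qed
 moreover have "?A \<subseteq> sets m" using assms by (auto simp: haar_measure_def)
 ultimately show "\<exists>A. countable A \<and> A \<subseteq> sets m \<and> \<Union>A = space m \<and> (\<forall>a\<in>A. emeasure m a \<noteq> \<infinity>)"
  by (intro exI[of _ ?A]) auto
qed

text \<open>The classical double-integral argument for uniqueness, run against the measure
 \<^term>\<open>conem\<close> that is already known to be invariant on both sides.\<close>

lemma haar_measure_cross:
 assumes n: "haar_measure n" and [measurable]: "f \<in> borel_measurable borel" "g \<in> borel_measurable borel"
 shows "(\<integral>\<^sup>+x. f x \<partial>conem) * (\<integral>\<^sup>+y. g y \<partial>n) = (\<integral>\<^sup>+x. f x \<partial>n) * (\<integral>\<^sup>+x. g (ginv x) \<partial>conem)"
proof -
 have sn[measurable_cong]: "sets n = sets borel" using n by (simp add: haar_measure_def)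
 interpret m: sigma_finite_measure conem by (rule haar_measure_sigma_finite[OF conem_haar])
 interpret n: sigma_finite_measure n by (rule haar_measure_sigma_finite[OF n])
 interpret p: pair_sigma_finite conem n ..
 have L: "(\<integral>\<^sup>+y. F (g * y) \<partial>m) = (\<integral>\<^sup>+y. F y \<partial>m)" if "haar_measure m" and [measurable]: "F \<in> borel_measurable borel"
  for F g and m :: "moebius measure"
 proof -
  have [measurable_cong]: "sets m = sets borel" using that by (simp add: haar_measure_def)
  have "(\<integral>\<^sup>+y. F y \<partial>m) = (\<integral>\<^sup>+y. F y \<partial>distr m borel (%x. g * x))" using that by (simp add: haar_measure_def)
  also have "\<dots> = (\<integral>\<^sup>+y. F (g * y) \<partial>m)" by (rule nn_integral_distr) measurable
  finally show ?thesis by simp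
 qed
 have R: "(\<integral>\<^sup>+y. F (y * g) \<partial>conem) = (\<integral>\<^sup>+y. F y \<partial>conem)" if [measurable]: "F \<in> borel_measurable borel" for F g
 proof -
  have "(\<integral>\<^sup>+y. F y \<partial>conem) = (\<integral>\<^sup>+y. F y \<partial>distr conem borel (%x. x * g))" by (simp add: conem_translate)
  also have "\<dots> = (\<integral>\<^sup>+y. F (y * g) \<partial>conem)" by (rule nn_integral_distr) measurable
  finally show ?thesis by simp
 qed
 have "(\<integral>\<^sup>+x. f x \<partial>conem) * (\<integral>\<^sup>+y. g y \<partial>n) = (\<integral>\<^sup>+y. (\<integral>\<^sup>+x. f (x * y) \<partial>conem) * g y \<partial>n)"
  by (simp add: R nn_integral_cmult)
 also have "\<dots> = (\<integral>\<^sup>+y. (\<integral>\<^sup>+x. f (x * y) * g y \<partial>conem) \<partial>n)"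
  by (simp add: nn_integral_multc)
 also have "\<dots> = (\<integral>\<^sup>+x. (\<integral>\<^sup>+y. f (x * y) * g y \<partial>n) \<partial>conem)"
  by (rule p.Fubini') measurable
 also have "\<dots> = (\<integral>\<^sup>+x. (\<integral>\<^sup>+y. f y * g (ginv x * y) \<partial>n) \<partial>conem)"
 proof (rule nn_integral_cong)
  fix x
  have "(\<integral>\<^sup>+y. f (x * y) * g (ginv x * (x * y)) \<partial>n) = (\<integral>\<^sup>+y. f y * g (ginv x * y) \<partial>n)"
   by (rule L[OF n, of "%y. f y * g (ginv x * y)"]) measurable
  then show "(\<integral>\<^sup>+y. f (x * y) * g y \<partial>n) = (\<integral>\<^sup>+y. f y * g (ginv x * y) \<partial>n)" by simp
 qed
 also have "\<dots> = (\<integral>\<^sup>+y. (\<integral>\<^sup>+x. f y * g (ginv x * y) \<partial>conem) \<partial>n)"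
  by (rule p.Fubini'[symmetric]) measurable
 also have "\<dots> = (\<integral>\<^sup>+y. f y * (\<integral>\<^sup>+x. g (ginv x) \<partial>conem) \<partial>n)"
 proof (rule nn_integral_cong)
  fix y
  have "(\<integral>\<^sup>+x. g (ginv (y * x) * y) \<partial>conem) = (\<integral>\<^sup>+x. g (ginv x * y) \<partial>conem)"
   by (rule L[OF conem_haar, of "%x. g (ginv x * y)"]) measurable
  then have "(\<integral>\<^sup>+x. g (ginv x * y) \<partial>conem) = (\<integral>\<^sup>+x. g (ginv x) \<partial>conem)"
   by (simp add: ginv_mult)
  then show "(\<integral>\<^sup>+x. f y * g (ginv x * y) \<partial>conem) = f y * (\<integral>\<^sup>+x. g (ginv x) \<partial>conem)"
   by (simp add: nn_integral_cmult)
 qed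
 also have "\<dots> = (\<integral>\<^sup>+x. f x \<partial>n) * (\<integral>\<^sup>+x. g (ginv x) \<partial>conem)"
  by (rule nn_integral_multc) measurable
 finally show ?thesis .
qed

lemma ennreal_mult_right_cancel': "c \<noteq> 0 ==> c \<noteq> \<infinity> ==> a * c = b * c ==> a = (b :: ennreal)"
 by (metis ennreal_mult_divide_eq infinity_ennreal_def)

lemma conem_half_ball:
 "emeasure conem (mball (1/2)) \<noteq> 0" "emeasure conem (mball (1/2)) \<noteq> \<infinity>"
proof -
 have "open {g. norm (ap g 0) < 1/2}"
  by (intro open_Collect_less continuous_intros) auto
 moreover have "1 \<in> {g. norm (ap g 0) < 1/2}" by (simp add: apply_one)
 ultimately have "0 < emeasure conem {g. norm (ap g 0) < 1/2}"
  using conem_open_pos by blast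
 also have "\<dots> \<le> emeasure conem (mball (1/2))"
  by (intro emeasure_mono) (auto simp: mball_def[symmetric] sets_conem, auto simp: mball_def)
 finally show "emeasure conem (mball (1/2)) \<noteq> 0" by simp
 show "emeasure conem (mball (1/2)) \<noteq> \<infinity>" using conem_ball_finite[of "1/2"] by simp
qed

text \<open>In the cross identity the indicator of a ball is put for \<open>g\<close>. The ball is
  closed under inversion, so the identity becomes proportionality of the two measures, with the
  ratio of the masses of that ball as constant.\<close>

lemma haar_measure_unique:
 assumes n: "haar_measure n"
 obtains c where "0 < c" "c < \<infinity>" "n = scale_measure c conem"
proof -
 let ?B = "mball (1/2)" let ?m = "conem"
 have [simp]: "sets n = sets borel" "sets ?m = sets borel" using n by (simp_all add: haar_measure_def sets_conem)
 have inv: "(%x. indicator ?B (ginv x)) = (indicator ?B :: _ => ennreal)"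
  using ginv_mball by (auto simp: indicator_def)
 have eq: "emeasure ?m A * emeasure n ?B = emeasure n A * emeasure ?m ?B" if "A \<in> sets borel" for A
  using haar_measure_cross[OF n, of "indicator A" "indicator ?B"] that by (simp add: inv)
 define c where "c = emeasure n ?B / emeasure ?m ?B"
 have B: "emeasure ?m ?B \<noteq> 0" "emeasure ?m ?B \<noteq> \<infinity>" by (fact conem_half_ball)+
 have nB: "emeasure n ?B < \<infinity>" using n compact_mball[of "1/2"] by (simp add: haar_measure_def)
 have em: "emeasure n A = c * emeasure ?m A" if "A \<in> sets borel" for A
 proof (rule ennreal_mult_right_cancel'[OF B])
  have "c * emeasure ?m ?B = emeasure n ?B"
   unfolding c_def using B by (simp add: ennreal_divide_times ennreal_divide_self less_top)
  then show "emeasure n A * emeasure ?m ?B = c * emeasure ?m A * emeasure ?m ?B"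
   using eq[OF that] by (metis mult.assoc mult.commute)
 qed
 show ?thesis
 proof
  show "n = scale_measure c ?m" by (rule measure_eqI) (auto simp: em)
  show "c < \<infinity>" using nB B ennreal_divide_eq_top_iff[of "emeasure n ?B" "emeasure ?m ?B"]
   unfolding c_def by (auto simp: less_top[symmetric])
  show "0 < c"
  proof (rule ccontr)
   assume "\<not> 0 < c"
   then have "emeasure n UNIV = 0" using em[of UNIV] by simp
   then show False using n by (simp add: haar_measure_def)
  qed
 qed
qed

section \<open>Properties of the chosen Haar measure\<close>

lemma haar_haar_measure: "haar_measure haar"
 unfolding haar_def by (rule someI) (rule conem_haar)

lemma sets_haar [measurable_cong, simp]: "sets haar = sets borel"
 using haar_haar_measure by (simp add: haar_measure_def)

lemma space_haar [simp]: "space haar = UNIV"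
 using sets_eq_imp_space_eq[OF sets_haar] by simp

interpretation haar: sigma_finite_measure haar
 by (rule haar_measure_sigma_finite[OF haar_haar_measure])

lemma distr_haar_left: "distr haar borel (%x. g * x) = haar"
 using haar_haar_measure by (simp add: haar_measure_def)

text \<open>\<open>haar_measure\<close> asks for left invariance; invariance on the right is
  inherited from \<open>conem\<close> through uniqueness.\<close>

lemma distr_haar_right: "distr haar borel (%x. x * g) = haar"
proof -
 obtain c where c: "haar = scale_measure c conem" using haar_measure_unique[OF haar_haar_measure] by metis
 show ?thesis
 proof (rule measure_eqI)
  fix A assume "A \<in> sets (distr haar borel (%x. x * g))"
  then have A: "A \<in> sets borel" by simp
  have "emeasure (distr haar borel (%x. x * g)) A = c * emeasure (distr conem borel (%x. x * g)) A"
   using A by (simp add: emeasure_distr space_conem) (simp add: c)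
  then show "emeasure (distr haar borel (%x. x * g)) A = emeasure haar A"
   by (simp add: conem_translate) (simp add: c)
 qed simp
qed

lemma haar_open_pos: "open U ==> U \<noteq> {} ==> emeasure haar U \<noteq> 0"
proof -
 assume U: "open U" "U \<noteq> {}"
 obtain c where c: "0 < c" "haar = scale_measure c conem" using haar_measure_unique[OF haar_haar_measure] by metis
 have "emeasure haar U = c * emeasure conem U" by (simp only: c(2) emeasure_scale_measure)
 then show ?thesis using c(1) conem_open_pos[OF U] by auto
qed

lemma haar_ball_finite: "rho < 1 ==> emeasure haar (mball rho) < \<infinity>"
 using haar_haar_measure compact_mball by (simp add: haar_measure_def)

lemma nn_integral_haar_left:
 assumes [measurable]: "F \<in> borel_measurable borel"
 shows "(\<integral>\<^sup>+x. F (g * x) \<partial>haar) = (\<integral>\<^sup>+x. F x \<partial>haar)"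
proof -
 have "(\<integral>\<^sup>+x. F x \<partial>haar) = (\<integral>\<^sup>+x. F x \<partial>distr haar borel (%x. g * x))" by (simp add: distr_haar_left)
 also have "\<dots> = (\<integral>\<^sup>+x. F (g * x) \<partial>haar)" by (rule nn_integral_distr) measurable
 finally show ?thesis by simp
qed

lemma AE_haar_left:
 assumes "AE x in haar. P x" shows "AE x in haar. P (g * x)"
proof -
 have "AE x in distr haar borel (%x. g * x). P x" by (subst distr_haar_left) (rule assms)
 then show ?thesis by (rule AE_distrD[rotated]) measurable
qed

lemma AE_haar_right:
 assumes "AE x in haar. P x" shows "AE x in haar. P (x * g)"
proof -
 have "AE x in distr haar borel (%x. x * g). P x" by (subst distr_haar_right) (rule assms)
 then show ?thesis by (rule AE_distrD[rotated]) measurable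
qed

section \<open>The Riesz representation on a compact Hausdorff space\<close>

definition cfun :: "'x topology => ('x => real) set" where
 "cfun X = {f. continuous_map X euclideanreal f}"

lemma cfun_intros:
 "(%_. c) \<in> cfun X"
 "f \<in> cfun X ==> g \<in> cfun X ==> (%x. f x + g x) \<in> cfun X"
 "f \<in> cfun X ==> g \<in> cfun X ==> (%x. f x - g x) \<in> cfun X"
 "f \<in> cfun X ==> g \<in> cfun X ==> (%x. f x * g x) \<in> cfun X"
 "f \<in> cfun X ==> g \<in> cfun X ==> (%x. max (f x) (g x)) \<in> cfun X"
 "f \<in> cfun X ==> g \<in> cfun X ==> (%x. min (f x) (g x)) \<in> cfun X"
 by (auto simp: cfun_def intro!: continuous_intros continuous_map_real_max continuous_map_real_min)

text \<open>A positive normalised linear functional on C(X). Members of \<open>cfun X\<close> are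
  functions on the whole type that may differ off the space; positivity is tested on the space only,
  which forces the functional to ignore such differences.\<close>

definition is_mean :: "'x topology => (('x => real) => real) => bool" where
 "is_mean X Lam \<longleftrightarrow> (\<forall>f\<in>cfun X. \<forall>g\<in>cfun X. Lam (%x. f x + g x) = Lam f + Lam g)
   \<and> (\<forall>f\<in>cfun X. \<forall>c. Lam (%x. c * f x) = c * Lam f)
   \<and> (\<forall>f\<in>cfun X. (\<forall>x\<in>topspace X. 0 \<le> f x) \<longrightarrow> 0 \<le> Lam f)
   \<and> Lam (%_. 1) = 1"

lemma space_borel_of [simp]: "space (borel_of X) = topspace X"
 unfolding borel_of_def by (rule space_measure_of) (auto dest: openin_subset)

lemma sets_borel_of: "sets (borel_of X) = sigma_sets (topspace X) {U. openin X U}"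
 unfolding borel_of_def by (rule sets_measure_of) (auto dest: openin_subset)

lemma openin_borel_of [intro]: "openin X U ==> U \<in> sets (borel_of X)"
 by (simp add: sets_borel_of)

lemma closedin_borel_of [intro]: "closedin X C ==> C \<in> sets (borel_of X)"
proof -
 assume C: "closedin X C"
 then have "topspace X - C \<in> sets (borel_of X)" by (auto simp: closedin_def)
 then have "space (borel_of X) - (topspace X - C) \<in> sets (borel_of X)" by blast
 moreover have "topspace X - (topspace X - C) = C" using closedin_subset[OF C] by auto
 ultimately show ?thesis by simp
qed

lemma cfun_measurable: "f \<in> cfun X ==> f \<in> borel_measurable (borel_of X)"
proof (rule borel_measurableI)
 fix S :: "real set" assume f: "f \<in> cfun X" and S: "open S"
 have "openin X {x \<in> topspace X. f x \<in> S}"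
  using f S openin_continuous_map_preimage[of X euclideanreal f S] by (simp add: cfun_def)
 moreover have "f -` S \<inter> space (borel_of X) = {x \<in> topspace X. f x \<in> S}" by auto
 ultimately show "f -` S \<inter> space (borel_of X) \<in> sets (borel_of X)" by auto
qed

lemma cfun_bounded:
 assumes "compact_space X" "f \<in> cfun X"
 obtains B where "0 \<le> B" "\<And>x. x \<in> topspace X ==> \<bar>f x\<bar> \<le> B"
proof -
 have "compactin euclideanreal (f ` topspace X)"
  using image_compactin[of X "topspace X" euclideanreal f] assms by (simp add: cfun_def compact_space_def)
 then have "bounded (f ` topspace X)" by (simp add: compact_imp_bounded)
 then obtain B where "B > 0" "\<And>x. x \<in> topspace X ==> \<bar>f x\<bar> \<le> B"
  by (auto simp: bounded_pos)
 then show ?thesis using that by (metis less_imp_le)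
qed

locale mean_functional =
 fixes X :: "'x topology" and Lam :: "('x => real) => real"
 assumes cpt: "compact_space X" and haus: "Hausdorff_space X" and mean: "is_mean X Lam"
begin

lemma add: "f \<in> cfun X ==> g \<in> cfun X ==> Lam (%x. f x + g x) = Lam f + Lam g"
 and scale: "f \<in> cfun X ==> Lam (%x. c * f x) = c * Lam f"
 and pos: "f \<in> cfun X ==> (\<And>x. x \<in> topspace X ==> 0 \<le> f x) ==> 0 \<le> Lam f"
 and one: "Lam (%_. 1) = 1"
 using mean by (auto simp: is_mean_def)

lemma diff: "f \<in> cfun X ==> g \<in> cfun X ==> Lam (%x. f x - g x) = Lam f - Lam g"
proof -
 assume f: "f \<in> cfun X" and g: "g \<in> cfun X"
 have "(%x. (- 1) * g x) \<in> cfun X" by (intro cfun_intros g)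
 from add[OF f this] show ?thesis by (simp only: scale[OF g]) simp
qed

lemma mono:
 assumes "f \<in> cfun X" "g \<in> cfun X" "\<And>x. x \<in> topspace X ==> f x \<le> g x"
 shows "Lam f \<le> Lam g"
proof -
 have "0 \<le> Lam (%x. g x - f x)" by (intro pos cfun_intros) (use assms in auto)
 then show ?thesis by (simp add: diff assms)
qed

lemma normal: "normal_space X"
 using cpt haus by (simp add: compact_Hausdorff_or_regular_imp_normal_space)

section \<open>A content on closed sets\<close>

definition dominating :: "'x set => ('x => real) set" where
 "dominating C = {f \<in> cfun X. (\<forall>x\<in>topspace X. 0 \<le> f x) \<and> (\<forall>x\<in>C. 1 \<le> f x)}"

text \<open>The content of the Riesz theorem, an infimum over continuous majorants of the indicator.
  It is defined for every set, but its additivity is shown and used for closed sets.\<close>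

definition content :: "'x set => real" where
 "content C = Inf (Lam ` dominating C)"

lemma dominating_nonempty: "Lam ` dominating C \<noteq> {}"
proof -
 have "(%_. 1) \<in> dominating C" by (auto simp: dominating_def cfun_intros)
 then show ?thesis by blast
qed

lemma dominating_bdd: "bdd_below (Lam ` dominating C)"
 by (rule bdd_belowI[of _ 0]) (auto simp: dominating_def intro!: pos)

lemma content_le: "f \<in> dominating C ==> content C \<le> Lam f"
 unfolding content_def by (rule cInf_lower) (auto intro: dominating_bdd)

lemma content_greatest: "(\<And>f. f \<in> dominating C ==> a \<le> Lam f) ==> a \<le> content C"
 unfolding content_def by (rule cInf_greatest) (use dominating_nonempty in auto)

lemma content_approx:
 assumes "e > 0" obtains f where "f \<in> dominating C" "Lam f < content C + e"
proof -
 have "\<exists>x\<in>Lam ` dominating C. x < content C + e"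
  using cInf_lessD[OF dominating_nonempty, of C "content C + e"] assms unfolding content_def by auto
 then show ?thesis using that by auto
qed

lemma content_nonneg: "0 \<le> content C"
 by (rule content_greatest) (auto simp: dominating_def intro: pos)

lemma content_le_one: "content C \<le> 1"
 using content_le[of "%_. 1" C] one by (auto simp: dominating_def cfun_intros)

lemma content_empty: "content {} = 0"
proof -
 have "content {} \<le> Lam (%x. 0 * 1)" by (rule content_le) (auto simp: dominating_def cfun_intros)
 also have "\<dots> = 0" using scale[OF cfun_intros(1)[of 1], of 0] by simp
 finally show ?thesis using content_nonneg[of "{}"] by simp
qed

lemma content_subadd: "content (C \<union> D) \<le> content C + content D"
proof (rule field_le_epsilon)
 fix e :: real assume e: "e > 0"
 obtain f where f: "f \<in> dominating C" "Lam f < content C + e/2" using content_approx[of "e/2" C] e by auto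
 obtain g where g: "g \<in> dominating D" "Lam g < content D + e/2" using content_approx[of "e/2" D] e by auto
 have fg: "f \<in> cfun X" "g \<in> cfun X" using f g by (auto simp: dominating_def)
 \<comment> \<open>The positive parts are taken because \<open>f\<close> and \<open>g\<close> are
   known to be nonnegative only on the space, while C and D are arbitrary sets.\<close>
 have "(%x. max (f x) 0 + max (g x) 0) \<in> dominating (C \<union> D)"
  using f g by (force simp: dominating_def intro!: cfun_intros)
 then have "content (C \<union> D) \<le> Lam (%x. max (f x) 0 + max (g x) 0)" by (rule content_le)
 also have "\<dots> = Lam (%x. max (f x) 0) + Lam (%x. max (g x) 0)" by (intro add cfun_intros fg)
 also have "Lam (%x. max (f x) 0) \<le> Lam f" by (intro mono cfun_intros fg) (use f in \<open>auto simp: dominating_def\<close>)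
 also have "Lam (%x. max (g x) 0) \<le> Lam g" by (intro mono cfun_intros fg) (use g in \<open>auto simp: dominating_def\<close>)
 finally show "content (C \<union> D) \<le> content C + content D + e" using f g by simp
qed

text \<open>A Urysohn function phi with values 0 on C and 1 on D splits any majorant of the union as
  f * (1 - phi) + f * phi, a majorant for C plus one for D.\<close>

lemma content_disjoint:
 assumes "closedin X C" "closedin X D" "C \<inter> D = {}"
 shows "content (C \<union> D) = content C + content D"
proof (rule antisym[OF content_subadd])
 obtain phi where phi: "continuous_map X (top_of_set {0..1}) phi" "phi ` C \<subseteq> {0::real}" "phi ` D \<subseteq> {1}"
  using Urysohn_lemma[of X C D 0 1] normal assms
  by (auto simp: disjnt_def)
 have p: "phi \<in> cfun X" "\<And>x. x \<in> topspace X ==> 0 \<le> phi x \<and> phi x \<le> 1"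
  using phi(1) by (auto simp: cfun_def continuous_map_in_subtopology)
 show "content C + content D \<le> content (C \<union> D)"
 proof (rule content_greatest)
  fix f assume f: "f \<in> dominating (C \<union> D)"
  then have fc: "f \<in> cfun X" by (auto simp: dominating_def)
  have "content C \<le> Lam (%x. f x * (1 - phi x))"
   by (rule content_le) (use f p phi(2) in \<open>auto simp: dominating_def intro!: cfun_intros\<close>)
  moreover have "content D \<le> Lam (%x. f x * phi x)"
   by (rule content_le) (use f p phi(3) in \<open>auto simp: dominating_def intro!: cfun_intros\<close>)
  moreover have "Lam (%x. f x * (1 - phi x) + f x * phi x) = Lam (%x. f x * (1 - phi x)) + Lam (%x. f x * phi x)"
   by (intro add cfun_intros fc p)
  ultimately show "content C + content D \<le> Lam f" by (simp add: algebra_simps)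
 qed
qed

text \<open>Normality separates C - U from C - V by open sets; deleting one of these from C at a
  time leaves the two pieces. This yields subadditivity of \<open>open_mass\<close>.\<close>

lemma closedin_split:
 assumes C: "closedin X C" and U: "openin X U" and V: "openin X V" and sub: "C \<subseteq> U \<union> V"
 obtains D E where "closedin X D" "closedin X E" "D \<subseteq> U" "E \<subseteq> V" "C = D \<union> E"
proof -
 have "closedin X (C - U)" "closedin X (C - V)" "disjnt (C - U) (C - V)"
  using C U V sub by (auto simp: disjnt_def)
 then obtain A B where AB: "openin X A" "openin X B" "C - U \<subseteq> A" "C - V \<subseteq> B" "disjnt A B"
  using normal unfolding normal_space_def by meson
 show ?thesis
  by (rule that[of "C - A" "C - B"]) (use AB C in \<open>auto simp: disjnt_def\<close>)
qed

section \<open>The outer measure and its Caratheodory extension\<close>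

definition open_mass :: "'x set => ennreal" where
 "open_mass U = (SUP C\<in>{C. closedin X C \<and> C \<subseteq> U}. ennreal (content C))"

definition omass :: "'x set => ennreal" where
 "omass A = (INF U\<in>{U. openin X U \<and> A \<subseteq> U}. open_mass U)"

lemma open_mass_mono: "U \<subseteq> V ==> open_mass U \<le> open_mass V"
 unfolding open_mass_def by (rule SUP_subset_mono) auto

lemma content_le_open_mass: "closedin X C ==> C \<subseteq> U ==> ennreal (content C) \<le> open_mass U"
 unfolding open_mass_def by (rule SUP_upper) auto

lemma omass_le: "openin X U ==> A \<subseteq> U ==> omass A \<le> open_mass U"
 unfolding omass_def by (rule INF_lower) auto

lemma omass_mono: "A \<subseteq> B ==> omass A \<le> omass B"
 unfolding omass_def by (rule INF_superset_mono) auto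

lemma omass_open: "openin X U ==> omass U = open_mass U"
 unfolding omass_def by (intro antisym INF_lower INF_greatest) (auto intro: open_mass_mono)

lemma open_mass_Un:
 assumes "openin X U" "openin X V"
 shows "open_mass (U \<union> V) \<le> open_mass U + open_mass V"
 unfolding open_mass_def[of "U \<union> V"]
proof (rule SUP_least)
 fix C assume "C \<in> {C. closedin X C \<and> C \<subseteq> U \<union> V}"
 then obtain D E where DE: "closedin X D" "closedin X E" "D \<subseteq> U" "E \<subseteq> V" "C = D \<union> E"
  using closedin_split assms by blast
 have "ennreal (content C) \<le> ennreal (content D) + ennreal (content E)"
  using content_subadd[of D E] content_nonneg by (simp add: DE(5) flip: ennreal_plus)
 also have "\<dots> \<le> open_mass U + open_mass V" by (intro add_mono content_le_open_mass DE)
 finally show "ennreal (content C) \<le> open_mass U + open_mass V" .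
qed

lemma open_mass_empty: "open_mass {} = 0"
proof -
 have "open_mass {} \<le> 0" unfolding open_mass_def by (rule SUP_least) (auto simp: content_empty)
 then show ?thesis by simp
qed

lemma open_mass_UN_finite:
 "(\<And>i. openin X (U i)) ==> open_mass (\<Union>i<n. U i) \<le> (\<Sum>i<n. open_mass (U i))" for U :: "nat => 'x set"
proof (induction n)
 case (Suc n)
 have "(\<Union>i<Suc n. U i) = (\<Union>i<n. U i) \<union> U n" by (auto simp: less_Suc_eq)
 then have "open_mass (\<Union>i<Suc n. U i) \<le> open_mass (\<Union>i<n. U i) + open_mass (U n)"
  using Suc.prems by (auto intro!: open_mass_Un)
 then show ?case using Suc by (auto intro: order_trans add_right_mono)
qed (simp add: open_mass_empty)

text \<open>A closed set inside the union is compact, so finitely many of the open sets already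
  cover it.\<close>

lemma open_mass_UN:
 fixes U :: "nat => 'x set"
 assumes U: "\<And>i. openin X (U i)"
 shows "open_mass (\<Union>i. U i) \<le> (\<Sum>i. open_mass (U i))"
 unfolding open_mass_def[of "\<Union>i. U i"]
proof (rule SUP_least)
 fix C assume "C \<in> {C. closedin X C \<and> C \<subseteq> (\<Union>i. U i)}"
 then have C: "closedin X C" "C \<subseteq> (\<Union>i. U i)" by auto
 have "compactin X C" using C(1) cpt closedin_compact_space by blast
 then obtain F where F: "finite F" "F \<subseteq> range U" "C \<subseteq> \<Union>F"
  using C(2) U unfolding compactin_def by (metis (no_types, lifting) imageE)
 obtain I where I: "finite I" "F = U ` I" using F finite_subset_image by metis
 obtain n where n: "I \<subseteq> {..<n}" using I(1) finite_nat_iff_bounded by auto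
 have "C \<subseteq> (\<Union>i<n. U i)" using F(3) I(2) n by auto
 then have "ennreal (content C) \<le> open_mass (\<Union>i<n. U i)" by (rule content_le_open_mass[OF C(1)])
 also have "\<dots> \<le> (\<Sum>i<n. open_mass (U i))" by (rule open_mass_UN_finite[OF U])
 also have "\<dots> \<le> (\<Sum>i. open_mass (U i))" by (rule sum_le_suminf) auto
 finally show "ennreal (content C) \<le> (\<Sum>i. open_mass (U i))" .
qed

lemma open_mass_le_one: "open_mass U \<le> 1"
 unfolding open_mass_def by (rule SUP_least) (use content_le_one in \<open>auto simp: ennreal_le_1\<close>)

lemma omass_le_one: "A \<subseteq> topspace X ==> omass A \<le> 1"
 by (rule order_trans[OF omass_le[OF openin_topspace] open_mass_le_one])

lemma omass_approx:
 assumes "A \<subseteq> topspace X" "0 < e"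
 obtains U where "openin X U" "A \<subseteq> U" "open_mass U < omass A + ennreal e"
proof -
 have "omass A < omass A + ennreal e"
  using omass_le_one[OF assms(1)] assms(2)
  by (cases "omass A" rule: ennreal_cases) (auto simp: ennreal_less_iff top_unique simp flip: ennreal_plus)
 then show ?thesis using that unfolding omass_def INF_less_iff by auto
qed

lemma outer_measure_space_mass: "outer_measure_space (Pow (topspace X)) omass"
 unfolding outer_measure_space_def
proof (intro conjI)
 show "positive (Pow (topspace X)) omass"
  by (simp add: positive_def omass_open open_mass_empty)
 show "increasing (Pow (topspace X)) omass" by (auto simp: increasing_def intro: omass_mono)
 show "countably_subadditive (Pow (topspace X)) omass"
  unfolding countably_subadditive_def
 proof (intro allI impI)
  fix A :: "nat => 'x set" assume A: "range A \<subseteq> Pow (topspace X)"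
  show "omass (\<Union>i. A i) \<le> (\<Sum>i. omass (A i))"
  proof (rule ennreal_le_epsilon)
   fix e :: real assume e: "0 < e"
   have "\<exists>U. openin X U \<and> A i \<subseteq> U \<and> open_mass U < omass (A i) + ennreal (e * (1/2) ^ Suc i)" for i
   proof -
    have "A i \<subseteq> topspace X" using A by auto
    then show ?thesis using omass_approx[of "A i" "e * (1/2) ^ Suc i"] e by (metis half_gt_zero_iff mult_pos_pos zero_less_one zero_less_power)
   qed
   then obtain U where U: "\<And>i. openin X (U i)" "\<And>i. A i \<subseteq> U i"
    "\<And>i. open_mass (U i) < omass (A i) + ennreal (e * (1/2) ^ Suc i)" by metis
   have "omass (\<Union>i. A i) \<le> open_mass (\<Union>i. U i)"
    using U(1,2) by (intro omass_le) auto
   also have "\<dots> \<le> (\<Sum>i. open_mass (U i))" by (rule open_mass_UN[OF U(1)])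
   also have "\<dots> \<le> (\<Sum>i. omass (A i) + ennreal (e * (1/2) ^ Suc i))"
    using U(3) by (intro suminf_le less_imp_le) auto
   also have "\<dots> = (\<Sum>i. omass (A i)) + (\<Sum>i. ennreal (e * (1/2) ^ Suc i))"
    by (rule suminf_add[symmetric]) auto
   also have "(\<Sum>i. ennreal (e * (1/2) ^ Suc i)) = ennreal e"
    using sums_mult[OF power_half_series, of e] e by (intro suminf_ennreal_eq) auto
   finally show "omass (\<Union>i. A i) \<le> (\<Sum>i. omass (A i)) + ennreal e" .
  qed
 qed
qed

text \<open>Inside an open V containing A, a closed C in V \<inter> U is chosen before a closed D in
  V - C. Then C and D are disjoint and their contents add up to at most the mass of V; the suprema
  over D and over C are taken in that order.\<close>

lemma open_caratheodory:
 assumes U: "openin X U" and A: "A \<subseteq> topspace X"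
 shows "omass (U \<inter> A) + omass ((topspace X - U) \<inter> A) \<le> omass A"
 unfolding omass_def[of A]
proof (rule INF_greatest)
 fix V assume "V \<in> {V. openin X V \<and> A \<subseteq> V}"
 then have V: "openin X V" "A \<subseteq> V" by auto
 have *: "ennreal (content C) + omass ((topspace X - U) \<inter> A) \<le> open_mass V"
  if C: "closedin X C" "C \<subseteq> V \<inter> U" for C
 proof -
  have W: "openin X (V - C)" using V C by blast
  have "omass ((topspace X - U) \<inter> A) \<le> open_mass (V - C)"
   using V C by (intro omass_le W) auto
  moreover have "ennreal (content C) + open_mass (V - C) \<le> open_mass V"
   unfolding open_mass_def[of "V - C"]
  proof (subst ennreal_SUP_add_right)
   show "{D. closedin X D \<and> D \<subseteq> V - C} \<noteq> {}" by auto
   show "(SUP D\<in>{D. closedin X D \<and> D \<subseteq> V - C}. ennreal (content C) + ennreal (content D)) \<le> open_mass V"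
   proof (rule SUP_least)
    fix D assume "D \<in> {D. closedin X D \<and> D \<subseteq> V - C}"
    then have D: "closedin X D" "D \<subseteq> V - C" by auto
    have "ennreal (content C) + ennreal (content D) = ennreal (content (C \<union> D))"
    proof -
     have "C \<inter> D = {}" using D(2) by auto
     then show ?thesis using content_disjoint[OF C(1) D(1)] content_nonneg by (simp flip: ennreal_plus)
    qed
    also have "\<dots> \<le> open_mass V" using C D by (intro content_le_open_mass) auto
    finally show "ennreal (content C) + ennreal (content D) \<le> open_mass V" .
   qed
  qed
  ultimately show ?thesis by (meson add_left_mono order_trans)
 qed
 have "omass (U \<inter> A) \<le> open_mass (V \<inter> U)" using U V by (intro omass_le) auto
 then have "omass (U \<inter> A) + omass ((topspace X - U) \<inter> A)
   \<le> open_mass (V \<inter> U) + omass ((topspace X - U) \<inter> A)" by (rule add_right_mono)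
 also have "\<dots> \<le> open_mass V"
  unfolding open_mass_def[of "V \<inter> U"]
 proof (subst ennreal_SUP_add_left[symmetric])
  show "{C. closedin X C \<and> C \<subseteq> V \<inter> U} \<noteq> {}" by auto
  show "(SUP C\<in>{C. closedin X C \<and> C \<subseteq> V \<inter> U}. ennreal (content C) + omass ((topspace X - U) \<inter> A)) \<le> open_mass V"
   by (rule SUP_least) (use * in auto)
 qed
 finally show "omass (U \<inter> A) + omass ((topspace X - U) \<inter> A) \<le> open_mass V" .
qed

definition rmeasure :: "'x measure" where
 "rmeasure = measure_of (topspace X) (sets (borel_of X)) omass"

lemma measure_space_mass: "measure_space (topspace X) (sets (borel_of X)) omass"
proof -
 interpret P: sigma_algebra "topspace X" "Pow (topspace X)" by (rule sigma_algebra_Pow)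
 let ?L = "lambda_system (topspace X) (Pow (topspace X)) omass"
 have L: "measure_space (topspace X) ?L omass"
  by (rule P.caratheodory_lemma[OF outer_measure_space_mass])
 have "U \<in> ?L" if U: "openin X U" for U
 proof -
  have "omass (U \<inter> A) + omass ((topspace X - U) \<inter> A) = omass A" if A: "A \<subseteq> topspace X" for A
  proof (rule antisym[OF open_caratheodory[OF U A]])
   have sub: "subadditive (Pow (topspace X)) omass"
    using outer_measure_space_mass unfolding outer_measure_space_def
    by (intro P.countably_subadditive_subadditive) blast+
   have "A = (U \<inter> A) \<union> ((topspace X - U) \<inter> A)" using A by blast
   then have "omass A = omass ((U \<inter> A) \<union> ((topspace X - U) \<inter> A))" by (rule arg_cong)
   also have "\<dots> \<le> omass (U \<inter> A) + omass ((topspace X - U) \<inter> A)"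
    by (rule sub[unfolded subadditive_def, rule_format]) (use A in blast)+
   finally show "omass A \<le> omass (U \<inter> A) + omass ((topspace X - U) \<inter> A)" .
  qed
  then show ?thesis using openin_subset[OF U] by (auto simp: lambda_system_def)
 qed
 moreover have "sigma_algebra (topspace X) ?L" using L by (simp add: measure_space_def)
 ultimately have "sets (borel_of X) \<subseteq> ?L"
  unfolding sets_borel_of by (intro sigma_algebra.sigma_sets_subset) auto
 then show ?thesis
  using L sets.sigma_algebra_axioms[of "borel_of X"]
  unfolding measure_space_def positive_def countably_additive_def by (auto simp: subset_eq image_subset_iff)
qed

lemma sets_rmeasure: "sets rmeasure = sets (borel_of X)"
 unfolding rmeasure_def by (metis sets.sets_measure_of_eq space_borel_of)

lemma space_rmeasure: "space rmeasure = topspace X"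
 using sets_eq_imp_space_eq[OF sets_rmeasure] by simp

lemma emeasure_rmeasure: "A \<in> sets (borel_of X) ==> emeasure rmeasure A = omass A"
 unfolding rmeasure_def using measure_space_mass
 by (intro emeasure_measure_of_sigma) (auto simp: measure_space_def)

lemma prob_rmeasure: "prob_space rmeasure"
proof
 have "1 \<le> content (topspace X)"
  by (rule content_greatest) (use mono[OF cfun_intros(1)[of 1]] one in \<open>auto simp: dominating_def\<close>)
 then have "1 \<le> open_mass (topspace X)"
  using content_le_open_mass[of "topspace X" "topspace X"] order_trans[of 1 "ennreal (content (topspace X))"]
  by (auto simp: ennreal_ge_1)
 then have "open_mass (topspace X) = 1" using open_mass_le_one antisym by blast
 then show "emeasure rmeasure (space rmeasure) = 1"
  by (simp add: space_rmeasure emeasure_rmeasure openin_borel_of omass_open)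
qed

lemma rmeasure_in_prob_measures: "rmeasure \<in> prob_measures X"
proof -
 interpret prob_space rmeasure by (rule prob_rmeasure)
 have "\<exists>C\<subseteq>A. compactin X C \<and> measure rmeasure (A - C) < e" if A: "A \<in> sets rmeasure" and e: "0 < e" for A e
 proof -
  have sub: "A \<subseteq> topspace X" using sets.sets_into_space[OF A] by (simp add: space_rmeasure)
  obtain U where U: "openin X U" "topspace X - A \<subseteq> U" "open_mass U < omass (topspace X - A) + ennreal e"
   using omass_approx[of "topspace X - A" e] e by auto
  have cA: "topspace X - A \<in> sets rmeasure" using A sets.compl_sets[OF A] by (simp add: space_rmeasure)
  have Us: "U \<in> sets rmeasure" using U(1) by (auto simp: sets_rmeasure)
  have "ennreal (prob U) < ennreal (prob (topspace X - A)) + ennreal e"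
   using U(3) Us cA by (simp add: emeasure_eq_measure[symmetric] emeasure_rmeasure omass_open[OF U(1)] sets_rmeasure)
  then have "prob U < prob (topspace X - A) + e"
   using e by (simp add: ennreal_less_iff flip: ennreal_plus)
  moreover have "prob U = prob (topspace X - A) + prob (U \<inter> A)"
  proof -
   have "U = (topspace X - A) \<union> (U \<inter> A)" using U(2) openin_subset[OF U(1)] by auto
   then show ?thesis using finite_measure_Union[of "topspace X - A" "U \<inter> A"] cA Us A by auto
  qed
  moreover have "A - (topspace X - U) = U \<inter> A" using sub by auto
  moreover have "compactin X (topspace X - U)" using U(1) cpt by (intro closedin_compact_space) auto
  moreover have "topspace X - U \<subseteq> A" using U(2) by auto
  ultimately show ?thesis by (intro exI[of _ "topspace X - U"]) auto
 qed
 then show ?thesis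
  using prob_rmeasure by (simp add: prob_measures_def sets_rmeasure space_rmeasure)
qed

text \<open>On the open set where f > 1 - e, the function f / (1 - e) majorises the indicator of
  every closed subset, so the mass of that set is at most Lam f / (1 - e); then e tends to
  0.\<close>

lemma rmeasure_le:
 assumes C: "closedin X C" and f: "f \<in> dominating C"
 shows "measure rmeasure C \<le> Lam f"
proof -
 interpret prob_space rmeasure by (rule prob_rmeasure)
 have fc: "f \<in> cfun X" using f by (auto simp: dominating_def)
 have "(1 - e) * measure rmeasure C \<le> Lam f" if e: "0 < e" "e < 1" for e :: real
 proof -
  define U where "U = {x \<in> topspace X. f x \<in> {1 - e<..}}"
  have U: "openin X U"
   unfolding U_def using fc openin_continuous_map_preimage[of X euclideanreal f "{1 - e<..}"] by (simp add: cfun_def)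
  have CU: "C \<subseteq> U" using f closedin_subset[OF C] e by (force simp: U_def dominating_def)
  have "open_mass U \<le> ennreal (Lam f / (1 - e))"
   unfolding open_mass_def
  proof (rule SUP_least)
   fix D assume "D \<in> {D. closedin X D \<and> D \<subseteq> U}"
   then have D: "closedin X D" "D \<subseteq> U" by auto
   have "(%x. (1 / (1 - e)) * f x) \<in> dominating D"
   proof -
    have "(%x. (1 / (1 - e)) * f x) \<in> cfun X" by (intro cfun_intros fc)
    then show ?thesis using f e D(2) by (auto simp: dominating_def U_def field_simps subset_eq)
   qed
   from content_le[OF this] show "ennreal (content D) \<le> ennreal (Lam f / (1 - e))"
    unfolding scale[OF fc] by (intro ennreal_leI) simp
  qed
  then have "ennreal (measure rmeasure C) \<le> ennreal (Lam f / (1 - e))"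
   using omass_le[OF U CU] C
   by (simp add: emeasure_eq_measure[symmetric] emeasure_rmeasure closedin_borel_of)
  moreover have "0 \<le> Lam f / (1 - e)" using f e by (auto simp: dominating_def intro!: divide_nonneg_pos pos)
  ultimately have "measure rmeasure C \<le> Lam f / (1 - e)" by (simp add: ennreal_le_iff)
  then show ?thesis using e by (simp add: field_simps)
 qed
 then have ev: "\<forall>\<^sub>F e in at_right 0. (1 - e) * measure rmeasure C \<le> Lam f"
  by (auto simp: eventually_at_right_field intro!: exI[of _ 1])
 have lim: "((%e. (1 - e) * measure rmeasure C) \<longlongrightarrow> (1 - 0) * measure rmeasure C) (at_right 0)"
  by (intro tendsto_intros)
 show ?thesis using tendsto_upperbound[OF lim ev] by simp
qed

text \<open>Layer-cake: \<open>f\<close> is the average of the truncations \<open>min (max (n f - k) 0) 1\<close>, \<open>k < n\<close>, each of which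
 dominates the indicator of \<open>{n f \<ge> k + 1}\<close>.\<close>

lemma integral_le:
 assumes f: "f \<in> cfun X" and b: "\<And>x. x \<in> topspace X ==> 0 \<le> f x \<and> f x \<le> 1"
 shows "(LINT x|rmeasure. f x) \<le> Lam f"
proof (rule field_le_epsilon)
 fix e :: real assume "e > 0"
 interpret prob_space rmeasure by (rule prob_rmeasure)
 obtain m where m: "1 / real (Suc m) < e" using \<open>e > 0\<close> nat_approx_posE by blast
 define n where "n = Suc m"
 have n: "0 < real n" "1 / real n < e" using m by (auto simp: n_def)
 define g where "g k = (%x. min (max (real n * f x + (- real k)) 0) 1)" for k
 define C where "C k = {x \<in> topspace X. f x \<in> {(real k + 1) / real n..}}" for k
 have gc: "g k \<in> cfun X" for k unfolding g_def by (intro cfun_intros f)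
 have Cc: "closedin X (C k)" for k
  unfolding C_def using f closedin_continuous_map_preimage[of X euclideanreal f "{(real k + 1) / real n..}"]
  by (simp add: cfun_def)
 have gd: "g k \<in> dominating (C k)" for k
  using gc n by (auto simp: dominating_def g_def C_def field_simps)
 have sg: "(\<Sum>k<j. g k x) = min (real n * f x) (real j)" if "x \<in> topspace X" for x j
 proof (induction j)
  case 0
  have "0 \<le> real n * f x" using b[OF that] by simp
  then show ?case by (simp add: min_def)
 next
  case (Suc j)
  then show ?case using b[OF that] by (simp add: g_def min_def max_def)
 qed
 have Lsum: "Lam (%x. \<Sum>k<j. g k x) = (\<Sum>k<j. Lam (g k)) \<and> (%x. \<Sum>k<j. g k x) \<in> cfun X" for j
 proof (induction j)
  case 0
  have "Lam (%x. 0 * 1) = 0" using scale[OF cfun_intros(1)[of 1], of 0] by simp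
  then show ?case by (simp add: cfun_intros)
 qed (simp add: add gc cfun_intros)
 have "Lam (%x. real n * f x) = Lam (%x. \<Sum>k<n. g k x)"
 proof (rule antisym)
  have *: "real n * f x = (\<Sum>k<n. g k x)" if "x \<in> topspace X" for x
   using sg[OF that, of n] b[OF that] n(1) by (simp add: min_def mult_le_cancel_left1 not_le)
  have "(%x. real n * f x) \<in> cfun X" by (intro cfun_intros f)
  moreover have "(%x. \<Sum>k<n. g k x) \<in> cfun X" using Lsum[of n] by blast
  ultimately show "Lam (%x. real n * f x) \<le> Lam (%x. \<Sum>k<n. g k x)" "Lam (%x. \<Sum>k<n. g k x) \<le> Lam (%x. real n * f x)"
   using * by (intro mono; simp)+
 qed
 then have nL: "real n * Lam f = (\<Sum>k<n. Lam (g k))" using Lsum[of n] scale[OF f] by simp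
 have meas: "f \<in> borel_measurable rmeasure"
  using cfun_measurable[OF f] by (simp cong: measurable_cong_sets add: sets_rmeasure)
 have Cs: "C k \<in> sets rmeasure" for k using Cc by (auto simp: sets_rmeasure)
 \<comment> \<open>The indicators of the \<open>C k\<close> count the integers from 1 to n that n *
   f x reaches, which falls short of n * f x by at most 1. The induction runs over truncations at
   j.\<close>
 have "real n * f x \<le> 1 + (\<Sum>k<n. indicator (C k) x)" if x: "x \<in> topspace X" for x
 proof -
  have "min (real n * f x) (real j) \<le> 1 + (\<Sum>k<j. indicator (C k) x :: real)" for j
  proof (induction j)
   case (Suc j)
   show ?case
   proof (cases "real j + 1 \<le> real n * f x")
    case True
    then have "x \<in> C k" if "k \<le> j" for k
     using that n x by (auto simp: C_def field_simps)
    then have "(\<Sum>k<Suc j. indicator (C k) x :: real) = (\<Sum>k<Suc j. 1)" by (intro sum.cong) auto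
    then show ?thesis by simp
   next
    case False
    show ?thesis
    proof (cases "real j \<le> real n * f x")
     case True
     then have "x \<in> C k" if "k < j" for k
      using that n x by (auto simp: C_def field_simps)
     then have "(\<Sum>k<j. indicator (C k) x :: real) = (\<Sum>k<j. 1)" by (intro sum.cong) auto
     then have s: "(\<Sum>k<j. indicator (C k) x :: real) = real j" by simp
     have i: "(0 :: real) \<le> indicator (C j) x" by simp
     show ?thesis
      unfolding sum.lessThan_Suc s using False min.cobounded1[of "real n * f x" "real (Suc j)"] i by linarith
    next
     case False
     then have "min (real n * f x) (real (Suc j)) = min (real n * f x) (real j)" by simp
     moreover have "(0 :: real) \<le> indicator (C j) x" by simp
     ultimately show ?thesis unfolding sum.lessThan_Suc using Suc by linarith
    qed
   qed
  qed (use b[OF x] n in auto)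
  from this[of n] show ?thesis using b[OF x] n(1) by (simp add: min_def mult_le_cancel_left1 not_le split: if_splits)
 qed
 note le = this
 have ind: "integrable rmeasure (indicator (C k) :: _ => real)" for k
  using Cs by (intro integrable_const_bound[of _ 1]) auto
 have intf: "integrable rmeasure f"
  using b meas by (intro integrable_const_bound[of _ 1]) (auto simp: space_rmeasure)
 have ints: "integrable rmeasure (%x. \<Sum>k<n. indicator (C k) x :: real)"
  by (intro Bochner_Integration.integrable_sum ind)
 have "(LINT x|rmeasure. real n * f x) \<le> (LINT x|rmeasure. 1 + (\<Sum>k<n. indicator (C k) x))"
  by (intro integral_mono integrable_mult_right intf ints Bochner_Integration.integrable_add integrable_const le)
   (simp add: space_rmeasure)
 also have "\<dots> = 1 + (LINT x|rmeasure. (\<Sum>k<n. indicator (C k) x))" using ints by (simp add: prob_space)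
 also have "(LINT x|rmeasure. (\<Sum>k<n. indicator (C k) x)) = (\<Sum>k<n. (LINT x|rmeasure. indicator (C k) x :: real))"
  by (rule Bochner_Integration.integral_sum) (rule ind)
 also have "\<dots> = (\<Sum>k<n. measure rmeasure (C k))" using Cs by simp
 also have "1 + (\<Sum>k<n. measure rmeasure (C k)) \<le> 1 + (\<Sum>k<n. Lam (g k))"
  by (intro add_left_mono sum_mono rmeasure_le[OF Cc gd])
 finally have "real n * (LINT x|rmeasure. f x) \<le> 1 + real n * Lam f" by (simp add: nL)
 then have "(LINT x|rmeasure. f x) \<le> Lam f + 1 / real n" using n(1) by (simp add: field_simps)
 then show "(LINT x|rmeasure. f x) \<le> Lam f + e" using n(2) by linarith
qed

lemma integrable_rmeasure: "f \<in> cfun X ==> integrable rmeasure f"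
proof -
 assume f: "f \<in> cfun X"
 interpret prob_space rmeasure by (rule prob_rmeasure)
 obtain B where "\<And>x. x \<in> topspace X ==> \<bar>f x\<bar> \<le> B" using cfun_bounded[OF cpt f] by metis
 moreover have "f \<in> borel_measurable rmeasure"
  using cfun_measurable[OF f] by (simp cong: measurable_cong_sets add: sets_rmeasure)
 ultimately show ?thesis by (intro integrable_const_bound[of _ B]) (auto simp: space_rmeasure)
qed

text \<open>The one-sided bound applied to f and to 1 - f gives equality for functions with values
  in [0, 1]; an affine change of scale brings any member of \<open>cfun X\<close> there.\<close>

lemma integral_rmeasure:
 assumes f: "f \<in> cfun X" shows "(LINT x|rmeasure. f x) = Lam f"
proof -
 interpret prob_space rmeasure by (rule prob_rmeasure)
 have unit: "(LINT x|rmeasure. f x) = Lam f"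
  if f: "f \<in> cfun X" and b: "\<And>x. x \<in> topspace X ==> 0 \<le> f x \<and> f x \<le> 1" for f
 proof (rule antisym[OF integral_le[OF f b]])
  have "(LINT x|rmeasure. 1 - f x) \<le> Lam (%x. 1 - f x)"
   by (rule integral_le) (use b in \<open>auto intro!: cfun_intros f\<close>)
  then show "Lam f \<le> (LINT x|rmeasure. f x)"
   using integrable_rmeasure[OF f] diff[OF cfun_intros(1)[of 1] f] one by (simp add: prob_space)
 qed
 obtain B where B: "0 \<le> B" "\<And>x. x \<in> topspace X ==> \<bar>f x\<bar> \<le> B" using cfun_bounded[OF cpt f] by metis
 \<comment> \<open>The summand 1 keeps the denominator positive when the bound \<open>B\<close> is
   0.\<close>
 define c where "c = 1 / (2 * B + 1)"
 define g where "g = (%x. c * (f x + B))"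
 have c: "c > 0" "c * (2 * B) \<le> 1" using B(1) by (auto simp: c_def field_simps)
 have gc: "g \<in> cfun X" unfolding g_def by (intro cfun_intros f)
 have "0 \<le> g x \<and> g x \<le> 1" if "x \<in> topspace X" for x
 proof -
  have "0 \<le> f x + B" "f x + B \<le> 2 * B" using B(2)[OF that] by auto
  then show ?thesis unfolding g_def using c by (meson less_imp_le mult_left_mono mult_nonneg_nonneg order_trans)
 qed
 from unit[OF gc this] have e: "(LINT x|rmeasure. g x) = Lam g" .
 have "Lam g = c * Lam (%x. f x + B)" unfolding g_def by (intro scale cfun_intros f)
 also have "Lam (%x. f x + B) = Lam f + Lam (%_. B * 1)" using add[OF f cfun_intros(1)[of B]] by simp
 also have "Lam (%_. B * 1) = B" using scale[OF cfun_intros(1)[of 1], of B] one by simp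
 finally have "Lam g = c * (Lam f + B)" .
 moreover have "(LINT x|rmeasure. g x) = c * ((LINT x|rmeasure. f x) + B)"
  using integrable_rmeasure[OF f] by (simp add: g_def prob_space)
 ultimately show ?thesis using e c(1) by simp
qed

end

section \<open>Probability measures as a compact affine system\<close>

lemma limitin_topology_generated_by:
 assumes x: "x \<in> \<Union>S" and ev: "\<And>U. U \<in> S ==> x \<in> U ==> \<forall>\<^sub>F n in F. f n \<in> U"
 shows "limitin (topology_generated_by S) f x F"
proof -
 have "x \<in> U \<longrightarrow> (\<forall>\<^sub>F n in F. f n \<in> U)" if "generate_topology_on S U" for U
  using that
 proof induction
  case (Int a b)
  then show ?case by (auto elim: eventually_elim2)
 next
  case (UN K)
  show ?case
  proof
   assume "x \<in> \<Union>K"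
   then obtain k where k: "k \<in> K" "x \<in> k" by blast
   then have "\<forall>\<^sub>F n in F. f n \<in> k" using UN by blast
   then show "\<forall>\<^sub>F n in F. f n \<in> \<Union>K" by (rule eventually_mono) (use k in blast)
  qed
 qed (use ev in auto)
 then show ?thesis using x
  by (auto simp: limitin_def openin_topology_generated_by_iff)
qed

lemma continuous_map_generated:
 assumes "\<And>x. x \<in> topspace T ==> f x \<in> \<Union>S"
  and "\<And>U. U \<in> S ==> openin T {x \<in> topspace T. f x \<in> U}"
 shows "continuous_map T (topology_generated_by S) f"
proof -
 have "openin T {x \<in> topspace T. f x \<in> U}" if "generate_topology_on S U" for U
  using that
 proof induction
  case (Int a b)
  have eq: "{x \<in> topspace T. f x \<in> a \<inter> b} = {x \<in> topspace T. f x \<in> a} \<inter> {x \<in> topspace T. f x \<in> b}" by auto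
  show ?case unfolding eq by (rule openin_Int) (use Int in simp_all)
 next
  case (UN K)
  have eq: "{x \<in> topspace T. f x \<in> \<Union>K} = (\<Union>k\<in>K. {x \<in> topspace T. f x \<in> k})" by auto
  show ?case unfolding eq by (rule openin_Union) (use UN in auto)
 qed (use assms in auto)
 then show ?thesis using assms(1)
  by (auto simp: continuous_map_def openin_topology_generated_by_iff topology_generated_by_topspace)
qed

lemma prob_subbasis_Union:
 "\<Union> {{mu \<in> prob_measures X. (LINT x|mu. f x) \<in> U} | f U. continuous_map X euclideanreal f \<and> open U} = prob_measures X"
 (is "\<Union>?S = _")
proof
 have "{mu \<in> prob_measures X. (LINT x|mu. (0 :: real)) \<in> UNIV} \<in> ?S"
  by (rule CollectI, rule exI[of _ "%_. 0"], rule exI[of _ UNIV]) simp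
 then show "prob_measures X \<subseteq> \<Union>?S" by auto
qed auto

lemma topspace_prob_topology [simp]: "topspace (prob_topology X) = prob_measures X"
 unfolding prob_topology_def topology_generated_by_topspace by (rule prob_subbasis_Union)

lemma probsD:
 assumes "mu \<in> prob_measures X"
 shows "prob_space mu" "space mu = topspace X" "sets mu = sets (borel_of X)"
 using assms by (simp_all add: prob_measures_def)

lemma cfun_measurable_prob: "mu \<in> prob_measures X ==> f \<in> cfun X ==> f \<in> borel_measurable mu"
 using cfun_measurable[of f X] measurable_cong_sets[of mu "borel_of X" borel borel] probsD(3) by blast

lemma cfun_integrable:
 assumes "compact_space X" "mu \<in> prob_measures X" "f \<in> cfun X"
 shows "integrable mu f"
proof -
 interpret prob_space mu using probsD(1)[OF assms(2)] .
 obtain B where "\<And>x. x \<in> topspace X ==> \<bar>f x\<bar> \<le> B" using cfun_bounded[OF assms(1,3)] by metis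
 then show ?thesis
  using cfun_measurable_prob[OF assms(2,3)] probsD(2)[OF assms(2)]
  by (intro integrable_const_bound[of _ B]) auto
qed

lemma continuous_map_integral:
 "f \<in> cfun X ==> continuous_map (prob_topology X) euclideanreal (%mu. LINT x|mu. f x)"
 unfolding continuous_map_def
proof (intro conjI allI impI)
 fix U :: "real set" assume "f \<in> cfun X" "openin euclideanreal U"
 then have "{mu \<in> prob_measures X. (LINT x|mu. f x) \<in> U}
   \<in> {{mu \<in> prob_measures X. (LINT x|mu. f x) \<in> U} | f U. continuous_map X euclideanreal f \<and> open U}"
  by (auto simp: cfun_def)
 then show "openin (prob_topology X) {mu \<in> topspace (prob_topology X). (LINT x|mu. f x) \<in> U}"
  unfolding topspace_prob_topology by (unfold prob_topology_def) (rule topology_generated_by_Basis)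
qed auto

lemma continuous_map_into_prob:
 assumes "\<And>t. t \<in> topspace T ==> Psi t \<in> prob_measures X"
  and "\<And>f. f \<in> cfun X ==> continuous_map T euclideanreal (%t. LINT x|Psi t. f x)"
 shows "continuous_map T (prob_topology X) Psi"
 unfolding prob_topology_def
proof (rule continuous_map_generated)
 show "Psi x \<in> \<Union> {{mu \<in> prob_measures X. (LINT x|mu. f x) \<in> U} | f U. continuous_map X euclideanreal f \<and> open U}"
  if "x \<in> topspace T" for x
  unfolding prob_subbasis_Union by (rule assms(1)[OF that])
next
 fix W assume "W \<in> {{mu \<in> prob_measures X. (LINT x|mu. f x) \<in> U} | f U. continuous_map X euclideanreal f \<and> open U}"
 then obtain f U where W: "W = {mu \<in> prob_measures X. (LINT x|mu. f x) \<in> U}" "f \<in> cfun X" "open U"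
  by (auto simp: cfun_def)
 have "{x \<in> topspace T. Psi x \<in> W} = {t \<in> topspace T. (LINT x|Psi t. f x) \<in> U}" using assms(1) W(1) by auto
 then show "openin T {x \<in> topspace T. Psi x \<in> W}"
  using openin_continuous_map_preimage[OF assms(2)[OF W(2)], of U] W(3) by simp
qed

lemma limitin_prob:
 assumes "mu \<in> prob_measures X" "\<And>n. nu n \<in> prob_measures X"
  and "\<And>f. f \<in> cfun X ==> ((%n. LINT x|nu n. f x) \<longlongrightarrow> (LINT x|mu. f x)) F"
 shows "limitin (prob_topology X) nu mu F"
 unfolding prob_topology_def
proof (rule limitin_topology_generated_by)
 show "mu \<in> \<Union> {{mu \<in> prob_measures X. (LINT x|mu. f x) \<in> U} | f U. continuous_map X euclideanreal f \<and> open U}"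
  unfolding prob_subbasis_Union by (rule assms(1))
next
 fix W assume "W \<in> {{mu \<in> prob_measures X. (LINT x|mu. f x) \<in> U} | f U. continuous_map X euclideanreal f \<and> open U}" "mu \<in> W"
 then obtain f U where W: "W = {mu \<in> prob_measures X. (LINT x|mu. f x) \<in> U}" "f \<in> cfun X" "open U" "(LINT x|mu. f x) \<in> U"
  by (auto simp: cfun_def)
 have "\<forall>\<^sub>F n in F. (LINT x|nu n. f x) \<in> U" using topological_tendstoD[OF assms(3)[OF W(2)] W(3,4)] .
 then show "\<forall>\<^sub>F n in F. nu n \<in> W" using assms(2) W(1) by simp
qed

text \<open>Urysohn functions squeeze a closed set between itself and an open neighbourhood of almost the
 same measure.\<close>

lemma prob_measures_eqI:
 assumes X: "compact_space X" "Hausdorff_space X" and mu: "mu \<in> prob_measures X" and nu: "nu \<in> prob_measures X"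
  and eq: "\<And>f. f \<in> cfun X ==> (LINT x|mu. f x) = (LINT x|nu. f x)"
 shows "mu = nu"
proof -
 have closed_le: "measure mu C \<le> measure nu C"
  if mu: "mu \<in> prob_measures X" and nu: "nu \<in> prob_measures X"
   and eq: "\<And>f. f \<in> cfun X ==> (LINT x|mu. f x) = (LINT x|nu. f x)" and C: "closedin X C" for mu nu C
 proof (rule field_le_epsilon)
  fix e :: real assume e: "0 < e"
  interpret mu: prob_space mu using probsD(1)[OF mu] .
  interpret nu: prob_space nu using probsD(1)[OF nu] .
  have S[simp]: "sets mu = sets (borel_of X)" "sets nu = sets (borel_of X)" "space mu = topspace X" "space nu = topspace X"
   using probsD[OF mu] probsD[OF nu] by auto
  have Cs: "C \<in> sets (borel_of X)" using C by auto
  have "topspace X - C \<in> sets nu" using C by (auto simp: closedin_def)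
  then obtain D where D: "D \<subseteq> topspace X - C" "compactin X D" "measure nu (topspace X - C - D) < e"
   using nu e unfolding prob_measures_def by blast
  have Dc: "closedin X D" using D(2) X(2) compactin_imp_closedin by blast
  have "normal_space X" using X by (simp add: compact_Hausdorff_or_regular_imp_normal_space)
  moreover have "disjnt D C" using D(1) by (auto simp: disjnt_def)
  ultimately obtain phi where phi: "continuous_map X (top_of_set {0..1}) phi" "phi ` D \<subseteq> {0::real}" "phi ` C \<subseteq> {1}"
   using Urysohn_lemma[of X D C 0 1] Dc C by auto
  have p: "phi \<in> cfun X" "\<And>x. x \<in> topspace X ==> 0 \<le> phi x \<and> phi x \<le> 1"
   using phi(1) by (auto simp: cfun_def continuous_map_in_subtopology)
  have "measure mu C = (LINT x|mu. indicator C x)" using Cs closedin_subset[OF C] by (simp add: Int_absorb2)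
  also have "\<dots> \<le> (LINT x|mu. phi x)"
  proof (rule integral_mono)
   show "integrable mu (indicator C :: _ => real)"
    using Cs unfolding S(1)[symmetric] by (intro mu.integrable_const_bound[of _ 1] borel_measurable_indicator) auto
   show "integrable mu phi" by (rule cfun_integrable[OF X(1) mu p(1)])
   show "indicator C x \<le> phi x" if "x \<in> space mu" for x
    using p(2)[of x] phi(3) that by (auto split: split_indicator)
  qed
  also have "\<dots> = (LINT x|nu. phi x)" by (rule eq[OF p(1)])
  also have "\<dots> \<le> (LINT x|nu. indicator (topspace X - D) x)"
  proof (rule integral_mono)
   show "integrable nu phi" by (rule cfun_integrable[OF X(1) nu p(1)])
   show "integrable nu (indicator (topspace X - D) :: _ => real)"
   proof -
    have "topspace X - D \<in> sets nu" unfolding S(2) using Dc by (auto simp: closedin_def)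
    then show ?thesis by (intro nu.integrable_const_bound[of _ 1] borel_measurable_indicator) auto
   qed
   show "phi x \<le> indicator (topspace X - D) x" if "x \<in> space nu" for x
    using p(2)[of x] phi(2) that by (auto split: split_indicator)
  qed
  also have "\<dots> = measure nu (topspace X - D)"
  proof -
   have "(topspace X - D) \<inter> topspace X = topspace X - D" by blast
   then show ?thesis by simp
  qed
  also have "topspace X - D = C \<union> (topspace X - C - D)" using D(1) closedin_subset[OF C] by auto
  also have "measure nu \<dots> \<le> measure nu C + measure nu (topspace X - C - D)"
   using Cs Dc C by (intro measure_Un_le) (auto simp: closedin_borel_of closedin_def openin_borel_of)
  finally show "measure mu C \<le> measure nu C + e" using D(3) by simp
 qed
 interpret mu: prob_space mu using probsD(1)[OF mu] .
 interpret nu: prob_space nu using probsD(1)[OF nu] .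
 show ?thesis
 proof (rule measure_eqI_generator_eq[where \<Omega> = "topspace X" and E = "{C. closedin X C}" and A = "%_. topspace X"])
  show "Int_stable {C. closedin X C}" by (auto simp: Int_stable_def)
  show "{C. closedin X C} \<subseteq> Pow (topspace X)" by (auto dest: closedin_subset)
  show "emeasure mu C = emeasure nu C" if "C \<in> {C. closedin X C}" for C
   using closed_le[OF mu nu eq] closed_le[OF nu mu eq[symmetric]] that
   by (simp add: mu.emeasure_eq_measure nu.emeasure_eq_measure antisym)
  have "sigma_sets (topspace X) {U. openin X U} = sigma_sets (topspace X) {C. closedin X C}"
  proof (rule antisym)
   have 1: "U \<in> sigma_sets (topspace X) {C. closedin X C}" if "openin X U" for U
   proof -
    have "topspace X - (topspace X - U) \<in> sigma_sets (topspace X) {C. closedin X C}"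
     using that by (intro sigma_sets.Compl sigma_sets.Basic) auto
    moreover have "topspace X - (topspace X - U) = U" using openin_subset[OF that] by auto
    ultimately show ?thesis by simp
   qed
   show "sigma_sets (topspace X) {U. openin X U} \<subseteq> sigma_sets (topspace X) {C. closedin X C}"
    by (rule sigma_sets_mono) (use 1 in auto)
   show "sigma_sets (topspace X) {C. closedin X C} \<subseteq> sigma_sets (topspace X) {U. openin X U}"
    by (rule sigma_sets_mono) (use closedin_borel_of in \<open>auto simp: sets_borel_of\<close>)
  qed
  then show "sets mu = sigma_sets (topspace X) {C. closedin X C}"
   "sets nu = sigma_sets (topspace X) {C. closedin X C}"
   using probsD[OF mu] probsD[OF nu] by (auto simp: sets_borel_of)
  show "range (%_. topspace X) \<subseteq> {C. closedin X C}" by auto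
  show "(\<Union>i::nat. topspace X) = topspace X" by auto
  show "emeasure mu (topspace X) \<noteq> \<infinity>" for i :: nat by simp
 qed
qed

lemma Hausdorff_prob_topology:
 assumes X: "compact_space X" "Hausdorff_space X"
 shows "Hausdorff_space (prob_topology X)"
 unfolding Hausdorff_space_def topspace_prob_topology
proof (intro allI impI)
 fix mu nu assume "mu \<in> prob_measures X \<and> nu \<in> prob_measures X \<and> mu \<noteq> nu"
 then obtain f where m: "mu \<in> prob_measures X" "nu \<in> prob_measures X" and f: "f \<in> cfun X" "(LINT x|mu. f x) \<noteq> (LINT x|nu. f x)"
  using prob_measures_eqI[OF X] by blast
 obtain U V where UV: "open U" "open V" "(LINT x|mu. f x) \<in> U" "(LINT x|nu. f x) \<in> V" "U \<inter> V = {}"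
  using hausdorff[OF f(2)] by metis
 let ?P = "%U. {mu \<in> topspace (prob_topology X). (LINT x|mu. f x) \<in> U}"
 have "openin (prob_topology X) (?P U)" "openin (prob_topology X) (?P V)"
  using UV by (intro openin_continuous_map_preimage[OF continuous_map_integral[OF f(1)]]; simp)+
 moreover have "mu \<in> ?P U" "nu \<in> ?P V" "disjnt (?P U) (?P V)" using UV m by (auto simp: disjnt_def)
 ultimately show "\<exists>U V. openin (prob_topology X) U \<and> openin (prob_topology X) V \<and> mu \<in> U \<and> nu \<in> V \<and> disjnt U V"
  by blast
qed

section \<open>Compactness of the space of probability measures\<close>

definition cfun_bound :: "'x topology => ('x => real) => real" where
 "cfun_bound X f = (SOME B. 0 \<le> B \<and> (\<forall>x\<in>topspace X. \<bar>f x\<bar> \<le> B))"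

lemma cfun_bound:
 assumes "compact_space X" "f \<in> cfun X"
 shows "0 \<le> cfun_bound X f" "x \<in> topspace X ==> \<bar>f x\<bar> \<le> cfun_bound X f"
proof -
 have "\<exists>B. 0 \<le> B \<and> (\<forall>x\<in>topspace X. \<bar>f x\<bar> \<le> B)" using cfun_bounded[OF assms] by metis
 from someI_ex[OF this] show "0 \<le> cfun_bound X f" "x \<in> topspace X ==> \<bar>f x\<bar> \<le> cfun_bound X f"
  by (auto simp: cfun_bound_def)
qed

text \<open>The value 0 off \<open>cfun X\<close> makes a functional depend on its restriction to
  C(X) alone, and places all of them in a product of bounded intervals.\<close>

definition means :: "'x topology => (('x => real) => real) set" where
 "means X = {Lam. is_mean X Lam \<and> (\<forall>f. f \<notin> cfun X \<longrightarrow> Lam f = 0)}"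

lemma mean_le_bound:
 assumes "compact_space X" "is_mean X Lam" "f \<in> cfun X"
 shows "\<bar>Lam f\<bar> \<le> cfun_bound X f"
proof -
 let ?B = "cfun_bound X f"
 have c1: "(%_. ?B * 1) \<in> cfun X" and c2: "(%x. (- 1) * f x) \<in> cfun X" by (intro cfun_intros assms)+
 have m: "Lam (%x. f x + g x) = Lam f + Lam g" if "f \<in> cfun X" "g \<in> cfun X" for f g
  using assms(2) that by (simp add: is_mean_def)
 have sc: "Lam (%x. c * f x) = c * Lam f" if "f \<in> cfun X" for f c using assms(2) that by (simp add: is_mean_def)
 have B: "Lam (%_. ?B * 1) = ?B" using sc[OF cfun_intros(1)[of 1], of ?B] assms(2) by (simp add: is_mean_def)
 have p: "0 \<le> Lam g" if "g \<in> cfun X" "\<And>x. x \<in> topspace X ==> 0 \<le> g x" for g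
  using assms(2) that by (simp add: is_mean_def)
 have b: "- ?B \<le> f x" "f x \<le> ?B" if "x \<in> topspace X" for x
  using cfun_bound(2)[OF assms(1,3) that] by linarith+
 have "0 \<le> Lam (%x. ?B * 1 + f x)"
  by (rule p[OF cfun_intros(2)[OF c1 assms(3)]]) (use b(1) in force)
 moreover have "0 \<le> Lam (%x. ?B * 1 + (- 1) * f x)"
  by (rule p[OF cfun_intros(2)[OF c1 c2]]) (use b(2) in force)
 ultimately show ?thesis using m[OF c1 assms(3)] m[OF c1 c2] sc[OF assms(3), of "- 1"] B by simp
qed

text \<open>The Banach-Alaoglu argument: each defining condition is closed for pointwise
  convergence, and the product of the intervals given by \<open>cfun_bound\<close>, with {0} as
  factor off \<open>cfun X\<close>, is compact by Tychonoff.\<close>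

lemma compact_means:
 assumes X: "compact_space X"
 shows "compact (means X)"
proof -
 let ?B = "%f. if f \<in> cfun X then {- cfun_bound X f .. cfun_bound X f} else {0}"
 have "compactin (product_topology (%_. euclideanreal) UNIV) (PiE UNIV ?B)"
  by (subst compactin_PiE) auto
 then have cpt: "compact (Pi UNIV ?B)"
  unfolding euclidean_product_topology PiE_UNIV_domain by simp
 have ev: "continuous_on UNIV (%Lam :: ('a => real) => real. Lam f)" for f by simp
 have "closed {Lam. is_mean X Lam \<and> (\<forall>f. f \<notin> cfun X \<longrightarrow> Lam f = 0)}"
  unfolding is_mean_def Ball_def
  by (intro closed_Collect_conj closed_Collect_all closed_Collect_imp open_Collect_const
   closed_Collect_eq closed_Collect_le continuous_intros ev)
 then have "closed (means X)" by (simp add: means_def)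
 moreover have "means X \<subseteq> Pi UNIV ?B"
 proof
  fix Lam assume "Lam \<in> means X"
  then have L: "is_mean X Lam" "\<And>f. f \<notin> cfun X ==> Lam f = 0" by (simp_all add: means_def)
  show "Lam \<in> Pi UNIV ?B"
  proof
   fix f show "Lam f \<in> ?B f"
    using mean_le_bound[OF X L(1), of f] L(2)[of f] by (simp add: abs_le_iff) linarith
  qed
 qed
 ultimately show ?thesis using cpt compact_Int_closed[of "Pi UNIV ?B" "means X"] by (simp add: Int_absorb1)
qed

definition represent :: "'x topology => (('x => real) => real) => 'x measure" where
 "represent X Lam = mean_functional.rmeasure X Lam"

lemma represent:
 assumes "compact_space X" "Hausdorff_space X" "Lam \<in> means X"
 shows "represent X Lam \<in> prob_measures X" "f \<in> cfun X ==> (LINT x|represent X Lam. f x) = Lam f"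
proof -
 interpret mean_functional X Lam by unfold_locales (use assms in \<open>auto simp: means_def\<close>)
 show "represent X Lam \<in> prob_measures X" "f \<in> cfun X ==> (LINT x|represent X Lam. f x) = Lam f"
  unfolding represent_def by (fact rmeasure_in_prob_measures, fact integral_rmeasure)
qed

lemma mean_of_prob:
 assumes "compact_space X" "mu \<in> prob_measures X"
 shows "(%f. if f \<in> cfun X then LINT x|mu. f x else 0) \<in> means X"
proof -
 interpret prob_space mu using probsD(1)[OF assms(2)] .
 show ?thesis
  unfolding means_def is_mean_def mem_Collect_eq
 proof (intro conjI ballI allI impI)
  fix f g c assume f: "f \<in> cfun X"
  have "(%x. c * f x) \<in> cfun X" by (intro cfun_intros f)
  then show "(if (%x. c * f x) \<in> cfun X then LINT x|mu. c * f x else 0) = c * (if f \<in> cfun X then LINT x|mu. f x else 0)"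
   using f by simp
  show "(if (%x. f x + g x) \<in> cfun X then LINT x|mu. f x + g x else 0)
    = (if f \<in> cfun X then LINT x|mu. f x else 0) + (if g \<in> cfun X then LINT x|mu. g x else 0)" if g: "g \<in> cfun X"
   using f g cfun_intros(2)[OF f g] cfun_integrable[OF assms] by simp
  show "0 \<le> (if f \<in> cfun X then LINT x|mu. f x else 0)" if "\<forall>x\<in>topspace X. 0 \<le> f x"
   using that probsD(2)[OF assms(2)] by (auto intro!: integral_nonneg_AE AE_I2)
 qed (use prob_space probsD(2)[OF assms(2)] in \<open>simp_all add: cfun_intros\<close>)
qed

text \<open>The Riesz representation is a continuous map of the compact set of means onto the
  measures.\<close>

lemma compact_prob_topology:
 assumes X: "compact_space X" "Hausdorff_space X"
 shows "compact_space (prob_topology X)"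
proof -
 have "continuous_map (top_of_set (means X)) (prob_topology X) (represent X)"
 proof (rule continuous_map_into_prob)
  show "represent X Lam \<in> prob_measures X" if "Lam \<in> topspace (top_of_set (means X))" for Lam
   using represent(1)[OF X] that by simp
  fix f assume f: "f \<in> cfun X"
  have "continuous_on (means X) (%Lam. Lam f)" by (rule continuous_on_subset[OF continuous_on_product_coordinates]) simp
  then have "continuous_on (means X) (%Lam. LINT x|represent X Lam. f x)"
   by (rule continuous_on_eq) (simp add: represent(2)[OF X _ f])
  then show "continuous_map (top_of_set (means X)) euclideanreal (%Lam. LINT x|represent X Lam. f x)" by simp
 qed
 moreover have "represent X ` means X = prob_measures X"
 proof (intro set_eqI iffI)
  fix mu assume mu: "mu \<in> prob_measures X"
  define Lam where "Lam = (%f. if f \<in> cfun X then LINT x|mu. f x else 0)"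
  have m: "Lam \<in> means X" unfolding Lam_def by (rule mean_of_prob[OF X(1) mu])
  have "represent X Lam = mu"
  proof (rule prob_measures_eqI[OF X represent(1)[OF X m] mu])
   fix f assume f: "f \<in> cfun X"
   have "(LINT x|represent X Lam. f x) = Lam f" by (rule represent(2)[OF X m f])
   also have "\<dots> = (LINT x|mu. f x)" unfolding Lam_def by (rule if_P[OF f])
   finally show "(LINT x|represent X Lam. f x) = (LINT x|mu. f x)" .
  qed
  then show "mu \<in> represent X ` means X" by (rule image_eqI[OF sym m])
 qed (use represent(1)[OF X] in auto)
 moreover have "compactin (top_of_set (means X)) (means X)"
  using compact_means[OF X(1)] by (simp add: compactin_subtopology)
 ultimately show ?thesis
  unfolding compact_space_def topspace_prob_topology by (metis image_compactin)
qed

text \<open>Inner regularity is transported by taking images of compact sets; these are closed,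
  hence measurable, because Y is Hausdorff.\<close>

lemma push_forward_prob:
 assumes "compact_space X" "Hausdorff_space X" "mu \<in> prob_measures X" "continuous_map X Y phi" "Hausdorff_space Y"
 shows "distr mu (borel_of Y) phi \<in> prob_measures Y"
  and "f \<in> borel_measurable (borel_of Y) ==> (LINT x|distr mu (borel_of Y) phi. f x) = (LINT x|mu. (f (phi x) :: real))"
  and "phi \<in> mu \<rightarrow>\<^sub>M borel_of Y"
proof -
 interpret prob_space mu using probsD(1)[OF assms(3)] .
 have S: "sets mu = sets (borel_of X)" "space mu = topspace X" using probsD[OF assms(3)] by auto
 show m: "phi \<in> mu \<rightarrow>\<^sub>M borel_of Y"
  unfolding borel_of_def
 proof (rule measurable_measure_of)
  show "{U. openin Y U} \<subseteq> Pow (topspace Y)" by (auto dest: openin_subset)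
  show "phi \<in> space mu \<rightarrow> topspace Y" using assms(4) by (auto simp: S continuous_map_def)
  fix U assume "U \<in> {U. openin Y U}"
  then have "openin X {x \<in> topspace X. phi x \<in> U}" using openin_continuous_map_preimage[OF assms(4)] by auto
  moreover have "phi -` U \<inter> space mu = {x \<in> topspace X. phi x \<in> U}" by (auto simp: S)
  ultimately show "phi -` U \<inter> space mu \<in> sets mu" by (simp add: S openin_borel_of)
 qed
 show "f \<in> borel_measurable (borel_of Y) ==> (LINT x|distr mu (borel_of Y) phi. f x) = (LINT x|mu. f (phi x))"
  by (rule integral_distr[OF m])
 have "\<exists>C\<subseteq>A. compactin Y C \<and> measure (distr mu (borel_of Y) phi) (A - C) < e"
  if A: "A \<in> sets (borel_of Y)" and e: "0 < e" for A e
 proof -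
  have "phi -` A \<inter> space mu \<in> sets mu" using measurable_sets[OF m A] .
  then obtain C where C: "C \<subseteq> phi -` A \<inter> space mu" "compactin X C" "prob (phi -` A \<inter> space mu - C) < e"
   using assms(3) e unfolding prob_measures_def by blast
  have k: "compactin Y (phi ` C)" using image_compactin[OF C(2) assms(4)] .
  then have cl: "closedin Y (phi ` C)" using compactin_imp_closedin assms(5) by blast
  have Cs: "C \<in> sets mu" using compactin_imp_closedin[OF assms(2) C(2)] by (simp add: S closedin_borel_of)
  have "measure (distr mu (borel_of Y) phi) (A - phi ` C) = prob (phi -` (A - phi ` C) \<inter> space mu)"
   using A cl by (intro measure_distr[OF m]) auto
  also have "\<dots> \<le> prob (phi -` A \<inter> space mu - C)"
   using measurable_sets[OF m A] Cs by (intro finite_measure_mono) auto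
  finally show ?thesis using C(1,3) k by (intro exI[of _ "phi ` C"]) auto
 qed
 then show "distr mu (borel_of Y) phi \<in> prob_measures Y"
  using prob_space_distr[OF m] by (simp add: prob_measures_def)
qed

lemma cfun_comp: "continuous_map X Y phi ==> f \<in> cfun Y ==> (%x. f (phi x)) \<in> cfun X"
 unfolding cfun_def mem_Collect_eq using continuous_map_compose[of X Y phi euclideanreal f] by (simp add: comp_def)

lemma integral_push_forward_cfun:
 assumes "compact_space X" "Hausdorff_space X" "mu \<in> prob_measures X" "continuous_map X Y phi" "Hausdorff_space Y" "f \<in> cfun Y"
 shows "(LINT x|distr mu (borel_of Y) phi. f x) = (LINT x|mu. f (phi x))"
 by (rule push_forward_prob(2)[OF assms(1-5) cfun_measurable[OF assms(6)]])

text \<open>Compactness of X turns joint continuity of F into uniform closeness in x for nearby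
  parameters, by the tube lemma. A second error of e/3 comes from moving the measure with the
  parameter fixed.\<close>

lemma continuous_parametric_integral:
 assumes X: "compact_space X" and F: "continuous_map (prod_topology A X) euclideanreal (%(a, x). F a x)"
 shows "continuous_map (prod_topology A (prob_topology X)) euclideanreal (%(a, mu). LINT x|mu. F a x)"
proof -
 have Fa: "F a \<in> cfun X" if "a \<in> topspace A" for a
 proof -
  have "continuous_map X (prod_topology A X) (%x. (a, x))" using that by (intro continuous_map_pairedI) auto
  from continuous_map_compose[OF this F] show ?thesis by (simp add: cfun_def comp_def)
 qed
 have "\<exists>W. openin (prod_topology A (prob_topology X)) W \<and> (a, mu) \<in> W \<and>
   (\<forall>(b, nu)\<in>W. \<bar>(LINT x|nu. F b x) - (LINT x|mu. F a x)\<bar> < e)"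
  if a: "a \<in> topspace A" and mu: "mu \<in> prob_measures X" and e: "0 < e" for a mu and e :: real
 proof -
  have c: "continuous_map (prod_topology A X) euclideanreal (%p. \<bar>F (fst p) (snd p) - F a (snd p)\<bar>)"
  proof -
   have "continuous_map (prod_topology A X) euclideanreal (%p. F a (snd p))"
    using Fa[OF a] unfolding cfun_def mem_Collect_eq
    by (rule continuous_map_compose[OF continuous_map_snd, unfolded comp_def])
   moreover have "continuous_map (prod_topology A X) euclideanreal (%p. F (fst p) (snd p))"
    using F unfolding case_prod_beta .
   ultimately show ?thesis by (intro continuous_map_real_abs continuous_map_diff)
  qed
  let ?W = "{p \<in> topspace (prod_topology A X). \<bar>F (fst p) (snd p) - F a (snd p)\<bar> \<in> {..<e/3}}"
  have W: "openin (prod_topology A X) ?W" by (rule openin_continuous_map_preimage[OF c]) auto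
  have "{a} \<times> topspace X \<subseteq> ?W" using a e by auto
  then obtain U V where UV: "openin A U" "openin X V" "a \<in> U" "topspace X \<subseteq> V" "U \<times> V \<subseteq> ?W"
   using tube_lemma_right[OF W, of "topspace X" a] X a unfolding compact_space_def by blast
  let ?V = "{nu \<in> topspace (prob_topology X). (LINT x|nu. F a x) \<in> {(LINT x|mu. F a x) - e/3<..<(LINT x|mu. F a x) + e/3}}"
  have V': "openin (prob_topology X) ?V"
   by (rule openin_continuous_map_preimage[OF continuous_map_integral[OF Fa[OF a]]]) auto
  have "\<bar>(LINT x|nu. F b x) - (LINT x|mu. F a x)\<bar> < e" if b: "b \<in> U" and nu: "nu \<in> ?V" for b nu
  proof -
   have bA: "b \<in> topspace A" using b openin_subset[OF UV(1)] by auto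
   have nup: "nu \<in> prob_measures X" using nu by simp
   interpret prob_space nu using probsD(1)[OF nup] .
   have i: "integrable nu (F b)" "integrable nu (F a)" using cfun_integrable[OF X nup] Fa a bA by auto
   have "\<bar>(LINT x|nu. F b x) - (LINT x|nu. F a x)\<bar> = \<bar>LINT x|nu. F b x - F a x\<bar>" using i by simp
   also have "\<dots> \<le> (LINT x|nu. \<bar>F b x - F a x\<bar>)" by (rule integral_abs_bound)
   also have "\<dots> \<le> (LINT x|nu. e/3)"
   proof (rule integral_mono)
    fix x assume "x \<in> space nu"
    then have "(b, x) \<in> ?W" using b UV(4,5) probsD(2)[OF nup] by blast
    then show "\<bar>F b x - F a x\<bar> \<le> e/3" by simp
   qed (use i in auto)
   also have "\<dots> = e/3" by (simp add: prob_space)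
   finally have 1: "\<bar>(LINT x|nu. F b x) - (LINT x|nu. F a x)\<bar> \<le> e/3" .
   have 2: "(LINT x|mu. F a x) - e/3 < (LINT x|nu. F a x)" "(LINT x|nu. F a x) < (LINT x|mu. F a x) + e/3"
    using nu by auto
   show ?thesis using 1 2 by linarith
  qed
  then show ?thesis
   using UV V' mu e by (intro exI[of _ "U \<times> ?V"]) (auto simp: openin_prod_Times_iff)
 qed
 note key = this
 show ?thesis
  unfolding continuous_map_def
 proof (intro conjI allI impI)
  fix S :: "real set" assume S: "openin euclideanreal S"
  let ?P = "prod_topology A (prob_topology X)" and ?f = "%(a, mu). LINT x|mu. F a x"
  show "openin ?P {p \<in> topspace ?P. ?f p \<in> S}"
   unfolding openin_subopen[of ?P "{p \<in> topspace ?P. ?f p \<in> S}"]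
  proof
   fix p assume "p \<in> {p \<in> topspace ?P. ?f p \<in> S}"
   then obtain a mu where p: "p = (a, mu)" "a \<in> topspace A" "mu \<in> prob_measures X" "(LINT x|mu. F a x) \<in> S" by auto
   then obtain e where e: "e > 0" "ball (LINT x|mu. F a x) e \<subseteq> S" using S by (auto simp: open_contains_ball)
   from key[OF p(2,3) e(1)] obtain W where W: "openin ?P W" "p \<in> W"
    "\<forall>(b, nu)\<in>W. \<bar>(LINT x|nu. F b x) - (LINT x|mu. F a x)\<bar> < e" using p(1) by auto
   have "W \<subseteq> {p \<in> topspace ?P. ?f p \<in> S}"
    using openin_subset[OF W(1)] W(3) e(2) by (fastforce simp: dist_real_def abs_minus_commute)
   then show "\<exists>T. openin ?P T \<and> p \<in> T \<and> T \<subseteq> {p \<in> topspace ?P. ?f p \<in> S}" using W by blast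
  qed
 qed auto
qed

lemma G_system_D:
 assumes "G_system X al"
 shows "topspace X \<noteq> {}" "compact_space X" "Hausdorff_space X"
  "continuous_map (prod_topology euclidean X) X (%(g, x). al g x)"
  "\<And>x. x \<in> topspace X ==> al 1 x = x"
  "\<And>g h x. x \<in> topspace X ==> al (g * h) x = al g (al h x)"
  "\<And>g. continuous_map X X (al g)"
  "\<And>g x. x \<in> topspace X ==> al g x \<in> topspace X"
proof -
 show c: "continuous_map (prod_topology euclidean X) X (%(g, x). al g x)" using assms by (simp add: G_system_def)
 show g: "continuous_map X X (al g)" for g
 proof -
  have "continuous_map X (prod_topology euclidean X) (%x. (g, x))" by (intro continuous_map_pairedI) auto
  from continuous_map_compose[OF this c] show ?thesis by (simp add: comp_def)
 qed
 show "\<And>g x. x \<in> topspace X ==> al g x \<in> topspace X" using g by (auto simp: continuous_map_def)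
qed (use assms in \<open>auto simp: G_system_def\<close>)

lemma distr_cong_id: "sets mu = sets N ==> (\<And>x. x \<in> space mu ==> f x = x) ==> distr mu N f = mu"
 by (subst distr_cong[of mu mu N N f "%x. x"]) (auto intro: distr_id2)

lemma G_system_prob:
 assumes G: "G_system X al"
 shows "G_system (prob_topology X) (push_forward X al)"
proof -
 note D = G_system_D[OF G]
 have pf: "push_forward X al g mu \<in> prob_measures X" if "mu \<in> prob_measures X" for g mu
  unfolding push_forward_def using push_forward_prob(1)[OF D(2,3) that D(7) D(3)] .
 show ?thesis
  unfolding G_system_def
 proof (intro conjI allI ballI)
  obtain x where x: "x \<in> topspace X" using D(1) by blast
  \<comment> \<open>Evaluation at a point is a mean, so there is at least one measure.\<close>
  have "(%f. if f \<in> cfun X then f x else 0) \<in> means X"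
   using x by (auto simp: means_def is_mean_def cfun_intros)
  from represent(1)[OF D(2,3) this] show "topspace (prob_topology X) \<noteq> {}" by auto
  show "compact_space (prob_topology X)" "Hausdorff_space (prob_topology X)"
   using compact_prob_topology Hausdorff_prob_topology D by auto
  show "continuous_map (prod_topology euclidean (prob_topology X)) (prob_topology X) (%(g, mu). push_forward X al g mu)"
  proof (rule continuous_map_into_prob)
   show "(case t of (g, mu) => push_forward X al g mu) \<in> prob_measures X"
    if "t \<in> topspace (prod_topology euclidean (prob_topology X))" for t
    using that pf by (auto split: prod.split)
   fix f assume f: "f \<in> cfun X"
   have eq: "(%(g, x). f (al g x)) = f \<circ> (%(g, x). al g x)" by (simp add: fun_eq_iff)
   have "continuous_map (prod_topology euclidean X) euclideanreal (%(g, x). f (al g x))"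
    unfolding eq using f by (intro continuous_map_compose[OF D(4)]) (simp add: cfun_def)
   from continuous_parametric_integral[OF D(2) this]
   show "continuous_map (prod_topology euclidean (prob_topology X)) euclideanreal
     (%t. LINT x|(case t of (g, mu) => push_forward X al g mu). f x)"
    by (rule continuous_map_eq)
     (auto simp: push_forward_def integral_push_forward_cfun[OF D(2,3) _ D(7) D(3) f])
  qed
  fix mu assume mu: "mu \<in> topspace (prob_topology X)"
  then have S: "sets mu = sets (borel_of X)" "space mu = topspace X" by (auto dest: probsD)
  show "push_forward X al 1 mu = mu"
   unfolding push_forward_def by (rule distr_cong_id) (auto simp: S D(5))
  fix g h
  have m: "al k \<in> mu \<rightarrow>\<^sub>M borel_of X" for k using push_forward_prob(3)[OF D(2,3) _ D(7) D(3), of mu] mu by simp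
  have m2: "al g \<in> borel_of X \<rightarrow>\<^sub>M borel_of X" using m[of g] measurable_cong_sets[OF S(1) refl] by blast
  have "push_forward X al g (push_forward X al h mu) = distr mu (borel_of X) (al g \<circ> al h)"
   unfolding push_forward_def by (rule distr_distr[OF m2 m])
  also have "\<dots> = push_forward X al (g * h) mu"
   unfolding push_forward_def by (rule distr_cong) (auto simp: S D(6))
  finally show "push_forward X al (g * h) mu = push_forward X al g (push_forward X al h mu)" by simp
 qed
qed

section \<open>Convex combinations and push-forwards of measures\<close>

lemma mix_measure:
 assumes X: "Hausdorff_space X"
  and mu: "mu \<in> prob_measures X" and nu: "nu \<in> prob_measures X" and t: "t \<in> {0..1}"
 shows "mix_measure t mu nu \<in> prob_measures X"
  and "A \<in> sets (borel_of X) ==> emeasure (mix_measure t mu nu) A = ennreal (1 - t) * emeasure mu A + ennreal t * emeasure nu A"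
  and "sets (mix_measure t mu nu) = sets (borel_of X)"
proof -
 interpret mu: prob_space mu using probsD(1)[OF mu] .
 interpret nu: prob_space nu using probsD(1)[OF nu] .
 have S: "sets mu = sets (borel_of X)" "space mu = topspace X" "sets nu = sets (borel_of X)" "space nu = topspace X"
  using probsD[OF mu] probsD[OF nu] by auto
 show s: "sets (mix_measure t mu nu) = sets (borel_of X)" 
  unfolding mix_measure_def S by (metis sets.sets_measure_of_eq space_borel_of)
 have em: "emeasure (mix_measure t mu nu) A = ennreal (1 - t) * emeasure mu A + ennreal t * emeasure nu A"
  if "A \<in> sets mu" for A
 proof (rule emeasure_measure_of[OF mix_measure_def])
  show "countably_additive (sets (mix_measure t mu nu)) (%A. ennreal (1 - t) * emeasure mu A + ennreal t * emeasure nu A)"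
  proof (rule countably_additiveI)
   fix A :: "nat => _" assume A: "range A \<subseteq> sets (mix_measure t mu nu)" "disjoint_family A"
   have "(\<Sum>i. emeasure mu (A i)) = emeasure mu (\<Union>i. A i)" "(\<Sum>i. emeasure nu (A i)) = emeasure nu (\<Union>i. A i)"
    using A by (auto intro!: suminf_emeasure simp: s S)
   then show "(\<Sum>i. ennreal (1 - t) * emeasure mu (A i) + ennreal t * emeasure nu (A i))
     = ennreal (1 - t) * emeasure mu (\<Union>i. A i) + ennreal t * emeasure nu (\<Union>i. A i)"
    by (simp add: suminf_add[symmetric])
  qed
 qed (use that sets.sets_into_space[of _ "borel_of X"] in \<open>auto simp: s S positive_def\<close>)
 then show "A \<in> sets (borel_of X) ==> emeasure (mix_measure t mu nu) A = ennreal (1 - t) * emeasure mu A + ennreal t * emeasure nu A"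
  by (simp add: S)
 have sp: "space (mix_measure t mu nu) = topspace X" using sets_eq_imp_space_eq[OF s] by simp
 interpret M: prob_space "mix_measure t mu nu"
 proof
  show "emeasure (mix_measure t mu nu) (space (mix_measure t mu nu)) = 1"
   using em[of "space mu"] openin_borel_of[OF openin_topspace, of X] mu.emeasure_space_1 nu.emeasure_space_1 t
   by (simp add: sp S) (simp flip: ennreal_plus)
 qed
 have me: "measure (mix_measure t mu nu) A = (1 - t) * measure mu A + t * measure nu A" if "A \<in> sets mu" for A
  using em[OF that] t by (simp add: M.emeasure_eq_measure mu.emeasure_eq_measure nu.emeasure_eq_measure
    flip: ennreal_mult ennreal_plus)
 have "\<exists>C\<subseteq>A. compactin X C \<and> measure (mix_measure t mu nu) (A - C) < e"
  if A: "A \<in> sets (borel_of X)" and e: "0 < e" for A e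
 proof -
  have cs: "\<exists>C\<subseteq>A. compactin X C \<and> measure mu (A - C) < e" "\<exists>C\<subseteq>A. compactin X C \<and> measure nu (A - C) < e"
   using A e mu nu by (auto simp: prob_measures_def)
  then obtain C D where CD: "C \<subseteq> A" "compactin X C" "measure mu (A - C) < e" "D \<subseteq> A" "compactin X D" "measure nu (A - D) < e"
   by blast
  have cl: "C \<in> sets (borel_of X)" "D \<in> sets (borel_of X)"
   using compactin_imp_closedin[OF X] CD(2,5) by (auto intro: closedin_borel_of)
  have "measure mu (A - (C \<union> D)) \<le> measure mu (A - C)" "measure nu (A - (C \<union> D)) \<le> measure nu (A - D)"
   using A cl by (auto intro!: mu.finite_measure_mono nu.finite_measure_mono simp: S)
  then have le: "measure mu (A - (C \<union> D)) < e" "measure nu (A - (C \<union> D)) < e" using CD by auto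
  have "(1 - t) * measure mu (A - (C \<union> D)) + t * measure nu (A - (C \<union> D)) < e"
   using le t by (intro convex_bound_lt) auto
  then have "measure (mix_measure t mu nu) (A - (C \<union> D)) < e" using A cl by (subst me) (auto simp: S)
  then show ?thesis using CD by (intro exI[of _ "C \<union> D"]) (auto intro: compactin_Un)
 qed
 then show "mix_measure t mu nu \<in> prob_measures X"
  using M.prob_space_axioms by (simp add: prob_measures_def s sp)
qed

lemma nn_integral_mix:
 assumes X: "Hausdorff_space X"
  and mu: "mu \<in> prob_measures X" and nu: "nu \<in> prob_measures X" and t: "t \<in> {0..1}"
  and f: "f \<in> borel_measurable (borel_of X)"
 shows "(\<integral>\<^sup>+x. f x \<partial>mix_measure t mu nu) = ennreal (1 - t) * (\<integral>\<^sup>+x. f x \<partial>mu) + ennreal t * (\<integral>\<^sup>+x. f x \<partial>nu)"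
proof -
 note M = mix_measure[OF X mu nu t]
 have [measurable_cong]: "sets mu = sets (borel_of X)" "sets nu = sets (borel_of X)" "sets (mix_measure t mu nu) = sets (borel_of X)"
  using probsD[OF mu] probsD[OF nu] M(3) by auto
 have sp: "space (mix_measure t mu nu) = topspace X" "space mu = topspace X" "space nu = topspace X"
  using probsD[OF mu] probsD[OF nu] probsD[OF M(1)] by auto
 show ?thesis using f
 proof (induction rule: borel_measurable_induct)
  case (cong f g)
  have "(\<integral>\<^sup>+x. g x \<partial>N) = (\<integral>\<^sup>+x. f x \<partial>N)" if "space N = topspace X" for N
   using that cong(3) by (intro nn_integral_cong) auto
  with cong(4) sp show ?case by simp
 next
  case (set A)
  then show ?case using M(2)[OF set] \<open>sets mu = _\<close> \<open>sets nu = _\<close> \<open>sets (mix_measure t mu nu) = _\<close> by simp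
 next
  case (mult u c)
  note [measurable] = mult(2)
  show ?case by (simp add: nn_integral_cmult mult(4) distrib_left mult.left_commute)
 next
  case (add u v)
  have [measurable]: "u \<in> borel_measurable (borel_of X)" "v \<in> borel_measurable (borel_of X)" using add by auto
  have "(\<integral>\<^sup>+x. u x + v x \<partial>N) = (\<integral>\<^sup>+x. u x \<partial>N) + (\<integral>\<^sup>+x. v x \<partial>N)"
   if [measurable_cong]: "sets N = sets (borel_of X)" for N by (rule nn_integral_add) measurable
  then show ?case using add \<open>sets mu = _\<close> \<open>sets nu = _\<close> \<open>sets (mix_measure t mu nu) = _\<close>
   by (simp add: distrib_left ac_simps)
 next
  case (seq U)
  note [measurable] = seq(1)
  have incU: "incseq U" using seq by blast
  have IH: "(\<integral>\<^sup>+x. U i x \<partial>mix_measure t mu nu) = ennreal (1 - t) * (\<integral>\<^sup>+x. U i x \<partial>mu) + ennreal t * (\<integral>\<^sup>+x. U i x \<partial>nu)" for i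
   using seq by blast
  have eq: "(\<integral>\<^sup>+x. (SUP i. U i) x \<partial>N) = (SUP i. \<integral>\<^sup>+x. U i x \<partial>N)" if [measurable_cong]: "sets N = sets (borel_of X)" for N
   using nn_integral_monotone_convergence_SUP[OF incU, of N] by (simp add: image_comp)
  have inc: "incseq (%i. c * (\<integral>\<^sup>+x. U i x \<partial>N))" for N :: "'a measure" and c :: ennreal
   using incU by (auto simp: incseq_def le_fun_def intro!: mult_left_mono nn_integral_mono)
  show ?case
   using \<open>sets mu = _\<close> \<open>sets nu = _\<close> \<open>sets (mix_measure t mu nu) = _\<close>
   by (simp only: eq IH SUP_mult_left_ennreal ennreal_SUP_add[OF inc inc])
 qed
qed

text \<open>Adding the bound \<open>B\<close> makes the integrand nonnegative, which reduces the
  claim to \<open>nn_integral_mix\<close>.\<close>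

lemma integral_mix:
 assumes X: "compact_space X" "Hausdorff_space X"
  and mu: "mu \<in> prob_measures X" and nu: "nu \<in> prob_measures X" and t: "t \<in> {0..1}"
  and f: "f \<in> borel_measurable (borel_of X)" and B: "\<And>x. x \<in> topspace X ==> \<bar>f x\<bar> \<le> (B :: real)"
 shows "(LINT x|mix_measure t mu nu. f x) = (1 - t) * (LINT x|mu. f x) + t * (LINT x|nu. f x)"
proof -
 have nn: "(\<integral>\<^sup>+x. ennreal (f x + B) \<partial>N) = ennreal ((LINT x|N. f x) + B)" "0 \<le> (LINT x|N. f x) + B"
  if N: "N \<in> prob_measures X" for N
 proof -
  interpret prob_space N using probsD(1)[OF N] .
  have [measurable_cong]: "sets N = sets (borel_of X)" using probsD[OF N] by simp
  note [measurable] = f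
  have sp: "space N = topspace X" using probsD[OF N] by simp
  have fi: "integrable N f" using B by (intro integrable_const_bound[of _ B]) (auto simp: sp)
  have p: "0 \<le> f x + B" if "x \<in> space N" for x using B[of x] that by (auto simp: sp)
  have "(\<integral>\<^sup>+x. ennreal (f x + B) \<partial>N) = ennreal (LINT x|N. f x + B)"
   using fi p by (intro nn_integral_eq_integral) auto
  also have e: "(LINT x|N. f x + B) = (LINT x|N. f x) + B" using fi by (simp add: prob_space)
  finally show "(\<integral>\<^sup>+x. ennreal (f x + B) \<partial>N) = ennreal ((LINT x|N. f x) + B)" .
  have "0 \<le> (LINT x|N. f x + B)" using p by (intro integral_nonneg_AE AE_I2) auto
  then show "0 \<le> (LINT x|N. f x) + B" by (simp add: e)
 qed
 have m: "(%x. ennreal (f x + B)) \<in> borel_measurable (borel_of X)" using f by measurable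
 have "ennreal ((LINT x|mix_measure t mu nu. f x) + B)
   = ennreal ((1 - t) * ((LINT x|mu. f x) + B) + t * ((LINT x|nu. f x) + B))"
  using nn_integral_mix[OF X(2) mu nu t m] nn[OF mu] nn[OF nu] nn[OF mix_measure(1)[OF X(2) mu nu t]] t
  by (simp add: ennreal_mult ennreal_plus)
 then have "(LINT x|mix_measure t mu nu. f x) + B = (1 - t) * ((LINT x|mu. f x) + B) + t * ((LINT x|nu. f x) + B)"
  using nn(2)[OF mu] nn(2)[OF nu] nn(2)[OF mix_measure(1)[OF X(2) mu nu t]] t
  by (subst (asm) ennreal_inj) auto
 then show ?thesis by (simp add: algebra_simps)
qed

lemma integral_mix_cfun:
 assumes "compact_space X" "Hausdorff_space X" "mu \<in> prob_measures X" "nu \<in> prob_measures X" "t \<in> {0..1}" "f \<in> cfun X"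
 shows "(LINT x|mix_measure t mu nu. f x) = (1 - t) * (LINT x|mu. f x) + t * (LINT x|nu. f x)"
 by (rule integral_mix[OF assms(1-5) cfun_measurable[OF assms(6)] cfun_bound(2)[OF assms(1,6)]])

lemma affine_action_prob:
 assumes G: "G_system X al"
 shows "affine_action (prob_system X al)"
 unfolding affine_action_def prob_system_def affine_structure.simps topspace_prob_topology
proof (intro ballI conjI allI)
 note D = G_system_D[OF G]
 fix t :: real and mu nu g assume t: "t \<in> {0..1}" and m: "mu \<in> prob_measures X" "nu \<in> prob_measures X"
 show mm: "mix_measure t mu nu \<in> prob_measures X" by (rule mix_measure(1)[OF D(3) m t])
 have pf: "push_forward X al g mu \<in> prob_measures X" if "mu \<in> prob_measures X" for mu
  unfolding push_forward_def using push_forward_prob(1)[OF D(2,3) that D(7) D(3)] .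
 show "push_forward X al g (mix_measure t mu nu) = mix_measure t (push_forward X al g mu) (push_forward X al g nu)"
 proof (rule prob_measures_eqI[OF D(2,3) pf[OF mm] mix_measure(1)[OF D(3) pf[OF m(1)] pf[OF m(2)] t]])
  fix f assume f: "f \<in> cfun X"
  have "(%x. f (al g x)) \<in> cfun X" by (rule cfun_comp[OF D(7) f])
  then show "(LINT x|push_forward X al g (mix_measure t mu nu). f x)
    = (LINT x|mix_measure t (push_forward X al g mu) (push_forward X al g nu). f x)"
   using m mm t pf[OF m(1)] pf[OF m(2)] integral_push_forward_cfun[OF D(2,3) _ D(7) D(3) f]
   by (simp add: integral_mix_cfun[OF D(2,3)] f push_forward_def)
 qed
qed

lemma return_prob_measures:
 assumes "Hausdorff_space X" "x \<in> topspace X"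
 shows "return (borel_of X) x \<in> prob_measures X"
proof -
 interpret prob_space "return (borel_of X) x" using assms by (intro prob_space_return) simp
 have cx: "compactin X {x}" using assms by simp
 have xs: "{x} \<in> sets (borel_of X)" using compactin_imp_closedin[OF assms(1) cx] by auto
 have "\<exists>C\<subseteq>A. compactin X C \<and> measure (return (borel_of X) x) (A - C) < e"
  if A: "A \<in> sets (borel_of X)" and e: "0 < e" for A e
 proof (cases "x \<in> A")
  case True
  have "measure (return (borel_of X) x) (A - {x}) = 0" using A xs by (subst measure_return) auto
  then show ?thesis using True e cx by (intro exI[of _ "{x}"]) auto
 next
  case False
  then have "measure (return (borel_of X) x) (A - {}) = 0" using A by (subst measure_return) auto
  then show ?thesis using e by (intro exI[of _ "{}"]) auto
 qed
 then show ?thesis using prob_space_axioms by (simp add: prob_measures_def)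
qed

lemma integral_return_cfun: "x \<in> topspace X ==> f \<in> cfun X ==> (LINT y|return (borel_of X) x. f y) = f x"
 by (rule integral_return) (auto intro: cfun_measurable)

lemma push_forward_return:
 assumes "G_system X al" "x \<in> topspace X"
 shows "push_forward X al g (return (borel_of X) x) = return (borel_of X) (al g x)"
proof -
 note D = G_system_D[OF assms(1)]
 have "al g \<in> borel_of X \<rightarrow>\<^sub>M borel_of X"
  using push_forward_prob(3)[OF D(2,3) return_prob_measures[OF D(3) assms(2)] D(7) D(3)]
  by (simp cong: measurable_cong_sets)
 then show ?thesis unfolding push_forward_def using assms(2) by (intro distr_return) auto
qed

lemma return_inj:
 assumes "compact_space X" "Hausdorff_space X" "x \<in> topspace X" "y \<in> topspace X"
  "return (borel_of X) x = return (borel_of X) y"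
 shows "x = y"
proof (rule ccontr)
 assume ne: "x \<noteq> y"
 have "{x} \<in> sets (borel_of X)" using compactin_imp_closedin[OF assms(2), of "{x}"] assms(3) by auto
 then have "measure (return (borel_of X) x) {x} = 1" "measure (return (borel_of X) y) {x} = 0"
  using ne by (simp_all add: measure_return)
 then show False using assms(5) by simp
qed

section \<open>The Markov--Kakutani theorem and the stabilizer of a boundary point\<close>

text \<open>The common ground of the three uses of the fixed point theorem: locally convex spaces,
  the pointwise topology on functionals, and \<open>weak_star\<close>.\<close>

definition tvs :: "'v::real_vector topology => bool" where
 "tvs T \<longleftrightarrow> topspace T = UNIV \<and> Hausdorff_space T
   \<and> continuous_map (prod_topology T T) T (%(x, y). x + y)
   \<and> continuous_map (prod_topology euclideanreal T) T (%(r, x). r *\<^sub>R x)"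

lemma locally_convex_tvs: "locally_convex_topology T ==> tvs T"
 by (simp add: locally_convex_topology_def tvs_def)

context
 fixes T :: "'v::real_vector topology"
 assumes T: "tvs T"
begin

lemma tvs_topspace: "topspace T = UNIV" and tvs_Hausdorff: "Hausdorff_space T"
 using T by (auto simp: tvs_def)

lemma tvs_add:
 assumes "continuous_map Z T f" "continuous_map Z T g"
 shows "continuous_map Z T (%z. f z + g z)"
proof -
 have "continuous_map Z (prod_topology T T) (%z. (f z, g z))" using assms by (rule continuous_map_pairedI)
 moreover have "continuous_map (prod_topology T T) T (%(x, y). x + y)" using T by (simp add: tvs_def)
 ultimately have "continuous_map Z T ((%(x, y). x + y) \<circ> (%z. (f z, g z)))" by (rule continuous_map_compose)
 then show ?thesis by (simp add: comp_def)
qed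

lemma tvs_scaleR:
 assumes "continuous_map Z euclideanreal r" "continuous_map Z T g"
 shows "continuous_map Z T (%z. r z *\<^sub>R g z)"
proof -
 have "continuous_map Z (prod_topology euclideanreal T) (%z. (r z, g z))" using assms by (rule continuous_map_pairedI)
 moreover have "continuous_map (prod_topology euclideanreal T) T (%(r, x). r *\<^sub>R x)" using T by (simp add: tvs_def)
 ultimately have "continuous_map Z T ((%(r, x). r *\<^sub>R x) \<circ> (%z. (r z, g z)))" by (rule continuous_map_compose)
 then show ?thesis by (simp add: comp_def)
qed

lemma tvs_diff:
 assumes "continuous_map Z T f" "continuous_map Z T g"
 shows "continuous_map Z T (%z. f z - g z)"
proof -
 have "continuous_map Z T (%z. f z + (- 1) *\<^sub>R g z)" by (intro tvs_add tvs_scaleR assms) auto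
 then show ?thesis by simp
qed

text \<open>Compact sets are bounded: scalar multiplication sends {0} \<times> K to 0, and the tube
  lemma gives a whole interval of scalars that send K into U.\<close>

lemma tvs_absorb_compact:
 assumes K: "compactin T K" and U: "openin T U" "0 \<in> U"
 shows "\<exists>n. \<forall>x\<in>K. (1 / real (Suc n)) *\<^sub>R x \<in> U"
proof -
 let ?W = "{p \<in> topspace (prod_topology euclideanreal T). fst p *\<^sub>R snd p \<in> U}"
 have "continuous_map (prod_topology euclideanreal T) T (%p. fst p *\<^sub>R snd p)"
  by (intro tvs_scaleR continuous_map_fst continuous_map_snd)
 then have W: "openin (prod_topology euclideanreal T) ?W" using U(1) by (rule openin_continuous_map_preimage)
 have "{0} \<times> K \<subseteq> ?W" using U(2) tvs_topspace by auto
 then obtain I V where IV: "openin euclideanreal I" "0 \<in> I" "K \<subseteq> V" "I \<times> V \<subseteq> ?W"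
  using tube_lemma_right[OF W K, of 0] by auto
 obtain e where e: "e > 0" "ball 0 e \<subseteq> I" using IV(1,2) by (auto simp: open_contains_ball)
 obtain n where "1 / real (Suc n) < e" using nat_approx_posE[OF e(1)] by blast
 then have "1 / real (Suc n) \<in> I" using e(2) by (auto simp: subset_eq)
 then have "(1 / real (Suc n), x) \<in> ?W" if "x \<in> K" for x using IV(3,4) that by blast
 then show ?thesis by (intro exI[of _ n]) simp
qed

definition affine_on :: "'v set => ('v => 'v) => bool" where
 "affine_on Q f \<longleftrightarrow> (\<forall>t\<in>{0..1}. \<forall>x\<in>Q. \<forall>y\<in>Q. f ((1 - t) *\<^sub>R x + t *\<^sub>R y) = (1 - t) *\<^sub>R f x + t *\<^sub>R f y)"

text \<open>The average \<open>a\<close> of x, f x, ..., f^m x satisfies f a - a = (f^(m+1) x - x) /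
  (m + 1). If f had no fixed point, the image of f - id would be compact and avoid 0, whereas the
  differences Q - Q are bounded and such quotients enter every neighbourhood of 0.\<close>

lemma markov_kakutani_single:
 assumes Q: "compactin T Q" "convex Q" "Q \<noteq> {}"
  and f: "f ` Q \<subseteq> Q" "continuous_map (subtopology T Q) T f" "affine_on Q f"
 shows "\<exists>x\<in>Q. f x = x"
proof (rule ccontr)
 assume no: "\<not> (\<exists>x\<in>Q. f x = x)"
 obtain x where x: "x \<in> Q" using Q(3) by blast
 define D where "D = (%y. f y - y)"
 have cD: "continuous_map (subtopology T Q) T D"
  unfolding D_def by (intro tvs_diff f(2)) (simp add: continuous_map_from_subtopology)
 have "compactin (subtopology T Q) Q" using Q(1) by (simp add: compactin_subtopology)
 then have "compactin T (D ` Q)" using cD by (rule image_compactin)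
 then have cl: "closedin T (D ` Q)" using compactin_imp_closedin[OF tvs_Hausdorff] by blast
 have U: "openin T (UNIV - D ` Q)" using cl by (simp add: closedin_def tvs_topspace)
 have "0 \<notin> D ` Q" using no by (auto simp: D_def)
 then have U0: "0 \<in> UNIV - D ` Q" by blast
 have "compactin (prod_topology (subtopology T Q) (subtopology T Q)) (Q \<times> Q)"
  using Q(1) by (simp add: compactin_Times compactin_subtopology)
 moreover have "continuous_map (prod_topology (subtopology T Q) (subtopology T Q)) T (%p. fst p - snd p)"
  using continuous_map_in_subtopology[of "prod_topology (subtopology T Q) (subtopology T Q)" T Q fst]
   continuous_map_in_subtopology[of "prod_topology (subtopology T Q) (subtopology T Q)" T Q snd]
   continuous_map_fst[of "subtopology T Q" "subtopology T Q"] continuous_map_snd[of "subtopology T Q" "subtopology T Q"]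
  by (intro tvs_diff) auto
 ultimately have "compactin T ((%p. fst p - snd p) ` (Q \<times> Q))" by (rule image_compactin)
 then obtain n where n: "\<And>d. d \<in> (%p. fst p - snd p) ` (Q \<times> Q) ==> (1 / real (Suc n)) *\<^sub>R d \<in> UNIV - D ` Q"
  using tvs_absorb_compact[OF _ U U0] by blast
 have it: "(f ^^ k) x \<in> Q" for k by (induction k) (use x f(1) in auto)
 have "\<exists>a\<in>Q. D a = (1 / real (Suc m)) *\<^sub>R ((f ^^ Suc m) x - x)" for m
 proof (induction m)
  case 0
  show ?case using x by (intro bexI[of _ x]) (auto simp: D_def)
 next
  case (Suc m)
  then obtain a where a: "a \<in> Q" "D a = (1 / real (Suc m)) *\<^sub>R ((f ^^ Suc m) x - x)" by blast
  \<comment> \<open>The weight that turns an average of m + 1 orbit points into the average of m +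
    2.\<close>
  define t where "t = 1 / real (Suc (Suc m))"
  define y where "y = (f ^^ Suc m) x"
  have t: "t \<in> {0..1}" "(1 - t) * (1 / real (Suc m)) = t" by (auto simp: t_def field_simps)
  have y: "y \<in> Q" "f y = (f ^^ Suc (Suc m)) x" using it[of "Suc m"] by (auto simp: y_def)
  let ?b = "(1 - t) *\<^sub>R a + t *\<^sub>R y"
  have b: "?b \<in> Q" using convexD_alt[OF Q(2) a(1) y(1), of t] t(1) by auto
  have "f ?b = (1 - t) *\<^sub>R f a + t *\<^sub>R f y" using f(3) t(1) a(1) y(1) by (auto simp: affine_on_def)
  then have "D ?b = (1 - t) *\<^sub>R D a + t *\<^sub>R f y - t *\<^sub>R y" by (simp add: D_def algebra_simps)
  also have "(1 - t) *\<^sub>R D a = t *\<^sub>R (y - x)" unfolding a(2) scaleR_scaleR t(2) y_def ..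
  finally have "D ?b = t *\<^sub>R (f y - x)" by (simp add: algebra_simps)
  then show ?case using b y(2) unfolding t_def by metis
 qed
 then obtain a where a: "a \<in> Q" "D a = (1 / real (Suc n)) *\<^sub>R ((f ^^ Suc n) x - x)" by blast
 have "(f ^^ Suc n) x - x \<in> (%p. fst p - snd p) ` (Q \<times> Q)"
  using it[of "Suc n"] x by (intro image_eqI[of _ _ "((f ^^ Suc n) x, x)"]) auto
 from n[OF this] a show False by (metis Diff_iff imageI)
qed

text \<open>Commutativity makes the fixed point set of finitely many maps invariant under one more,
  so finite families are settled by induction from the single map; compactness passes to the whole
  family by the finite intersection property.\<close>

lemma markov_kakutani:
 assumes Q: "compactin T Q" "convex Q" "Q \<noteq> {}"
  and f: "\<And>f. f \<in> \<F> ==> f ` Q \<subseteq> Q" "\<And>f. f \<in> \<F> ==> continuous_map (subtopology T Q) T f" "\<And>f. f \<in> \<F> ==> affine_on Q f"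
  and comm: "\<And>f g x. f \<in> \<F> ==> g \<in> \<F> ==> x \<in> Q ==> f (g x) = g (f x)"
 defines "Fix \<equiv> %F. {x \<in> Q. \<forall>f\<in>F. f x = x}"
 shows "Fix \<F> \<noteq> {}" "compactin T (Fix \<F>)" "convex (Fix \<F>)"
proof -
 have Qc: "closedin T Q" using compactin_imp_closedin[OF tvs_Hausdorff Q(1)] .
 have cl1: "closedin T {x \<in> Q. f x = x}" if "f \<in> \<F>" for f
 proof -
  have "closedin (subtopology T Q) {x \<in> topspace (subtopology T Q). f x = x}"
   by (rule closedin_continuous_maps_eq[OF tvs_Hausdorff f(2)[OF that]])
    (simp add: continuous_map_from_subtopology)
  then show ?thesis using Qc closedin_trans_full by (auto simp: tvs_topspace)
 qed
 have cl: "closedin T (Fix F)" if "F \<subseteq> \<F>" for F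
 proof (cases "F = {}")
  case False
  have "Fix F = (\<Inter>f\<in>F. {x \<in> Q. f x = x})" using False by (auto simp: Fix_def)
  then show ?thesis using cl1 that False by (metis (no_types, lifting) closedin_INT subset_iff)
 qed (simp add: Fix_def Qc)
 have cp: "compactin T (Fix F)" if "F \<subseteq> \<F>" for F
  using closed_compactin[OF Q(1) _ cl[OF that]] by (auto simp: Fix_def)
 have cv: "convex (Fix F)" if "F \<subseteq> \<F>" for F
  unfolding convex_alt
 proof (intro ballI allI impI)
  fix x y and t :: real assume x: "x \<in> Fix F" "y \<in> Fix F" "0 \<le> t \<and> t \<le> 1"
  then have "f ((1 - t) *\<^sub>R x + t *\<^sub>R y) = (1 - t) *\<^sub>R x + t *\<^sub>R y" if "f \<in> F" for f
   using f(3)[of f] that \<open>F \<subseteq> \<F>\<close> by (auto simp: Fix_def affine_on_def subset_eq)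
  then show "(1 - t) *\<^sub>R x + t *\<^sub>R y \<in> Fix F"
   using x convexD_alt[OF Q(2), of x y t] by (auto simp: Fix_def)
 qed
 show "compactin T (Fix \<F>)" "convex (Fix \<F>)" using cp cv by auto
 have ne: "Fix F \<noteq> {}" if "finite F" "F \<subseteq> \<F>" for F
  using that
 proof induction
  case (insert g F)
  then have F: "F \<subseteq> \<F>" "g \<in> \<F>" by auto
  have "\<exists>x\<in>Fix F. g x = x"
  proof (rule markov_kakutani_single[OF cp[OF F(1)] cv[OF F(1)]])
   show "Fix F \<noteq> {}" using insert by auto
   show "g ` Fix F \<subseteq> Fix F"
   proof
    fix y assume "y \<in> g ` Fix F"
    then obtain x where x: "x \<in> Q" "\<And>f. f \<in> F ==> f x = x" "y = g x" by (auto simp: Fix_def)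
    have "f y = y" if "f \<in> F" for f
     using comm[of f g x] x F that by (metis subset_iff)
    then show "y \<in> Fix F" using f(1)[OF F(2)] x by (auto simp: Fix_def)
   qed
   have "Fix F \<subseteq> Q" by (auto simp: Fix_def)
   then show "continuous_map (subtopology T (Fix F)) T g"
    using continuous_map_from_subtopology_mono[OF f(2)[OF F(2)]] by blast
   show "affine_on (Fix F) g" using f(3)[OF F(2)] by (auto simp: affine_on_def Fix_def)
  qed
  then show ?case by (auto simp: Fix_def)
 qed (use Q(3) in \<open>auto simp: Fix_def\<close>)
 have "Q \<inter> \<Inter>\<F>' \<noteq> {}" if fin: "finite \<F>'" "\<F>' \<subseteq> (%f. {x \<in> Q. f x = x}) ` \<F>" for \<F>'
 proof -
  obtain F where F: "finite F" "F \<subseteq> \<F>" "\<F>' = (%f. {x \<in> Q. f x = x}) ` F" using finite_subset_image[OF fin] by blast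
  obtain x where "x \<in> Fix F" using ne[OF F(1,2)] by blast
  then show ?thesis using F(3) by (auto simp: Fix_def)
 qed
 then have "Q \<inter> \<Inter>((%f. {x \<in> Q. f x = x}) ` \<F>) \<noteq> {}"
  using Q(1) cl1 unfolding compactin_fip by (metis (no_types, lifting) imageE)
 then show "Fix \<F> \<noteq> {}" by (auto simp: Fix_def)
qed

end

text \<open>The parabolic one-parameter group fixing the boundary point 1.\<close>

definition horo :: "real => moebius" where
 "horo s = mob (1 + \<i> * of_real s, \<i> * of_real s)"

text \<open>When a^2 - c^2 = 1, an element of the group fixing both 1 and - 1. These elements
  commute with each other.\<close>

definition hyper :: "real => real => moebius" where
 "hyper a c = mob (of_real a, of_real c)"

lemma horo_SU11: "(1 + \<i> * of_real s, \<i> * of_real s) \<in> SU11"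
 by (simp add: SU11_def algebra_simps)

lemma hyper_SU11: "a\<^sup>2 - c\<^sup>2 = 1 ==> (of_real a, of_real c) \<in> SU11"
 by (simp add: SU11_norm)

lemma horo_mult: "horo s * horo t = horo (s + t)"
 unfolding horo_def mob_mult[OF horo_SU11 horo_SU11, symmetric]
 by (simp add: SU11_mult_def algebra_simps)

lemma hyper_commute: "a\<^sup>2 - c\<^sup>2 = 1 ==> a'\<^sup>2 - c'\<^sup>2 = 1 ==> hyper a c * hyper a' c' = hyper a' c' * hyper a c"
 unfolding hyper_def by (simp add: hyper_SU11 SU11_mult_def algebra_simps flip: mob_mult)

text \<open>Hyperbolic elements normalise the parabolic group: conjugation rescales its parameter,
  because a + c and a - c are inverse to each other.\<close>

lemma hyper_horo:
 assumes "a\<^sup>2 - c\<^sup>2 = 1"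
 shows "horo (t * (a + c)) * hyper a c = hyper a c * horo (t * (a - c))"
proof -
 have "(a + c) * (a - c) = 1" using assms by (simp add: power2_eq_square algebra_simps)
 then have h: "of_real (a + c) * of_real (a - c) = (1 :: complex)" by (metis of_real_1 of_real_mult)
 have 1: "\<i> * of_real t * (of_real a + of_real c) * (of_real a - of_real c) = \<i> * (of_real t :: complex)"
  using h by (simp add: mult.assoc)
 show ?thesis
  unfolding hyper_def horo_def mob_mult[OF horo_SU11 hyper_SU11[OF assms], symmetric]
   mob_mult[OF hyper_SU11[OF assms] horo_SU11, symmetric] SU11_mult_def prod.case
  using 1 by (simp add: algebra_simps)
qed

text \<open>Fixing 1 says exactly that the two entries have the same imaginary part. The real parts
  then form the hyperbolic factor, and the common imaginary part gives the parabolic parameter after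
  division by a - c.\<close>

lemma stabilizer_decomp:
 assumes "ap p 1 = 1"
 obtains s a c where "a\<^sup>2 - c\<^sup>2 = 1" "p = horo s * hyper a c"
proof -
 obtain u v where uv: "(u, v) \<in> SU11" "p = mob (u, v)" using mob_surj by (metis surj_pair)
 have d: "v + cnj u \<noteq> 0" using SU11_denominator[OF uv(1), of 1] by simp
 have "(u + cnj v) / (v + cnj u) = 1" using assms by (simp add: uv apply_mob moebius_map_def)
 then have "u + cnj v = v + cnj u" using d by simp
 then have im: "Im u = Im v" by (simp add: complex_eq_iff)
 define a where "a = Re u" define c where "c = Re v"
 have n: "(norm u)\<^sup>2 = 1 + (norm v)\<^sup>2" using uv(1) SU11_norm by blast
 have ac: "a\<^sup>2 - c\<^sup>2 = 1" using n im by (simp add: cmod_power2 a_def c_def)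
 then have nz: "(a - c) \<noteq> 0" by (auto simp: power2_eq_square)
 define s where "s = Im u / (a - c)"
 have s: "s * a - s * c = Im u" using nz by (simp add: s_def diff_divide_distrib[symmetric] right_diff_distrib[symmetric])
 have "horo s * hyper a c = mob (SU11_mult (1 + \<i> * of_real s, \<i> * of_real s) (of_real a, of_real c))"
  unfolding horo_def hyper_def by (rule mob_mult[OF horo_SU11 hyper_SU11[OF ac], symmetric])
 also have "SU11_mult (1 + \<i> * of_real s, \<i> * of_real s) (of_real a, of_real c) = (u, v)"
  using s im by (simp add: SU11_mult_def complex_eq_iff a_def c_def algebra_simps)
 finally have "p = horo s * hyper a c" using uv(2) by simp
 with ac show ?thesis by (rule that)
qed

text \<open>The stabilizer of the boundary point 1 is an extension of the abelian group of hyperbolic elements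
 by the abelian group of parabolic ones, so Markov--Kakutani applies twice.\<close>

lemma stabilizer_fixed_point:
 fixes T :: "'v::real_vector topology" and act :: "moebius => 'v => 'v"
 assumes T: "tvs T" and Q: "compactin T Q" "convex Q" "Q \<noteq> {}"
  and act: "\<And>g x. x \<in> Q ==> act g x \<in> Q" "\<And>g. continuous_map (subtopology T Q) T (act g)" "\<And>g. affine_on Q (act g)"
  and comp: "\<And>g h x. x \<in> Q ==> act (g * h) x = act g (act h x)"
 shows "\<exists>x\<in>Q. \<forall>p. ap p 1 = 1 \<longrightarrow> act p x = x"
proof -
 define R where "R = {x \<in> Q. \<forall>f\<in>range (%s. act (horo s)). f x = x}"
 have c1: "f (g x) = g (f x)" if fg: "f \<in> range (%s. act (horo s))" "g \<in> range (%s. act (horo s))" "x \<in> Q" for f g x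
 proof -
  obtain s where "f = act (horo s)" using fg(1) by blast
  moreover obtain t where "g = act (horo t)" using fg(2) by blast
  ultimately show ?thesis using fg(3) comp[symmetric] by (simp add: horo_mult add.commute)
 qed
 have h: "f ` Q \<subseteq> Q" "continuous_map (subtopology T Q) T f" "affine_on Q f"
  if "f \<in> range (%s. act (horo s))" for f using that act by auto
 have "R \<noteq> {}" unfolding R_def by (rule markov_kakutani(1)[OF T Q]) (erule (2) c1 | erule h)+
 moreover have "compactin T R" unfolding R_def by (rule markov_kakutani(2)[OF T Q]) (erule (2) c1 | erule h)+
 moreover have "convex R" unfolding R_def by (rule markov_kakutani(3)[OF T Q]) (erule (2) c1 | erule h)+
 ultimately have R: "R \<noteq> {}" "compactin T R" "convex R" by blast+
 have RQ: "R \<subseteq> Q" by (auto simp: R_def)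
 let ?A = "{act (hyper a c) | a c. a\<^sup>2 - c\<^sup>2 = 1}"
 \<comment> \<open>The parabolic fixed points are permuted by the hyperbolic elements, by the
   commutation rule \<open>hyper_horo\<close>, so the second application of Markov-Kakutani can take
   place inside \<open>R\<close>.\<close>
 have inv: "act (hyper a c) x \<in> R" if ac: "a\<^sup>2 - c\<^sup>2 = 1" and x: "x \<in> R" for a c x
 proof -
  have xQ: "x \<in> Q" using x RQ by auto
  have "act (horo s) (act (hyper a c) x) = act (hyper a c) x" for s
  proof -
   have nz: "a + c \<noteq> 0" using ac by (auto simp: power2_eq_square algebra_simps add_eq_0_iff)
   define t where "t = s / (a + c)"
   have s: "s = t * (a + c)" using nz by (simp add: t_def)
   have "act (horo s) (act (hyper a c) x) = act (horo (t * (a + c)) * hyper a c) x" using comp[OF xQ] s by simp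
   also have "\<dots> = act (hyper a c) (act (horo (t * (a - c))) x)" using comp[OF xQ] by (simp add: hyper_horo[OF ac])
   also have "act (horo (t * (a - c))) x = x" using x by (auto simp: R_def)
   finally show ?thesis .
  qed
  then show ?thesis using act(1)[OF xQ] by (auto simp: R_def)
 qed
 have "{x \<in> R. \<forall>f\<in>?A. f x = x} \<noteq> {}"
 proof (rule markov_kakutani(1)[OF T R(2,3,1)])
  fix f g x assume fg: "f \<in> ?A"
  then obtain a c where f: "f = act (hyper a c)" "a\<^sup>2 - c\<^sup>2 = 1" by blast
  show "f ` R \<subseteq> R" using inv[OF f(2)] f(1) by auto
  show "continuous_map (subtopology T R) T f"
   using continuous_map_from_subtopology_mono[OF act(2) RQ] f(1) by blast
  show "affine_on R f" using act(3)[of "hyper a c"] RQ by (auto simp: f(1) affine_on_def[OF T] subset_eq)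
  assume "g \<in> ?A" and x: "x \<in> R"
  then obtain a' c' where g: "g = act (hyper a' c')" "a'\<^sup>2 - c'\<^sup>2 = 1" by blast
  show "f (g x) = g (f x)" using x RQ comp[symmetric] hyper_commute[OF f(2) g(2)] by (auto simp: f(1) g(1))
 qed
 then obtain x where x: "x \<in> R" "\<And>f. f \<in> ?A ==> f x = x" by blast
 have "act p x = x" if p: "ap p 1 = 1" for p
 proof -
  obtain s a c where d: "a\<^sup>2 - c\<^sup>2 = 1" "p = horo s * hyper a c" using stabilizer_decomp[OF p] by blast
  have "act (hyper a c) x = x" using x(2) d(1) by blast
  moreover have "act (horo s) x = x" using x(1) by (auto simp: R_def)
  ultimately show ?thesis using comp[of x] x(1) RQ by (auto simp: d(2))
 qed
 then show ?thesis using x(1) RQ by blast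
qed

text \<open>The elements g * rot ze and rot (ap g ze) send 1 to the same point, so they differ by an
  element of the stabilizer. This is what turns a stabilizer-fixed point into an equivariant map on
  the circle.\<close>

lemma rot_decomp:
 assumes "norm ze = 1"
 obtains p where "ap p 1 = 1" "g * rot ze = rot (ap g ze) * p"
proof -
 let ?p = "ginv (rot (ap g ze)) * (g * rot ze)"
 have n: "norm (ap g ze) = 1" using norm_apply_circle[OF assms] .
 have "ap ?p 1 = cnj (ap g ze) * ap g ze"
  using n assms by (simp add: apply_mult apply_rot ginv_rot)
 also have "\<dots> = 1" using n by (metis complex_norm_square mult.commute of_real_1 power_one)
 finally have "ap ?p 1 = 1" .
 then show ?thesis using that[of ?p] by simp
qed

section \<open>Measures on the circle\<close>

abbreviation circ :: "complex topology" where "circ \<equiv> top_of_set circle"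

lemma cfun_circ: "f \<in> cfun circ \<longleftrightarrow> continuous_on circle f"
 by (simp add: cfun_def)

lemma compact_circ: "compact_space circ" and Hausdorff_circ: "Hausdorff_space circ"
 by (auto simp: compact_space_subtopology Hausdorff_space_subtopology)

lemma sets_borel_circ: "sets (borel_of circ) = sets (restrict_space borel circle)"
proof
 have "U \<in> sets (restrict_space borel circle)" if U: "openin circ U" for U
 proof -
  obtain S where "open S" "U = circle \<inter> S" using U unfolding openin_open by blast
  then show ?thesis by (auto simp: sets_restrict_space)
 qed
 moreover have "sigma_algebra circle (sets (restrict_space borel circle))"
  using sets.sigma_algebra_axioms[of "restrict_space borel circle"] by (simp add: space_restrict_space)
 ultimately show "sets (borel_of circ) \<subseteq> sets (restrict_space borel circle)"
  unfolding sets_borel_of topspace_euclidean_subtopology by (intro sigma_algebra.sigma_sets_subset) auto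
 have "(%x. x) \<in> borel_measurable (borel_of circ)"
 proof (rule borel_measurableI)
  fix S :: "complex set" assume "open S"
  then have "openin circ (circle \<inter> S)" by auto
  moreover have "(%x. x) -` S \<inter> space (borel_of circ) = circle \<inter> S" by auto
  ultimately show "(%x. x) -` S \<inter> space (borel_of circ) \<in> sets (borel_of circ)" by (metis openin_borel_of)
 qed
 then have "(%x. x) -` A \<inter> space (borel_of circ) \<in> sets (borel_of circ)" if "A \<in> sets borel" for A
  using that by (rule measurable_sets)
 then show "sets (restrict_space borel circle) \<subseteq> sets (borel_of circ)"
  by (auto simp: sets_restrict_space Int_commute)
qed

lemma measurable_borel_circ: "f \<in> borel_measurable borel ==> f \<in> borel_measurable (borel_of circ)"
 using measurable_restrict_space1[of f borel borel circle] measurable_cong_sets[OF sets_borel_circ refl] by blast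

lemma borel_circ_cont:
 "continuous_on circle f ==> f \<in> borel_measurable (borel_of circ)"
 using borel_measurable_continuous_on_restrict[of circle f] measurable_cong_sets[OF sets_borel_circ refl] by blast

text \<open>A finite Borel measure on the plane is inner regular by compact sets, and a measure on
  the circle is viewed as one on the plane that lives on the circle.\<close>

lemma circle_prob_measuresI:
 assumes "prob_space mu" and S: "sets mu = sets (borel_of circ)"
 shows "mu \<in> prob_measures circ"
proof -
 interpret prob_space mu by fact
 have sp: "space mu = circle" using sets_eq_imp_space_eq[OF S] by simp
 have cs: "circle \<in> sets borel" by simp
 have id: "(%x. x) \<in> mu \<rightarrow>\<^sub>M borel"
  using measurable_borel_circ[of "%x. x"] measurable_cong_sets[OF S refl, of borel] by auto
 let ?N = "distr mu borel (%x. x)"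
 have N: "emeasure ?N A = emeasure mu (A \<inter> circle)" if "A \<in> sets borel" for A
  using emeasure_distr[OF id that] by (simp add: sp Int_def vimage_def)
 have "\<exists>C\<subseteq>A. compactin circ C \<and> measure mu (A - C) < e" if A: "A \<in> sets mu" and e: "0 < e" for A and e :: real
 proof -
  have Ac: "A \<subseteq> circle" using sets.sets_into_space[OF A] sp by simp
  have Ab: "A \<in> sets borel" using A cs by (auto simp: S sets_borel_circ sets_restrict_space)
  have "emeasure ?N A = (SUP K\<in>{K. K \<subseteq> A \<and> compact K}. emeasure ?N K)"
   by (rule inner_regular) (use Ab N[of UNIV] emeasure_space_1 sp in auto)
  moreover have NA: "emeasure ?N A = ennreal (prob A)" using N[OF Ab] Ac by (simp add: Int_absorb2 emeasure_eq_measure)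
  have "\<exists>K. K \<subseteq> A \<and> compact K \<and> prob A < prob K + e"
  proof (cases "prob A < e")
   case True
   then show ?thesis by (intro exI[of _ "{}"]) auto
  next
   case False
   have "ennreal (prob A - e) < ennreal (prob A)" using e False by (intro ennreal_lessI) (auto intro: le_less_trans[OF _ e] simp: not_less)
   then have "ennreal (prob A - e) < (SUP K\<in>{K. K \<subseteq> A \<and> compact K}. emeasure ?N K)"
    using calculation NA by simp
   then obtain K where K: "K \<subseteq> A" "compact K" "ennreal (prob A - e) < emeasure ?N K"
    unfolding less_SUP_iff by auto
   have "emeasure ?N K = ennreal (prob K)"
    using N[of K] K Ac by (simp add: Int_absorb2 emeasure_eq_measure borel_compact)
   then have "prob A - e < prob K" using K(3) False by (simp add: ennreal_less_iff)
   then show ?thesis using K by (intro exI[of _ K]) auto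
  qed
  then obtain K where K: "K \<subseteq> A" "compact K" "prob A < prob K + e" by blast
  have Ks: "K \<in> sets mu" using K(1,2) Ac by (auto simp: S sets_borel_circ sets_restrict_space borel_compact intro!: image_eqI[of _ _ K])
  have "prob (A - K) < e" using finite_measure_Diff[OF A Ks K(1)] K(3) by simp
  moreover have "compactin circ K" using K Ac by (auto simp: compactin_subtopology)
  ultimately show ?thesis using K(1) by blast
 qed
 then show ?thesis using \<open>prob_space mu\<close> S sp by (simp add: prob_measures_def)
qed

lemma prob_measures_circ: "mu \<in> prob_measures circ \<longleftrightarrow> prob_space mu \<and> sets mu = sets (borel_of circ)"
 using circle_prob_measuresI probsD by blast

lemma G_system_circ: "G_system circ ap"
 unfolding G_system_def
proof (intro conjI ballI allI)
 have "prod_topology (euclidean :: moebius topology) circ = top_of_set (UNIV \<times> circle)"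
  using prod_topology_subtopology_eu[of "UNIV :: moebius set" circle] by simp
 moreover have "continuous_on (UNIV \<times> circle) (%p. ap (fst p) (snd p))"
  by (intro continuous_intros) auto
 ultimately show "continuous_map (prod_topology euclidean circ) circ (%(g, x). ap g x)"
  by (auto simp: continuous_map_in_subtopology case_prod_beta norm_apply_circle)
 fix x assume x: "x \<in> topspace circ"
 then show "ap 1 x = x" by (simp add: apply_one)
 fix g h
 show "ap (g * h) x = ap g (ap h x)" using x by (simp add: apply_mult)
qed (auto simp: compact_circ Hausdorff_circ compact_space_subtopology Hausdorff_space_subtopology intro!: exI[of _ 1])

abbreviation push :: "moebius => complex measure => complex measure" where
 "push \<equiv> push_forward circ ap"

abbreviation probs :: "complex measure set" where "probs \<equiv> prob_measures circ"

lemma continuous_map_apply_circ: "continuous_map circ circ (ap g)"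
 using G_system_D(7)[OF G_system_circ] .

lemma push_in: "mu \<in> probs ==> push g mu \<in> probs"
 unfolding push_forward_def
 by (rule push_forward_prob(1)[OF compact_circ Hausdorff_circ _ continuous_map_apply_circ Hausdorff_circ])

lemma measurable_apply_circ: "mu \<in> probs ==> ap g \<in> mu \<rightarrow>\<^sub>M borel_of circ"
 by (rule push_forward_prob(3)[OF compact_circ Hausdorff_circ _ continuous_map_apply_circ Hausdorff_circ])

lemma integral_push:
 fixes f :: "complex => 'b::{banach, second_countable_topology}"
 assumes "mu \<in> probs" "f \<in> borel_measurable (borel_of circ)"
 shows "(LINT x|push g mu. f x) = (LINT x|mu. f (ap g x))"
 unfolding push_forward_def by (rule integral_distr[OF measurable_apply_circ[OF assms(1)] assms(2)])

lemma circle_measurable: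
 "mu \<in> probs ==> f \<in> borel_measurable (borel_of circ) ==> f \<in> borel_measurable mu"
 using measurable_cong_sets[OF probsD(3) refl] by blast

lemma circle_integrable:
 fixes f :: "complex => 'b::{banach, second_countable_topology}"
 assumes mu: "mu \<in> probs" and f: "f \<in> borel_measurable (borel_of circ)" and B: "\<And>x. norm x = 1 ==> norm (f x) \<le> B"
 shows "integrable mu f"
proof -
 interpret prob_space mu using probsD(1)[OF mu] .
 show ?thesis
  using circle_measurable[OF mu f] B probsD(2)[OF mu] by (intro integrable_const_bound[of _ B]) auto
qed

lemma circ_integrable_cont:
 fixes f :: "complex => 'b::{banach, second_countable_topology}"
 assumes mu: "mu \<in> probs" and f: "continuous_on circle f"
 shows "integrable mu f"
proof -
 have "bounded (f ` circle)" using f by (intro compact_imp_bounded compact_continuous_image) auto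
 then obtain B where "\<forall>x\<in>circle. norm (f x) \<le> B" by (auto simp: bounded_iff)
 then show ?thesis by (intro circle_integrable[OF mu borel_circ_cont[OF f], of B]) auto
qed

text \<open>Harmonic polynomials. Products leave the class on the plane, but on the circle a product
  agrees with another member, so the restrictions form the algebra of real trigonometric
  polynomials.\<close>

inductive harmpoly :: "(complex => real) => bool" where
 mono: "harmpoly (%z. Re (c * z ^ k))"
| add: "harmpoly p ==> harmpoly q ==> harmpoly (%z. p z + q z)"

text \<open>A product of real parts is half the real part of the product plus half the real part of
  the product with one factor conjugated. On the circle z^j * cnj z^k collapses to z^(j - k) when k
  \<le> j.\<close>

lemma harmpoly_mult_mono:
 "\<exists>q. harmpoly q \<and> (\<forall>z\<in>circle. Re (a * z ^ j) * Re (b * z ^ k) = q z)"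
proof -
 have *: "\<exists>q. harmpoly q \<and> (\<forall>z\<in>circle. Re (a * z ^ j) * Re (b * z ^ k) = q z)" if "k \<le> j" for a b j k
 proof -
  let ?q = "%z. Re (a * b / 2 * z ^ (j + k)) + Re (a * cnj b / 2 * z ^ (j - k))"
  have "Re (a * z ^ j) * Re (b * z ^ k) = ?q z" if z: "z \<in> circle" for z
  proof -
   have zz: "z ^ k * cnj z ^ k = 1"
    using z by (simp add: power_mult_distrib[symmetric] complex_norm_square[symmetric])
   have "z ^ j * cnj z ^ k = z ^ (j - k) * (z ^ k * cnj z ^ k)"
    using \<open>k \<le> j\<close> by (simp add: mult.assoc[symmetric] power_add[symmetric])
   then have e: "z ^ (j - k) = z ^ j * cnj z ^ k" using zz by simp
   have re: "Re x * Re y = Re (x * y) / 2 + Re (x * cnj y) / 2" for x y by (simp add: field_simps)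
   have "a * cnj b / 2 * z ^ (j - k) = a * z ^ j * cnj (b * z ^ k) / 2" unfolding e by (simp add: mult_ac)
   moreover have "a * b / 2 * z ^ (j + k) = a * z ^ j * (b * z ^ k) / 2" by (simp add: power_add mult_ac)
   ultimately show ?thesis by (simp only: re) simp
  qed
  moreover have "harmpoly ?q" by (intro harmpoly.intros)
  ultimately show ?thesis by blast
 qed
 show ?thesis
 proof (cases "k \<le> j")
  case False
  then show ?thesis using *[of j k b a] by (simp add: mult.commute)
 qed (rule *)
qed

lemma harmpoly_mult:
 assumes "harmpoly p" "harmpoly q"
 shows "\<exists>r. harmpoly r \<and> (\<forall>z\<in>circle. p z * q z = r z)"
 using assms
proof (induction p)
 case (mono a j)
 then show ?case
 proof (induction q)
  case (add q q')
  then obtain r r' where "harmpoly r" "\<forall>z\<in>circle. Re (a * z ^ j) * q z = r z" "harmpoly r'" "\<forall>z\<in>circle. Re (a * z ^ j) * q' z = r' z" by blast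
  then show ?case by (intro exI[of _ "%z. r z + r' z"]) (auto intro: harmpoly.add simp: distrib_left)
 qed (rule harmpoly_mult_mono)
next
 case (add p p')
 then obtain r r' where "harmpoly r" "\<forall>z\<in>circle. p z * q z = r z" "harmpoly r'" "\<forall>z\<in>circle. p' z * q z = r' z" by blast
 then show ?case by (intro exI[of _ "%z. r z + r' z"]) (auto intro: harmpoly.add simp: distrib_right)
qed

lemma harmpoly_continuous: "harmpoly p ==> continuous_on A p"
 by (induction rule: harmpoly.induct) (auto intro!: continuous_intros)

lemma harmpoly_dense:
 assumes "continuous_on circle f" "e > 0"
 obtains p where "harmpoly p" "\<And>z. norm z = 1 ==> \<bar>f z - p z\<bar> < e"
proof -
 interpret function_ring_on "{f. \<exists>p. harmpoly p \<and> (\<forall>z\<in>circle. f z = p z)}" circle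
 proof
  show "continuous_on circle f" if fg: "f \<in> {f. \<exists>p. harmpoly p \<and> (\<forall>z\<in>circle. f z = p z)}" for f
  proof -
   obtain p where "harmpoly p" "\<forall>z\<in>circle. f z = p z" using fg by blast
   then show ?thesis using continuous_on_cong[of circle circle f p] harmpoly_continuous by blast
  qed
  show "(%x. f x + g x) \<in> {f. \<exists>p. harmpoly p \<and> (\<forall>z\<in>circle. f z = p z)}"
   if fg: "f \<in> {f. \<exists>p. harmpoly p \<and> (\<forall>z\<in>circle. f z = p z)}" "g \<in> {f. \<exists>p. harmpoly p \<and> (\<forall>z\<in>circle. f z = p z)}" for f g
  proof -
   obtain p q where "harmpoly p" "\<forall>z\<in>circle. f z = p z" "harmpoly q" "\<forall>z\<in>circle. g z = q z" using fg by auto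
   then show ?thesis by (intro CollectI exI[of _ "%z. p z + q z"]) (auto intro: harmpoly.add)
  qed
  show "(%x. f x * g x) \<in> {f. \<exists>p. harmpoly p \<and> (\<forall>z\<in>circle. f z = p z)}"
   if fg: "f \<in> {f. \<exists>p. harmpoly p \<and> (\<forall>z\<in>circle. f z = p z)}" "g \<in> {f. \<exists>p. harmpoly p \<and> (\<forall>z\<in>circle. f z = p z)}" for f g
  proof -
   obtain p q where pq: "harmpoly p" "\<forall>z\<in>circle. f z = p z" "harmpoly q" "\<forall>z\<in>circle. g z = q z" using fg by auto
   then obtain r where "harmpoly r" "\<forall>z\<in>circle. p z * q z = r z" using harmpoly_mult by blast
   then show ?thesis using pq by (intro CollectI exI[of _ r]) auto
  qed
  show "(%_. c) \<in> {f. \<exists>p. harmpoly p \<and> (\<forall>z\<in>circle. f z = p z)}" for c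
   using harmpoly.mono[of "of_real c" 0] by (intro CollectI exI[of _ "%z. Re (of_real c * z ^ 0)"]) auto
  show "\<exists>f\<in>{f. \<exists>p. harmpoly p \<and> (\<forall>z\<in>circle. f z = p z)}. f x \<noteq> f y" if "x \<in> circle" "y \<in> circle" "x \<noteq> y" for x y
  proof (cases "Re x = Re y")
   case True
   then have "Re (- \<i> * x ^ 1) \<noteq> Re (- \<i> * y ^ 1)" using that(3) by (simp add: complex_eq_iff)
   then show ?thesis using harmpoly.mono[of "- \<i>" 1] by (intro bexI[of _ "%z. Re (- \<i> * z ^ 1)"]) auto
  next
   case False
   then show ?thesis using harmpoly.mono[of 1 1] by (intro bexI[of _ "%z. Re (1 * z ^ 1)"]) auto
  qed
 qed auto
 obtain g where "g \<in> {f. \<exists>p. harmpoly p \<and> (\<forall>z\<in>circle. f z = p z)}" "\<forall>x\<in>circle. \<bar>f x - g x\<bar> < e"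
  using Stone_Weierstrass_basic[OF assms] by blast
 then show ?thesis using that by auto
qed

lemma integral_harmpoly:
 assumes "mu \<in> probs" "nu \<in> probs" "\<And>k. (LINT z|mu. z ^ k) = (LINT z|nu. z ^ k)" "harmpoly p"
 shows "(LINT z|mu. p z) = (LINT z|nu. p z)"
 using assms(4)
proof induction
 case (mono c k)
 have "(LINT z|mu. Re (c * z ^ k)) = Re (c * (LINT z|mu. z ^ k))" if "mu \<in> probs" for mu
 proof -
  have "integrable mu (%z. c * z ^ k)" by (intro circ_integrable_cont[OF that] continuous_intros)
  then have "(LINT z|mu. Re (c * z ^ k)) = Re (LINT z|mu. c * z ^ k)" by (rule integral_Re)
  then show ?thesis by (simp only: integral_mult_right_zero)
 qed
 then show ?case using assms by simp
next
 case (add p q)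
 then show ?case
  using circ_integrable_cont[OF assms(1) harmpoly_continuous] circ_integrable_cont[OF assms(2) harmpoly_continuous]
  by simp
qed

text \<open>Moments with k \<ge> 0 suffice, because the measures are real and the real parts of c *
  z^k span a uniformly dense set of continuous functions on the circle.\<close>

lemma probs_eqI:
 assumes mu: "mu \<in> probs" and nu: "nu \<in> probs" and m: "\<And>k. (LINT z|mu. z ^ k) = (LINT z|nu. z ^ k)"
 shows "mu = nu"
proof (rule prob_measures_eqI[OF compact_circ Hausdorff_circ mu nu])
 fix f assume "f \<in> cfun circ"
 then have f: "continuous_on circle f" by (simp add: cfun_circ)
 have le: "\<bar>(LINT z|mu. f z) - (LINT z|nu. f z)\<bar> \<le> 2 * e" if e: "e > 0" for e
 proof -
  obtain p where p: "harmpoly p" "\<And>z. norm z = 1 ==> \<bar>f z - p z\<bar> < e" by (rule harmpoly_dense[OF f e]) (rule that)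
  have b: "\<bar>(LINT z|mu. f z) - (LINT z|mu. p z)\<bar> \<le> e" if mu: "mu \<in> probs" for mu
  proof -
   interpret prob_space mu using probsD(1)[OF mu] .
   have i: "integrable mu f" "integrable mu p" using circ_integrable_cont[OF mu] f harmpoly_continuous[OF p(1)] by auto
   have "\<bar>(LINT z|mu. f z) - (LINT z|mu. p z)\<bar> = \<bar>LINT z|mu. f z - p z\<bar>" using i by simp
   also have "\<dots> \<le> (LINT z|mu. \<bar>f z - p z\<bar>)" by (rule integral_abs_bound)
   also have "\<dots> \<le> (LINT z|mu. e)"
    using i p(2) probsD(2)[OF mu] by (intro integral_mono) (auto simp: less_imp_le)
   finally show ?thesis by (simp add: prob_space)
  qed
  show ?thesis using b[OF mu] b[OF nu] integral_harmpoly[OF mu nu m p(1)] by linarith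
 qed
 show "(LINT z|mu. f z) = (LINT z|nu. f z)"
 proof (rule ccontr)
  assume ne: "(LINT z|mu. f z) \<noteq> (LINT z|nu. f z)"
  then show False using le[of "\<bar>(LINT z|mu. f z) - (LINT z|nu. f z)\<bar> / 4"] by auto
 qed
qed

section \<open>Normalised arc length and integral formulas for it\<close>

definition arc :: "complex measure" where
 "arc = distr (restrict_space lborel {0..1}) (borel_of circ) (%t. cis (2 * pi * t))"

lemma measurable_cis_circ: "(%t. cis (2 * pi * t)) \<in> restrict_space lborel {0..1} \<rightarrow>\<^sub>M borel_of circ"
proof -
 have "(%t. cis (2 * pi * t)) \<in> borel \<rightarrow>\<^sub>M restrict_space borel circle"
  by (intro measurable_restrict_space2 borel_measurable_continuous_onI continuous_intros) auto
 then have "(%t. cis (2 * pi * t)) \<in> lborel \<rightarrow>\<^sub>M borel_of circ"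
  using measurable_cong_sets[OF sets_lborel sets_borel_circ] by blast
 then show ?thesis by (rule measurable_restrict_space1)
qed

lemma arc_in: "arc \<in> probs"
proof -
 have "prob_space (restrict_space lborel {0..1 :: real})" by (rule prob_spaceI) (simp add: emeasure_restrict_space space_restrict_space)
 then have "prob_space arc" unfolding arc_def by (rule prob_space.prob_space_distr[OF _ measurable_cis_circ])
 then show ?thesis by (simp add: prob_measures_circ arc_def)
qed

interpretation arc: prob_space arc using probsD(1)[OF arc_in] .

lemma sets_arc: "sets arc = sets (borel_of circ)" and space_arc: "space arc = circle"
 using probsD[OF arc_in] by auto

lemma integral_arc:
 fixes f :: "complex => 'b::euclidean_space"
 assumes f: "continuous_on circle f"
 shows "(LINT z|arc. f z) = integral {0..1} (%t. f (cis (2 * pi * t)))"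
proof -
 have c: "continuous_on {0..1} (%t. f (cis (2 * pi * t)))"
  by (rule continuous_on_compose2[OF f]) (auto intro!: continuous_intros)
 have "(LINT z|arc. f z) = (LINT t|restrict_space lborel {0..1}. f (cis (2 * pi * t)))"
  unfolding arc_def by (rule integral_distr[OF measurable_cis_circ borel_circ_cont[OF f]])
 also have "\<dots> = (LINT t:{0..1}|lborel. f (cis (2 * pi * t)))"
  unfolding set_lebesgue_integral_def by (rule integral_restrict_space) simp
 also have "\<dots> = integral {0..1} (%t. f (cis (2 * pi * t)))"
  using borel_integrable_atLeastAtMost'[OF c] by (rule set_borel_integral_eq_integral(2))
 finally show ?thesis .
qed

text \<open>The Cauchy formula on the unit circle with the curve element written as 2 * pi * \<i> *
  x dt; this is the source of the extra factor x in the integrand.\<close>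

lemma cauchy_arc:
 assumes f: "continuous_on (cball 0 1) f" "f holomorphic_on disk" and z: "norm z < 1"
 shows "(LINT x|arc. f x * x / (x - z)) = f z"
proof -
 have nz: "x - z \<noteq> 0" if "norm x = 1" for x using that z by auto
 have c: "continuous_on circle (%x. f x * x / (x - z))"
  using nz by (intro continuous_intros continuous_on_subset[OF f(1)]) auto
 let ?c = "2 * of_real pi * \<i> :: complex"
 have "((%u. f u / (u - z)) has_contour_integral (2 * of_real pi * \<i> * f z)) (circlepath 0 1)"
  using f z by (intro Cauchy_integral_circlepath) auto
 then have "((%t. f (circlepath 0 1 t) / (circlepath 0 1 t - z) * vector_derivative (circlepath 0 1) (at t within {0..1}))
   has_integral (2 * of_real pi * \<i> * f z)) {0..1}" by (simp add: has_contour_integral_def)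
 moreover have "f (circlepath 0 1 t) / (circlepath 0 1 t - z) * vector_derivative (circlepath 0 1) (at t within {0..1})
   = (2 * of_real pi * \<i>) * (f (cis (2 * pi * t)) * cis (2 * pi * t) / (cis (2 * pi * t) - z))" if "t \<in> {0..1}" for t
 proof -
  have "circlepath 0 1 t = cis (2 * pi * t)" by (simp add: circlepath cis_conv_exp mult_ac)
  moreover have "vector_derivative (circlepath 0 1) (at t within {0..1}) = 2 * of_real pi * \<i> * cis (2 * pi * t)"
   using that by (simp add: vector_derivative_circlepath01 cis_conv_exp mult_ac)
  ultimately show ?thesis by simp
 qed
 ultimately have "((%t. ?c * (f (cis (2 * pi * t)) * cis (2 * pi * t) / (cis (2 * pi * t) - z)))
   has_integral (?c * f z)) {0..1}" by (rule has_integral_eq[rotated])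
 from has_integral_mult_right[OF this, of "1 / ?c"]
 have "((%t. f (cis (2 * pi * t)) * cis (2 * pi * t) / (cis (2 * pi * t) - z)) has_integral f z) {0..1}"
  by (simp only: mult.assoc[symmetric]) simp
 then show ?thesis unfolding integral_arc[OF c] by (rule integral_unique)
qed

lemma mean_value_arc:
 assumes "continuous_on (cball 0 1) f" "f holomorphic_on disk"
 shows "(LINT x|arc. f x) = f 0"
proof -
 have "(LINT x|arc. f x * x / (x - 0)) = (LINT x|arc. f x)"
  by (rule Bochner_Integration.integral_cong) (auto simp: space_arc)
 then show ?thesis using cauchy_arc[OF assms, of 0] by simp
qed

lemma apply_holomorphic: "continuous_on (cball 0 1) (ap g)" "ap g holomorphic_on disk"
proof -
 show "continuous_on (cball 0 1) (ap g)" by (intro continuous_intros) auto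
 have "(%z. rotp g * (z + shiftp g) / (1 + cnj (shiftp g) * z)) holomorphic_on disk"
  by (intro holomorphic_intros denominator_nonzero) auto
 then show "ap g holomorphic_on disk"
  by (rule holomorphic_transform) (simp add: apply_coords)
qed

lemma moment_push_arc: "(LINT z|push g arc. z ^ k) = ap g 0 ^ k"
proof -
 have "(LINT z|push g arc. z ^ k) = (LINT z|arc. ap g z ^ k)"
  by (rule integral_push[OF arc_in]) (intro borel_circ_cont continuous_intros)
 also have "\<dots> = ap g 0 ^ k"
  by (rule mean_value_arc) (intro continuous_intros holomorphic_intros apply_holomorphic)+
 finally show ?thesis .
qed

lemma moment_arc: "(LINT z|arc. z ^ k) = 0 ^ k"
 by (rule mean_value_arc) (intro continuous_intros holomorphic_intros)+

lemma push_rot_moment: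
 assumes "mu \<in> probs" "norm om = 1"
 shows "(LINT z|push (rot om) mu. z ^ k) = om ^ k * (LINT z|mu. z ^ k)"
proof -
 have "(LINT z|push (rot om) mu. z ^ k) = (LINT z|mu. ap (rot om) z ^ k)"
  by (rule integral_push[OF assms(1)]) (intro borel_circ_cont continuous_intros)
 also have "\<dots> = (LINT z|mu. om ^ k * z ^ k)"
  using probsD(2)[OF assms(1)] assms(2)
  by (intro Bochner_Integration.integral_cong) (auto simp: apply_rot power_mult_distrib)
 finally show ?thesis by simp
qed

text \<open>Rotation by the angle pi / k changes the sign of the k-th moment, so invariance makes
  every moment of positive order vanish, and moments determine the measure.\<close>

lemma rotation_invariant_arc:
 assumes mu: "mu \<in> probs" and inv: "\<And>om. norm om = 1 ==> push (rot om) mu = mu"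
 shows "mu = arc"
proof (rule probs_eqI[OF mu arc_in])
 interpret prob_space mu using probsD(1)[OF mu] .
 fix k show "(LINT z|mu. z ^ k) = (LINT z|arc. z ^ k)"
 proof (cases "k = 0")
  case False
  let ?w = "cis (pi / real k)"
  have "real k * (pi / real k) = pi" using False by simp
  then have "?w ^ k = - 1" by (simp only: Complex.DeMoivre cis_pi)
  then have "(LINT z|mu. z ^ k) = - (LINT z|mu. z ^ k)"
   using push_rot_moment[OF mu, of ?w k] inv[of ?w] by simp
  then have "(LINT z|mu. z ^ k) = 0" by (simp add: complex_eq_iff)
  then show ?thesis using False by (simp add: moment_arc)
 qed (simp add: prob_space arc.prob_space)
qed

lemma push_rot_arc: "norm om = 1 ==> push (rot om) arc = arc"
 by (rule probs_eqI[OF push_in[OF arc_in] arc_in])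
  (simp add: push_rot_moment[OF arc_in] moment_arc power_0_left)

section \<open>The Poisson kernel as the density of a pushed-forward arc measure\<close>

definition poisson :: "complex => complex => real" where
 "poisson z ze = (1 - (norm z)\<^sup>2) / (norm (ze - z))\<^sup>2"

lemma poisson_nonneg: "norm z < 1 ==> 0 \<le> poisson z ze"
 by (simp add: poisson_def abs_square_le_1)

text \<open>The first summand is a Cauchy kernel divided by the curve element, the second is
  holomorphic in ze and vanishes at 0. Integrated against a power, one gives z^k and the other
  nothing.\<close>

lemma poisson_split:
 assumes "norm z < 1" "norm ze = 1"
 shows "of_real (poisson z ze) = ze / (ze - z) + cnj z * ze / (1 - cnj z * ze)"
proof -
 have nz: "ze - z \<noteq> 0" "cnj ze - cnj z \<noteq> 0" "ze \<noteq> 0" using assms by auto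
 have zz: "ze * cnj ze = 1" using assms by (simp add: complex_norm_square[symmetric])
 have d: "1 - cnj z * ze = ze * (cnj ze - cnj z)" using zz by (simp add: algebra_simps)
 have "ze / (ze - z) + cnj z * ze / (1 - cnj z * ze) = ze / (ze - z) + cnj z / (cnj ze - cnj z)"
  unfolding d using nz by simp
 also have "\<dots> = (ze * (cnj ze - cnj z) + cnj z * (ze - z)) / ((ze - z) * (cnj ze - cnj z))"
  using nz by (simp add: add_frac_eq mult.commute)
 also have "ze * (cnj ze - cnj z) + cnj z * (ze - z) = 1 - z * cnj z" using zz by (simp add: algebra_simps)
 also have "1 - z * cnj z = of_real (1 - (norm z)\<^sup>2)" unfolding complex_norm_square[symmetric] by simp
 also have "(ze - z) * (cnj ze - cnj z) = of_real ((norm (ze - z))\<^sup>2)"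
  using complex_norm_square[of "ze - z"] by simp
 finally show ?thesis by (simp add: poisson_def)
qed

lemma poisson_continuous: "norm z < 1 ==> continuous_on circle (poisson z)"
 unfolding poisson_def by (intro continuous_intros) auto

lemma moment_poisson:
 assumes z: "norm z < 1"
 shows "(LINT x|arc. of_real (poisson z x) * x ^ k) = z ^ k"
proof -
 have nz: "1 - cnj z * x \<noteq> 0" if "norm x \<le> 1" for x
  using denominator_nonzero[of "- cnj z" x] z that by simp
 have nz': "x - z \<noteq> 0" if "norm x = 1" for x using that z by auto
 have c1: "continuous_on circle (%x. x ^ k * x / (x - z))" using nz' by (intro continuous_intros) auto
 have c2: "continuous_on (cball 0 1) (%x. cnj z * x ^ Suc k / (1 - cnj z * x))" using nz by (intro continuous_intros) auto
 have "(LINT x|arc. of_real (poisson z x) * x ^ k) = (LINT x|arc. x ^ k * x / (x - z) + cnj z * x ^ Suc k / (1 - cnj z * x))"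
  by (rule Bochner_Integration.integral_cong) (auto simp: space_arc poisson_split z distrib_right distrib_left mult_ac)
 also have "\<dots> = (LINT x|arc. x ^ k * x / (x - z)) + (LINT x|arc. cnj z * x ^ Suc k / (1 - cnj z * x))"
  using c1 continuous_on_subset[OF c2, of circle]
  by (intro Bochner_Integration.integral_add circ_integrable_cont[OF arc_in]) auto
 also have "(LINT x|arc. x ^ k * x / (x - z)) = z ^ k"
  by (rule cauchy_arc[OF _ _ z]) (intro continuous_intros holomorphic_intros)+
 also have "(LINT x|arc. cnj z * x ^ Suc k / (1 - cnj z * x)) = 0"
  using mean_value_arc[OF c2] nz by (force intro!: holomorphic_intros)
 finally show ?thesis by simp
qed

text \<open>Both measures have k-th moment g(0)^k, one by the mean value property of the holomorphic
  function (ap g)^k, the other by the Cauchy formula.\<close>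

lemma push_arc_density:
 "push g arc = density arc (%x. ennreal (poisson (ap g 0) x))"
proof -
 let ?z = "ap g 0" let ?D = "density arc (%x. ennreal (poisson ?z x))"
 have m: "poisson ?z \<in> borel_measurable arc"
  by (intro circle_measurable[OF arc_in] borel_circ_cont poisson_continuous) simp
 have mom: "(LINT x|?D. x ^ k) = ?z ^ k" for k
 proof -
  have "(LINT x|?D. x ^ k) = (LINT x|arc. poisson ?z x *\<^sub>R x ^ k)"
   by (rule integral_density[OF circle_measurable[OF arc_in] m])
    (auto intro!: borel_circ_cont continuous_intros simp: poisson_nonneg)
  then show ?thesis using moment_poisson[of ?z k] by (simp add: scaleR_conv_of_real)
 qed
 have "integrable arc (poisson ?z)" by (intro circ_integrable_cont[OF arc_in] poisson_continuous) simp
 moreover have "(LINT x|arc. poisson ?z x) = 1"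
 proof -
  have "complex_of_real (LINT x|arc. poisson ?z x) = (LINT x|arc. complex_of_real (poisson ?z x))" by simp
  also have "\<dots> = 1" using moment_poisson[of ?z 0] by simp
  finally show ?thesis by (metis of_real_eq_1_iff)
 qed
 ultimately have "(\<integral>\<^sup>+x. ennreal (poisson ?z x) \<partial>arc) = 1"
  by (subst nn_integral_eq_integral) (auto simp: poisson_nonneg)
 then have "prob_space ?D" using m by (intro prob_spaceI) (simp add: emeasure_density cong: nn_integral_cong)
 then have D: "?D \<in> probs" by (simp add: prob_measures_circ sets_arc)
 show ?thesis
  by (rule probs_eqI[OF push_in[OF arc_in] D]) (simp add: moment_push_arc mom)
qed

section \<open>Irreducibility of the space of measures on the circle\<close>

definition angle :: "complex => real" where
 "angle z = (if 0 \<le> Im z then arccos (Re z) else - arccos (Re z))"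

lemma cis_angle: assumes "norm z = 1" shows "cis (angle z) = z"
proof -
 have b: "\<bar>Re z\<bar> \<le> 1" using assms abs_Re_le_cmod[of z] by simp
 have n: "(Re z)\<^sup>2 + (Im z)\<^sup>2 = 1" using assms by (simp add: cmod_power2[symmetric])
 have "sin (arccos (Re z)) = sqrt (1 - (Re z)\<^sup>2)" using b by (simp add: sin_arccos_abs)
 also have "1 - (Re z)\<^sup>2 = (Im z)\<^sup>2" using n by simp
 finally have s: "sin (arccos (Re z)) = \<bar>Im z\<bar>" by simp
 have c: "cos (arccos (Re z)) = Re z" using b by (simp add: cos_arccos_abs)
 show ?thesis using s c by (auto simp: angle_def complex_eq_iff)
qed

lemma measurable_angle: "angle \<in> borel_measurable (borel_of circ)"
proof -
 have [measurable]: "(%z. arccos (Re z)) \<in> borel_measurable (borel_of circ)"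
 proof (intro borel_circ_cont continuous_on_arccos' continuous_intros ballI)
  fix z :: complex assume "z \<in> circle"
  then show "-1 \<le> Re z \<and> Re z \<le> 1" using abs_Re_le_cmod[of z] by (auto simp: abs_le_iff)
 qed
 have [measurable]: "Im \<in> borel_measurable (borel_of circ)" by (intro borel_circ_cont continuous_intros)
 show ?thesis unfolding angle_def by measurable
qed

lemma angle_bounded: assumes "norm z = 1" shows "\<bar>angle z\<bar> \<le> 4"
proof -
 have "-1 \<le> Re z" "Re z \<le> 1" using assms abs_Re_le_cmod[of z] by (auto simp: abs_le_iff)
 then have "0 \<le> arccos (Re z)" "arccos (Re z) \<le> pi" using arccos_lbound arccos_ubound by auto
 then show ?thesis using pi_less_4 by (auto simp: angle_def)
qed

text \<open>The angle rounded down to a multiple of 1 / (n + 1). The image is finite and the maps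
  converge pointwise to the identity, so they turn a measure into finitely supported
  approximations.\<close>

definition round_circle :: "nat => complex => complex" where
 "round_circle n z = cis (of_int \<lfloor>real (Suc n) * angle z\<rfloor> / real (Suc n))"

lemma round_circle_finite: "finite (round_circle n ` circle)"
proof -
 let ?I = "{- (4 * int (Suc n)) - 1 .. 4 * int (Suc n)}"
 have "round_circle n ` circle \<subseteq> (%k. cis (of_int k / real (Suc n))) ` ?I"
 proof
  fix w assume "w \<in> round_circle n ` circle"
  then obtain z where z: "norm z = 1" "w = round_circle n z" by auto
  have "\<bar>real (Suc n) * angle z\<bar> \<le> 4 * real (Suc n)"
   using angle_bounded[OF z(1)] by (simp add: abs_mult mult.commute del: of_nat_Suc)
  then have "- (4 * real (Suc n)) \<le> real (Suc n) * angle z" "real (Suc n) * angle z \<le> 4 * real (Suc n)"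
   by linarith+
  then have "of_int (- (4 * int (Suc n))) \<le> real (Suc n) * angle z" "real (Suc n) * angle z < of_int (4 * int (Suc n) + 1)"
   by simp_all
  then have "- (4 * int (Suc n)) \<le> \<lfloor>real (Suc n) * angle z\<rfloor>" "\<lfloor>real (Suc n) * angle z\<rfloor> < 4 * int (Suc n) + 1"
   by (simp_all only: le_floor_iff floor_less_iff)
  then have "\<lfloor>real (Suc n) * angle z\<rfloor> \<in> ?I" by simp
  then show "w \<in> (%k. cis (of_int k / real (Suc n))) ` ?I" unfolding z(2) round_circle_def by (rule imageI)
 qed
 then show ?thesis using finite_subset by blast
qed

lemma round_circle_tendsto:
 assumes "norm z = 1" shows "(%n. round_circle n z) \<longlonglongrightarrow> z"
proof -
 have "(%n. of_int \<lfloor>real (Suc n) * angle z\<rfloor> / real (Suc n)) \<longlonglongrightarrow> angle z"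
 proof (rule LIMSEQ_Suc[of "%n. of_int \<lfloor>real n * angle z\<rfloor> / real n"])
  show "(%n. of_int \<lfloor>real n * angle z\<rfloor> / real n) \<longlonglongrightarrow> angle z"
  proof (rule tendsto_sandwich[of "%n. angle z - 1 / real n" _ _ "%_. angle z"])
   have "angle z - 1 / real n \<le> of_int \<lfloor>real n * angle z\<rfloor> / real n \<and> of_int \<lfloor>real n * angle z\<rfloor> / real n \<le> angle z" if "n > 0" for n
   proof -
    have "of_int \<lfloor>real n * angle z\<rfloor> \<le> real n * angle z" "real n * angle z - 1 \<le> of_int \<lfloor>real n * angle z\<rfloor>" by linarith+
    then have "(real n * angle z - 1) / real n \<le> of_int \<lfloor>real n * angle z\<rfloor> / real n"
     "of_int \<lfloor>real n * angle z\<rfloor> / real n \<le> (real n * angle z) / real n"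
     by (intro divide_right_mono; simp)+
    then show ?thesis using that by (simp add: diff_divide_distrib)
   qed
   then show "\<forall>\<^sub>F n in sequentially. angle z - 1 / real n \<le> of_int \<lfloor>real n * angle z\<rfloor> / real n"
    "\<forall>\<^sub>F n in sequentially. of_int \<lfloor>real n * angle z\<rfloor> / real n \<le> angle z"
    by (auto intro: eventually_mono[OF eventually_gt_at_top[of 0]])
   show "(%n. angle z - 1 / real n) \<longlonglongrightarrow> angle z"
    using tendsto_diff[OF tendsto_const lim_1_over_n, of "angle z"] by simp
  qed simp
 qed
 then have "(%n. round_circle n z) \<longlonglongrightarrow> cis (angle z)"
  unfolding round_circle_def by (intro tendsto_intros isCont_tendsto_compose[of _ cis]) auto
 then show ?thesis by (simp add: cis_angle assms)
qed

lemma measurable_round_circle: "mu \<in> probs ==> round_circle n \<in> mu \<rightarrow>\<^sub>M borel_of circ"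
proof -
 assume mu: "mu \<in> probs"
 note [measurable] = measurable_angle
 have [measurable]: "cis \<in> borel_measurable borel" by (intro borel_measurable_continuous_onI continuous_intros)
 have "round_circle n \<in> borel_measurable (borel_of circ)" unfolding round_circle_def by measurable
 then have "round_circle n \<in> borel_of circ \<rightarrow>\<^sub>M restrict_space borel circle"
  by (intro measurable_restrict_space2) (auto simp: round_circle_def)
 then show ?thesis using measurable_cong_sets[OF probsD(3)[OF mu] sets_borel_circ] by blast
qed

definition mix_closed :: "complex measure set => bool" where
 "mix_closed C \<longleftrightarrow> (\<forall>t\<in>{0..1}. \<forall>mu\<in>C. \<forall>nu\<in>C. mix_measure t mu nu \<in> C)"

abbreviation dirac :: "complex => complex measure" where "dirac \<equiv> return (borel_of circ)"

lemma dirac_in: "norm z = 1 ==> dirac z \<in> probs"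
 by (rule return_prob_measures[OF Hausdorff_circ]) simp

lemma probs_measure_eqI:
 assumes mu: "mu \<in> probs" and nu: "nu \<in> probs"
  and "\<And>A. A \<in> sets (borel_of circ) ==> measure mu A = measure nu A"
 shows "mu = nu"
proof (rule measure_eqI)
 interpret mu: prob_space mu using probsD(1)[OF mu] .
 interpret nu: prob_space nu using probsD(1)[OF nu] .
 show "sets mu = sets nu" using probsD(3) mu nu by metis
 fix A assume "A \<in> sets mu"
 then show "emeasure mu A = emeasure nu A"
  using assms(3) probsD(3)[OF mu] by (simp add: mu.emeasure_eq_measure nu.emeasure_eq_measure)
qed

lemma singleton_borel_circ: "norm x = 1 ==> {x} \<in> sets (borel_of circ)"
 by (rule closedin_borel_of) (auto intro: closed_subset)

text \<open>Induction on the support: if the point x has mass t < 1, the measure is the mixture of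
  the point mass at x and the measure conditioned on the complement of x. When t = 1 there is
  nothing to condition on and the measure is the point mass.\<close>

lemma finite_support_mem:
 assumes C: "mix_closed C" "\<And>z. norm z = 1 ==> dirac z \<in> C" and F: "finite F" "F \<subseteq> circle"
 shows "mu \<in> probs ==> measure mu F = 1 ==> mu \<in> C"
 using F
proof (induction F arbitrary: mu)
 case (insert x F)
 interpret prob_space mu using probsD(1)[OF insert(4)] .
 have S[simp]: "sets mu = sets (borel_of circ)" "space mu = circle" using probsD[OF insert(4)] by auto
 have x: "norm x = 1" "F \<subseteq> circle" using insert by auto
 have xs: "{x} \<in> sets (borel_of circ)" by (rule singleton_borel_circ[OF x(1)])
 have Fs: "F \<in> sets (borel_of circ)"
 proof -
  have "(\<Union>y\<in>F. {y}) \<in> sets (borel_of circ)" using insert(1) x(2) by (intro sets.finite_UN singleton_borel_circ) auto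
  then show ?thesis by simp
 qed
 define t where "t = prob {x}"
 have t01: "t \<in> {0..1}" by (simp add: t_def)
 let ?S = "circle - {x}"
 have Ss: "?S \<in> sets (borel_of circ)" using sets.compl_sets[of "{x}" "borel_of circ"] xs by simp
 have pS: "prob ?S = 1 - t" using prob_compl[of "{x}"] xs by (simp add: t_def)
 show ?case
 proof (cases "t = 1")
  case True
  have "mu = dirac x"
  proof (rule probs_measure_eqI[OF insert(4) dirac_in[OF x(1)]])
   fix A assume A: "A \<in> sets (borel_of circ)"
   have "AE y in mu. y \<in> {x}" using True AE_prob_1[of "{x}"] by (simp add: t_def)
   then have "prob A = (if x \<in> A then 1 else 0)"
   proof -
    assume ae: "AE y in mu. y \<in> {x}"
    show ?thesis
    proof (cases "x \<in> A")
     case True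
     have "AE y in mu. y \<in> A" using ae by eventually_elim (use True in auto)
     then show ?thesis using True prob_eq_1[of A] A by simp
    next
     case False
     have "AE y in mu. y \<notin> A" using ae by eventually_elim (use False in auto)
     then show ?thesis using False prob_eq_0[of A] A by simp
    qed
   qed
   then show "prob A = measure (dirac x) A" using A by (simp add: measure_return indicator_def)
  qed
  then show ?thesis using C(2)[OF x(1)] by simp
 next
  case False
  then have t1: "t < 1" using t01 by auto
  define nu where "nu = uniform_measure mu ?S"
  have "prob_space nu" unfolding nu_def by (rule prob_space_uniform_measure) (use t1 Ss pS in \<open>auto simp: emeasure_eq_measure\<close>)
  then have nu: "nu \<in> probs" by (simp add: prob_measures_circ nu_def)
  have nuA: "measure nu A = prob (?S \<inter> A) / (1 - t)" if "A \<in> sets (borel_of circ)" for A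
   using that Ss pS t1 unfolding nu_def by (subst measure_uniform_measure) (auto simp: emeasure_eq_measure)
  have "?S \<inter> F = F" using insert(2) x(2) by auto
  moreover have "prob (insert x F) = prob {x} + prob F"
   using finite_measure_Union[of "{x}" F] xs Fs insert(2) by simp
  ultimately have "measure nu F = 1" using nuA[OF Fs] insert(5) t1 by (simp add: t_def)
  then have "nu \<in> C" using insert.IH[OF nu] x(2) by blast
  then have "mix_measure t nu (dirac x) \<in> C" using C x(1) t01 unfolding mix_closed_def by blast
  moreover have "mix_measure t nu (dirac x) = mu"
  proof (rule probs_measure_eqI[OF mix_measure(1)[OF Hausdorff_circ nu dirac_in[OF x(1)] t01] insert(4)])
   fix A assume A: "A \<in> sets (borel_of circ)"
   interpret nu: prob_space nu by fact
   interpret d: prob_space "dirac x" using probsD(1)[OF dirac_in[OF x(1)]] .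
   interpret m: prob_space "mix_measure t nu (dirac x)"
    using probsD(1)[OF mix_measure(1)[OF Hausdorff_circ nu dirac_in[OF x(1)] t01]] .
   have "measure (mix_measure t nu (dirac x)) A = (1 - t) * measure nu A + t * measure (dirac x) A"
    using mix_measure(2)[OF Hausdorff_circ nu dirac_in[OF x(1)] t01 A] t01
    by (simp add: m.emeasure_eq_measure nu.emeasure_eq_measure d.emeasure_eq_measure flip: ennreal_mult ennreal_plus)
   also have "\<dots> = prob (?S \<inter> A) + t * indicator A x" using nuA[OF A] t1 A by (simp add: measure_return)
   also have "t * indicator A x = prob ({x} \<inter> A)"
    by (cases "x \<in> A") (auto simp: t_def)
   also have "prob (?S \<inter> A) + prob ({x} \<inter> A) = prob ((?S \<inter> A) \<union> ({x} \<inter> A))"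
    using Ss xs A by (intro finite_measure_Union[symmetric]) auto
   also have "(?S \<inter> A) \<union> ({x} \<inter> A) = A" using sets.sets_into_space[OF A] by auto
   finally show "measure (mix_measure t nu (dirac x)) A = prob A" .
  qed
  ultimately show ?thesis by simp
 qed
qed simp

text \<open>Every measure is a limit of finitely supported ones. Besides irreducibility, this serves
  as a density principle: a closed convex condition need only be checked on point masses.\<close>

lemma closed_mix_closed_UNIV:
 assumes C: "closedin (prob_topology circ) C" "mix_closed C" "\<And>z. norm z = 1 ==> dirac z \<in> C"
 shows "C = probs"
proof
 show "C \<subseteq> probs" using closedin_subset[OF C(1)] by simp
 show "probs \<subseteq> C"
 proof
  fix mu assume mu: "mu \<in> probs"
  interpret prob_space mu using probsD(1)[OF mu] .
  have sp: "space mu = circle" using probsD(2)[OF mu] by simp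
  define nu where "nu n = distr mu (borel_of circ) (round_circle n)" for n
  have nu: "nu n \<in> probs" for n
   unfolding prob_measures_circ nu_def using prob_space_distr[OF measurable_round_circle[OF mu]] by simp
  have "nu n \<in> C" for n
  proof (rule finite_support_mem[OF C(2,3) round_circle_finite[of n] _ nu])
   show sub: "round_circle n ` circle \<subseteq> circle" by (auto simp: round_circle_def)
   have "finite (round_circle n ` circle)" by (rule round_circle_finite)
   then have "(\<Union>y\<in>round_circle n ` circle. {y}) \<in> sets (borel_of circ)"
    using sub by (intro sets.finite_UN singleton_borel_circ) auto
   then have "round_circle n ` circle \<in> sets (borel_of circ)" by simp
   then have "measure (nu n) (round_circle n ` circle) = prob (round_circle n -` (round_circle n ` circle) \<inter> space mu)"
    unfolding nu_def by (rule measure_distr[OF measurable_round_circle[OF mu]])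
   also have "round_circle n -` (round_circle n ` circle) \<inter> space mu = space mu" by (auto simp: sp)
   finally show "measure (nu n) (round_circle n ` circle) = 1" by (simp add: prob_space)
  qed
  moreover have "limitin (prob_topology circ) nu mu sequentially"
  proof (rule limitin_prob[OF mu nu])
   fix f assume f: "f \<in> cfun circ"
   obtain B where B: "\<And>x. x \<in> topspace circ ==> \<bar>f x\<bar> \<le> B" using cfun_bounded[OF compact_circ f] by metis
   have rc: "round_circle n x \<in> circle" for n x by (simp add: round_circle_def)
   have "(%n. LINT x|mu. f (round_circle n x)) \<longlonglongrightarrow> (LINT x|mu. f x)"
   proof (rule integral_dominated_convergence[where w = "%_. B"])
    show "f \<in> borel_measurable mu" by (rule cfun_measurable_prob[OF mu f])
    show "(%x. f (round_circle n x)) \<in> borel_measurable mu" for n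
     using measurable_compose[OF measurable_round_circle[OF mu] cfun_measurable[OF f]] .
    show "AE x in mu. (%n. f (round_circle n x)) \<longlonglongrightarrow> f x"
    proof (rule AE_I2)
     fix x assume x: "x \<in> space mu"
     have "continuous_on circle f" using f by (simp add: cfun_circ)
     then show "(%n. f (round_circle n x)) \<longlonglongrightarrow> f x"
      using x sp rc by (intro continuous_on_tendsto_compose[of circle f] round_circle_tendsto) auto
    qed
   qed (use B rc sp in auto)
   then show "(%n. LINT x|nu n. f x) \<longlonglongrightarrow> (LINT x|mu. f x)"
    unfolding nu_def by (subst integral_distr[OF measurable_round_circle[OF mu] cfun_measurable[OF f]])
  qed
  ultimately show "mu \<in> C" using limitin_closedin[OF _ C(1)] by fastforce
 qed
qed

text \<open>A probability measure has countably many atoms and the circle is uncountable. The point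
  found serves as the repelling point of the contraction.\<close>

lemma exists_null_point:
 assumes "mu \<in> probs" obtains b where "norm b = 1" "measure mu {b} = 0"
proof -
 interpret prob_space mu using probsD(1)[OF assms] .
 have "connected circle" by (rule connected_sphere) simp
 then have "uncountable circle" by (rule connected_uncountable[of _ 1 "-1"]) auto
 moreover have "countable {x. measure mu {x} \<noteq> 0}" by (rule countable_support)
 ultimately have "\<not> circle \<subseteq> {x. measure mu {x} \<noteq> 0}" using countable_subset by blast
 then show ?thesis using that by auto
qed

text \<open>Hyperbolic elements with attracting point 1 and repelling point - 1 move every other
  boundary point to 1 as their shift tends to 1. A preliminary rotation carries a point without mass
  to - 1, and dominated convergence does the rest.\<close>

lemma contract_to_dirac:
 assumes mu: "mu \<in> probs"
 obtains g where "limitin (prob_topology circ) (%n. push (g n) mu) (dirac 1) sequentially"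
proof -
 interpret prob_space mu using probsD(1)[OF mu] .
 have sp: "space mu = circle" using probsD(2)[OF mu] by simp
 obtain b where b: "norm b = 1" "prob {b} = 0" using exists_null_point[OF mu] .
 \<comment> \<open>The rotation that takes b to - 1.\<close>
 define r where "r = - cnj b"
 have r: "norm r = 1" "r * b = - 1"
  using b(1) by (simp_all add: r_def) (metis complex_norm_square mult.commute of_real_1 power_one)
 \<comment> \<open>Any sequence in [0, 1) tending to 1 would serve.\<close>
 define t where "t n = 1 - 1 / real (Suc (Suc n))" for n
 have t: "0 \<le> t n" "t n < 1" for n by (auto simp: t_def)
 have tl: "t \<longlonglongrightarrow> 1"
  unfolding t_def using tendsto_diff[OF tendsto_const LIMSEQ_Suc[OF LIMSEQ_Suc[OF lim_1_over_n]], of "1::real"] by simp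
 define g where "g n = moebius_of (1, of_real (t n)) * rot r" for n
 have ga: "ap (g n) z = (r * z + of_real (t n)) / (1 + of_real (t n) * (r * z))" if "norm z = 1" for n z
  using that t[of n] r(1) by (simp add: g_def apply_mult apply_rot apply_moebius_of norm_mult)
 have lim: "(%n. ap (g n) z) \<longlonglongrightarrow> 1" if z: "norm z = 1" "z \<noteq> b" for z
 proof -
  have "r * z \<noteq> - 1"
  proof
   assume "r * z = - 1"
   then have "r * z = r * b" using r(2) by simp
   then show False using r(1) z(2) by auto
  qed
  then have nz: "1 + of_real 1 * (r * z) \<noteq> 0" by (simp add: add_eq_0_iff)
  have "(%n. (r * z + of_real (t n)) / (1 + of_real (t n) * (r * z))) \<longlonglongrightarrow> (r * z + of_real 1) / (1 + of_real 1 * (r * z))"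
   by (intro tendsto_intros tl nz)
  also have "(r * z + of_real 1) / (1 + of_real 1 * (r * z)) = 1" using nz by (simp add: add.commute)
  finally show ?thesis using ga[OF z(1)] by simp
 qed
 have bs: "{b} \<in> sets mu" using singleton_borel_circ[OF b(1)] probsD(3)[OF mu] by simp
 have ae: "AE z in mu. z \<noteq> b" using prob_eq_0[OF bs] b(2) by simp
 have "limitin (prob_topology circ) (%n. push (g n) mu) (dirac 1) sequentially"
 proof (rule limitin_prob[OF dirac_in push_in[OF mu]])
  fix f assume f: "f \<in> cfun circ"
  obtain B where B: "\<And>x. x \<in> topspace circ ==> \<bar>f x\<bar> \<le> B" using cfun_bounded[OF compact_circ f] by metis
  have "(%n. LINT x|mu. f (ap (g n) x)) \<longlonglongrightarrow> (LINT x|mu. f 1)"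
  proof (rule integral_dominated_convergence[where w = "%_. B"])
   show "(%x. f (ap (g n) x)) \<in> borel_measurable mu" for n
    using measurable_compose[OF measurable_apply_circ[OF mu] cfun_measurable[OF f]] .
   have fc: "continuous_on circle f" using f by (simp add: cfun_circ)
   show "AE x in mu. (%n. f (ap (g n) x)) \<longlonglongrightarrow> f 1"
    using ae AE_space
   proof eventually_elim
    case (elim x)
    then show ?case using sp
     by (intro continuous_on_tendsto_compose[OF fc] lim) (auto simp: norm_apply_circle)
   qed
  qed (use B sp in \<open>auto simp: norm_apply_circle\<close>)
  then show "(%n. LINT x|push (g n) mu. f x) \<longlonglongrightarrow> (LINT x|dirac 1. f x)"
   using integral_push[OF mu cfun_measurable[OF f]] integral_return_cfun[of 1 circ f] f by (simp add: prob_space)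
 qed simp
 then show ?thesis by (rule that)
qed

lemma push_dirac: "norm z = 1 ==> push g (dirac z) = dirac (ap g z)"
 by (rule push_forward_return[OF G_system_circ]) simp

lemma circle_sys_sel: "top_of circle_measures_system = prob_topology circ" "act_of circle_measures_system = push"
 "mix_of circle_measures_system = mix_measure"
 by (simp_all add: circle_measures_system_def prob_system_def)

text \<open>The contraction puts the point mass at 1 into the set, rotations then put all point
  masses there, and a closed convex set containing them is everything.\<close>

lemma irreducible_probs:
 assumes C: "C \<noteq> {}" "closedin (prob_topology circ) C" "mix_closed C" "\<And>g mu. mu \<in> C ==> push g mu \<in> C"
 shows "C = probs"
proof (rule closed_mix_closed_UNIV[OF C(2,3)])
 obtain mu where mu: "mu \<in> C" using C(1) by blast
 then have "mu \<in> probs" using closedin_subset[OF C(2)] by auto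
 then obtain g where "limitin (prob_topology circ) (%n. push (g n) mu) (dirac 1) sequentially" by (rule contract_to_dirac)
 then have "dirac 1 \<in> C" using limitin_closedin[OF _ C(2)] C(4)[OF mu] by fastforce
 then have "push (rot z) (dirac 1) \<in> C" for z by (rule C(4))
 then show "dirac z \<in> C" if "norm z = 1" for z using that by (metis apply_rot mult.right_neutral norm_one order_refl push_dirac)
qed

lemma irreducible_circle_measures_system: "irreducible_affine circle_measures_system"
 unfolding irreducible_affine_def circle_sys_sel topspace_prob_topology
 by (intro allI impI irreducible_probs) (auto simp: mix_closed_def)

lemma minimal_circ: "minimal_system circ ap"
 unfolding minimal_system_def
proof (intro conjI G_system_circ allI impI, elim conjE)
 fix C assume C: "C \<noteq> {}" "closedin circ C" "\<forall>g. \<forall>x\<in>C. ap g x \<in> C"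
 obtain x where x: "x \<in> C" using C(1) by blast
 have Cc: "C \<subseteq> circle" using closedin_subset[OF C(2)] by simp
 have "y \<in> C" if y: "norm y = 1" for y
 proof -
  have n: "norm (y / x) = 1" "x \<noteq> 0" using x Cc y by (auto simp: norm_divide)
  have "norm x = 1" using x Cc by auto
  then have "ap (rot (y / x)) x = y" using n by (simp add: apply_rot)
  then show ?thesis using C(3) x by metis
 qed
 then show "C = topspace circ" using Cc by auto
qed

lemma strongly_proximal_circ: "strongly_proximal circ ap"
 unfolding strongly_proximal_def
proof (intro conjI G_system_circ ballI)
 fix mu assume mu: "mu \<in> probs"
 then obtain g where g: "limitin (prob_topology circ) (%n. push (g n) mu) (dirac 1) sequentially" by (rule contract_to_dirac)
 let ?R = "range (%g. push g mu)"
 have "?R \<subseteq> topspace (prob_topology circ)" using push_in[OF mu] by auto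
 then have "?R \<subseteq> prob_topology circ closure_of ?R" by (rule closure_of_subset)
 then have "dirac 1 \<in> prob_topology circ closure_of ?R"
  by (intro limitin_closedin[OF g closedin_closure_of]) (auto intro: always_eventually)
 then show "\<exists>x\<in>topspace circ. dirac x \<in> prob_topology circ closure_of ?R" by (intro bexI[of _ 1]) auto
qed

section \<open>Barycentres and the universal irreducible affine system\<close>

context
 fixes T :: "'v::real_vector topology"
 assumes T: "tvs T"
begin

lemma tvs_mix_continuous: "continuous_map T T (%x. a *\<^sub>R x + y)"
 by (intro tvs_add[OF T] tvs_scaleR[OF T]) (auto simp: tvs_topspace[OF T])

text \<open>One variable is moved to the closure at a time, so only continuity of an affine map of
  one variable is used.\<close>

lemma tvs_closure_convex:
 assumes S: "convex S" shows "convex (T closure_of S)"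
proof -
 let ?K = "T closure_of S"
 have SK: "S \<subseteq> ?K" by (rule closure_of_subset) (simp add: tvs_topspace[OF T])
 have cl: "closedin T {x. a *\<^sub>R x + y \<in> ?K}" for a y
  using closedin_continuous_map_preimage[OF tvs_mix_continuous[of a y] closedin_closure_of[of T S]]
  by (simp add: tvs_topspace[OF T])
 have 1: "(1 - t) *\<^sub>R x + t *\<^sub>R y \<in> ?K" if "x \<in> S" "y \<in> ?K" "0 \<le> t" "t \<le> 1" for x y t
 proof -
  have "S \<subseteq> {y. t *\<^sub>R y + (1 - t) *\<^sub>R x \<in> ?K}"
   using SK convexD_alt[OF S \<open>x \<in> S\<close> _ that(3,4)] by (auto simp: add.commute)
  then have "?K \<subseteq> {y. t *\<^sub>R y + (1 - t) *\<^sub>R x \<in> ?K}" using closure_of_minimal[OF _ cl] by blast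
  then show ?thesis using that(2) by (auto simp: add.commute)
 qed
 have "(1 - t) *\<^sub>R x + t *\<^sub>R y \<in> ?K" if "x \<in> ?K" "y \<in> ?K" "0 \<le> t" "t \<le> 1" for x y t
 proof -
  have "S \<subseteq> {x. (1 - t) *\<^sub>R x + t *\<^sub>R y \<in> ?K}" using 1 that(2-4) by blast
  then have "?K \<subseteq> {x. (1 - t) *\<^sub>R x + t *\<^sub>R y \<in> ?K}" using closure_of_minimal[OF _ cl] by blast
  then show ?thesis using that(1) by blast
 qed
 then show ?thesis unfolding convex_alt by blast
qed

end

context
 fixes T :: "'v::real_vector topology" and Q :: "'v set" and xi :: "complex => 'v"
 assumes lc: "locally_convex_topology T" and Q: "compactin T Q" "convex Q"
  and xi: "continuous_map circ T xi" "\<And>z. norm z = 1 ==> xi z \<in> Q"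
begin

abbreviation (input) "prodtop \<equiv> prod_topology (prob_topology circ) (subtopology T Q)"

definition graph_like :: "(complex measure \<times> 'v) set => bool" where
 "graph_like R \<longleftrightarrow> closedin prodtop R
   \<and> (\<forall>t\<in>{0..1}. \<forall>p\<in>R. \<forall>q\<in>R. (mix_measure t (fst p) (fst q), (1 - t) *\<^sub>R snd p + t *\<^sub>R snd q) \<in> R)
   \<and> (\<forall>z. norm z = 1 \<longrightarrow> (dirac z, xi z) \<in> R)"

text \<open>The graph of the barycentre map is the smallest closed convex set containing the pairs
 \<open>(\<delta>\<^sub>z, xi z)\<close>; partitions of unity show that it is single-valued.\<close>

definition bary_graph :: "(complex measure \<times> 'v) set" where
 "bary_graph = \<Inter>(Collect graph_like)"

lemma tvsT: "tvs T" using lc by (rule locally_convex_tvs)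

lemma topQ: "topspace (subtopology T Q) = Q" by (simp add: tvs_topspace[OF tvsT])

lemma graph_like_top: "graph_like (probs \<times> Q)"
proof -
 have "(1 - t) *\<^sub>R x + t *\<^sub>R y \<in> Q" if "x \<in> Q" "y \<in> Q" "t \<in> {0..1}" for x y t
  using convexD_alt[OF Q(2), of x y t] that by auto
 moreover have "closedin prodtop (probs \<times> Q)"
  using closedin_topspace[of prodtop] by (simp add: tvs_topspace[OF tvsT])
 ultimately show ?thesis
  unfolding graph_like_def using mix_measure(1)[OF Hausdorff_circ] dirac_in xi(2) by auto
qed

lemma bary_graph: "graph_like bary_graph" "graph_like R ==> bary_graph \<subseteq> R"
proof -
 have "closedin prodtop bary_graph"
  unfolding bary_graph_def using graph_like_top by (intro closedin_Inter) (auto simp: graph_like_def)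
 moreover have "(mix_measure t (fst p) (fst q), (1 - t) *\<^sub>R snd p + t *\<^sub>R snd q) \<in> bary_graph"
  if "t \<in> {0..1}" "p \<in> bary_graph" "q \<in> bary_graph" for t p q
  unfolding bary_graph_def
 proof
  fix R assume R: "R \<in> Collect graph_like"
  then have "p \<in> R" "q \<in> R" using that by (auto simp: bary_graph_def)
  then show "(mix_measure t (fst p) (fst q), (1 - t) *\<^sub>R snd p + t *\<^sub>R snd q) \<in> R"
   using R that(1) unfolding mem_Collect_eq graph_like_def by blast
 qed
 moreover have "(dirac z, xi z) \<in> bary_graph" if "norm z = 1" for z
  unfolding bary_graph_def using that by (auto simp: graph_like_def)
 ultimately show "graph_like bary_graph" unfolding graph_like_def by blast
qed (auto simp: bary_graph_def)

text \<open>Local convexity supplies the convex V: continuity of subtraction at 0 makes V - V land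
  in a neighbourhood of 0 that is disjoint from an open neighbourhood of d, and disjointness from an
  open set survives passing to closures.\<close>

lemma small_closed_convex:
 assumes "d \<noteq> 0"
 obtains V where "openin T V" "0 \<in> V" "convex V" "\<And>a b. a \<in> T closure_of V ==> b \<in> T closure_of V ==> a - b \<noteq> d"
proof -
 have "\<exists>U V. openin T U \<and> openin T V \<and> 0 \<in> U \<and> d \<in> V \<and> disjnt U V"
  using tvs_Hausdorff[OF tvsT] assms by (simp add: Hausdorff_space_def tvs_topspace[OF tvsT])
 then obtain O1 O2 where O: "openin T O1" "openin T O2" "0 \<in> O1" "d \<in> O2" "disjnt O1 O2" by blast
 let ?P = "%S. {p \<in> topspace (prod_topology T T). fst p - snd p \<in> S}"
 have diff: "continuous_map (prod_topology T T) T (%p. fst p - snd p)"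
  by (intro tvs_diff[OF tvsT] continuous_map_fst continuous_map_snd)
 have P: "openin (prod_topology T T) (?P O1)" "openin (prod_topology T T) (?P O2)"
  using O(1,2) by (simp_all only: openin_continuous_map_preimage[OF diff])
 have "(0, 0) \<in> topspace (prod_topology T T)" unfolding topspace_prod_topology tvs_topspace[OF tvsT] by blast
 moreover have "fst (0 :: 'v, 0 :: 'v) - snd (0 :: 'v, 0 :: 'v) \<in> O1" using O(3) by simp
 ultimately have "(0, 0) \<in> ?P O1" by blast
 then have "\<exists>A B. openin T A \<and> openin T B \<and> 0 \<in> A \<and> 0 \<in> B \<and> A \<times> B \<subseteq> ?P O1"
  by (rule openin_prod_topology_alt[THEN iffD1, OF P(1), rule_format])
 then obtain A B where AB: "openin T A" "openin T B" "0 \<in> A" "0 \<in> B" "A \<times> B \<subseteq> ?P O1"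
  by (elim exE conjE)
 have "openin T (A \<inter> B)" "0 \<in> A \<inter> B" using AB by auto
 then obtain V where V: "openin T V" "0 \<in> V" "convex V" "V \<subseteq> A \<inter> B"
  using lc unfolding locally_convex_topology_def by blast
 have "a - b \<noteq> d" if ab: "a \<in> T closure_of V" "b \<in> T closure_of V" for a b
 proof
  assume e: "a - b = d"
  have "(a, b) \<in> prod_topology T T closure_of (V \<times> V)" unfolding closure_of_Times using ab by (rule SigmaI)
  then have cl: "\<forall>S. (a, b) \<in> S \<and> openin (prod_topology T T) S \<longrightarrow> (\<exists>p. p \<in> V \<times> V \<and> p \<in> S)"
   unfolding in_closure_of by (rule conjunct2)
  have "(a, b) \<in> topspace (prod_topology T T)" unfolding topspace_prod_topology tvs_topspace[OF tvsT] by blast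
  moreover have "fst (a, b) - snd (a, b) \<in> O2" using e O(4) by simp
  ultimately have "(a, b) \<in> ?P O2" by blast
  from cl[rule_format, OF conjI[OF this P(2)]] obtain p where p: "p \<in> V \<times> V" "p \<in> ?P O2" by (elim exE conjE)
  then have "p \<in> ?P O1" using V(4) AB(5) by blast
  with p(2) show False using O(5) by (auto simp: disjnt_def)
 qed
 then show ?thesis using V that by blast
qed

text \<open>Let the F U be a partition of unity subordinate to open sets on which \<open>xi\<close>
  moves by less than V from its value at c U. The approximate barycentre s mu, the sum of (LINT
  x|mu. F U x) times xi (c U), is continuous and affine in mu and within V of xi z at a point mass.
  So the pairs (mu, q) with q - s mu in the closure of V form a \<open>graph_like\<close> set, and
  two values over one mu would differ by a difference excluded by the choice of V.\<close>

lemma bary_functional: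
 assumes "(mu, q) \<in> bary_graph" "(mu, q') \<in> bary_graph"
 shows "q = q'"
proof (rule ccontr)
 assume "q \<noteq> q'"
 then have "q - q' \<noteq> 0" by simp
 then obtain V where V: "openin T V" "0 \<in> V" "convex V"
  "\<And>a b. a \<in> T closure_of V ==> b \<in> T closure_of V ==> a - b \<noteq> q - q'" by (rule small_closed_convex) blast
 let ?W = "T closure_of V"
 have W: "closedin T ?W" "convex ?W" "V \<subseteq> ?W"
  using V(3) tvs_closure_convex[OF tvsT] closure_of_subset[of V T] by (auto simp: tvs_topspace[OF tvsT])
 have "\<exists>S. open S \<and> {w \<in> circle. xi w - xi z \<in> V} = circle \<inter> S" if "z \<in> circle" for z
 proof -
  have "continuous_map circ T (%w. xi w - xi z)"
   by (intro tvs_diff[OF tvsT] xi(1)) (simp add: tvs_topspace[OF tvsT])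
  then have "openin circ {w \<in> topspace circ. xi w - xi z \<in> V}" using V(1) by (rule openin_continuous_map_preimage)
  then show ?thesis by (simp add: openin_open)
 qed
 then obtain S where S: "\<And>z. z \<in> circle ==> open (S z)" "\<And>z. z \<in> circle ==> {w \<in> circle. xi w - xi z \<in> V} = circle \<inter> S z" by metis
 have zS: "z \<in> S z" if "z \<in> circle" for z
 proof -
  have "z \<in> {w \<in> circle. xi w - xi z \<in> V}" using that V(2) by simp
  then have "z \<in> circle \<inter> S z" by (simp only: S(2)[OF that])
  then show ?thesis by blast
 qed
 have "compact circle" "circle \<subseteq> (\<Union>z\<in>circle. S z)" using zS by auto
 then obtain D where D: "D \<subseteq> circle" "finite D" "circle \<subseteq> (\<Union>z\<in>D. S z)"
  using compactE_image[of circle circle S] S(1) by metis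
 let ?C = "S ` D"
 have fC: "finite ?C" using D by simp
 define c where "c U = (SOME z. z \<in> D \<and> S z = U)" for U
 have c: "c U \<in> D" "S (c U) = U" if "U \<in> ?C" for U
  using someI_ex[of "%z. z \<in> D \<and> S z = U"] that by (auto simp: c_def)
 have cov: "circle \<subseteq> \<Union>?C" using D(3) by blast
 have op: "open U" if "U \<in> ?C" for U using that S(1) D(1) by auto
 have lf: "\<exists>V. open V \<and> x \<in> V \<and> finite {U \<in> ?C. U \<inter> V \<noteq> {}}" for x
  using fC by (intro exI[of _ UNIV]) auto
 obtain F :: "complex set => complex => real" where F: "\<And>U. U \<in> ?C ==> continuous_on circle (F U) \<and> (\<forall>x\<in>circle. 0 \<le> F U x)"
  "\<And>x U. U \<in> ?C ==> x \<in> circle ==> x \<notin> U ==> F U x = 0"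
  "\<And>x. x \<in> circle ==> supp_sum (%W. F W x) ?C = 1"
  by (rule subordinate_partition_of_unity[OF cov op lf]; (assumption | (rule that; assumption)))
 have Fs: "(\<Sum>U\<in>?C. F U x) = 1" if "x \<in> circle" for x
 proof -
  have "supp_sum (%W. F W x) ?C = (\<Sum>U\<in>?C. F U x)"
   unfolding supp_sum_def by (rule sum.mono_neutral_left[OF fC]) (auto simp: support_on_def)
  then show ?thesis using F(3)[OF that] by simp
 qed
 have Fc: "F U \<in> cfun circ" if "U \<in> ?C" for U using F(1)[OF that] by (simp add: cfun_circ)
 define s where "s mu = (\<Sum>U\<in>?C. (LINT x|mu. F U x) *\<^sub>R xi (c U))" for mu
 let ?R = "{p \<in> topspace prodtop. snd p - s (fst p) \<in> ?W}"
 have sum_cont: "continuous_map prodtop T (%p. \<Sum>U\<in>I. (LINT x|fst p. F U x) *\<^sub>R xi (c U))" if "I \<subseteq> ?C" "finite I" for I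
  using that(2,1)
 proof induction
  case (insert U I)
  have "continuous_map prodtop euclideanreal ((%mu. LINT x|mu. F U x) \<circ> fst)"
   using insert by (intro continuous_map_compose[OF continuous_map_fst] continuous_map_integral Fc) auto
  then have "continuous_map prodtop euclideanreal (%p. LINT x|fst p. F U x)" by (simp add: comp_def)
  then have "continuous_map prodtop T (%p. (LINT x|fst p. F U x) *\<^sub>R xi (c U))"
   by (intro tvs_scaleR[OF tvsT]) (auto simp: tvs_topspace[OF tvsT])
  then show ?case using insert by (simp add: tvs_add[OF tvsT])
 qed (simp add: tvs_topspace[OF tvsT])
 have "graph_like ?R"
  unfolding graph_like_def
 proof (intro conjI ballI allI impI)
  have "continuous_map prodtop T snd"
   using continuous_map_snd continuous_map_into_fulltopology by blast
  then have "continuous_map prodtop T (%p. snd p - s (fst p))"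
   unfolding s_def by (intro tvs_diff[OF tvsT] sum_cont fC) auto
  then show "closedin prodtop ?R" using W(1) by (rule closedin_continuous_map_preimage)
 next
  fix t :: real and p p' assume t: "t \<in> {0..1}" and p: "p \<in> ?R" "p' \<in> ?R"
  obtain mu x nu y where pq: "p = (mu, x)" "p' = (nu, y)" by force
  have m: "mu \<in> probs" "nu \<in> probs" "x \<in> Q" "y \<in> Q" "x - s mu \<in> ?W" "y - s nu \<in> ?W"
   using p unfolding pq topspace_prod_topology topspace_prob_topology topQ by auto
  have "s (mix_measure t mu nu) = (1 - t) *\<^sub>R s mu + t *\<^sub>R s nu"
   unfolding s_def scaleR_sum_right sum.distrib[symmetric]
   by (rule sum.cong) (auto simp: integral_mix_cfun[OF compact_circ Hausdorff_circ m(1,2) t Fc] scaleR_add_left)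
  then have "(1 - t) *\<^sub>R x + t *\<^sub>R y - s (mix_measure t mu nu) = (1 - t) *\<^sub>R (x - s mu) + t *\<^sub>R (y - s nu)"
   by (simp add: algebra_simps)
  also have "\<dots> \<in> ?W" using convexD_alt[OF W(2) m(5,6), of t] t by auto
  finally have "(1 - t) *\<^sub>R x + t *\<^sub>R y - s (mix_measure t mu nu) \<in> ?W" .
  moreover have "(1 - t) *\<^sub>R x + t *\<^sub>R y \<in> Q" using convexD_alt[OF Q(2) m(3,4), of t] t by auto
  moreover have "mix_measure t mu nu \<in> probs" by (rule mix_measure(1)[OF Hausdorff_circ m(1,2) t])
  ultimately show "(mix_measure t (fst p) (fst p'), (1 - t) *\<^sub>R snd p + t *\<^sub>R snd p') \<in> ?R"
   unfolding pq mem_Collect_eq topspace_prod_topology topspace_prob_topology topQ by simp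
 next
  fix z :: complex assume z: "norm z = 1"
  \<comment> \<open>Where F U z vanishes, z may lie outside U and the difference outside V;
    replacing it by 0 keeps every term of the convex combination in V without changing the
    sum.\<close>
  define y where "y U = (if F U z = 0 then 0 else xi z - xi (c U))" for U
  have "y U \<in> V" if U: "U \<in> ?C" for U
  proof (cases "F U z = 0")
   case False
   then have "z \<in> circle \<inter> S (c U)" using F(2)[OF U, of z] z c(2)[OF U] by auto
   have cU: "c U \<in> circle" using c(1)[OF U] D(1) by blast
   have "z \<in> {w \<in> circle. xi w - xi (c U) \<in> V}" unfolding S(2)[OF cU] by fact
   then show ?thesis using False by (simp add: y_def)
  qed (simp add: y_def V(2))
  then have "(\<Sum>U\<in>?C. F U z *\<^sub>R y U) \<in> V"
   using F(1) z by (intro convex_sum[OF fC V(3)] Fs) auto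
  also have "(\<Sum>U\<in>?C. F U z *\<^sub>R y U) = (\<Sum>U\<in>?C. F U z *\<^sub>R xi z - F U z *\<^sub>R xi (c U))"
   by (rule sum.cong) (auto simp: y_def algebra_simps)
  also have "\<dots> = xi z - s (dirac z)"
   using Fs[of z] z integral_return_cfun[of z circ] Fc
   by (simp add: sum_subtractf s_def scaleR_sum_left[symmetric])
  finally have "xi z - s (dirac z) \<in> ?W" using W(3) by blast
  then show "(dirac z, xi z) \<in> ?R"
   unfolding mem_Collect_eq topspace_prod_topology topspace_prob_topology topQ using dirac_in[OF z] xi(2)[OF z] by simp
 qed
 then have "bary_graph \<subseteq> ?R" by (rule bary_graph(2))
 then have "q - s mu \<in> ?W" "q' - s mu \<in> ?W" using assms by auto
 then have "(q - s mu) - (q' - s mu) \<noteq> q - q'" by (rule V(4))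
 then show False by simp
qed

lemma compact_prodtop: "compact_space prodtop"
 using compact_prob_topology[OF compact_circ Hausdorff_circ] Q(1)
 by (simp add: compact_space_prod_topology compactin_subspace)

text \<open>The projection of the graph to the measures is closed, convex and contains the point
  masses, so the map is defined everywhere. Continuity is the closed graph property for maps between
  compact Hausdorff spaces.\<close>

lemma barycentre_exists:
 "\<exists>Psi. continuous_map (prob_topology circ) (subtopology T Q) Psi
   \<and> (\<forall>t\<in>{0..1}. \<forall>mu\<in>probs. \<forall>nu\<in>probs. Psi (mix_measure t mu nu) = (1 - t) *\<^sub>R Psi mu + t *\<^sub>R Psi nu)
   \<and> (\<forall>z. norm z = 1 \<longrightarrow> Psi (dirac z) = xi z)"
proof -
 note G = bary_graph(1)[unfolded graph_like_def]
 have Gc: "closedin prodtop bary_graph" and Gm: "\<And>t p q. t \<in> {0..1} ==> p \<in> bary_graph ==> q \<in> bary_graph ==>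
   (mix_measure t (fst p) (fst q), (1 - t) *\<^sub>R snd p + t *\<^sub>R snd q) \<in> bary_graph"
  and Gd: "\<And>z. norm z = 1 ==> (dirac z, xi z) \<in> bary_graph"
  using G by blast+
 have proj: "closedin (prob_topology circ) (fst ` K)" if "closedin prodtop K" for K
 proof -
  have "compactin prodtop K" using closedin_compact_space[OF compact_prodtop that] .
  then have "compactin (prob_topology circ) (fst ` K)" using continuous_map_fst by (rule image_compactin)
  then show ?thesis using compactin_imp_closedin Hausdorff_prob_topology[OF compact_circ Hausdorff_circ] by blast
 qed
 have total: "fst ` bary_graph = probs"
 proof (rule closed_mix_closed_UNIV[OF proj[OF Gc]])
  show "mix_closed (fst ` bary_graph)" unfolding mix_closed_def using Gm by force
  show "dirac z \<in> fst ` bary_graph" if "norm z = 1" for z using Gd[OF that] by force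
 qed
 define Psi where "Psi mu = (THE q. (mu, q) \<in> bary_graph)" for mu
 have PsiI: "Psi mu = q" if "(mu, q) \<in> bary_graph" for mu q
  unfolding Psi_def using that bary_functional by blast
 have Psi: "(mu, Psi mu) \<in> bary_graph" if m: "mu \<in> probs" for mu
 proof -
  obtain q where "(mu, q) \<in> bary_graph" using m unfolding total[symmetric] by force
  then show ?thesis using PsiI by simp
 qed
 have sub: "bary_graph \<subseteq> probs \<times> Q" using bary_graph(2)[OF graph_like_top] .
 have "continuous_map (prob_topology circ) (subtopology T Q) Psi"
  unfolding continuous_map_closedin
 proof (intro conjI allI impI)
  show "Psi \<in> topspace (prob_topology circ) \<rightarrow> topspace (subtopology T Q)" using Psi sub unfolding topQ by auto
  fix K assume K: "closedin (subtopology T Q) K"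
  have "closedin prodtop (topspace (prob_topology circ) \<times> K)"
   using K closedin_topspace[of "prob_topology circ"] by (simp add: closedin_prod_Times_iff)
  then have "closedin (prob_topology circ) (fst ` (bary_graph \<inter> (probs \<times> K)))"
   using Gc by (intro proj closedin_Int) auto
  moreover have "fst ` (bary_graph \<inter> (probs \<times> K)) = {mu \<in> topspace (prob_topology circ). Psi mu \<in> K}"
  proof (intro set_eqI iffI)
   fix mu assume "mu \<in> {mu \<in> topspace (prob_topology circ). Psi mu \<in> K}"
   then show "mu \<in> fst ` (bary_graph \<inter> (probs \<times> K))" using Psi[of mu] by force
  qed (use PsiI in auto)
  ultimately show "closedin (prob_topology circ) {mu \<in> topspace (prob_topology circ). Psi mu \<in> K}" by simp
 qed
 moreover have "Psi (mix_measure t mu nu) = (1 - t) *\<^sub>R Psi mu + t *\<^sub>R Psi nu"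
  if "t \<in> {0..1}" "mu \<in> probs" "nu \<in> probs" for t mu nu
  using Gm[OF that(1) Psi[OF that(2)] Psi[OF that(3)]] by (intro PsiI) simp
 moreover have "Psi (dirac z) = xi z" if "norm z = 1" for z using Gd[OF that] by (rule PsiI)
 ultimately show ?thesis by blast
qed

end

text \<open>The orbit map g |-> al g x is constant on left cosets of the stabilizer of 1, so it
  descends to the circle; rotations give a section of g |-> g(1), which makes the descended map
  visibly continuous.\<close>

lemma orbit_map_circle:
 assumes G: "G_system X al" and x: "x \<in> topspace X" and fix1: "\<And>p. ap p 1 = 1 ==> al p x = x"
 shows "continuous_map circ X (%z. al (rot z) x)"
  and "norm z = 1 ==> al g (al (rot z) x) = al (rot (ap g z)) x"
proof -
 note D = G_system_D[OF G]
 have "continuous_map circ (prod_topology euclidean X) (%z. (rot z, x))"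
  using continuous_on_rot x by (intro continuous_map_pairedI) auto
 from continuous_map_compose[OF this D(4)] show "continuous_map circ X (%z. al (rot z) x)" by (simp add: comp_def)
 assume z: "norm z = 1"
 obtain p where p: "ap p 1 = 1" "g * rot z = rot (ap g z) * p" using rot_decomp[OF z] .
 have "al g (al (rot z) x) = al (g * rot z) x" using D(6)[OF x] by simp
 also have "\<dots> = al (rot (ap g z)) x" using D(6)[OF x] fix1[OF p(1)] by (simp add: p(2))
 finally show "al g (al (rot z) x) = al (rot (ap g z)) x" .
qed

text \<open>The stabilizer has a fixed point in Q; its orbit map on the circle, extended to measures
  by barycentres, is an affine homomorphism. Its image is compact, convex and invariant, so
  irreducibility of Q makes it onto.\<close>

lemma universal_circle_measures:
 "universal_irreducible_affine TYPE('v::real_vector) circle_measures_system"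
 unfolding universal_irreducible_affine_def
proof (intro conjI allI impI, goal_cases)
 case 1 show ?case unfolding circle_sys_sel by (rule G_system_prob[OF G_system_circ])
next
 case 2 show ?case unfolding circle_measures_system_def by (rule affine_action_prob[OF G_system_circ])
next
 case 3 show ?case by (rule irreducible_circle_measures_system)
next
 case (4 T Q al)
 then have lc: "locally_convex_topology T" and cQ: "convex Q" and G: "G_system (subtopology T Q) al"
  and aff: "affine_action (vector_system T Q al)" and irr: "irreducible_affine (vector_system T Q al)"
  by (auto simp: affine_G_system_def)
 note tv = locally_convex_tvs[OF lc]
 have tQ: "topspace (subtopology T Q) = Q" by (simp add: tvs_topspace[OF tv])
 note D = G_system_D[OF G, unfolded tQ]
 have kQ: "compactin T Q" using D(2) by (simp add: compactin_subspace tvs_topspace[OF tv])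
 have affQ: "affine_on Q (al g)" for g
  using aff unfolding affine_action_def affine_on_def[OF tv] vector_system_def affine_structure.simps tQ by blast
 have cT: "continuous_map (subtopology T Q) T (al g)" for g
  using D(7) continuous_map_into_fulltopology by blast
 have "\<exists>x\<in>Q. \<forall>p. ap p 1 = 1 \<longrightarrow> al p x = x"
  by (rule stabilizer_fixed_point[OF tv kQ cQ]) (use D affQ cT in auto)
 then obtain x where x: "x \<in> Q" "\<And>p. ap p 1 = 1 ==> al p x = x" by blast
 define xi where "xi z = al (rot z) x" for z
 have xic: "continuous_map circ (subtopology T Q) xi"
  unfolding xi_def using x by (intro orbit_map_circle(1)[OF G]) (simp_all only: tQ)
 have eqv: "al g (xi z) = xi (ap g z)" if "norm z = 1" for g z
  unfolding xi_def using x(1) by (intro orbit_map_circle(2)[OF G _ x(2) that]) (simp_all only: tQ)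
 have "continuous_map circ T xi" using xic continuous_map_into_fulltopology by blast
 moreover have "xi z \<in> Q" for z using D(8) x(1) by (simp add: xi_def)
 ultimately obtain Psi where Psi: "continuous_map (prob_topology circ) (subtopology T Q) Psi"
  "\<And>t mu nu. t \<in> {0..1} ==> mu \<in> probs ==> nu \<in> probs ==> Psi (mix_measure t mu nu) = (1 - t) *\<^sub>R Psi mu + t *\<^sub>R Psi nu"
  "\<And>z. norm z = 1 ==> Psi (dirac z) = xi z"
  using barycentre_exists[OF lc kQ cQ, of xi] by blast
 note DM = G_system_D[OF G_system_prob[OF G_system_circ]]
 have PsiQ: "Psi mu \<in> Q" if "mu \<in> probs" for mu
  using continuous_map_funspace[OF Psi(1)] that unfolding tQ topspace_prob_topology by (rule funcset_mem)
 \<comment> \<open>This holds on point masses, where \<open>Psi\<close> is \<open>xi\<close>; both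
   sides are continuous and affine in mu, so the set where they agree is everything.\<close>
 have equi: "Psi (push g mu) = al g (Psi mu)" if "mu \<in> probs" for g mu
 proof -
  have "{mu \<in> topspace (prob_topology circ). Psi (push g mu) = al g (Psi mu)} = probs"
  proof (rule closed_mix_closed_UNIV)
   have 1: "continuous_map (prob_topology circ) (subtopology T Q) (%mu. Psi (push g mu))"
    using continuous_map_compose[OF DM(7) Psi(1)] by (simp add: comp_def)
   have 2: "continuous_map (prob_topology circ) (subtopology T Q) (%mu. al g (Psi mu))"
    using continuous_map_compose[OF Psi(1) D(7)] by (simp add: comp_def)
   show "closedin (prob_topology circ) {mu \<in> topspace (prob_topology circ). Psi (push g mu) = al g (Psi mu)}"
    by (rule closedin_continuous_maps_eq[OF D(3) 1 2])
   show "mix_closed {mu \<in> topspace (prob_topology circ). Psi (push g mu) = al g (Psi mu)}"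
    unfolding mix_closed_def
   proof (intro ballI CollectI conjI)
    fix t :: real and mu nu assume t: "t \<in> {0..1}" and m: "mu \<in> {mu \<in> topspace (prob_topology circ). Psi (push g mu) = al g (Psi mu)}"
     "nu \<in> {mu \<in> topspace (prob_topology circ). Psi (push g mu) = al g (Psi mu)}"
    then have m': "mu \<in> probs" "nu \<in> probs" by auto
    show "mix_measure t mu nu \<in> topspace (prob_topology circ)" using mix_measure(1)[OF Hausdorff_circ m' t] by simp
    have "push g (mix_measure t mu nu) = mix_measure t (push g mu) (push g nu)"
     using affine_action_prob[OF G_system_circ] t m' by (simp add: affine_action_def prob_system_def)
    then have "Psi (push g (mix_measure t mu nu)) = (1 - t) *\<^sub>R al g (Psi mu) + t *\<^sub>R al g (Psi nu)"
     using Psi(2)[OF t push_in[OF m'(1)] push_in[OF m'(2)]] m by simp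
    also have "\<dots> = al g (Psi (mix_measure t mu nu))"
     using affQ[of g] t m' PsiQ unfolding affine_on_def[OF tv] by (simp add: Psi(2))
    finally show "Psi (push g (mix_measure t mu nu)) = al g (Psi (mix_measure t mu nu))" .
   qed
   show "dirac z \<in> {mu \<in> topspace (prob_topology circ). Psi (push g mu) = al g (Psi mu)}" if "norm z = 1" for z
    using that dirac_in[OF that] by (simp add: push_dirac Psi(3) norm_apply_circle eqv)
  qed
  then show ?thesis using that by blast
 qed
 have hom: "affine_hom circle_measures_system (vector_system T Q al) Psi"
  unfolding affine_hom_def circle_sys_sel topspace_prob_topology
  using Psi(1,2) equi by (simp add: vector_system_def)
 have "Psi ` probs = Q"
 proof -
  let ?C = "Psi ` probs"
  have "compactin (subtopology T Q) ?C"
   using image_compactin[OF _ Psi(1)] DM(2) by (simp add: compact_space_def)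
  then have "closedin (subtopology T Q) ?C" by (rule compactin_imp_closedin[OF D(3)])
  moreover have "?C \<noteq> {}" using dirac_in[of 1] by auto
  moreover have "\<forall>t\<in>{0..1}. \<forall>x\<in>?C. \<forall>y\<in>?C. (1 - t) *\<^sub>R x + t *\<^sub>R y \<in> ?C"
  proof (intro ballI)
   fix t :: real and x y assume t: "t \<in> {0..1}" and "x \<in> ?C" "y \<in> ?C"
   then obtain mu nu where m: "mu \<in> probs" "nu \<in> probs" "x = Psi mu" "y = Psi nu" by blast
   show "(1 - t) *\<^sub>R x + t *\<^sub>R y \<in> ?C"
    unfolding m(3,4) Psi(2)[OF t m(1,2), symmetric] by (rule imageI) (rule mix_measure(1)[OF Hausdorff_circ m(1,2) t])
  qed
  moreover have "\<forall>g. \<forall>x\<in>?C. al g x \<in> ?C"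
  proof (intro allI ballI)
   fix g x assume "x \<in> ?C"
   then obtain mu where m: "mu \<in> probs" "x = Psi mu" by blast
   show "al g x \<in> ?C" unfolding m(2) equi[OF m(1), symmetric] by (rule imageI) (rule push_in[OF m(1)])
  qed
  ultimately show ?thesis
   using irr[unfolded irreducible_affine_def vector_system_def affine_structure.simps tQ, rule_format, of ?C]
   by (simp only: simp_thms)
 qed
 then have "Psi ` topspace (top_of circle_measures_system) = topspace (top_of (vector_system T Q al))"
  unfolding circle_sys_sel by (simp add: vector_system_def tvs_topspace[OF tv])
 with hom show ?case unfolding affine_image_def by blast
qed

section \<open>The universal minimal strongly proximal system\<close>

text \<open>Real-valued functionals become points of a topological vector space under pointwise
  operations, as the Markov-Kakutani theorem requires.\<close>

instantiation "fun" :: (type, real_vector) real_vector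
begin

definition scaleR_fun :: "real => ('a => 'b) => 'a => 'b" where
 "scaleR_fun r f = (%x. r *\<^sub>R f x)"

instance
 by standard (auto simp: scaleR_fun_def fun_eq_iff scaleR_add_right scaleR_add_left)

end

lemma tvs_fun: "tvs (euclidean :: ('i => real) topology)"
 unfolding tvs_def
proof (intro conjI)
 have "Hausdorff_space (product_topology (%_ :: 'i. euclideanreal) UNIV)"
  by (simp add: Hausdorff_space_product_topology)
 then show "Hausdorff_space (euclidean :: ('i => real) topology)" unfolding euclidean_product_topology .
 have pt: "prod_topology (euclidean :: 'c topology) (euclidean :: 'd topology) = euclidean"
  for c :: "'c::topological_space" and d :: "'d::topological_space"
  using prod_topology_subtopology_eu[of "UNIV :: 'c set" "UNIV :: 'd set"] by simp
 have c: "continuous_on UNIV (%x. g x i)" if "continuous_on UNIV g" for g :: "'z::topological_space => 'i => real" and i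
  by (rule continuous_on_compose2[OF continuous_on_product_coordinates that]) simp
 have "continuous_on UNIV (%p :: ('i => real) \<times> ('i => real). fst p + snd p)"
 proof (rule continuous_on_coordinatewise_then_product)
  show "continuous_on UNIV (%p :: ('i => real) \<times> ('i => real). (fst p + snd p) i)" for i
   unfolding plus_fun_apply
   by (rule continuous_on_add; rule c; rule continuous_on_fst[OF continuous_on_id] continuous_on_snd[OF continuous_on_id])
 qed
 then show "continuous_map (prod_topology euclidean euclidean) (euclidean :: ('i => real) topology) (%(x, y). x + y)"
  unfolding pt case_prod_beta continuous_map_iff_continuous2 .
 have "continuous_on UNIV (%p :: real \<times> ('i => real). fst p *\<^sub>R snd p)"
 proof (rule continuous_on_coordinatewise_then_product)
  show "continuous_on UNIV (%p :: real \<times> ('i => real). (fst p *\<^sub>R snd p) i)" for i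
   unfolding scaleR_fun_def
   by (intro continuous_on_scaleR continuous_on_fst continuous_on_id c[OF continuous_on_snd])
 qed
 then show "continuous_map (prod_topology euclideanreal euclidean) (euclidean :: ('i => real) topology) (%(r, x). r *\<^sub>R x)"
  unfolding pt case_prod_beta continuous_map_iff_continuous2 .
qed simp

lemma mean_cong:
 assumes "compact_space X" "Hausdorff_space X" "is_mean X Lam" "f \<in> cfun X" "g \<in> cfun X" "\<And>x. x \<in> topspace X ==> f x = g x"
 shows "Lam f = Lam g"
proof -
 interpret mean_functional X Lam using assms by unfold_locales
 show ?thesis by (rule antisym; rule mono) (use assms in auto)
qed

text \<open>Push-forward expressed on functionals. The value 0 off \<open>cfun X\<close> keeps the
  result in \<open>means X\<close>.\<close>

definition mean_act :: "'x topology => (moebius => 'x => 'x) => moebius => (('x => real) => real) => ('x => real) => real" where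
 "mean_act X al g Lam = (%f. if f \<in> cfun X then Lam (%x. f (al g x)) else 0)"

text \<open>The means form a compact convex set in a vector space with the pointwise topology, so
  the stabilizer fixes one of them, and the Riesz theorem turns it into a fixed measure.\<close>

lemma invariant_prob_measure:
 assumes G: "G_system X al"
 obtains mu where "mu \<in> prob_measures X" "\<And>p. ap p 1 = 1 ==> push_forward X al p mu = mu"
proof -
 note D = G_system_D[OF G]
 have cc: "(%x. f (al g x)) \<in> cfun X" if "f \<in> cfun X" for f g by (rule cfun_comp[OF D(7) that])
 have comp: "mean_act X al (g * h) Lam = mean_act X al g (mean_act X al h Lam)" if L: "Lam \<in> means X" for g h Lam
 proof (rule ext)
  fix f
  show "mean_act X al (g * h) Lam f = mean_act X al g (mean_act X al h Lam) f"
  proof (cases "f \<in> cfun X")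
   case True
   have "Lam (%x. f (al (g * h) x)) = Lam (%x. f (al g (al h x)))"
   proof (rule mean_cong[where X = X and Lam = Lam, OF D(2,3)])
    show "is_mean X Lam" using L by (simp add: means_def)
    show "f (al (g * h) x) = f (al g (al h x))" if "x \<in> topspace X" for x by (simp only: D(6)[OF that])
   qed (rule cc[OF True] cc[OF cc[OF True]])+
   then show ?thesis using True cc[OF True] by (simp add: mean_act_def)
  qed (simp add: mean_act_def)
 qed
 have aff: "affine_on (means X) (mean_act X al g)" for g
  unfolding affine_on_def[OF tvs_fun]
  by (intro ballI ext) (simp add: mean_act_def scaleR_fun_def)
 have "\<exists>Lam\<in>means X. \<forall>p. ap p 1 = 1 \<longrightarrow> mean_act X al p Lam = Lam"
 proof (rule stabilizer_fixed_point[OF tvs_fun])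
  show "compactin euclidean (means X)" using compact_means[OF D(2)] by simp
  obtain x where x: "x \<in> topspace X" using D(1) by blast
  have "(%f. if f \<in> cfun X then f x else 0) \<in> means X"
   using x by (auto simp: means_def is_mean_def cfun_intros)
  then show "means X \<noteq> {}" by blast
  show "convex (means X)"
   unfolding convex_alt
  proof (intro ballI allI impI)
   fix Lam Lam' and t :: real assume L: "Lam \<in> means X" "Lam' \<in> means X" and t: "0 \<le> t \<and> t \<le> 1"
   have e: "(1 - t) *\<^sub>R Lam + t *\<^sub>R Lam' = (%f. (1 - t) * Lam f + t * Lam' f)" by (simp add: fun_eq_iff scaleR_fun_def)
   show "(1 - t) *\<^sub>R Lam + t *\<^sub>R Lam' \<in> means X"
    unfolding e means_def is_mean_def mem_Collect_eq
   proof (intro conjI ballI allI impI)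
    fix f assume f: "f \<in> cfun X"
    show "0 \<le> (1 - t) * Lam f + t * Lam' f" if "\<forall>x\<in>topspace X. 0 \<le> f x"
     using L t f that by (intro add_nonneg_nonneg mult_nonneg_nonneg) (auto simp: means_def is_mean_def)
   qed (use L in \<open>simp_all add: means_def is_mean_def algebra_simps\<close>)
  qed
  show "mean_act X al g Lam \<in> means X" if L: "Lam \<in> means X" for g Lam
   using L cc D(8) by (auto simp: means_def is_mean_def mean_act_def cfun_intros)
  show "continuous_map (subtopology euclidean (means X)) euclidean (mean_act X al g)" for g
  proof -
   have "continuous_on (means X) (%Lam. mean_act X al g Lam f)" for f
    by (cases "f \<in> cfun X")
     (auto simp: mean_act_def intro: continuous_on_subset[OF continuous_on_product_coordinates])
   then have "continuous_on (means X) (mean_act X al g)" by (rule continuous_on_coordinatewise_then_product)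
   then show ?thesis by simp
  qed
  show "affine_on (means X) (mean_act X al g)" for g
   by (rule aff)
  show "mean_act X al (g * h) Lam = mean_act X al g (mean_act X al h Lam)" if L: "Lam \<in> means X" for g h Lam
   by (rule comp[OF L])
 qed
 then obtain Lam where L: "Lam \<in> means X" "\<And>p. ap p 1 = 1 ==> mean_act X al p Lam = Lam" by blast
 note R = represent[OF D(2,3) L(1)]
 have GM: "G_system (prob_topology X) (push_forward X al)" by (rule G_system_prob[OF G])
 have "push_forward X al p (represent X Lam) = represent X Lam" if p: "ap p 1 = 1" for p
 proof (rule prob_measures_eqI[OF D(2,3) _ R(1)])
  show "push_forward X al p (represent X Lam) \<in> prob_measures X" using G_system_D(8)[OF GM] R(1) by simp
  fix f assume f: "f \<in> cfun X"
  have "(LINT x|push_forward X al p (represent X Lam). f x) = (LINT x|represent X Lam. f (al p x))"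
   unfolding push_forward_def by (rule integral_push_forward_cfun[OF D(2,3) R(1) D(7) D(3) f])
  also have "\<dots> = Lam (%x. f (al p x))" by (rule R(2)[OF cc[OF f]])
  also have "\<dots> = mean_act X al p Lam f" using f by (simp add: mean_act_def)
  also have "\<dots> = (LINT x|represent X Lam. f x)" by (simp add: L(2)[OF p] R(2)[OF f])
  finally show "(LINT x|push_forward X al p (represent X Lam). f x) = (LINT x|represent X Lam. f x)" .
 qed
 then show ?thesis using R(1) that by blast
qed

text \<open>The orbit of a stabilizer-fixed measure mu is the continuous image of the circle, hence
  already closed. Strong proximality therefore puts a point mass in the orbit itself, so mu is the
  point mass at a stabilizer-fixed point x, and the orbit map of x is the factor map.\<close>

lemma universal_circle:
 "universal_minimal_strongly_proximal TYPE('y) circ ap"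
 unfolding universal_minimal_strongly_proximal_def
proof (intro conjI minimal_circ strongly_proximal_circ allI impI, elim conjE)
 fix Y :: "'y topology" and be assume min: "minimal_system Y be" and sp: "strongly_proximal Y be"
 have G: "G_system Y be" using min by (simp add: minimal_system_def)
 note D = G_system_D[OF G]
 have GM: "G_system (prob_topology Y) (push_forward Y be)" by (rule G_system_prob[OF G])
 note DM = G_system_D[OF GM, unfolded topspace_prob_topology]
 obtain mu where mu: "mu \<in> prob_measures Y" "\<And>p. ap p 1 = 1 ==> push_forward Y be p mu = mu"
  by (rule invariant_prob_measure[OF G]) (rule that)
 have mut: "mu \<in> topspace (prob_topology Y)" using mu(1) by simp
 let ?K = "(%z. push_forward Y be (rot z) mu) ` circle"
 have "compactin circ circle" by (simp add: compactin_subtopology)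
 then have "compactin (prob_topology Y) ?K" by (rule image_compactin[OF _ orbit_map_circle(1)[OF GM mut mu(2)]])
 then have Kc: "closedin (prob_topology Y) ?K" by (rule compactin_imp_closedin[OF DM(3)])
 have "range (%g. push_forward Y be g mu) \<subseteq> ?K"
 proof
  fix nu assume "nu \<in> range (%g. push_forward Y be g mu)"
  then obtain g where g: "nu = push_forward Y be g mu" by blast
  obtain p where p: "ap p 1 = 1" "g * rot 1 = rot (ap g 1) * p" using rot_decomp[of 1 g] by auto
  have "nu = push_forward Y be (rot (ap g 1)) mu"
   using DM(6)[OF mu(1)] mu(2)[OF p(1)] p(2) g by (metis mult.right_neutral rot_one)
  then show "nu \<in> ?K" using norm_apply_circle[of 1 g] by auto
 qed
 then have cl: "prob_topology Y closure_of range (%g. push_forward Y be g mu) \<subseteq> ?K" by (rule closure_of_minimal[OF _ Kc])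
 obtain y where y: "y \<in> topspace Y"
  "return (borel_of Y) y \<in> prob_topology Y closure_of range (%g. push_forward Y be g mu)"
  using sp mu(1) unfolding strongly_proximal_def by blast
 have "return (borel_of Y) y \<in> ?K" by (rule subsetD[OF cl y(2)])
 then obtain z where z: "z \<in> circle" "return (borel_of Y) y = push_forward Y be (rot z) mu" by (rule imageE)
 define x where "x = be (ginv (rot z)) y"
 have x: "x \<in> topspace Y" using D(8) y(1) by (simp add: x_def)
 have "mu = push_forward Y be (ginv (rot z)) (push_forward Y be (rot z) mu)"
  by (simp only: DM(6)[OF mu(1), symmetric] ginv DM(5)[OF mu(1)])
 also have "\<dots> = return (borel_of Y) x"
  unfolding z(2)[symmetric] x_def by (rule push_forward_return[OF G y(1)])
 finally have mux: "mu = return (borel_of Y) x" .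
 have fx: "be p x = x" if "ap p 1 = 1" for p
  using mu(2)[OF that] push_forward_return[OF G x, of p] return_inj[OF D(2,3) D(8)[OF x] x] by (simp add: mux)
 define \<pi> where "\<pi> z = be (rot z) x" for z
 have \<pi>c: "continuous_map circ Y \<pi>" unfolding \<pi>_def by (rule orbit_map_circle(1)[OF G x fx])
 have eqv: "\<pi> (ap g z) = be g (\<pi> z)" if "norm z = 1" for g z
  unfolding \<pi>_def by (rule orbit_map_circle(2)[OF G x fx that, symmetric])
 have "compactin Y (\<pi> ` circle)" using image_compactin[OF \<open>compactin circ circle\<close> \<pi>c] .
 then have "closedin Y (\<pi> ` circle)" by (rule compactin_imp_closedin[OF D(3)])
 moreover have "\<pi> ` circle \<noteq> {}" by auto
 moreover have "\<forall>g. \<forall>y\<in>\<pi> ` circle. be g y \<in> \<pi> ` circle"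
 proof (intro allI ballI)
  fix g y assume "y \<in> \<pi> ` circle"
  then obtain z where z: "norm z = 1" "y = \<pi> z" by auto
  show "be g y \<in> \<pi> ` circle" unfolding z(2) eqv[OF z(1), symmetric]
   by (rule imageI) (simp add: norm_apply_circle z(1))
 qed
 ultimately have "\<pi> ` circle \<noteq> {} \<and> closedin Y (\<pi> ` circle) \<and> (\<forall>g. \<forall>y\<in>\<pi> ` circle. be g y \<in> \<pi> ` circle)"
  by (intro conjI)
 then have img: "\<pi> ` circle = topspace Y" by (rule mp[OF spec[OF conjunct2[OF min[unfolded minimal_system_def]], of "\<pi> ` circle"]])
 show "factor_of Y be circ ap"
  unfolding factor_of_def
 proof (intro exI[of _ \<pi>] conjI allI ballI)
  show "\<pi> ` topspace circ = topspace Y" using img by simp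
  show "\<pi> (ap g z) = be g (\<pi> z)" if "z \<in> topspace circ" for g z using that by (intro eqv) simp
 qed (rule \<pi>c)
qed

section \<open>Bounded harmonic functions and the Poisson formula\<close>

lemma integral_arc_2pi:
 fixes f :: "complex => real"
 assumes f: "continuous_on circle f"
 shows "(LINT x|arc. f x) = 1 / (2 * pi) * integral {0..2 * pi} (%t. f (cis t))"
proof -
 have "continuous_on {0..2 * pi} (%t. f (cis t))"
  by (rule continuous_on_compose2[OF f]) (auto intro!: continuous_intros)
 then have "((%t. f (cis t)) has_integral integral {0..2 * pi} (%t. f (cis t))) {0..2 * pi}"
  by (intro integrable_integral integrable_continuous_interval)
 from has_integral_stretch_real[OF this, of "2 * pi"]
 have "((%t. f (cis (2 * pi * t))) has_integral (1 / (2 * pi)) *\<^sub>R integral {0..2 * pi} (%t. f (cis t))) ((%x. x / (2 * pi)) ` {0..2 * pi})"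
  by simp
 moreover have "(%x. x / (2 * pi)) ` {0..2 * pi} = {0..1}"
  using image_divide_atLeastAtMost[of "2 * pi" 0 "2 * pi"] by simp
 ultimately have "integral {0..1} (%t. f (cis (2 * pi * t))) = 1 / (2 * pi) * integral {0..2 * pi} (%t. f (cis t))"
  by (intro integral_unique) simp
 then show ?thesis using integral_arc[OF f] by simp
qed

lemma circle_in_disk:
 fixes x z :: complex
 assumes "0 < r" "r < 1 - norm z" "norm x \<le> 1"
 shows "norm (z + of_real r * x) < 1"
proof -
 have "norm (z + of_real r * x) \<le> norm z + r * norm x"
  using norm_triangle_ineq[of z "of_real r * x"] assms(1) unfolding norm_mult norm_of_real by simp
 also have "\<dots> \<le> norm z + r * 1" using assms by (intro add_left_mono mult_left_mono) auto
 finally show ?thesis using assms by simp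
qed

lemma continuous_on_small_circle:
 assumes h: "continuous_on disk h" and r: "0 < r" "r < 1 - norm z"
 shows "continuous_on circle (%x. h (z + of_real r * x))"
proof (rule continuous_on_compose2[OF h])
 show "(%x. z + of_real r * x) ` circle \<subseteq> disk" using circle_in_disk[OF r] by auto
qed (intro continuous_intros)

definition local_mean_value :: "(complex => real) => bool" where
 "local_mean_value w \<longleftrightarrow> (\<forall>z\<in>disk. \<forall>\<^sub>F r in at_right 0. w z = (LINT x|arc. w (z + of_real r * x)))"

lemma eventually_small_radius: "norm z < 1 ==> \<forall>\<^sub>F r in at_right 0. 0 < r \<and> r < 1 - norm z"
 unfolding eventually_at_right_field by (intro exI[of _ "1 - norm z"]) auto

lemma harmonic_on_disk_iff: "harmonic_on_disk h \<longleftrightarrow> continuous_on disk h \<and> local_mean_value h"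
proof -
 have "(\<forall>\<^sub>F r in at_right 0. h z = 1 / (2 * pi) * integral {0..2 * pi} (%t. h (z + of_real r * cis t)))
   \<longleftrightarrow> (\<forall>\<^sub>F r in at_right 0. h z = (LINT x|arc. h (z + of_real r * x)))"
  if h: "continuous_on disk h" and z: "norm z < 1" for z
 proof (rule eventually_subst)
  show "\<forall>\<^sub>F r in at_right 0. (h z = 1 / (2 * pi) * integral {0..2 * pi} (%t. h (z + of_real r * cis t)))
    = (h z = (LINT x|arc. h (z + of_real r * x)))"
   using eventually_small_radius[OF z]
  proof eventually_elim
   case (elim r)
   then show ?case using integral_arc_2pi[OF continuous_on_small_circle[OF h, of r z]] by simp
  qed
 qed
 then show ?thesis unfolding harmonic_on_disk_def local_mean_value_def by auto
qed

text \<open>Among the points where the maximum over the closed disk is attained, one of largest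
  modulus is chosen. If it were interior, the mean value property would put a whole small circle
  around it into the maximum set, and that circle reaches points of larger modulus.\<close>

lemma maximum_principle:
 assumes w: "continuous_on (cball 0 1) w" and mv: "local_mean_value w"
  and le: "\<And>x. norm x = 1 ==> w x \<le> e" and z: "norm z \<le> 1"
 shows "w z \<le> e"
proof -
 obtain m where m: "norm m \<le> 1" "\<And>y. norm y \<le> 1 ==> w y \<le> w m"
  using continuous_attains_sup[of "cball 0 1" w] w by auto
 define E where "E = {y \<in> cball 0 1. w y = w m}"
 have "closed E" unfolding E_def by (rule continuous_closed_preimage_constant[OF w]) simp
 then have "compact E" unfolding E_def by (metis (no_types, lifting) bounded_cball bounded_subset compact_eq_bounded_closed mem_Collect_eq subsetI)
 moreover have "E \<noteq> {}" using m(1) by (auto simp: E_def)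
 ultimately obtain y where y: "y \<in> E" "\<And>x. x \<in> E ==> norm x \<le> norm y"
  using continuous_attains_sup[of E norm] by (auto intro: continuous_intros)
 have wy: "w y = w m" "norm y \<le> 1" using y(1) by (auto simp: E_def)
 have "norm y = 1"
 proof (rule ccontr)
  assume "norm y \<noteq> 1"
  then have ny: "norm y < 1" using wy by simp
  have "\<forall>\<^sub>F r in at_right 0. (0 < r \<and> r < 1 - norm y) \<and> w y = (LINT x|arc. w (y + of_real r * x))"
   using mv ny by (intro eventually_conj eventually_small_radius) (auto simp: local_mean_value_def)
  moreover have "at_right (0 :: real) \<noteq> bot" by simp
  ultimately obtain r where r: "0 < r" "r < 1 - norm y" "w y = (LINT x|arc. w (y + of_real r * x))"
   using eventually_happens' by blast
  have wd: "continuous_on disk w" using w by (rule continuous_on_subset) auto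
  have c: "continuous_on circle (%x. w m - w (y + of_real r * x))"
   by (intro continuous_intros continuous_on_small_circle[OF wd r(1,2)])
  have ci: "integrable arc (%x. w (y + of_real r * x))"
   by (rule circ_integrable_cont[OF arc_in continuous_on_small_circle[OF wd r(1,2)]])
  have "(LINT x|arc. w m - w (y + of_real r * x)) = 0" using ci r(3) wy(1) by (simp add: arc.prob_space)
  then have "integral {0..1} (%t. w m - w (y + of_real r * cis (2 * pi * t))) = 0" using integral_arc[OF c] by simp
  moreover have "continuous_on {0..1} (%t. w m - w (y + of_real r * cis (2 * pi * t)))"
   by (rule continuous_on_compose2[OF c]) (auto intro!: continuous_intros)
  moreover have "0 \<le> w m - w (y + of_real r * cis (2 * pi * t))" for t
   using m(2)[of "y + of_real r * cis (2 * pi * t)"] circle_in_disk[OF r(1,2), of "cis (2 * pi * t)"] by simp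
  ultimately have all: "\<forall>t\<in>{0..1}. w m - w (y + of_real r * cis (2 * pi * t)) = 0"
   by (subst (asm) integral_eq_0_iff) auto
  \<comment> \<open>The direction of y itself, so that the point of the small circle in this
    direction has modulus |y| + r.\<close>
  define t where "t = Arg2pi y / (2 * pi)"
  have t: "t \<in> {0..1}" using Arg2pi_ge_0[of y] Arg2pi_lt_2pi[of y] by (auto simp: t_def)
  have yc: "y = of_real (norm y) * cis (2 * pi * t)" using Arg2pi_eq[of y] by (simp add: t_def cis_conv_exp mult.commute)
  have e: "y + of_real r * cis (2 * pi * t) = of_real (norm y + r) * cis (2 * pi * t)"
   by (subst (1) yc) (simp add: distrib_right)
  have "norm (y + of_real r * cis (2 * pi * t)) = norm y + r" unfolding e norm_mult norm_of_real norm_cis using r(1) by simp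
  moreover have "y + of_real r * cis (2 * pi * t) \<in> E"
   using all t circle_in_disk[OF r(1,2), of "cis (2 * pi * t)"] by (auto simp: E_def)
  ultimately show False using y(2) r(1) by fastforce
 qed
 then have "w m \<le> e" using le wy(1) by metis
 then show ?thesis using m(2)[OF z] by simp
qed

lemma harmpoly_mean_value:
 assumes "harmpoly p" shows "p z = (LINT x|arc. p (z + of_real r * x))"
 using assms
proof induction
 case (mono c k)
 have i: "integrable arc (%x. c * (z + of_real r * x) ^ k)"
  by (intro circ_integrable_cont[OF arc_in] continuous_intros)
 have "(LINT x|arc. c * (z + of_real r * x) ^ k) = c * (z + of_real r * 0) ^ k"
  by (rule mean_value_arc) (intro continuous_intros holomorphic_intros)+
 also have "\<dots> = c * z ^ k" by simp
 finally show ?case unfolding integral_Re[OF i] by (simp only:)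
next
 case (add p q)
 have i: "integrable arc (%x. p (z + of_real r * x))" if "harmpoly p" for p
  by (intro circ_integrable_cont[OF arc_in] continuous_on_compose2[OF harmpoly_continuous[OF that, of UNIV]] continuous_intros) auto
 show ?case using add i by simp
qed

lemma harmpoly_apply: assumes "harmpoly p" shows "p (ap g 0) = (LINT x|arc. p (ap g x))"
 using assms
proof induction
 case (mono c k)
 have i: "integrable arc (%x. c * ap g x ^ k)"
  by (intro circ_integrable_cont[OF arc_in] continuous_intros) auto
 have "(LINT x|arc. c * ap g x ^ k) = c * ap g 0 ^ k"
  by (rule mean_value_arc) (intro continuous_intros holomorphic_intros apply_holomorphic)+
 then show ?case unfolding integral_Re[OF i] by (simp only:)
next
 case (add p q)
 have i: "integrable arc (%x. p (ap g x))" if "harmpoly p" for p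
  by (intro circ_integrable_cont[OF arc_in] continuous_on_compose2[OF harmpoly_continuous[OF that, of UNIV]] continuous_intros) auto
 show ?case using add i by simp
qed

lemma local_mean_value_diff:
 assumes w: "continuous_on (cball 0 1) w" "local_mean_value w" and p: "harmpoly p"
 shows "local_mean_value (%z. w z - p z)" "local_mean_value (%z. p z - w z)"
proof -
 have wd: "continuous_on disk w" using w(1) by (rule continuous_on_subset) auto
 have E: "\<forall>\<^sub>F r in at_right 0. w z - p z = (LINT x|arc. w (z + of_real r * x) - p (z + of_real r * x))
   \<and> p z - w z = (LINT x|arc. p (z + of_real r * x) - w (z + of_real r * x))" if z: "z \<in> disk" for z
 proof -
  have "\<forall>\<^sub>F r in at_right 0. w z = (LINT x|arc. w (z + of_real r * x))" using w(2) z by (simp add: local_mean_value_def)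
  moreover have "\<forall>\<^sub>F r in at_right 0. 0 < r \<and> r < 1 - norm z" using z by (intro eventually_small_radius) simp
  ultimately show ?thesis
  proof eventually_elim
   case (elim r)
   have "integrable arc (%x. w (z + of_real r * x))" "integrable arc (%x. p (z + of_real r * x))"
    using elim by (intro circ_integrable_cont[OF arc_in] continuous_on_small_circle wd harmpoly_continuous[OF p]; simp)+
   then show ?case using elim(1) harmpoly_mean_value[OF p, of z r] by simp
  qed
 qed
 show "local_mean_value (%z. w z - p z)" "local_mean_value (%z. p z - w z)"
  unfolding local_mean_value_def by (intro ballI, drule E, erule eventually_mono, simp)+
qed

text \<open>A harmonic polynomial close to w on the circle is equally close on the disk by the
  maximum principle, and for harmonic polynomials the identity is the mean value property of the
  holomorphic functions (ap g)^k.\<close>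

lemma mean_value_moebius:
 assumes w: "continuous_on (cball 0 1) w" "local_mean_value w"
 shows "w (ap g 0) = (LINT x|arc. w (ap g x))"
proof -
 have le: "\<bar>w (ap g 0) - (LINT x|arc. w (ap g x))\<bar> \<le> 2 * e" if e: "e > 0" for e
 proof -
  have wc: "continuous_on circle w" using w(1) by (rule continuous_on_subset) auto
  obtain p where p: "harmpoly p" "\<And>x. norm x = 1 ==> \<bar>w x - p x\<bar> < e" by (rule harmpoly_dense[OF wc e]) (rule that)
  have b1: "w z - p z \<le> e" if z: "norm z \<le> 1" for z
  proof (rule maximum_principle[OF _ local_mean_value_diff(1)[OF w p(1)] _ z])
   show "w x - p x \<le> e" if "norm x = 1" for x using p(2)[OF that] by linarith
  qed (rule continuous_on_diff[OF w(1) harmpoly_continuous[OF p(1)]])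
  have b2: "p z - w z \<le> e" if z: "norm z \<le> 1" for z
  proof (rule maximum_principle[OF _ local_mean_value_diff(2)[OF w p(1)] _ z])
   show "p x - w x \<le> e" if "norm x = 1" for x using p(2)[OF that] by linarith
  qed (rule continuous_on_diff[OF harmpoly_continuous[OF p(1)] w(1)])
  have b: "\<bar>w z - p z\<bar> \<le> e" if "norm z \<le> 1" for z using b1[OF that] b2[OF that] by linarith
  have c: "continuous_on circle (%x. w (ap g x))" "continuous_on circle (%x. p (ap g x))"
   by (rule continuous_on_compose2[OF w(1)] continuous_on_compose2[OF harmpoly_continuous[OF p(1), of UNIV]];
     auto intro!: continuous_intros simp: norm_apply_circle)+
  note i = circ_integrable_cont[OF arc_in c(1)] circ_integrable_cont[OF arc_in c(2)]
  have "\<bar>(LINT x|arc. p (ap g x)) - (LINT x|arc. w (ap g x))\<bar> = \<bar>LINT x|arc. p (ap g x) - w (ap g x)\<bar>"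
   using i by simp
  also have "\<dots> \<le> (LINT x|arc. \<bar>p (ap g x) - w (ap g x)\<bar>)" by (rule integral_abs_bound)
  also have "\<dots> \<le> (LINT x|arc. e)"
   using i b by (intro integral_mono) (auto simp: space_arc norm_apply_circle abs_minus_commute)
  finally have "\<bar>(LINT x|arc. p (ap g x)) - (LINT x|arc. w (ap g x))\<bar> \<le> e" by (simp add: arc.prob_space)
  moreover have "\<bar>w (ap g 0) - p (ap g 0)\<bar> \<le> e" by (rule b) (simp add: less_imp_le)
  ultimately show ?thesis using harmpoly_apply[OF p(1), of g] by linarith
 qed
 show ?thesis
 proof (rule ccontr)
  assume "w (ap g 0) \<noteq> (LINT x|arc. w (ap g x))"
  then show False using le[of "\<bar>w (ap g 0) - (LINT x|arc. w (ap g x))\<bar> / 4"] by auto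
 qed
qed

lemma integral_push_arc_poisson:
 assumes u: "u \<in> borel_measurable (borel_of circ)"
 shows "(LINT x|arc. u (ap g x)) = (LINT x|arc. poisson (ap g 0) x * (u x :: real))"
proof -
 have "(LINT x|arc. u (ap g x)) = (LINT x|push g arc. u x)" by (rule integral_push[OF arc_in u, symmetric])
 also have "\<dots> = (LINT x|arc. poisson (ap g 0) x *\<^sub>R u x)"
  unfolding push_arc_density
  by (rule integral_density[OF circle_measurable[OF arc_in u]])
   (auto intro!: circle_measurable[OF arc_in] borel_circ_cont poisson_continuous simp: poisson_nonneg)
 finally show ?thesis by simp
qed

lemma integral_poisson: "norm z < 1 ==> (LINT x|arc. poisson z x) = 1"
 using integral_push_arc_poisson[of "%_. 1"] ex_apply_zero[of z] by (auto simp: arc.prob_space)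

text \<open>The dilated function z |-> h (r * z) is continuous up to the circle, so the mean value
  formula along g applies to it, with g chosen so that g(0) = z.\<close>

lemma harmonic_dilate:
 assumes h: "continuous_on disk h" "local_mean_value h" and r: "0 < r" "r < 1" and z: "norm z < 1"
 shows "h (of_real r * z) = (LINT x|arc. poisson z x * h (of_real r * x))"
proof -
 let ?w = "%z. h (of_real r * z)"
 have in_disk: "norm (of_real r * y) < 1" if "norm y \<le> 1" for y :: complex
 proof -
  have "norm (of_real r * y) \<le> r * 1" using that r by (simp add: norm_mult mult_left_le)
  then show ?thesis using r by simp
 qed
 have c: "continuous_on (cball 0 1) ?w"
  by (rule continuous_on_compose2[OF h(1)]) (use in_disk in \<open>auto intro!: continuous_intros\<close>)
 have "local_mean_value ?w"
  unfolding local_mean_value_def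
 proof
  fix y :: complex assume "y \<in> disk"
  then have "of_real r * y \<in> disk" using in_disk[of y] by auto
  then have "\<forall>\<^sub>F s in at_right 0. h (of_real r * y) = (LINT x|arc. h (of_real r * y + of_real s * x))"
   using h(2) by (simp add: local_mean_value_def)
  then obtain b where b: "b > 0" "\<And>s. 0 < s ==> s < b ==> h (of_real r * y) = (LINT x|arc. h (of_real r * y + of_real s * x))"
   unfolding eventually_at_right_field by blast
  have "h (of_real r * y) = (LINT x|arc. h (of_real r * (y + of_real s * x)))" if "0 < s" "s < b / r" for s
  proof -
   have "0 < r * s" "r * s < b" using that r by (auto simp: field_simps)
   then have "h (of_real r * y) = (LINT x|arc. h (of_real r * y + of_real (r * s) * x))" by (rule b(2))
   then show ?thesis by (simp add: distrib_left mult.assoc)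
  qed
  then show "\<forall>\<^sub>F s in at_right 0. h (of_real r * y) = (LINT x|arc. h (of_real r * (y + of_real s * x)))"
   unfolding eventually_at_right_field using b(1) r by (intro exI[of _ "b / r"]) auto
 qed
 note mv = mean_value_moebius[OF c this]
 obtain g where g: "ap g 0 = z" using ex_apply_zero[OF z] by blast
 have "?w \<in> borel_measurable (borel_of circ)"
  by (intro borel_circ_cont continuous_on_subset[OF c]) auto
 from integral_push_arc_poisson[OF this, of g] mv[of g] show ?thesis by (simp add: g)
qed

section \<open>Boundary values of bounded harmonic functions\<close>

lemma prob_cluster_point:
 assumes "\<And>n :: nat. nu n \<in> probs"
 obtains mu where "mu \<in> probs" "\<And>N. mu \<in> prob_topology circ closure_of (nu ` {N..})"
proof -
 let ?T = "prob_topology circ"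
 have "compactin ?T probs" using compact_prob_topology[OF compact_circ Hausdorff_circ] by (simp add: compact_space_def)
 moreover have "probs \<inter> \<Inter>F \<noteq> {}" if F: "finite F" "F \<subseteq> range (%N. ?T closure_of (nu ` {N..}))" for F
 proof -
  obtain I where I: "finite I" "F = (%N. ?T closure_of (nu ` {N..})) ` I" using finite_subset_image[OF F] by blast
  obtain M where M: "\<forall>N\<in>I. N \<le> M" using I(1) finite_nat_set_iff_bounded_le by blast
  have "nu M \<in> ?T closure_of (nu ` {N..})" if "N \<in> I" for N
   using closure_of_subset[of "nu ` {N..}" ?T] assms M that by auto
  then show ?thesis using assms[of M] by (auto simp: I(2))
 qed
 ultimately have "probs \<inter> \<Inter>(range (%N. ?T closure_of (nu ` {N..}))) \<noteq> {}"
  unfolding compactin_fip by (auto simp: closedin_closure_of)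
 then show ?thesis using that by auto
qed

lemma closure_integral:
 assumes "mu \<in> prob_topology circ closure_of S" "f \<in> cfun circ" "closed K" "\<And>nu. nu \<in> S ==> (LINT x|nu. f x) \<in> K"
  "S \<subseteq> probs"
 shows "(LINT x|mu. f x) \<in> K"
proof -
 have "closedin (prob_topology circ) {nu \<in> topspace (prob_topology circ). (LINT x|nu. f x) \<in> K}"
  using assms(3) by (intro closedin_continuous_map_preimage[OF continuous_map_integral[OF assms(2)]]) simp
 moreover have "S \<subseteq> {nu \<in> topspace (prob_topology circ). (LINT x|nu. f x) \<in> K}" using assms(4,5) by auto
 ultimately show ?thesis using closure_of_minimal assms(1) by blast
qed

text \<open>The bound for continuous functions passes to compact sets through the functions max 0 (1
  - n * distance), which decrease to the indicator, and to Borel sets by inner regularity.\<close>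

lemma dominated_measure:
 assumes mu: "mu \<in> probs" and C: "0 \<le> C"
  and le: "\<And>f. f \<in> cfun circ ==> (\<And>x. norm x = 1 ==> 0 \<le> f x) ==> (LINT x|mu. f x) \<le> C * (LINT x|arc. f x)"
  and A: "A \<in> sets (borel_of circ)"
 shows "measure mu A \<le> C * measure arc A"
proof -
 interpret prob_space mu using probsD(1)[OF mu] .
 have S: "sets mu = sets (borel_of circ)" "space mu = circle" using probsD[OF mu] by auto
 have K: "measure mu K \<le> C * measure arc K" if K: "compactin circ K" for K
 proof (cases "K = {}")
  case False
  have Kc: "K \<subseteq> circle" "closed K" using K by (auto simp: compactin_subtopology compact_imp_closed)
  have Ks: "K \<in> sets (borel_of circ)" by (rule closedin_borel_of) (rule compactin_imp_closedin[OF Hausdorff_circ K])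
  define f where "f n x = max 0 (1 - real n * infdist x K)" for n x
  have fc: "f n \<in> cfun circ" for n
   unfolding cfun_circ f_def by (intro continuous_intros continuous_on_infdist)
  have f01: "0 \<le> f n x" "f n x \<le> 1" for n x by (auto simp: f_def infdist_nonneg)
  have f1: "f n x = 1" if "x \<in> K" for n x using that by (simp add: f_def)
  have lim: "(%n. f n x) \<longlonglongrightarrow> indicator K x" for x
  proof (cases "x \<in> K")
   case False
   then have "infdist x K > 0" using in_closed_iff_infdist_zero[OF Kc(2) \<open>K \<noteq> {}\<close>, of x] infdist_nonneg[of x K] by simp
   then obtain N where N: "1 < real N * infdist x K" using reals_Archimedean3 by blast
   have "\<forall>\<^sub>F n in sequentially. f n x = 0"
    using eventually_ge_at_top[of N]
   proof eventually_elim
    case (elim n)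
    then have "real N * infdist x K \<le> real n * infdist x K" by (intro mult_right_mono infdist_nonneg) simp
    then show ?case using N by (simp add: f_def)
   qed
   then show ?thesis using False by (simp add: tendsto_eventually)
  qed (simp add: f1)
  have "(%n. LINT x|arc. f n x) \<longlonglongrightarrow> (LINT x|arc. indicator K x)"
  proof (rule integral_dominated_convergence[where w = "%_. 1"])
   show "indicator K \<in> borel_measurable arc" using Ks by (intro borel_measurable_indicator) (simp add: sets_arc)
  qed (use lim f01 cfun_measurable_prob[OF arc_in fc] in auto)
  then have "(%n. C * (LINT x|arc. f n x)) \<longlonglongrightarrow> C * measure arc K"
   using Ks Kc by (intro tendsto_mult_left) (simp add: space_arc Int_absorb2)
  moreover have "measure mu K \<le> C * (LINT x|arc. f n x)" for n
  proof -
   have "measure mu K = (LINT x|mu. indicator K x)" using Kc by (simp add: S Int_absorb2)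
   also have "\<dots> \<le> (LINT x|mu. f n x)"
   proof (rule integral_mono)
    show "integrable mu (indicator K :: _ => real)"
     using Ks by (intro integrable_const_bound[of _ 1] borel_measurable_indicator) (auto simp: S)
    show "integrable mu (f n)" by (rule cfun_integrable[OF compact_circ mu fc])
   qed (use f1 f01 in \<open>auto split: split_indicator\<close>)
   also have "\<dots> \<le> C * (LINT x|arc. f n x)" by (rule le[OF fc f01(1)])
   finally show ?thesis .
  qed
  ultimately show ?thesis by (intro LIMSEQ_le_const) auto
 qed simp
 show ?thesis
 proof (rule field_le_epsilon)
  fix e :: real assume e: "0 < e"
  then obtain K where K': "K \<subseteq> A" "compactin circ K" "measure mu (A - K) < e"
   using mu A unfolding prob_measures_def by blast
  have Ks: "K \<in> sets (borel_of circ)" by (rule closedin_borel_of) (rule compactin_imp_closedin[OF Hausdorff_circ K'(2)])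
  have "measure mu A = measure mu K + measure mu (A - K)"
   using finite_measure_Diff[of A K] A Ks K'(1) by (simp add: S)
  also have "\<dots> \<le> C * measure arc K + e" using K[OF K'(2)] K'(3) by simp
  also have "C * measure arc K \<le> C * measure arc A"
   using A C K'(1) by (intro mult_left_mono arc.finite_measure_mono) (auto simp: sets_arc)
  finally show "measure mu A \<le> C * measure arc A + e" by simp
 qed
qed

text \<open>A Radon-Nikodym density exists and is at most C almost everywhere; truncating it at C
  makes the bounds hold at every point.\<close>

lemma dominated_density:
 assumes mu: "mu \<in> probs" and C: "0 \<le> C"
  and le: "\<And>A. A \<in> sets (borel_of circ) ==> measure mu A \<le> C * measure arc A"
 obtains w :: "complex => real" where "w \<in> borel_measurable (borel_of circ)" "\<And>x. 0 \<le> w x" "\<And>x. w x \<le> C"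
  "mu = density arc (%x. ennreal (w x))"
proof -
 interpret prob_space mu using probsD(1)[OF mu] .
 have S: "sets mu = sets (borel_of circ)" using probsD[OF mu] by auto
 have "absolutely_continuous arc mu"
  unfolding absolutely_continuous_def
 proof
  fix N assume N: "N \<in> null_sets arc"
  then have "measure arc N = 0" "N \<in> sets (borel_of circ)" by (auto simp: null_sets_def measure_def sets_arc)
  then show "N \<in> null_sets mu" using le[of N] measure_nonneg[of mu N] by (auto simp: null_sets_def S emeasure_eq_measure)
 qed
 then obtain f where f: "f \<in> borel_measurable arc" "density arc f = mu"
  using arc.Radon_Nikodym[of mu] S sets_arc by auto
 \<comment> \<open>The threshold must exceed C strictly: on the set where f is larger, the mass
   would be at least (C + 1 / (k + 1)) times and at most C times the arc measure, which forces a
   null set.\<close>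
 have fb: "AE x in arc. f x \<le> ennreal (C + 1 / real (Suc k))" for k
 proof -
  let ?c = "C + 1 / real (Suc k)"
  define A where "A = {x \<in> space arc. ennreal ?c < f x}"
  have A: "A \<in> sets arc" unfolding A_def using f(1) by measurable
  have c: "0 \<le> ?c" using C by (simp add: add_nonneg_nonneg)
  have "ennreal (?c * measure arc A) = (\<integral>\<^sup>+x. ennreal ?c * indicator A x \<partial>arc)"
   using A c by (simp add: nn_integral_cmult_indicator arc.emeasure_eq_measure ennreal_mult)
  also have "\<dots> \<le> (\<integral>\<^sup>+x. f x * indicator A x \<partial>arc)"
   by (rule nn_integral_mono) (auto simp: A_def split: split_indicator)
  also have "\<dots> = emeasure mu A" using f A by (auto simp: emeasure_density)
  also have "\<dots> \<le> ennreal (C * measure arc A)" using le[of A] A by (simp add: sets_arc emeasure_eq_measure ennreal_leI)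
  finally have "?c * measure arc A \<le> C * measure arc A" using C by (subst (asm) ennreal_le_iff) auto
  then have "measure arc A = 0" using measure_nonneg[of arc A] by (simp add: field_simps) (smt (verit) divide_nonneg_nonneg mult_nonneg_nonneg of_nat_0_le_iff)?
  then have "AE x in arc. x \<notin> A" using A by (simp add: arc.prob_eq_0[symmetric])
  then show ?thesis using AE_space by eventually_elim (auto simp: A_def not_less)
 qed
 then have "AE x in arc. \<forall>k. f x \<le> ennreal (C + 1 / real (Suc k))" by (simp add: AE_all_countable)
 then have fC: "AE x in arc. f x \<le> ennreal C"
 proof eventually_elim
  case (elim x)
  show ?case
  proof (rule ennreal_le_epsilon)
   fix e :: real assume "0 < e"
   then obtain k where "1 / real (Suc k) < e" using nat_approx_posE by blast
   then have "ennreal (C + 1 / real (Suc k)) \<le> ennreal C + ennreal e"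
    using C \<open>0 < e\<close> by (simp flip: ennreal_plus add: ennreal_leI)
   then show "f x \<le> ennreal C + ennreal e" using elim order_trans by blast
  qed
 qed
 define w where "w x = min (enn2real (f x)) C" for x
 have fm: "f \<in> borel_measurable (borel_of circ)" using f(1) measurable_cong_sets[OF sets_arc refl] by blast
 have wm: "w \<in> borel_measurable (borel_of circ)" unfolding w_def using fm by measurable
 show ?thesis
 proof (rule that[OF wm])
  show "0 \<le> w x" "w x \<le> C" for x using C by (auto simp: w_def)
  have "AE x in arc. f x = ennreal (w x)"
   using fC
  proof eventually_elim
   case (elim x)
   then have "f x < top" by (simp add: order_le_less_trans)
   then have "f x = ennreal (enn2real (f x))" by simp
   moreover have "enn2real (f x) \<le> C" using elim C by (metis enn2real_leI)
   ultimately show ?case by (simp add: w_def min_def)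
  qed
  then have "density arc f = density arc (%x. ennreal (w x))"
   using f(1) circle_measurable[OF arc_in wm] by (intro density_cong) auto
  then show "mu = density arc (%x. ennreal (w x))" using f(2) by simp
 qed
qed

lemma density_arc_in:
 assumes w: "w \<in> borel_measurable (borel_of circ)" "\<And>x. norm x = 1 ==> 0 \<le> w x" and b: "\<And>x. norm x = 1 ==> w x \<le> B"
  and i: "(LINT x|arc. w x) = 1"
 shows "density arc (%x. ennreal (w x)) \<in> probs"
  and "f \<in> borel_measurable (borel_of circ) ==>
   (LINT x|density arc (%x. ennreal (w x)). f x) = (LINT x|arc. w x *\<^sub>R (f x :: 'b::{banach, second_countable_topology}))"
proof -
 have wi: "integrable arc w" by (rule circle_integrable[OF arc_in w(1), of B]) (use w(2) b in auto)
 have w0: "AE x in arc. 0 \<le> w x" using w(2) by (auto intro!: AE_I2 simp: space_arc)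
 have "(\<integral>\<^sup>+x. ennreal (w x) \<partial>arc) = 1" using nn_integral_eq_integral[OF wi w0] i by simp
 then have "prob_space (density arc (%x. ennreal (w x)))"
  using wi by (intro prob_spaceI) (simp add: emeasure_density space_arc[symmetric] cong: nn_integral_cong)
 then show "density arc (%x. ennreal (w x)) \<in> probs" by (simp add: prob_measures_circ sets_arc)
 show "(LINT x|density arc (%x. ennreal (w x)). f x) = (LINT x|arc. w x *\<^sub>R f x)" if "f \<in> borel_measurable (borel_of circ)" for f :: "complex => 'b"
  by (rule integral_density[OF circle_measurable[OF arc_in that] circle_measurable[OF arc_in w(1)] w0])
qed

lemma measurable_extend_circle:
 assumes "w \<in> borel_measurable (borel_of circ)"
 shows "(%x. if x \<in> circle then w x else (0 :: real)) \<in> borel_measurable borel"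
proof -
 have "w \<in> borel_measurable (restrict_space borel circle)" using assms measurable_cong_sets[OF sets_borel_circ refl] by blast
 then have "(%x. indicator circle x *\<^sub>R w x) \<in> borel_measurable borel"
  by (subst (asm) borel_measurable_restrict_space_iff) auto
 moreover have "(%x. indicator circle x *\<^sub>R w x) = (%x. if x \<in> circle then w x else 0)" by (auto simp: fun_eq_iff)
 ultimately show ?thesis by simp
qed

text \<open>The dilates h (r n * x), shifted and scaled, are probability densities with a common
  bound. A weak-star cluster point of these measures obeys the same bound, so it has a bounded
  density, and undoing the normalisation yields the boundary function.\<close>

lemma fatou:
 assumes h: "harmonic_on_disk h" "bounded (h ` disk)"
 obtains u B where "u \<in> borel_measurable borel" "\<And>x. \<bar>u x\<bar> \<le> B"
  "\<And>g. h (ap g 0) = (LINT x|arc. u (ap g x))"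
proof -
 have hc: "continuous_on disk h" "local_mean_value h" using h(1) by (auto simp: harmonic_on_disk_iff)
 obtain B0 where "\<forall>x\<in>h ` disk. norm x \<le> B0" using h(2) unfolding bounded_iff by blast
 then have B0: "\<bar>h z\<bar> \<le> B0" if "norm z < 1" for z using that by simp
 \<comment> \<open>One more than the bound of h, so that h + B is positive throughout and its value
   \<open>c\<close> at 0, which is the total mass of every dilate, can be divided out.\<close>
 define B where "B = B0 + 1"
 have hB: "\<bar>h z\<bar> < B" if "norm z < 1" for z using B0[OF that] by (simp add: B_def)
 define c where "c = h 0 + B"
 have c: "c > 0" using hB[of 0] by (simp add: c_def)
 have B: "B > 0" using hB[of 0] by simp
 define r where "r n = 1 - 1 / real (n + 2)" for n
 have r: "0 < r n" "r n < 1" for n by (auto simp: r_def field_simps)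
 have rd: "norm (of_real (r n) * x) < 1" if "norm x \<le> 1" for n and x :: complex
 proof -
  have "norm (of_real (r n) * x) \<le> r n * 1" using that r[of n] by (simp add: norm_mult mult_left_le)
  then show ?thesis using r(2)[of n] by simp
 qed
 define v where "v n x = (h (of_real (r n) * x) + B) / c" for n x
 have vc: "continuous_on circle (v n)" for n
  unfolding v_def using c rd
  by (intro continuous_intros continuous_on_compose2[OF hc(1), of circle "%x. of_real (r n) * x"]) auto
 have vb: "0 \<le> v n x" "v n x \<le> 2 * B / c" if "norm x = 1" for n x
  using hB[OF rd[of x n]] that c by (auto simp: v_def divide_simps)
 have dil: "(LINT x|arc. poisson z x * v n x) = (h (of_real (r n) * z) + B) / c" if z: "norm z < 1" for z n
 proof -
  have i: "integrable arc (%x. poisson z x * h (of_real (r n) * x))" "integrable arc (poisson z)"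
   using rd by (intro circ_integrable_cont[OF arc_in] continuous_on_mult poisson_continuous[OF z]
     continuous_on_compose2[OF hc(1), of circle "%x. of_real (r n) * x"] continuous_intros; force)+
  have "(LINT x|arc. poisson z x * v n x) = (LINT x|arc. (poisson z x * h (of_real (r n) * x) + B * poisson z x) / c)"
   by (intro Bochner_Integration.integral_cong) (auto simp: v_def field_simps)
  also have "\<dots> = (h (of_real (r n) * z) + B) / c"
   using i integral_poisson[OF z] harmonic_dilate[OF hc r[of n] z] by simp
  finally show ?thesis .
 qed
 have v1: "(LINT x|arc. v n x) = 1" for n
 proof -
  have "(LINT x|arc. v n x) = (LINT x|arc. poisson 0 x * v n x)"
   by (rule Bochner_Integration.integral_cong) (auto simp: poisson_def space_arc)
  then show ?thesis using dil[of 0 n] c by (simp add: c_def)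
 qed
 define nu where "nu n = density arc (%x. ennreal (v n x))" for n
 have nu: "nu n \<in> probs" for n
  unfolding nu_def by (rule density_arc_in(1)[OF borel_circ_cont[OF vc] _ _ v1]) (rule vb, assumption)+
 have nui: "(LINT x|nu n. f x) = (LINT x|arc. v n x * f x)" if "continuous_on circle f" for f :: "complex => real" and n
 proof -
  have "(LINT x|nu n. f x) = (LINT x|arc. v n x *\<^sub>R f x)"
   unfolding nu_def
   by (rule density_arc_in(2)[OF borel_circ_cont[OF vc] _ _ v1 borel_circ_cont[OF that]]) (rule vb, assumption)+
  then show ?thesis by simp
 qed
 obtain mu where mu: "mu \<in> probs" "\<And>N. mu \<in> prob_topology circ closure_of (nu ` {N..})"
  by (rule prob_cluster_point[of nu, OF nu]) (rule that)
 let ?C = "2 * B / c"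
 have C: "0 \<le> ?C" using B c by simp
 have dom: "(LINT x|mu. f x) \<le> ?C * (LINT x|arc. f x)" if f: "f \<in> cfun circ" "\<And>x. norm x = 1 ==> 0 \<le> f x" for f
 proof -
  have fc: "continuous_on circle f" using f(1) by (simp add: cfun_circ)
  have "(LINT x|mu. f x) \<in> {..?C * (LINT x|arc. f x)}"
  proof (rule closure_integral[OF mu(2)[of 0] f(1)])
   fix nu' assume "nu' \<in> nu ` {0..}"
   then obtain n where n: "nu' = nu n" by blast
   have "(LINT x|arc. v n x * f x) \<le> (LINT x|arc. ?C * f x)"
    by (intro integral_mono circ_integrable_cont[OF arc_in] continuous_on_mult vc fc continuous_on_const mult_right_mono vb f(2))
     (simp_all add: space_arc)
   then show "(LINT x|nu'. f x) \<in> {..?C * (LINT x|arc. f x)}" by (simp add: n nui[OF fc])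
  qed (use nu in auto)
  then show ?thesis by simp
 qed
 obtain w where w: "w \<in> borel_measurable (borel_of circ)" "\<And>x. 0 \<le> w x" "\<And>x. w x \<le> ?C" "mu = density arc (%x. ennreal (w x))"
  by (rule dominated_density[OF mu(1) C dominated_measure[OF mu(1) C dom]]) (assumption | rule that)+
 \<comment> \<open>Undoes the normalisation (h + B) / c; the value 0 off the circle makes the
   function Borel on the plane.\<close>
 define u where "u x = (if x \<in> circle then c * w x - B else 0)" for x
 have um: "u \<in> borel_measurable borel" unfolding u_def using w(1) by (intro measurable_extend_circle) simp
 have ub: "\<bar>u x\<bar> \<le> 3 * B" for x
 proof -
  have "0 \<le> c * w x" "c * w x \<le> 2 * B" using c w(2,3)[of x] by (auto simp: field_simps)
  then show ?thesis using B by (auto simp: u_def abs_if)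
 qed
 have rep: "h z = (LINT x|arc. poisson z x * u x)" if z: "norm z < 1" for z
 proof -
  note pc = poisson_continuous[OF z]
  have "(%n. of_real (r n) * z) \<longlonglongrightarrow> of_real (1 - 0) * z"
   unfolding r_def by (intro tendsto_mult tendsto_of_real tendsto_diff tendsto_const LIMSEQ_ignore_initial_segment[OF lim_1_over_n])
  then have "(%n. (h (of_real (r n) * z) + B) / c) \<longlonglongrightarrow> (h z + B) / c"
   using z rd[of z] c by (intro tendsto_divide tendsto_add tendsto_const continuous_on_tendsto_compose[OF hc(1)]) auto
  then have lim: "(%n. LINT x|nu n. poisson z x) \<longlonglongrightarrow> (h z + B) / c"
   using dil[OF z] by (simp add: nui[OF pc] mult.commute)
  \<comment> \<open>Only a cluster point is available, but the integrals of the Poisson kernel along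
    the sequence converge, so the cluster point must give their limit.\<close>
  have "(LINT x|mu. poisson z x) = (h z + B) / c"
  proof (rule ccontr)
   let ?L = "(h z + B) / c"
   assume ne: "(LINT x|mu. poisson z x) \<noteq> ?L"
   define e where "e = \<bar>(LINT x|mu. poisson z x) - ?L\<bar> / 2"
   have e: "e > 0" using ne by (simp add: e_def)
   obtain N where "\<forall>n\<ge>N. norm ((LINT x|nu n. poisson z x) - ?L) < e" using LIMSEQ_D[OF lim e] by blast
   then have N: "(LINT x|nu n. poisson z x) \<in> cball ?L e" if "n \<ge> N" for n
    using that by (auto simp: dist_real_def abs_minus_commute less_imp_le)
   have "(LINT x|mu. poisson z x) \<in> cball ?L e"
    by (rule closure_integral[OF mu(2)[of N]]) (use N nu pc in \<open>auto simp: cfun_circ\<close>)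
   then show False using e by (simp add: e_def dist_real_def abs_minus_commute)
  qed
  moreover have "(LINT x|mu. poisson z x) = (LINT x|arc. w x * poisson z x)"
   using integral_density[OF circle_measurable[OF arc_in borel_circ_cont[OF pc]] circle_measurable[OF arc_in w(1)]] w(2)
   by (simp add: w(4))
  moreover have "(LINT x|arc. poisson z x * u x) = (LINT x|arc. c * (w x * poisson z x) - B * poisson z x)"
   by (intro Bochner_Integration.integral_cong) (auto simp: u_def space_arc algebra_simps)
  moreover have "integrable arc (%x. w x * poisson z x)" 
  proof (rule Bochner_Integration.integrable_bound[of _ "%x. ?C * poisson z x"])
   show "integrable arc (%x. ?C * poisson z x)"
    by (intro circ_integrable_cont[OF arc_in] continuous_on_mult continuous_on_const pc)
   show "(%x. w x * poisson z x) \<in> borel_measurable arc"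
    by (intro borel_measurable_times circle_measurable[OF arc_in] w(1) borel_circ_cont pc)
   show "AE x in arc. norm (w x * poisson z x) \<le> norm (?C * poisson z x)"
   proof (rule AE_I2)
    fix x
    have "\<bar>w x\<bar> \<le> \<bar>?C\<bar>" using w(2,3)[of x] by linarith
    then show "norm (w x * poisson z x) \<le> norm (?C * poisson z x)"
     unfolding real_norm_def abs_mult[of _ "poisson z x"] by (rule mult_right_mono) simp
   qed
  qed
  moreover have "integrable arc (poisson z)" by (rule circ_integrable_cont[OF arc_in pc])
  ultimately have "(LINT x|arc. poisson z x * u x) = c * ((h z + B) / c) - B * 1" by (simp add: integral_poisson[OF z])
  then show ?thesis using c by simp
 qed
 show ?thesis
 proof (rule that[OF um ub])
  fix g
  show "h (ap g 0) = (LINT x|arc. u (ap g x))"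
   using rep[of "ap g 0"] integral_push_arc_poisson[OF measurable_borel_circ[OF um], of g] by simp
 qed
qed

section \<open>Poisson integrals of bounded functions are harmonic\<close>

lemma poisson_le:
 assumes "norm z \<le> rho" "rho < 1" "norm x = 1"
 shows "poisson z x \<le> 1 / (1 - rho)\<^sup>2"
proof -
 have "1 - rho \<le> norm (x - z)" using norm_triangle_ineq2[of x z] assms by simp
 then have "(1 - rho)\<^sup>2 \<le> (norm (x - z))\<^sup>2" using assms by (intro power_mono) auto
 then show ?thesis unfolding poisson_def using assms by (intro frac_le) auto
qed

text \<open>In its disk variable the kernel is the real part of the holomorphic function (x + w) /
  (x - w).\<close>

lemma poisson_mean_value:
 assumes x: "norm x = 1" and r: "0 < r" "r < 1 - norm z"
 shows "(LINT y|arc. poisson (z + of_real r * y) x) = poisson z x"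
proof -
 have P: "poisson w x = Re ((x + w) / (x - w))" if "norm w < 1" for w
 proof -
  have "x - w \<noteq> 0" using that x by auto
  have "(x + w) / (x - w) = (x + w) * cnj (x - w) / (of_real ((norm (x - w))\<^sup>2))"
   by (metis complex_div_cnj of_real_power)
  moreover have "Re ((x + w) * cnj (x - w)) = 1 - (norm w)\<^sup>2"
  proof -
   have "Re ((x + w) * cnj (x - w)) = (Re x)\<^sup>2 + (Im x)\<^sup>2 - ((Re w)\<^sup>2 + (Im w)\<^sup>2)" by (simp add: algebra_simps power2_eq_square)
   then show ?thesis by (metis cmod_power2 x one_power2)
  qed
  ultimately show ?thesis by (simp add: poisson_def Re_divide_of_real)
 qed
 have d: "norm (z + of_real r * y) < 1" if "norm y \<le> 1" for y by (rule circle_in_disk[OF r that])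
 then have nz: "x - (z + of_real r * y) \<noteq> 0" if "norm y \<le> 1" for y using x that by fastforce
 let ?f = "%y. (x + (z + of_real r * y)) / (x - (z + of_real r * y))"
 have "continuous_on (cball 0 1) ?f" using nz by (intro continuous_intros) auto
 note fc = this
 moreover have "?f holomorphic_on disk" using nz by (intro holomorphic_intros) (auto simp: less_imp_le)
 ultimately have "(LINT y|arc. ?f y) = (x + z) / (x - z)" using mean_value_arc[of ?f] by simp
 moreover have "integrable arc ?f" by (rule circ_integrable_cont[OF arc_in continuous_on_subset[OF fc]]) auto
 moreover have "(LINT y|arc. poisson (z + of_real r * y) x) = (LINT y|arc. Re (?f y))"
  by (intro Bochner_Integration.integral_cong) (use d in \<open>auto simp: space_arc intro!: P\<close>)
 ultimately show ?thesis using r P[of z] integral_Re[of arc ?f] by simp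
qed

text \<open>Continuity is dominated convergence, the kernel being bounded uniformly on smaller
  disks; the mean value property is that of the kernel, carried through the integral by
  Fubini.\<close>

lemma poisson_harmonic:
 assumes u: "u \<in> borel_measurable borel" "\<And>x. \<bar>u x\<bar> \<le> B"
 defines "h \<equiv> restrict (%z. LINT x|arc. poisson z x * u x) disk"
 shows "harmonic_on_disk h" "\<And>z. norm z < 1 ==> \<bar>h z\<bar> \<le> B"
  "\<And>g. h (ap g 0) = (LINT x|arc. u (ap g x))"
proof -
 have um: "u \<in> borel_measurable arc" by (rule circle_measurable[OF arc_in measurable_borel_circ[OF u(1)]])
 have pm: "poisson z \<in> borel_measurable arc" if "norm z < 1" for z
  by (rule circle_measurable[OF arc_in borel_circ_cont[OF poisson_continuous[OF that]]])
 have B: "0 \<le> B" using u(2)[of 0] by simp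
 have bd: "norm (poisson z x * u x) \<le> 1 / (1 - rho)\<^sup>2 * B" if "norm z \<le> rho" "rho < 1" "norm x = 1" for z rho x
 proof -
  have "poisson z x * \<bar>u x\<bar> \<le> 1 / (1 - rho)\<^sup>2 * B" using poisson_le[OF that] u(2)[of x] by (intro mult_mono) auto
  then show ?thesis using poisson_nonneg[of z x] that by (simp add: abs_mult)
 qed
 show hg: "h (ap g 0) = (LINT x|arc. u (ap g x))" for g
  unfolding h_def using integral_push_arc_poisson[OF measurable_borel_circ[OF u(1)], of g] by simp
 show hb: "\<bar>h z\<bar> \<le> B" if z: "norm z < 1" for z
 proof -
  obtain g where g: "ap g 0 = z" using ex_apply_zero[OF z] by blast
  have i: "integrable arc (%x. u (ap g x))"
   by (rule arc.integrable_const_bound[of _ B])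
    (use u(2) measurable_compose[OF measurable_apply_circ[OF arc_in] measurable_borel_circ[OF u(1)]] in auto)
  have "\<bar>LINT x|arc. u (ap g x)\<bar> \<le> (LINT x|arc. \<bar>u (ap g x)\<bar>)" by (rule integral_abs_bound)
  also have "\<dots> \<le> (LINT x|arc. B)" using i u(2) by (intro integral_mono) auto
  finally show ?thesis using hg[of g] by (simp add: g arc.prob_space)
 qed
 have "continuous_on disk h"
  unfolding continuous_on_sequentially
 proof (intro allI ballI impI, elim conjE)
  fix s :: "nat => complex" and a assume a: "a \<in> disk" and s: "\<forall>n. s n \<in> disk" "s \<longlonglongrightarrow> a"
  define rho where "rho = (1 + norm a) / 2"
  have rho: "norm a < rho" "rho < 1" using a by (auto simp: rho_def)
  have "(%n. norm (s n)) \<longlonglongrightarrow> norm a" by (intro tendsto_norm s)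
  then have "\<forall>\<^sub>F n in sequentially. norm (s n) < rho" using rho(1) by (rule order_tendstoD)
  then obtain N where N: "\<And>n. n \<ge> N ==> norm (s n) < rho" unfolding eventually_sequentially by blast
  have "(%n. LINT x|arc. poisson (s (n + N)) x * u x) \<longlonglongrightarrow> (LINT x|arc. poisson a x * u x)"
  proof (rule integral_dominated_convergence[where w = "%_. 1 / (1 - rho)\<^sup>2 * B"])
   show "(%x. poisson a x * u x) \<in> borel_measurable arc" using a by (intro borel_measurable_times um pm) simp
   show "(%x. poisson (s (n + N)) x * u x) \<in> borel_measurable arc" for n using s(1) by (intro borel_measurable_times um pm) simp
   show "AE x in arc. norm (poisson (s (n + N)) x * u x) \<le> 1 / (1 - rho)\<^sup>2 * B" for n
    using N[of "n + N"] rho by (intro AE_I2 bd) (auto simp: space_arc)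
   show "AE x in arc. (%n. poisson (s (n + N)) x * u x) \<longlonglongrightarrow> poisson a x * u x"
   proof (rule AE_I2)
    fix x assume "x \<in> space arc"
    then have "x - a \<noteq> 0" using a by (auto simp: space_arc)
    then show "(%n. poisson (s (n + N)) x * u x) \<longlonglongrightarrow> poisson a x * u x"
     unfolding poisson_def by (intro tendsto_intros LIMSEQ_ignore_initial_segment[OF s(2)]) simp
   qed
  qed simp
  then have "(%n. LINT x|arc. poisson (s n) x * u x) \<longlonglongrightarrow> (LINT x|arc. poisson a x * u x)" by (rule LIMSEQ_offset)
  moreover have "(h \<circ> s) n = (LINT x|arc. poisson (s n) x * u x)" for n using s(1) by (simp add: h_def)
  moreover have "h a = (LINT x|arc. poisson a x * u x)" using a by (simp add: h_def)
  ultimately show "(h \<circ> s) \<longlonglongrightarrow> h a" by (simp add: comp_def)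
 qed
 moreover have "local_mean_value h"
  unfolding local_mean_value_def
 proof
  fix z :: complex assume "z \<in> disk"
  then have z: "norm z < 1" by simp
  show "\<forall>\<^sub>F r in at_right 0. h z = (LINT y|arc. h (z + of_real r * y))"
   using eventually_small_radius[OF z]
  proof eventually_elim
   case (elim r)
   then have r: "0 < r" "r < 1 - norm z" by auto
   have d: "norm (z + of_real r * y) \<le> norm z + r" if "norm y = 1" for y
    using norm_triangle_ineq[of z "of_real r * y"] that r by (simp add: norm_mult)
   interpret pair_prob_space arc arc ..
   have idm: "(%x. x) \<in> arc \<rightarrow>\<^sub>M borel" by (rule circle_measurable[OF arc_in borel_circ_cont[OF continuous_on_id]])
   have "(%(y, x). poisson (z + of_real r * y) x * u x) \<in> borel_measurable (borel \<Otimes>\<^sub>M borel)"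
    unfolding poisson_def using u(1) by measurable
   from measurable_compose[OF measurable_Pair[OF measurable_compose[OF measurable_fst idm] measurable_compose[OF measurable_snd idm]] this]
   have m: "(%(y, x). poisson (z + of_real r * y) x * u x) \<in> borel_measurable (arc \<Otimes>\<^sub>M arc)" by (simp add: case_prod_beta)
   have "integrable (arc \<Otimes>\<^sub>M arc) (%(y, x). poisson (z + of_real r * y) x * u x)"
   proof (rule P.integrable_const_bound[OF AE_I2 m])
    fix p assume "p \<in> space (arc \<Otimes>\<^sub>M arc)"
    then have "norm (fst p) = 1" "norm (snd p) = 1" by (auto simp: space_pair_measure space_arc)
    then show "norm (case p of (y, x) => poisson (z + of_real r * y) x * u x) \<le> 1 / (1 - (norm z + r))\<^sup>2 * B"
     using bd[OF d, of "fst p" "snd p"] r by (simp add: case_prod_beta)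
   qed
   from Fubini_integral[OF this]
   have F: "(LINT x|arc. LINT y|arc. poisson (z + of_real r * y) x * u x) = (LINT y|arc. LINT x|arc. poisson (z + of_real r * y) x * u x)" by simp
   have "(LINT y|arc. h (z + of_real r * y)) = (LINT y|arc. LINT x|arc. poisson (z + of_real r * y) x * u x)"
    by (intro Bochner_Integration.integral_cong) (use circle_in_disk[OF r] in \<open>auto simp: h_def space_arc\<close>)
   also have "\<dots> = (LINT x|arc. (LINT y|arc. poisson (z + of_real r * y) x) * u x)" unfolding F[symmetric] by simp
   also have "\<dots> = (LINT x|arc. poisson z x * u x)"
    by (intro Bochner_Integration.integral_cong) (auto simp: space_arc poisson_mean_value[OF _ r])
   also have "\<dots> = h z" using z by (simp add: h_def)
   finally show ?case by simp
  qed
 qed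
 ultimately show "harmonic_on_disk h" by (simp add: harmonic_on_disk_iff)
qed

text \<open>If every coefficient of positive order vanished, then arc length weighted by an affine
  image of u with values in [0, 2] and mean 1 would have the moments of arc length. The two measures
  would coincide, so the density would be 1 almost everywhere.\<close>

lemma nonconstant_moment:
 assumes u: "u \<in> borel_measurable borel" "\<And>x. \<bar>u x\<bar> \<le> B" and nc: "\<not> (\<exists>c :: real. AE x in arc. u x = c)"
 obtains n where "n > 0" "(LINT x|arc. of_real (u x) * x ^ n) \<noteq> (0 :: complex)"
proof -
 have "\<exists>n>0. (LINT x|arc. of_real (u x) * x ^ n) \<noteq> (0 :: complex)"
 proof (rule ccontr)
  assume "\<not> ?thesis"
  then have z: "(LINT x|arc. of_real (u x) * x ^ n) = (0 :: complex)" if "n > 0" for n using that by blast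
  define c where "c = (LINT x|arc. u x)"
  \<comment> \<open>Large enough for (u - c + K) / K to lie between 0 and 2; its mean is 1 because c
    is the mean of u.\<close>
  define K where "K = 1 + B + \<bar>c\<bar>"
  have K: "K > 0" using u(2)[of 0] by (simp add: K_def)
  define v where "v x = (u x - c + K) / K" for x
  have vm: "v \<in> borel_measurable (borel_of circ)" unfolding v_def using measurable_borel_circ[OF u(1)] by measurable
  have v0: "0 \<le> v x" "v x \<le> 2" for x using u(2)[of x] K by (auto simp: v_def K_def field_simps)
  have ui: "integrable arc u" by (rule circle_integrable[OF arc_in measurable_borel_circ[OF u(1)], of B]) (use u(2) in auto)
  have v1: "(LINT x|arc. v x) = 1" using ui K by (simp add: v_def arc.prob_space c_def)
  note D = density_arc_in[OF vm v0 v1]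
  have "density arc (%x. ennreal (v x)) = arc"
  proof (rule probs_eqI[OF D(1) arc_in])
   fix k
   have "(LINT x|density arc (%x. ennreal (v x)). x ^ k) = (LINT x|arc. v x *\<^sub>R x ^ k)"
    by (rule D(2)) (intro borel_circ_cont continuous_intros)
   also have "\<dots> = (LINT x|arc. x ^ k)"
   proof (cases "k = 0")
    case False
    have i: "integrable arc (%x. of_real (u x) * x ^ k)"
     by (rule circle_integrable[OF arc_in, of _ B])
      (use u in \<open>auto simp: norm_mult norm_power intro!: borel_measurable_times borel_measurable_of_real measurable_borel_circ\<close>)
    have j: "integrable arc (%x. x ^ k)" by (intro circ_integrable_cont[OF arc_in] continuous_intros)
    have "(LINT x|arc. v x *\<^sub>R x ^ k) = (LINT x|arc. of_real (1 / K) * (of_real (u x) * x ^ k) + of_real ((K - c) / K) * x ^ k)"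
     by (intro Bochner_Integration.integral_cong) (auto simp: v_def scaleR_conv_of_real add_divide_distrib diff_divide_distrib algebra_simps)
    also have "\<dots> = 0" using i j z[of k] False by (simp add: moment_arc)
    finally show ?thesis using False by (simp add: moment_arc)
   qed (use v1 in \<open>simp add: arc.prob_space scaleR_conv_of_real\<close>)
   finally show "(LINT x|density arc (%x. ennreal (v x)). x ^ k) = (LINT x|arc. x ^ k)" .
  qed
  then have "density arc (%x. ennreal (v x)) = density arc (%_. 1)" by (simp add: density_1)
  then have "AE x in arc. ennreal (v x) = 1"
   using circle_measurable[OF arc_in vm] by (intro arc.density_unique) auto
  then have "AE x in arc. u x = c"
  proof eventually_elim
   case (elim x)
   then have "v x = 1" using v0(1)[of x] by simp
   then show ?case using K by (simp add: v_def field_simps)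
  qed
  then show False using nc by blast
 qed
 then show ?thesis using that by blast
qed

section \<open>Essentially bounded functions and the weak* topology\<close>

lemma linf_rel_rep: "linf_rel (rep_linf F) (rep_linf F)"
 by (rule Quotient_rep_reflp[OF Quotient_linf])

lemma measurable_rep_linf [measurable]: "rep_linf F \<in> borel_measurable borel"
 using linf_rel_rep[of F] measurable_cong_sets[OF sets_haar refl] unfolding linf_rel_def by blast

lemma rep_linf_bounded:
 obtains B where "AE x in haar. \<bar>rep_linf F x\<bar> \<le> B"
 using linf_rel_rep[of F] that unfolding linf_rel_def by blast

lemma linf_relI:
 assumes "f \<in> borel_measurable borel" "AE x in haar. \<bar>f x\<bar> \<le> B"
 shows "linf_rel f f"
 using assms measurable_cong_sets[OF sets_haar refl, of borel] unfolding linf_rel_def by blast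

lemma rep_abs_linf: "linf_rel f f ==> AE x in haar. rep_linf (abs_linf f) x = f x"
 using Quotient_rep_abs[OF Quotient_linf, of f] unfolding linf_rel_def by blast

lemma abs_linf_eqI:
 assumes "linf_rel f f" "linf_rel g g" "AE x in haar. f x = g x"
 shows "abs_linf f = abs_linf g"
proof -
 have "linf_rel f g" using assms unfolding linf_rel_def by blast
 then show ?thesis using Quotient_rel[OF Quotient_linf, of f g] by blast
qed

lemma abs_rep_linf [simp]: "abs_linf (rep_linf F) = F"
 by (rule Quotient_abs_rep[OF Quotient_linf])

lemma linf_eqI: "AE x in haar. rep_linf F x = rep_linf G x ==> F = G"
 using abs_linf_eqI[OF linf_rel_rep linf_rel_rep, of F G] by simp

lemma rep_linf_add: "AE x in haar. rep_linf (F + G) x = rep_linf F x + rep_linf G x"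
proof -
 have "F + G = abs_linf (%x. rep_linf F x + rep_linf G x)"
  using plus_linf.abs_eq[OF linf_rel_rep linf_rel_rep, of F G] by simp
 then show ?thesis using rep_abs_linf[OF linf_rel_add[OF linf_rel_rep linf_rel_rep], of F G] by simp
qed

lemma rep_linf_scaleR: "AE x in haar. rep_linf (r *\<^sub>R F) x = r * rep_linf F x"
proof -
 have "r *\<^sub>R F = abs_linf (%x. r * rep_linf F x)"
  using scaleR_linf.abs_eq[OF linf_rel_rep, of r F] by simp
 then show ?thesis using rep_abs_linf[OF linf_rel_scale[OF linf_rel_rep], of r F] by simp
qed

lemma linf_rel_translate: assumes "linf_rel f f" shows "linf_rel (%x. f (x * g)) (%x. f (x * g))"
proof -
 obtain B where B: "AE x in haar. \<bar>f x\<bar> \<le> B" using assms unfolding linf_rel_def by blast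
 have [measurable]: "f \<in> borel_measurable borel" using assms measurable_cong_sets[OF sets_haar refl] unfolding linf_rel_def by blast
 show ?thesis by (rule linf_relI[OF _ AE_haar_right[OF B]]) measurable
qed

lemma rep_linf_act: "AE x in haar. rep_linf (linf_act g F) x = rep_linf F (x * g)"
 unfolding linf_act_def by (rule rep_abs_linf[OF linf_rel_translate[OF linf_rel_rep]])

lemma linf_act_abs:
 assumes "linf_rel f f" shows "linf_act g (abs_linf f) = abs_linf (%x. f (x * g))"
 unfolding linf_act_def
 by (rule abs_linf_eqI[OF linf_rel_translate[OF linf_rel_rep] linf_rel_translate[OF assms] AE_haar_right[OF rep_abs_linf[OF assms]]])

lemma integrable_haar_measurable: "integrable haar phi ==> phi \<in> borel_measurable borel"
 using borel_measurable_integrable measurable_cong_sets[OF sets_haar refl] by blast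

lemma integrable_linf:
 assumes phi: "integrable haar phi" shows "integrable haar (%x. rep_linf F x * phi x)"
proof -
 obtain B where B: "AE x in haar. \<bar>rep_linf F x\<bar> \<le> B" by (rule rep_linf_bounded)
 have [measurable]: "phi \<in> borel_measurable borel" by (rule integrable_haar_measurable[OF phi])
 show ?thesis
 proof (rule Bochner_Integration.integrable_bound[of _ "%x. B * phi x"])
  show "AE x in haar. norm (rep_linf F x * phi x) \<le> norm (B * phi x)"
   using B
  proof eventually_elim
   case (elim x)
   then have "\<bar>rep_linf F x\<bar> \<le> \<bar>B\<bar>" by linarith
   then show ?case unfolding real_norm_def abs_mult by (rule mult_right_mono) simp
  qed
 qed (use phi in simp, measurable)
qed

lemma pairing_abs:
 assumes "linf_rel f f" "integrable haar phi"
 shows "linf_pairing (abs_linf f) phi = (LINT x|haar. f x * phi x)"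
 unfolding linf_pairing_def
proof (rule integral_cong_AE)
 have [measurable]: "phi \<in> borel_measurable borel" by (rule integrable_haar_measurable[OF assms(2)])
 have [measurable]: "f \<in> borel_measurable borel" using assms measurable_cong_sets[OF sets_haar refl] unfolding linf_rel_def by blast
 show "(%x. rep_linf (abs_linf f) x * phi x) \<in> borel_measurable haar" "(%x. f x * phi x) \<in> borel_measurable haar" by measurable
 show "AE x in haar. rep_linf (abs_linf f) x * phi x = f x * phi x"
  using rep_abs_linf[OF assms(1)] by eventually_elim simp
qed

lemma pairing_add:
 assumes phi: "integrable haar phi"
 shows "linf_pairing (F + G) phi = linf_pairing F phi + linf_pairing G phi"
proof -
 have [measurable]: "phi \<in> borel_measurable borel" by (rule integrable_haar_measurable[OF phi])
 have "linf_pairing (F + G) phi = (LINT x|haar. rep_linf F x * phi x + rep_linf G x * phi x)"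
  unfolding linf_pairing_def
 proof (rule integral_cong_AE)
  show "AE x in haar. rep_linf (F + G) x * phi x = rep_linf F x * phi x + rep_linf G x * phi x"
   using rep_linf_add[of F G] by eventually_elim (simp add: distrib_right)
 qed measurable
 then show ?thesis unfolding linf_pairing_def by (simp add: integrable_linf[OF phi])
qed

lemma pairing_scaleR:
 assumes phi: "integrable haar phi" shows "linf_pairing (r *\<^sub>R F) phi = r * linf_pairing F phi"
proof -
 have [measurable]: "phi \<in> borel_measurable borel" by (rule integrable_haar_measurable[OF phi])
 have "linf_pairing (r *\<^sub>R F) phi = (LINT x|haar. r * (rep_linf F x * phi x))"
  unfolding linf_pairing_def
 proof (rule integral_cong_AE)
  show "AE x in haar. rep_linf (r *\<^sub>R F) x * phi x = r * (rep_linf F x * phi x)"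
   using rep_linf_scaleR[of r F] by eventually_elim simp
 qed measurable
 then show ?thesis unfolding linf_pairing_def by (simp add: integrable_linf[OF phi])
qed

lemma integral_haar_right:
 assumes [measurable]: "f \<in> borel_measurable borel"
 shows "(LINT x|haar. f (x * g)) = (LINT x|haar. (f x :: real))"
proof -
 have "(LINT x|haar. f x) = (LINT x|distr haar borel (%x. x * g). f x)" by (simp add: distr_haar_right)
 also have "\<dots> = (LINT x|haar. f (x * g))" by (rule integral_distr) measurable
 finally show ?thesis by simp
qed

lemma integrable_haar_right:
 assumes phi: "integrable haar (phi :: moebius => real)" shows "integrable haar (%x. phi (x * g))"
proof -
 have [measurable]: "phi \<in> borel_measurable borel" by (rule integrable_haar_measurable[OF phi])
 have "integrable (distr haar borel (%x. x * g)) phi" unfolding distr_haar_right by (rule phi)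
 then show ?thesis by (subst (asm) integrable_distr_eq) measurable
qed

lemma pairing_act:
 assumes phi: "integrable haar phi"
 shows "linf_pairing (linf_act g F) phi = linf_pairing F (%x. phi (x * ginv g))"
proof -
 have [measurable]: "phi \<in> borel_measurable borel" by (rule integrable_haar_measurable[OF phi])
 have "linf_pairing (linf_act g F) phi = (LINT x|haar. rep_linf F (x * g) * phi x)"
  unfolding linf_act_def by (rule pairing_abs[OF linf_rel_translate[OF linf_rel_rep] phi])
 also have "\<dots> = (LINT x|haar. (%y. rep_linf F y * phi (y * ginv g)) (x * g))" by simp
 also have "\<dots> = (LINT y|haar. rep_linf F y * phi (y * ginv g))" by (rule integral_haar_right) measurable
 finally show ?thesis by (simp add: linf_pairing_def)
qed

definition radius :: "nat => real" where "radius n = 1 - 1 / real (n + 2)"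

lemma radius_less: "radius n < 1" and radius_pos: "0 < radius n"
 by (auto simp: radius_def field_simps)

lemma eventually_mball: "\<forall>\<^sub>F n in sequentially. g \<in> mball (radius n)"
proof -
 have "(%n. 1 / real (n + 2)) \<longlonglongrightarrow> 0" by (rule LIMSEQ_ignore_initial_segment[OF lim_1_over_n])
 then have "radius \<longlonglongrightarrow> 1 - 0" unfolding radius_def[abs_def] by (intro tendsto_diff tendsto_const)
 then have "\<forall>\<^sub>F n in sequentially. norm (ap g 0) < radius n" by (rule order_tendstoD(1)) simp
 then show ?thesis by eventually_elim (simp add: mball_def)
qed

text \<open>The test function is the sign of the difference, cut off to a ball of finite measure;
  the balls exhaust the group.\<close>

lemma pairing_separates:
 assumes "\<And>phi. integrable haar phi ==> linf_pairing F phi = linf_pairing G phi"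
 shows "F = G"
proof (rule linf_eqI)
 define d where "d x = rep_linf F x - rep_linf G x" for x
 have dm [measurable]: "d \<in> borel_measurable borel" unfolding d_def by measurable
 have "AE x in haar. \<bar>d x\<bar> * indicator (mball (radius n)) x = 0" for n
 proof -
  let ?phi = "%x. sgn (d x) * indicator (mball (radius n)) x"
  have ib: "integrable haar (indicator (mball (radius n)) :: moebius => real)"
   using haar_ball_finite[OF radius_less] by (intro integrable_real_indicator) auto
  have "integrable haar ?phi"
  proof (rule Bochner_Integration.integrable_bound[OF ib])
   show "AE x in haar. norm (?phi x) \<le> norm (indicator (mball (radius n)) x :: real)"
    by (intro AE_I2) (auto simp: sgn_real_def split: split_indicator)
  qed measurable
  note phi = this
  have e: "\<bar>d x\<bar> * indicator (mball (radius n)) x = rep_linf F x * ?phi x - rep_linf G x * ?phi x" for x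
   by (simp add: d_def algebra_simps abs_sgn)
  have "(LINT x|haar. \<bar>d x\<bar> * indicator (mball (radius n)) x) = 0"
   unfolding e using assms[OF phi] by (simp add: integrable_linf[OF phi] linf_pairing_def)
  moreover have "integrable haar (%x. \<bar>d x\<bar> * indicator (mball (radius n)) x)"
   unfolding e by (intro Bochner_Integration.integrable_diff integrable_linf phi)
  ultimately show ?thesis by (subst (asm) integral_nonneg_eq_0_iff_AE) auto
 qed
 then have "AE x in haar. \<forall>n. \<bar>d x\<bar> * indicator (mball (radius n)) x = 0" unfolding AE_all_countable by blast
 then show "AE x in haar. rep_linf F x = rep_linf G x"
 proof eventually_elim
  case (elim x)
  obtain n where "x \<in> mball (radius n)" using eventually_mball[of x] unfolding eventually_sequentially by blast
  then show ?case using spec[OF elim, of n] by (simp add: d_def)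
 qed
qed

section \<open>The weak-star topology and the translation action\<close>

lemma topspace_weak_star [simp]: "topspace weak_star = UNIV"
proof -
 have "(UNIV :: linf set) \<in> {{F. linf_pairing F phi \<in> U} | phi U. integrable haar phi \<and> open U}"
  by (rule CollectI, rule exI[of _ "%_. 0"], rule exI[of _ UNIV]) auto
 then have "UNIV \<subseteq> \<Union> {{F. linf_pairing F phi \<in> U} | phi U. integrable haar phi \<and> open U}" by (rule Union_upper)
 then show ?thesis unfolding weak_star_def topology_generated_by_topspace by (rule top.extremum_uniqueI)
qed

lemma continuous_map_pairing:
 assumes "integrable haar phi" shows "continuous_map weak_star euclideanreal (%F. linf_pairing F phi)"
 unfolding continuous_map_def
proof (intro conjI allI impI)
 fix U :: "real set" assume "openin euclideanreal U"
 then have "{F. linf_pairing F phi \<in> U} \<in> {{F. linf_pairing F phi \<in> U} | phi U. integrable haar phi \<and> open U}"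
  using assms by auto
 then have "openin weak_star {F. linf_pairing F phi \<in> U}"
  unfolding weak_star_def by (rule topology_generated_by_Basis)
 then show "openin weak_star {F \<in> topspace weak_star. linf_pairing F phi \<in> U}" by simp
qed auto

lemma continuous_map_into_weak_star:
 assumes "\<And>phi. integrable haar phi ==> continuous_map T euclideanreal (%t. linf_pairing (f t) phi)"
 shows "continuous_map T weak_star f"
 unfolding weak_star_def
proof (rule continuous_map_generated)
 show "f x \<in> \<Union> {{F. linf_pairing F phi \<in> U} | phi U. integrable haar phi \<and> open U}" for x
  using topspace_weak_star unfolding weak_star_def topology_generated_by_topspace by auto
next
 fix W assume "W \<in> {{F. linf_pairing F phi \<in> U} | phi U. integrable haar phi \<and> open U}"
 then obtain phi U where W: "W = {F. linf_pairing F phi \<in> U}" "integrable haar phi" "open U" by blast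
 show "openin T {x \<in> topspace T. f x \<in> W}"
  using openin_continuous_map_preimage[OF assms[OF W(2)], of U] W(3) by (simp add: W(1))
qed

lemma Hausdorff_weak_star: "Hausdorff_space weak_star"
 unfolding Hausdorff_space_def
proof (intro allI impI)
 fix F G assume "F \<in> topspace weak_star \<and> G \<in> topspace weak_star \<and> F \<noteq> G"
 then obtain phi where phi: "integrable haar phi" "linf_pairing F phi \<noteq> linf_pairing G phi" using pairing_separates by blast
 obtain U V where UV: "open U" "open V" "linf_pairing F phi \<in> U" "linf_pairing G phi \<in> V" "U \<inter> V = {}"
  using hausdorff[OF phi(2)] by metis
 let ?P = "%U. {F \<in> topspace weak_star. linf_pairing F phi \<in> U}"
 have "openin weak_star (?P U)" "openin weak_star (?P V)"
  using UV by (intro openin_continuous_map_preimage[OF continuous_map_pairing[OF phi(1)]]; simp)+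
 moreover have "F \<in> ?P U" "G \<in> ?P V" "disjnt (?P U) (?P V)" using UV by (auto simp: disjnt_def)
 ultimately show "\<exists>U V. openin weak_star U \<and> openin weak_star V \<and> F \<in> U \<and> G \<in> V \<and> disjnt U V" by blast
qed

lemma tvs_weak_star: "tvs weak_star"
 unfolding tvs_def
proof (intro conjI topspace_weak_star Hausdorff_weak_star)
 show "continuous_map (prod_topology weak_star weak_star) weak_star (%(x, y). x + y)"
 proof (rule continuous_map_into_weak_star)
  fix phi :: "moebius => real" assume phi: "integrable haar phi"
  have "continuous_map (prod_topology weak_star weak_star) euclideanreal (%p. linf_pairing (fst p) phi + linf_pairing (snd p) phi)"
   using continuous_map_compose[OF continuous_map_fst continuous_map_pairing[OF phi], of weak_star]
    continuous_map_compose[OF continuous_map_snd continuous_map_pairing[OF phi], of weak_star]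
   by (intro continuous_map_add) (simp_all add: comp_def)
  then show "continuous_map (prod_topology weak_star weak_star) euclideanreal (%t. linf_pairing (case t of (x, y) => x + y) phi)"
   by (simp add: case_prod_beta pairing_add[OF phi])
 qed
 show "continuous_map (prod_topology euclideanreal weak_star) weak_star (%(r, x). r *\<^sub>R x)"
 proof (rule continuous_map_into_weak_star)
  fix phi :: "moebius => real" assume phi: "integrable haar phi"
  have "continuous_map (prod_topology euclideanreal weak_star) euclideanreal (%p. fst p * linf_pairing (snd p) phi)"
   using continuous_map_compose[OF continuous_map_snd continuous_map_pairing[OF phi], of euclideanreal]
   by (intro continuous_map_real_mult continuous_map_fst) (simp_all add: comp_def)
  then show "continuous_map (prod_topology euclideanreal weak_star) euclideanreal (%t. linf_pairing (case t of (r, x) => r *\<^sub>R x) phi)"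
   by (simp add: case_prod_beta pairing_scaleR[OF phi])
 qed
qed

lemma continuous_linf_act: "continuous_map weak_star weak_star (linf_act g)"
proof (rule continuous_map_into_weak_star)
 fix phi :: "moebius => real" assume phi: "integrable haar phi"
 show "continuous_map weak_star euclideanreal (%F. linf_pairing (linf_act g F) phi)"
  unfolding pairing_act[OF phi] by (rule continuous_map_pairing[OF integrable_haar_right[OF phi]])
qed

lemma linf_act_mix: "linf_act g (a *\<^sub>R F + b *\<^sub>R G) = a *\<^sub>R linf_act g F + b *\<^sub>R linf_act g G"
 by (rule pairing_separates) (simp add: pairing_act pairing_add pairing_scaleR integrable_haar_right)

lemma linf_act_mult: "linf_act (g * h) F = linf_act g (linf_act h F)"
 by (rule pairing_separates) (simp add: pairing_act integrable_haar_right ginv_mult mult.assoc)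

section \<open>Averages over the boundary orbit\<close>

lemma haar_ball_pos: "0 < rho ==> emeasure haar (mball rho) \<noteq> 0"
proof
 assume rho: "0 < rho" and z: "emeasure haar (mball rho) = 0"
 have "continuous_on UNIV (%g. norm (ap g 0))" by (intro continuous_intros) auto
 then have "open {g. norm (ap g 0) < rho}" by (intro open_Collect_less continuous_on_const)
 moreover have "1 \<in> {g. norm (ap g 0) < rho}" using rho by (simp add: apply_one)
 moreover have "emeasure haar {g. norm (ap g 0) < rho} \<le> emeasure haar (mball rho)"
  by (rule emeasure_mono) (auto simp: mball_def[symmetric] intro!: mball_sets, auto simp: mball_def)
 ultimately show False using haar_open_pos z by (metis empty_iff le_zero_eq)
qed

lemma measurable_apply_point [measurable]: "norm z \<le> 1 ==> (%g. ap g z) \<in> borel_measurable borel"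
 by (intro borel_measurable_continuous_onI continuous_intros) auto

lemma measurable_apply_boundary: "norm z = 1 ==> (%g. ap g z) \<in> borel \<rightarrow>\<^sub>M borel_of circ"
proof -
 assume z: "norm z = 1"
 have "(%g. ap g z) \<in> borel \<rightarrow>\<^sub>M restrict_space borel circle"
  using z by (intro measurable_restrict_space2 measurable_apply_point) (auto simp: norm_apply_circle)
 then show ?thesis using measurable_cong_sets[OF refl sets_borel_circ] by blast
qed

text \<open>The ball and Haar measure are both unchanged by left rotations, so the image on the
  circle is rotation invariant and hence arc length. This links null sets and averages on the group
  to those on the circle.\<close>

lemma distr_haar_ball:
 assumes rho: "0 < rho" "rho < 1" and z: "norm z = 1"
 shows "distr (uniform_measure haar (mball rho)) (borel_of circ) (%g. ap g z) = arc"
proof (rule rotation_invariant_arc)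
 let ?U = "uniform_measure haar (mball rho)"
 have m: "(%g. ap g z) \<in> ?U \<rightarrow>\<^sub>M borel_of circ"
  using measurable_apply_boundary[OF z] measurable_cong_sets[of ?U borel] by simp
 have "prob_space ?U" using haar_ball_pos[OF rho(1)] haar_ball_finite[OF rho(2)] by (intro prob_space_uniform_measure) auto
 then show in1: "distr ?U (borel_of circ) (%g. ap g z) \<in> probs"
  unfolding prob_measures_circ using prob_space.prob_space_distr[OF _ m] by simp
 fix om :: complex assume om: "norm om = 1"
 have mr: "ap (rot om) \<in> borel_of circ \<rightarrow>\<^sub>M borel_of circ"
  using measurable_apply_circ[OF in1, of "rot om"] measurable_cong_sets[OF probsD(3)[OF in1] refl] by blast
 show "push (rot om) (distr ?U (borel_of circ) (%g. ap g z)) = distr ?U (borel_of circ) (%g. ap g z)"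
  unfolding push_forward_def
 proof (rule measure_eqI)
  fix A assume "A \<in> sets (distr (distr ?U (borel_of circ) (%g. ap g z)) (borel_of circ) (ap (rot om)))"
  then have A: "A \<in> sets (borel_of circ)" by simp
  let ?S = "{g \<in> mball rho. ap g z \<in> A}"
  have S: "?S \<in> sets borel"
   using sets.Int[OF mball_sets[of rho] measurable_sets[OF measurable_apply_boundary[OF z] A]] by (simp add: vimage_def Int_def)
  have e1: "emeasure (distr ?U (borel_of circ) (%g. ap g z)) A = emeasure haar ?S / emeasure haar (mball rho)"
   using A measurable_sets[OF measurable_apply_boundary[OF z] A] by (subst emeasure_distr[OF m A]) (simp add: vimage_def Int_def)
  have "emeasure (distr (distr ?U (borel_of circ) (%g. ap g z)) (borel_of circ) (ap (rot om))) A
    = emeasure (distr ?U (borel_of circ) (ap (rot om) \<circ> (%g. ap g z))) A"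
   by (subst distr_distr[OF mr m]) (rule refl)
  also have "\<dots> = emeasure ?U ((%g. ap (rot om) (ap g z)) -` A)"
   using measurable_comp[OF m mr] by (subst emeasure_distr[OF _ A]) (auto simp: comp_def vimage_def)
  also have "(%g. ap (rot om) (ap g z)) -` A = {g. ap (rot om * g) z \<in> A}"
   using z by (auto simp: apply_mult)
  also have "emeasure ?U {g. ap (rot om * g) z \<in> A}
    = emeasure haar {g \<in> mball rho. ap (rot om * g) z \<in> A} / emeasure haar (mball rho)"
  proof (subst emeasure_uniform_measure)
   have "(%g. rot om * g) \<in> borel \<rightarrow>\<^sub>M (borel :: moebius measure)" by measurable
   from measurable_sets[OF measurable_compose[OF this measurable_apply_boundary[OF z]] A]
   show "{g. ap (rot om * g) z \<in> A} \<in> sets haar" by (simp add: vimage_def)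
  qed (auto simp: Int_def)
  also have "emeasure haar {g \<in> mball rho. ap (rot om * g) z \<in> A} = emeasure haar ?S"
  proof -
   have m: "{g \<in> mball rho. ap (rot om * g) z \<in> A} = (%g. rot om * g) -` ?S"
    using rot_mball[OF om] by auto
   have "(\<integral>\<^sup>+g. indicator ?S (rot om * g) \<partial>haar) = (\<integral>\<^sup>+g. indicator ?S g \<partial>haar)"
    using S by (intro nn_integral_haar_left borel_measurable_indicator)
   moreover have "(%g. rot om * g) -` ?S \<in> sets haar"
    using measurable_sets[OF _ S, of "%g. rot om * g" borel] by simp
   moreover have "indicator ?S (rot om * g) = (indicator ((%g. rot om * g) -` ?S) g :: ennreal)" for g by (simp add: indicator_def)
   ultimately show ?thesis unfolding m using S by simp
  qed
  finally show "emeasure (distr (distr ?U (borel_of circ) (%g. ap g z)) (borel_of circ) (ap (rot om))) A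
    = emeasure (distr ?U (borel_of circ) (%g. ap g z)) A" unfolding e1 .
 qed simp
qed

lemma nn_integral_haar_ball:
 assumes rho: "0 < rho" "rho < 1" and z: "norm z = 1" and f: "f \<in> borel_measurable (borel_of circ)"
 shows "(\<integral>\<^sup>+g. f (ap g z) * indicator (mball rho) g \<partial>haar) = emeasure haar (mball rho) * (\<integral>\<^sup>+x. f x \<partial>arc)"
proof -
 let ?U = "uniform_measure haar (mball rho)"
 let ?c = "emeasure haar (mball rho)"
 have m: "(%g. ap g z) \<in> ?U \<rightarrow>\<^sub>M borel_of circ"
  using measurable_apply_boundary[OF z] measurable_cong_sets[of ?U borel] by simp
 have c: "?c \<noteq> 0" "?c \<noteq> \<infinity>" using haar_ball_pos[OF rho(1)] haar_ball_finite[OF rho(2)] by auto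
 have fm [measurable]: "(%g. f (ap g z)) \<in> borel_measurable borel"
  by (rule measurable_compose[OF measurable_apply_boundary[OF z] f])
 have "(\<integral>\<^sup>+x. f x \<partial>arc) = (\<integral>\<^sup>+g. f (ap g z) \<partial>?U)"
  unfolding distr_haar_ball[OF rho z, symmetric] by (rule nn_integral_distr[OF m]) (use f in simp)
 also have "\<dots> = (\<integral>\<^sup>+g. f (ap g z) * indicator (mball rho) g \<partial>haar) / ?c"
  by (rule nn_integral_uniform_measure) (auto, measurable)
 finally have "?c * (\<integral>\<^sup>+x. f x \<partial>arc) = ?c * ((\<integral>\<^sup>+g. f (ap g z) * indicator (mball rho) g \<partial>haar) / ?c)" by simp
 also have "\<dots> = (\<integral>\<^sup>+g. f (ap g z) * indicator (mball rho) g \<partial>haar)"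
  unfolding ennreal_times_divide mult.commute[of ?c] by (rule mult_divide_eq_ennreal) (use c in auto)
 finally show ?thesis by simp
qed

text \<open>Null sets of the circle pull back to null sets of the group, ball by ball. It shows that
  a boundary function which is constant almost everywhere yields only constant classes.\<close>

lemma AE_arc_haar:
 assumes P: "AE x in arc. P x" and z: "norm z = 1"
 shows "AE g in haar. P (ap g z)"
proof -
 obtain N where N: "{x \<in> space arc. \<not> P x} \<subseteq> N" "emeasure arc N = 0" "N \<in> sets arc" using P by (rule AE_E)
 have Nm: "(indicator N :: complex => ennreal) \<in> borel_measurable (borel_of circ)" using N(3) by (simp add: sets_arc)
 have [measurable]: "(%g. indicator N (ap g z) :: ennreal) \<in> borel_measurable borel"
  by (rule measurable_compose[OF measurable_apply_boundary[OF z] Nm])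
 have "AE g in haar. indicator N (ap g z) * indicator (mball (radius n)) g = (0 :: ennreal)" for n
 proof -
  have "(\<integral>\<^sup>+g. indicator N (ap g z) * indicator (mball (radius n)) g \<partial>haar) = 0"
   using N(2,3) by (simp add: nn_integral_haar_ball[OF radius_pos radius_less z Nm])
  then show ?thesis by (subst (asm) nn_integral_0_iff_AE) auto
 qed
 then have "AE g in haar. \<forall>n. indicator N (ap g z) * indicator (mball (radius n)) g = (0 :: ennreal)"
  unfolding AE_all_countable by blast
 then show ?thesis
 proof eventually_elim
  case (elim g)
  obtain n where "g \<in> mball (radius n)" using eventually_mball[of g] unfolding eventually_sequentially by blast
  then have "ap g z \<notin> N" using spec[OF elim, of n] by (auto simp: indicator_def split: if_splits)
  moreover have "ap g z \<in> space arc" using z by (simp add: space_arc norm_apply_circle)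
  ultimately show ?case using N(1) by blast
 qed
qed

lemma continuous_on_approx:
 fixes f :: "'a::metric_space => real"
 assumes "\<And>e. e > 0 ==> \<exists>q. continuous_on S q \<and> (\<forall>x\<in>S. \<bar>f x - q x\<bar> \<le> e)"
 shows "continuous_on S f"
 unfolding continuous_on_iff
proof (intro ballI allI impI)
 fix x and e :: real assume x: "x \<in> S" and e: "e > 0"
 obtain q where q: "continuous_on S q" "\<And>y. y \<in> S ==> \<bar>f y - q y\<bar> \<le> e / 4" using assms[of "e / 4"] e by auto
 obtain d where d: "d > 0" "\<And>y. y \<in> S ==> dist y x < d ==> dist (q y) (q x) < e / 4"
  using q(1)[unfolded continuous_on_iff, rule_format, OF x, of "e / 4"] e by auto
 have "dist (f y) (f x) < e" if "y \<in> S" "dist y x < d" for y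
  using d(2)[OF that] q(2)[OF that(1)] q(2)[OF x] e unfolding dist_real_def by linarith
 then show "\<exists>d>0. \<forall>y\<in>S. dist y x < d \<longrightarrow> dist (f y) (f x) < e" using d(1) by blast
qed

text \<open>Continuous functions are dense in the integrable ones. The induction needs an argument
  only for indicators, where inner regularity gives a compact subset and distance functions
  approximate its indicator.\<close>

lemma continuous_dense_arc:
 fixes f :: "complex => real"
 assumes "integrable arc f"
 shows "\<forall>e>0. \<exists>v. continuous_on circle v \<and> (LINT x|arc. \<bar>f x - v x\<bar>) < e"
 using assms
proof induction
 case (base A c)
 show ?case
 proof (intro allI impI)
  fix e :: real assume e: "e > 0"
  have A: "A \<in> sets (borel_of circ)" using base by (simp add: sets_arc)
  \<comment> \<open>Two errors of at most |c| * b each must stay below e, also when c = 0.\<close>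
  define b where "b = e / (2 * (\<bar>c\<bar> + 1))"
  have b: "b > 0" "\<bar>c\<bar> * b < e / 2" "\<bar>c\<bar> * b \<le> e / 2" using e by (auto simp: b_def field_simps)
  obtain K where K: "K \<subseteq> A" "compactin circ K" "measure arc (A - K) < b"
   using arc_in A b(1) unfolding prob_measures_def sets_arc[symmetric] by blast
  have Ks: "K \<in> sets (borel_of circ)" by (rule closedin_borel_of) (rule compactin_imp_closedin[OF Hausdorff_circ K(2)])
  have Kc: "closed K" using K(2) by (auto simp: compactin_subtopology compact_imp_closed)
  have "\<exists>q. continuous_on circle q \<and> (LINT x|arc. \<bar>indicator K x - q x\<bar>) < b"
  proof (cases "K = {}")
   case True
   then show ?thesis using b(1) by (intro exI[of _ "%_. 0"]) auto
  next
   case False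
   define f where "f n x = max 0 (1 - real n * infdist x K)" for n x
   have fc: "continuous_on circle (f n)" for n unfolding f_def by (intro continuous_intros continuous_on_infdist)
   have f01: "0 \<le> f n x" "f n x \<le> 1" for n x by (auto simp: f_def infdist_nonneg)
   have lim: "(%n. f n x) \<longlonglongrightarrow> indicator K x" for x
   proof (cases "x \<in> K")
    case out: False
    then have "infdist x K > 0" using in_closed_iff_infdist_zero[OF Kc False, of x] infdist_nonneg[of x K] by simp
    then obtain N where N: "1 < real N * infdist x K" using reals_Archimedean3 by blast
    have "\<forall>\<^sub>F n in sequentially. f n x = 0"
     using eventually_ge_at_top[of N]
    proof eventually_elim
     case (elim n)
     then have "real N * infdist x K \<le> real n * infdist x K" by (intro mult_right_mono infdist_nonneg) simp
     then show ?case using N by (simp add: f_def)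
    qed
    then show ?thesis using out by (simp add: tendsto_eventually)
   qed (simp add: f_def)
   have Km: "(indicator K :: complex => real) \<in> borel_measurable arc"
    using Ks by (intro borel_measurable_indicator) (simp add: sets_arc)
   have fm: "f n \<in> borel_measurable arc" for n by (rule circle_measurable[OF arc_in borel_circ_cont[OF fc]])
   have "(%n. LINT x|arc. \<bar>indicator K x - f n x\<bar>) \<longlonglongrightarrow> (LINT x|arc. 0)"
   proof (rule integral_dominated_convergence[where w = "%_. 1"])
    show "AE x in arc. (%n. \<bar>indicator K x - f n x\<bar>) \<longlonglongrightarrow> 0"
    proof (rule AE_I2)
     fix x
     have "(%n. \<bar>indicator K x - f n x\<bar>) \<longlonglongrightarrow> \<bar>indicator K x - indicator K x\<bar>"
      by (intro tendsto_rabs tendsto_diff tendsto_const lim)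
     then show "(%n. \<bar>indicator K x - f n x\<bar>) \<longlonglongrightarrow> 0" by simp
    qed
    show "AE x in arc. norm \<bar>indicator K x - f n x\<bar> \<le> 1" for n
    proof (rule AE_I2)
     show "norm \<bar>indicator K x - f n x\<bar> \<le> 1" for x using f01[of n x] by (cases "x \<in> K") auto
    qed
   qed (use Km fm in auto)
   then have "\<forall>\<^sub>F n in sequentially. (LINT x|arc. \<bar>indicator K x - f n x\<bar>) < b"
    using b(1) by (intro order_tendstoD(2)) auto
   then obtain n where "(LINT x|arc. \<bar>indicator K x - f n x\<bar>) < b" unfolding eventually_sequentially by blast
   then show ?thesis using fc by blast
  qed
  then obtain q where q: "continuous_on circle q" "(LINT x|arc. \<bar>indicator K x - q x\<bar>) < b" by blast
  have i1: "integrable arc (indicator (A - K) :: complex => real)" "integrable arc (indicator K :: complex => real)"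
   using A Ks by (intro circle_integrable[OF arc_in borel_measurable_indicator, of _ 1]; auto simp: indicator_def)+
  have i2: "integrable arc q" by (rule circ_integrable_cont[OF arc_in q(1)])
  have "(LINT x|arc. \<bar>indicator A x *\<^sub>R c - c * q x\<bar>)
    \<le> (LINT x|arc. \<bar>c\<bar> * indicator (A - K) x + \<bar>c\<bar> * \<bar>indicator K x - q x\<bar>)"
  proof (rule integral_mono)
   show "integrable arc (%x. \<bar>indicator A x *\<^sub>R c - c * q x\<bar>)"
    using base i2 by (intro integrable_abs Bochner_Integration.integrable_diff integrable_mult_right integrable_scaleR_left integrable_real_indicator) auto
   show "integrable arc (%x. \<bar>c\<bar> * indicator (A - K) x + \<bar>c\<bar> * \<bar>indicator K x - q x\<bar>)"
    using i1 i2 by (intro Bochner_Integration.integrable_add integrable_mult_right integrable_abs Bochner_Integration.integrable_diff)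
   show "\<bar>indicator A x *\<^sub>R c - c * q x\<bar> \<le> \<bar>c\<bar> * indicator (A - K) x + \<bar>c\<bar> * \<bar>indicator K x - q x\<bar>" for x
   proof -
    have "indicator A x *\<^sub>R c - c * q x = c * indicator (A - K) x + c * (indicator K x - q x)"
     using K(1) by (auto split: split_indicator simp: algebra_simps)
    then have "\<bar>indicator A x *\<^sub>R c - c * q x\<bar> \<le> \<bar>c * indicator (A - K) x\<bar> + \<bar>c * (indicator K x - q x)\<bar>" by (simp only: abs_triangle_ineq)
    then show ?thesis by (simp add: abs_mult)
   qed
  qed
  also have "\<dots> = \<bar>c\<bar> * measure arc (A - K) + \<bar>c\<bar> * (LINT x|arc. \<bar>indicator K x - q x\<bar>)"
  proof -
   have "(A - K) \<inter> space arc = A - K" using sets.sets_into_space[OF base(1)] by blast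
   then show ?thesis using i1 i2 by simp
  qed
  also have "\<dots> \<le> \<bar>c\<bar> * b + \<bar>c\<bar> * b" using K(3) q(2) by (intro add_mono mult_left_mono) auto
  also have "\<dots> < e" using b(2) by linarith
  finally show "\<exists>v. continuous_on circle v \<and> (LINT x|arc. \<bar>indicator A x *\<^sub>R c - v x\<bar>) < e"
   using q(1) by (intro exI[of _ "%x. c * q x"]) (auto intro: continuous_intros)
 qed
next
 case (add f g)
 show ?case
 proof (intro allI impI)
  fix e :: real assume "e > 0"
  then have "e / 2 > 0" by simp
  then obtain v w where v: "continuous_on circle v" "(LINT x|arc. \<bar>f x - v x\<bar>) < e / 2"
   and w: "continuous_on circle w" "(LINT x|arc. \<bar>g x - w x\<bar>) < e / 2" using add.IH by blast
  have i: "integrable arc (%x. f x - v x)" "integrable arc (%x. g x - w x)"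
   using add.hyps circ_integrable_cont[OF arc_in v(1)] circ_integrable_cont[OF arc_in w(1)] by simp_all
  have "(LINT x|arc. \<bar>f x + g x - (v x + w x)\<bar>) \<le> (LINT x|arc. \<bar>f x - v x\<bar> + \<bar>g x - w x\<bar>)"
  proof (rule integral_mono)
   have "integrable arc (%x. \<bar>(f x - v x) + (g x - w x)\<bar>)" by (intro integrable_abs Bochner_Integration.integrable_add i)
   then show "integrable arc (%x. \<bar>f x + g x - (v x + w x)\<bar>)" by (simp add: algebra_simps)
   show "integrable arc (%x. \<bar>f x - v x\<bar> + \<bar>g x - w x\<bar>)" by (intro integrable_abs Bochner_Integration.integrable_add i)
  qed linarith
  also have "\<dots> = (LINT x|arc. \<bar>f x - v x\<bar>) + (LINT x|arc. \<bar>g x - w x\<bar>)" by (intro Bochner_Integration.integral_add integrable_abs i)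
  also have "\<dots> < e" using v(2) w(2) by simp
  finally show "\<exists>v. continuous_on circle v \<and> (LINT x|arc. \<bar>f x + g x - v x\<bar>) < e"
   using v(1) w(1) by (intro exI[of _ "%x. v x + w x"]) (auto intro: continuous_intros)
 qed
next
 case (lim f s)
 show ?case
 proof (intro allI impI)
  fix e :: real assume e: "e > 0"
  have "(%i. LINT x|arc. \<bar>f x - s i x\<bar>) \<longlonglongrightarrow> (LINT x|arc. 0)"
  proof (rule integral_dominated_convergence[where w = "%x. 3 * \<bar>f x\<bar>"])
   show "AE x in arc. (%i. \<bar>f x - s i x\<bar>) \<longlonglongrightarrow> 0"
   proof (rule AE_I2)
    fix x assume "x \<in> space arc"
    then have "(%i. \<bar>f x - s i x\<bar>) \<longlonglongrightarrow> \<bar>f x - f x\<bar>" by (intro tendsto_rabs tendsto_diff tendsto_const lim.hyps)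
    then show "(%i. \<bar>f x - s i x\<bar>) \<longlonglongrightarrow> 0" by simp
   qed
   show "AE x in arc. norm \<bar>f x - s i x\<bar> \<le> 3 * \<bar>f x\<bar>" for i
   proof (rule AE_I2)
    fix x assume "x \<in> space arc"
    then have "\<bar>s i x\<bar> \<le> 2 * \<bar>f x\<bar>" using lim.hyps(3)[of x i] by simp
    then show "norm \<bar>f x - s i x\<bar> \<le> 3 * \<bar>f x\<bar>" by simp
   qed
  qed (use lim.hyps in \<open>auto intro!: borel_measurable_diff borel_measurable_integrable\<close>)
  then have "\<forall>\<^sub>F i in sequentially. (LINT x|arc. \<bar>f x - s i x\<bar>) < e / 2" using e by (intro order_tendstoD(2)) auto
  then obtain i where i: "(LINT x|arc. \<bar>f x - s i x\<bar>) < e / 2" unfolding eventually_sequentially by blast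
  have "e / 2 > 0" using e by simp
  then obtain v where v: "continuous_on circle v" "(LINT x|arc. \<bar>s i x - v x\<bar>) < e / 2" using lim.IH[of i] by blast
  have vi: "integrable arc v" by (rule circ_integrable_cont[OF arc_in v(1)])
  have "(LINT x|arc. \<bar>f x - v x\<bar>) \<le> (LINT x|arc. \<bar>f x - s i x\<bar> + \<bar>s i x - v x\<bar>)"
   using lim.hyps(1)[of i] lim.hyps(4) vi by (intro integral_mono) auto
  also have "\<dots> = (LINT x|arc. \<bar>f x - s i x\<bar>) + (LINT x|arc. \<bar>s i x - v x\<bar>)"
   using lim.hyps(1)[of i] lim.hyps(4) vi by (intro Bochner_Integration.integral_add integrable_abs Bochner_Integration.integrable_diff)
  also have "\<dots> < e" using i v(2) by simp
  finally show "\<exists>v. continuous_on circle v \<and> (LINT x|arc. \<bar>f x - v x\<bar>) < e" using v(1) by blast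
 qed
qed

section \<open>The affine map defined by a boundary function\<close>

lemma measurable_prob_id: "mu \<in> probs ==> (%x. x) \<in> mu \<rightarrow>\<^sub>M borel"
 by (rule circle_measurable[OF _ borel_circ_cont[OF continuous_on_id]])

lemma measurable_apply_pair:
 assumes "mu \<in> probs" "u \<in> borel_measurable borel"
 shows "(%(g, x). u (ap g x)) \<in> borel_measurable (borel \<Otimes>\<^sub>M mu)"
proof -
 have "(%(g, x). u (ap g x)) \<in> borel_measurable (borel \<Otimes>\<^sub>M borel)"
  using assms(2) by measurable
 from measurable_compose[OF measurable_Pair[OF measurable_fst measurable_compose[OF measurable_snd measurable_prob_id[OF assms(1)]]] this]
 show ?thesis by (simp add: case_prod_beta)
qed

lemma continuous_circle_bounded:
 fixes v :: "complex => real"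
 assumes "continuous_on circle v"
 obtains C where "\<And>x. norm x = 1 ==> \<bar>v x\<bar> \<le> C"
proof -
 have "compact (v ` circle)" by (intro compact_continuous_image assms) auto
 then have "bounded (v ` circle)" by (rule compact_imp_bounded)
 then obtain C where "\<forall>y\<in>v ` circle. norm y \<le> C" unfolding bounded_iff by blast
 then show ?thesis by (intro that[of C]) auto
qed

lemma haar_ball_integral_diff:
 fixes u v :: "complex => real"
 assumes "u \<in> borel_measurable (borel_of circ)" "v \<in> borel_measurable (borel_of circ)" "integrable arc (%x. u x - v x)"
  and rho: "0 < rho" "rho < 1" and z: "norm z = 1"
 shows "integrable haar (%g. \<bar>u (ap g z) - v (ap g z)\<bar> * indicator (mball rho) g)"
  and "(LINT g|haar. \<bar>u (ap g z) - v (ap g z)\<bar> * indicator (mball rho) g)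
   = measure haar (mball rho) * (LINT x|arc. \<bar>u x - v x\<bar>)"
proof -
 let ?w = "%x. \<bar>u x - v x\<bar>"
 let ?F = "%g. ?w (ap g z) * indicator (mball rho) g"
 have wm: "?w \<in> borel_measurable (borel_of circ)" using assms(1,2) by measurable
 have wm': "(%x. ennreal (?w x)) \<in> borel_measurable (borel_of circ)" using wm by measurable
 have [measurable]: "(%g. ?w (ap g z)) \<in> borel_measurable borel"
  by (rule measurable_compose[OF measurable_apply_boundary[OF z] wm])
 have I: "integrable arc ?w" by (intro integrable_abs assms)
 have "(\<integral>\<^sup>+g. ennreal (?F g) \<partial>haar) = (\<integral>\<^sup>+g. ennreal (?w (ap g z)) * indicator (mball rho) g \<partial>haar)"
  by (intro nn_integral_cong) (simp split: split_indicator)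
 also have "\<dots> = emeasure haar (mball rho) * (\<integral>\<^sup>+x. ennreal (?w x) \<partial>arc)"
  by (rule nn_integral_haar_ball[OF rho z wm'])
 also have "(\<integral>\<^sup>+x. ennreal (?w x) \<partial>arc) = ennreal (LINT x|arc. ?w x)" using I by (intro nn_integral_eq_integral) auto
 also have "emeasure haar (mball rho) = ennreal (measure haar (mball rho))"
  using haar_ball_finite[OF rho(2)] by (intro emeasure_eq_ennreal_measure) auto
 finally have e: "(\<integral>\<^sup>+g. ennreal (?F g) \<partial>haar) = ennreal (measure haar (mball rho) * (LINT x|arc. ?w x))"
  by (simp add: ennreal_mult)
 have n: "AE g in haar. 0 \<le> ?F g" by (intro AE_I2) (simp add: indicator_def)
 show "integrable haar ?F" by (rule integrableI_nn_integral_finite[OF _ n e]) (measurable)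
 show "(LINT g|haar. ?F g) = measure haar (mball rho) * (LINT x|arc. ?w x)"
 proof -
  have "(LINT g|haar. ?F g) = enn2real (\<integral>\<^sup>+g. ennreal (?F g) \<partial>haar)"
   by (rule integral_eq_nn_integral[OF _ n]) measurable
  also have "\<dots> = measure haar (mball rho) * (LINT x|arc. ?w x)"
   unfolding e by (intro enn2real_ennreal mult_nonneg_nonneg measure_nonneg integral_nonneg_AE) simp
  finally show ?thesis .
 qed
qed

text \<open>The pairing of phi with the function g |-> u (ap g z), which represents the image of the
  point mass at z. Its continuity in z is what makes \<open>embed\<close> weak-star
  continuous.\<close>

definition orbit_pairing :: "(complex => real) => (moebius => real) => complex => real" where
 "orbit_pairing u phi z = (LINT g|haar. u (ap g z) * phi g)"

locale boundary_function =
 fixes u :: "complex => real" and B :: real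
 assumes u_measurable [measurable]: "u \<in> borel_measurable borel" and u_bounded: "\<bar>u x\<bar> \<le> B"
begin

lemma B_nonneg: "0 \<le> B" using u_bounded[of 0] by linarith

lemma u_circ: "u \<in> borel_measurable (borel_of circ)" by (rule measurable_borel_circ[OF u_measurable])

lemma bounded_integrable:
 assumes phi: "integrable haar phi" and f: "f \<in> borel_measurable borel" "\<And>x. \<bar>f x\<bar> \<le> C"
 shows "integrable haar (%g. f g * phi g :: real)" "\<bar>LINT g|haar. f g * phi g\<bar> \<le> C * (LINT g|haar. \<bar>phi g\<bar>)"
proof -
 have [measurable]: "phi \<in> borel_measurable borel" by (rule integrable_haar_measurable[OF phi])
 have b: "\<bar>f g * phi g\<bar> \<le> C * \<bar>phi g\<bar>" for g unfolding abs_mult by (rule mult_right_mono[OF f(2)]) simp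
 show i: "integrable haar (%g. f g * phi g)"
 proof (rule Bochner_Integration.integrable_bound[of _ "%g. C * \<bar>phi g\<bar>"])
  show "AE g in haar. norm (f g * phi g) \<le> norm (C * \<bar>phi g\<bar>)"
   using b by (intro AE_I2) (metis abs_ge_self order_trans real_norm_def)
 qed (use phi f(1) in simp, use f(1) in measurable)
 have "\<bar>LINT g|haar. f g * phi g\<bar> \<le> (LINT g|haar. \<bar>f g * phi g\<bar>)" by (rule integral_abs_bound)
 also have "\<dots> \<le> (LINT g|haar. C * \<bar>phi g\<bar>)" using i phi b by (intro integral_mono integrable_abs integrable_mult_right) auto
 finally show "\<bar>LINT g|haar. f g * phi g\<bar> \<le> C * (LINT g|haar. \<bar>phi g\<bar>)" by simp
qed

lemma measurable_u_apply: "norm z = 1 ==> (%g. u (ap g z)) \<in> borel_measurable borel"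
 by (rule measurable_compose[OF measurable_apply_boundary u_circ])

lemma continuous_orbit_pairing_continuous:
 assumes v: "continuous_on circle v" and phi: "integrable haar phi"
 shows "continuous_on circle (orbit_pairing v phi)"
 unfolding continuous_on_sequentially
proof (intro allI ballI impI, elim conjE)
 fix s :: "nat => complex" and a assume a: "a \<in> circle" and s: "\<forall>n. s n \<in> circle" "s \<longlonglongrightarrow> a"
 obtain C where C: "\<And>x. norm x = 1 ==> \<bar>v x\<bar> \<le> C" by (rule continuous_circle_bounded[OF v]) (rule that)
 have C': "\<bar>v x\<bar> \<le> \<bar>C\<bar>" if "norm x = 1" for x using C[OF that] by linarith
 have phim [measurable]: "phi \<in> borel_measurable borel" by (rule integrable_haar_measurable[OF phi])
 have m: "(%g. v (ap g z) * phi g) \<in> borel_measurable haar" if "norm z = 1" for z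
  using measurable_compose[OF measurable_apply_boundary[OF that] borel_circ_cont[OF v]] by measurable
 have "(%n. LINT g|haar. v (ap g (s n)) * phi g) \<longlonglongrightarrow> (LINT g|haar. v (ap g a) * phi g)"
 proof (rule integral_dominated_convergence[where w = "%g. \<bar>C\<bar> * \<bar>phi g\<bar>"])
  show "AE g in haar. (%n. v (ap g (s n)) * phi g) \<longlonglongrightarrow> v (ap g a) * phi g"
  proof (rule AE_I2)
   fix g
   have "continuous_on circle (ap g)" by (intro continuous_intros) auto
   from continuous_on_tendsto_compose[OF this s(2)] have "(%n. ap g (s n)) \<longlonglongrightarrow> ap g a" using a s(1) by simp
   from continuous_on_tendsto_compose[OF v this] have "(%n. v (ap g (s n))) \<longlonglongrightarrow> v (ap g a)"
    using a s(1) by (simp add: norm_apply_circle)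
   then show "(%n. v (ap g (s n)) * phi g) \<longlonglongrightarrow> v (ap g a) * phi g" by (intro tendsto_mult tendsto_const)
  qed
  show "AE g in haar. norm (v (ap g (s n)) * phi g) \<le> \<bar>C\<bar> * \<bar>phi g\<bar>" for n
   unfolding real_norm_def abs_mult using s(1) by (intro AE_I2 mult_right_mono C' norm_apply_circle) auto
 qed (use phi m a s(1) in auto)
 then show "(orbit_pairing v phi \<circ> s) \<longlonglongrightarrow> orbit_pairing v phi a" by (simp add: comp_def orbit_pairing_def)
qed

text \<open>Replacing u by a continuous v costs at most C times the Haar integral of |u - v| (ap g
  z) over the ball. That integral equals a constant times the arc integral of |u - v|, whatever z
  is, so the approximation is uniform in z.\<close>

lemma continuous_orbit_pairing_bounded:
 assumes phim [measurable]: "phi \<in> borel_measurable borel" and rho: "0 < rho" "rho < 1"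
  and b: "\<And>g. \<bar>phi g\<bar> \<le> C * indicator (mball rho) g"
 shows "continuous_on circle (orbit_pairing u phi)"
proof (rule continuous_on_approx)
 fix e :: real assume e: "e > 0"
 have ib: "integrable haar (indicator (mball rho) :: moebius => real)"
  using haar_ball_finite[OF rho(2)] by (intro integrable_real_indicator) auto
 have C: "0 \<le> C"
 proof -
  have "1 \<in> mball rho" using rho by (simp add: mball_def apply_one)
  then show ?thesis using b[of 1] by simp
 qed
 have phi: "integrable haar phi"
 proof (rule Bochner_Integration.integrable_bound[of _ "%g. C * indicator (mball rho) g"])
  show "AE g in haar. norm (phi g) \<le> norm (C * indicator (mball rho) g)"
   using b by (intro AE_I2) (metis abs_ge_self order_trans real_norm_def)
 qed (use ib in simp, measurable)
 define M where "M = C * measure haar (mball rho)"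
 have M: "0 \<le> M" using C by (simp add: M_def)
 have "e / (M + 1) > 0" using e M by simp
 moreover have "integrable arc u" by (rule circle_integrable[OF arc_in u_circ]) (use u_bounded in auto)
 ultimately obtain v where v: "continuous_on circle v" "(LINT x|arc. \<bar>u x - v x\<bar>) < e / (M + 1)"
  using continuous_dense_arc by blast
 have vi: "integrable arc (%x. u x - v x)"
  using \<open>integrable arc u\<close> circ_integrable_cont[OF arc_in v(1)] by simp
 obtain D where D: "\<And>x. norm x = 1 ==> \<bar>v x\<bar> \<le> D" by (rule continuous_circle_bounded[OF v(1)]) (rule that)
 have "\<bar>orbit_pairing u phi z - orbit_pairing v phi z\<bar> \<le> e" if z: "norm z = 1" for z
 proof -
  note H = haar_ball_integral_diff[OF u_circ borel_circ_cont[OF v(1)] vi rho z]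
  have vm [measurable]: "(%g. v (ap g z)) \<in> borel_measurable borel"
   by (rule measurable_compose[OF measurable_apply_boundary[OF z] borel_circ_cont[OF v(1)]])
  have iu: "integrable haar (%g. u (ap g z) * phi g)" by (rule bounded_integrable(1)[OF phi measurable_u_apply[OF z] u_bounded])
  have iv: "integrable haar (%g. v (ap g z) * phi g)"
   by (rule bounded_integrable(1)[OF phi vm, of D]) (rule D[OF norm_apply_circle[OF z]])
  have "\<bar>orbit_pairing u phi z - orbit_pairing v phi z\<bar> = \<bar>LINT g|haar. u (ap g z) * phi g - v (ap g z) * phi g\<bar>"
   unfolding orbit_pairing_def using iu iv by simp
  also have "\<dots> \<le> (LINT g|haar. \<bar>u (ap g z) * phi g - v (ap g z) * phi g\<bar>)" by (rule integral_abs_bound)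
  also have "\<dots> \<le> (LINT g|haar. C * (\<bar>u (ap g z) - v (ap g z)\<bar> * indicator (mball rho) g))"
  proof (rule integral_mono)
   show "integrable haar (%g. \<bar>u (ap g z) * phi g - v (ap g z) * phi g\<bar>)"
    by (intro integrable_abs Bochner_Integration.integrable_diff iu iv)
   show "integrable haar (%g. C * (\<bar>u (ap g z) - v (ap g z)\<bar> * indicator (mball rho) g))"
    by (intro integrable_mult_right H(1))
   fix g
   have "\<bar>u (ap g z) * phi g - v (ap g z) * phi g\<bar> = \<bar>u (ap g z) - v (ap g z)\<bar> * \<bar>phi g\<bar>"
    by (simp add: abs_mult[symmetric] left_diff_distrib)
   also have "\<dots> \<le> \<bar>u (ap g z) - v (ap g z)\<bar> * (C * indicator (mball rho) g)"
    by (rule mult_left_mono[OF b]) simp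
   finally show "\<bar>u (ap g z) * phi g - v (ap g z) * phi g\<bar>
     \<le> C * (\<bar>u (ap g z) - v (ap g z)\<bar> * indicator (mball rho) g)" by (simp add: mult_ac)
  qed
  also have "\<dots> = M * (LINT x|arc. \<bar>u x - v x\<bar>)" using H(2) by (simp add: M_def mult.assoc)
  also have "\<dots> \<le> M * (e / (M + 1))" using M v(2) by (intro mult_left_mono) auto
  also have "\<dots> \<le> e" using M e by (simp add: field_simps)
  finally show ?thesis .
 qed
 moreover have "continuous_on circle (orbit_pairing v phi)" by (rule continuous_orbit_pairing_continuous[OF v(1) phi])
 ultimately show "\<exists>q. continuous_on circle q \<and> (\<forall>x\<in>circle. \<bar>orbit_pairing u phi x - q x\<bar> \<le> e)" by auto
qed

text \<open>Truncating phi in size and in support changes the pairing by at most B times the L1 norm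
  of the difference, again uniformly in z.\<close>

lemma continuous_orbit_pairing:
 assumes phi: "integrable haar phi"
 shows "continuous_on circle (orbit_pairing u phi)"
proof (rule continuous_on_approx)
 fix e :: real assume e: "e > 0"
 have [measurable]: "phi \<in> borel_measurable borel" by (rule integrable_haar_measurable[OF phi])
 define psi where "psi n g = (if \<bar>phi g\<bar> \<le> real n then phi g else 0) * indicator (mball (radius n)) g" for n g
 have psim [measurable]: "psi n \<in> borel_measurable borel" for n unfolding psi_def by measurable
 have psib: "\<bar>psi n g\<bar> \<le> real n * indicator (mball (radius n)) g" for n g by (auto simp: psi_def split: split_indicator)
 have le: "\<bar>phi g - psi n g\<bar> \<le> \<bar>phi g\<bar>" "\<bar>psi n g\<bar> \<le> \<bar>phi g\<bar>" for n g by (auto simp: psi_def split: split_indicator)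
 have psii: "integrable haar (psi n)" for n
  by (rule Bochner_Integration.integrable_bound[OF phi]) (measurable, use le(2) in auto)
 have "(%n. LINT g|haar. \<bar>phi g - psi n g\<bar>) \<longlonglongrightarrow> (LINT g|haar. 0)"
 proof (rule integral_dominated_convergence[where w = "%g. \<bar>phi g\<bar>"])
  show "AE g in haar. (%n. \<bar>phi g - psi n g\<bar>) \<longlonglongrightarrow> 0"
  proof (rule AE_I2)
   fix g
   obtain N where N: "\<bar>phi g\<bar> \<le> real N" using real_arch_simple by blast
   have "\<forall>\<^sub>F n in sequentially. \<bar>phi g - psi n g\<bar> = 0"
    using eventually_ge_at_top[of N] eventually_mball[of g]
   proof eventually_elim
    case (elim n)
    then have "\<bar>phi g\<bar> \<le> real n" using N by (meson of_nat_le_iff order_trans)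
    then show ?case using elim(2) by (simp add: psi_def)
   qed
   then show "(%n. \<bar>phi g - psi n g\<bar>) \<longlonglongrightarrow> 0" by (rule tendsto_eventually)
  qed
 qed (use phi le in auto)
 then have lim0: "(%n. LINT g|haar. \<bar>phi g - psi n g\<bar>) \<longlonglongrightarrow> 0" by simp
 have eB: "e / (B + 1) > 0" using e B_nonneg by simp
 obtain n where n: "(LINT g|haar. \<bar>phi g - psi n g\<bar>) < e / (B + 1)"
  using order_tendstoD(2)[OF lim0 eB] unfolding eventually_sequentially by blast
 have "\<bar>orbit_pairing u phi z - orbit_pairing u (psi n) z\<bar> \<le> e" if z: "norm z = 1" for z
 proof -
  note um = measurable_u_apply[OF z]
  have d: "integrable haar (%g. phi g - psi n g)" using phi psii by simp
  have "orbit_pairing u phi z - orbit_pairing u (psi n) z = (LINT g|haar. u (ap g z) * (phi g - psi n g))"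
   unfolding orbit_pairing_def right_diff_distrib
   by (rule Bochner_Integration.integral_diff[symmetric]) (intro bounded_integrable(1)[OF _ um u_bounded] phi psii)+
  also have "\<bar>\<dots>\<bar> \<le> B * (LINT g|haar. \<bar>phi g - psi n g\<bar>)" by (rule bounded_integrable(2)[OF d um u_bounded])
  also have "\<dots> \<le> B * (e / (B + 1))" using n B_nonneg by (intro mult_left_mono) auto
  also have "\<dots> \<le> e" using B_nonneg e by (simp add: field_simps)
  finally show ?thesis .
 qed
 moreover have "continuous_on circle (orbit_pairing u (psi n))"
  by (rule continuous_orbit_pairing_bounded[OF psim radius_pos radius_less psib])
 ultimately show "\<exists>q. continuous_on circle q \<and> (\<forall>x\<in>circle. \<bar>orbit_pairing u phi x - q x\<bar> \<le> e)" by auto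
qed

section \<open>The map from measures on the circle to bounded functions on the group\<close>

definition average :: "complex measure => moebius => real" where
 "average mu g = (LINT x|mu. u (ap g x))"

definition embed :: "complex measure => linf" where
 "embed mu = abs_linf (average mu)"

lemma u_apply_circ: "mu \<in> probs ==> (%x. u (ap g x)) \<in> borel_measurable (borel_of circ)"
 using measurable_compose[OF measurable_apply_circ[OF arc_in, of g] u_circ] measurable_cong_sets[OF sets_arc refl] by blast

lemma u_apply_integrable: "mu \<in> probs ==> integrable mu (%x. u (ap g x))"
 by (rule circle_integrable[where B = B]) (auto intro: u_apply_circ simp: u_bounded)

lemma average_measurable:
 assumes mu: "mu \<in> probs" shows "average mu \<in> borel_measurable borel"
proof -
 interpret prob_space mu using probsD(1)[OF mu] .
 show ?thesis unfolding average_def[abs_def]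
  by (rule borel_measurable_lebesgue_integral[OF measurable_apply_pair[OF mu u_measurable]])
qed

lemma average_bounded:
 assumes mu: "mu \<in> probs" shows "\<bar>average mu g\<bar> \<le> B"
proof -
 interpret prob_space mu using probsD(1)[OF mu] .
 have "\<bar>average mu g\<bar> \<le> (LINT x|mu. \<bar>u (ap g x)\<bar>)" unfolding average_def by (rule integral_abs_bound)
 also have "\<dots> \<le> (LINT x|mu. B)" using u_apply_integrable[OF mu] u_bounded by (intro integral_mono) auto
 finally show ?thesis by (simp add: prob_space)
qed

lemma linf_rel_average: "mu \<in> probs ==> linf_rel (average mu) (average mu)"
 by (rule linf_relI[OF average_measurable]) (auto intro: average_bounded)

text \<open>By Fubini. It reduces weak-star continuity of \<open>embed\<close> to continuity of
  \<open>orbit_pairing u phi\<close> on the circle.\<close>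

lemma pairing_embed:
 assumes mu: "mu \<in> probs" and phi: "integrable haar phi"
 shows "linf_pairing (embed mu) phi = (LINT x|mu. orbit_pairing u phi x)"
proof -
 interpret P: prob_space mu using probsD(1)[OF mu] .
 interpret pair_sigma_finite haar mu by standard
 have [measurable]: "phi \<in> borel_measurable borel" by (rule integrable_haar_measurable[OF phi])
 have m0: "(%(g, x). u (ap g x)) \<in> borel_measurable (haar \<Otimes>\<^sub>M mu)"
  using measurable_apply_pair[OF mu u_measurable] measurable_cong_sets[OF sets_pair_measure_cong[OF sets_haar refl] refl] by blast
 have m1: "(%(g, x). phi g) \<in> borel_measurable (haar \<Otimes>\<^sub>M mu)" by measurable
 have "integrable (haar \<Otimes>\<^sub>M mu) (%(g, x). phi g)"
  by (rule Fubini_integrable) (use phi in \<open>auto simp: P.prob_space\<close>)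
 then have "integrable (haar \<Otimes>\<^sub>M mu) (%p. B * (case p of (g, x) => phi g))" by (rule integrable_mult_right)
 then have "integrable (haar \<Otimes>\<^sub>M mu) (%(g, x). u (ap g x) * phi g)"
 proof (rule Bochner_Integration.integrable_bound)
  show "(%(g, x). u (ap g x) * phi g) \<in> borel_measurable (haar \<Otimes>\<^sub>M mu)"
   using borel_measurable_times[OF m0 m1] by (simp add: case_prod_beta)
  show "AE p in haar \<Otimes>\<^sub>M mu. norm (case p of (g, x) => u (ap g x) * phi g) \<le> norm (B * (case p of (g, x) => phi g))"
   using u_bounded B_nonneg by (intro AE_I2) (auto simp: abs_mult intro!: mult_right_mono)
 qed
 from Fubini_integral[OF this]
 have "(LINT x|mu. LINT g|haar. u (ap g x) * phi g) = (LINT g|haar. LINT x|mu. u (ap g x) * phi g)" by simp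
 then show ?thesis
  unfolding embed_def pairing_abs[OF linf_rel_average[OF mu] phi] by (simp add: average_def orbit_pairing_def)
qed

lemma continuous_embed: "continuous_map (prob_topology circ) weak_star embed"
proof (rule continuous_map_into_weak_star)
 fix phi :: "moebius => real" assume phi: "integrable haar phi"
 have "continuous_map (prob_topology circ) euclideanreal (%mu. LINT x|mu. orbit_pairing u phi x)"
  by (rule continuous_map_integral) (simp add: cfun_circ continuous_orbit_pairing[OF phi])
 then show "continuous_map (prob_topology circ) euclideanreal (%mu. linf_pairing (embed mu) phi)"
  by (rule continuous_map_eq) (simp add: pairing_embed[OF _ phi])
qed

lemma embed_push:
 assumes mu: "mu \<in> probs" shows "embed (push g mu) = linf_act g (embed mu)"
proof -
 have "average (push g mu) = (%x. average mu (x * g))"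
 proof
  fix x
  have "average (push g mu) x = (LINT y|mu. u (ap x (ap g y)))"
   unfolding average_def by (rule integral_push[OF mu u_apply_circ[OF mu]])
  also have "\<dots> = average mu (x * g)"
   unfolding average_def
   by (rule Bochner_Integration.integral_cong) (auto simp: apply_mult probsD(2)[OF mu])
  finally show "average (push g mu) x = average mu (x * g)" .
 qed
 then show ?thesis unfolding embed_def linf_act_abs[OF linf_rel_average[OF mu]] by simp
qed

lemma embed_mix:
 assumes mu: "mu \<in> probs" and nu: "nu \<in> probs" and t: "t \<in> {0..1}"
 shows "embed (mix_measure t mu nu) = (1 - t) *\<^sub>R embed mu + t *\<^sub>R embed nu"
proof -
 have "average (mix_measure t mu nu) = (%g. (1 - t) * average mu g + t * average nu g)"
  unfolding average_def[abs_def]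
  by (rule ext) (rule integral_mix[OF compact_circ Hausdorff_circ mu nu t u_apply_circ[OF mu] u_bounded])
 moreover have "(1 - t) *\<^sub>R embed mu + t *\<^sub>R embed nu = abs_linf (%g. (1 - t) * average mu g + t * average nu g)"
  unfolding embed_def scaleR_linf.abs_eq[OF linf_rel_average[OF mu]] scaleR_linf.abs_eq[OF linf_rel_average[OF nu]]
  by (rule plus_linf.abs_eq) (intro linf_rel_scale linf_rel_average mu nu)+
 ultimately show ?thesis by (simp add: embed_def)
qed

lemma embed_dirac: "norm z = 1 ==> embed (dirac z) = abs_linf (%g. u (ap g z))"
 unfolding embed_def average_def[abs_def]
 by (rule arg_cong[of _ _ abs_linf], rule ext, rule integral_return) (auto intro: u_apply_circ[OF arc_in])

end

section \<open>Injectivity\<close>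

definition moment :: "complex measure => moebius => nat => complex" where
 "moment mu g n = (LINT x|mu. ap g x ^ n)"

lemma apply_power_integrable: "mu \<in> probs ==> integrable mu (%x. ap g x ^ n)"
 by (intro circ_integrable_cont continuous_intros) auto

lemma moment_rot:
 assumes mu: "mu \<in> probs" and om: "norm om = 1"
 shows "moment mu (rot om * g) n = om ^ n * moment mu g n"
proof -
 have "moment mu (rot om * g) n = (LINT x|mu. om ^ n * ap g x ^ n)"
  unfolding moment_def
  by (rule Bochner_Integration.integral_cong)
   (auto simp: probsD(2)[OF mu] apply_mult apply_rot om norm_apply_circle power_mult_distrib)
 then show ?thesis by (simp add: moment_def)
qed

text \<open>A sequence of hyperbolic elements tending to the identity. A countable family suffices
  for the derivative and lets statements about almost every g be translated by all its members at
  once.\<close>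

definition shift :: "nat => moebius" where "shift k = moebius_of (1, of_real (1 / real (k + 2)))"

lemma apply_shift:
 assumes "norm y = 1"
 shows "ap (shift k) y = (y + of_real (1 / real (k + 2))) / (1 + of_real (1 / real (k + 2)) * y)"
proof -
 have "norm (of_real (1 / real (k + 2)) :: complex) < 1" unfolding norm_of_real by simp
 then show ?thesis using assms unfolding shift_def by (simp add: apply_moebius_of del: of_real_divide)
qed

text \<open>Differentiating \<open>((y + t) / (1 + t y))\<^sup>m\<close> at \<open>t = 0\<close> relates the moments of orders \<open>m - 1\<close> and \<open>m + 1\<close>.\<close>

lemma moment_derivative:
 assumes mu: "mu \<in> probs"
 shows "(%k. (moment mu (shift k * g) (Suc n) - moment mu g (Suc n)) / of_real (1 / real (k + 2)))
  \<longlonglongrightarrow> of_nat (Suc n) * (moment mu g n - moment mu g (Suc (Suc n)))"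
proof -
 interpret prob_space mu using probsD(1)[OF mu] .
 let ?t = "%k. 1 / real (k + 2)"
 have t0: "(%k. complex_of_real (?t k)) \<longlonglongrightarrow> 0"
  using tendsto_of_real[OF LIMSEQ_ignore_initial_segment[OF lim_1_over_n, of 2], where 'a = complex] by simp
 have tn: "complex_of_real (?t k) \<noteq> 0" for k unfolding of_real_eq_0_iff by simp
 have sp: "space mu = circle" using probsD(2)[OF mu] by simp
 have "(%k. LINT x|mu. (ap (shift k * g) x ^ Suc n - ap g x ^ Suc n) / of_real (?t k))
   \<longlonglongrightarrow> (LINT x|mu. of_nat (Suc n) * (ap g x ^ n - ap g x ^ Suc (Suc n)))"
 \<comment> \<open>For t \<le> 1/2 the shift moves a boundary point by at most t * 2 / (1/2) = 4 *
   t, and the power contributes the factor n + 1.\<close>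
 proof (rule integral_dominated_convergence[where w = "%_. 4 * real (Suc n)"])
  show "(%x. of_nat (Suc n) * (ap g x ^ n - ap g x ^ Suc (Suc n))) \<in> borel_measurable mu"
   by (intro borel_measurable_times borel_measurable_const borel_measurable_diff borel_measurable_integrable[OF apply_power_integrable[OF mu]])
  show "(%x. (ap (shift k * g) x ^ Suc n - ap g x ^ Suc n) / of_real (?t k)) \<in> borel_measurable mu" for k
   by (intro borel_measurable_divide borel_measurable_const borel_measurable_diff borel_measurable_integrable[OF apply_power_integrable[OF mu]])
  show "AE x in mu. (%k. (ap (shift k * g) x ^ Suc n - ap g x ^ Suc n) / of_real (?t k))
    \<longlonglongrightarrow> of_nat (Suc n) * (ap g x ^ n - ap g x ^ Suc (Suc n))"
  proof (rule AE_I2)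
   fix x assume "x \<in> space mu"
   then have x: "norm x = 1" by (simp add: sp)
   define y where "y = ap g x"
   have y: "norm y = 1" using x by (simp add: y_def norm_apply_circle)
   have "((%t. ((y + t) / (1 + t * y)) ^ Suc n) has_field_derivative of_nat (Suc n) * (y ^ n - y ^ Suc (Suc n))) (at 0)"
   proof -
    have "((%t. (y + t) / (1 + t * y)) has_field_derivative (1 - y * y)) (at 0)"
     by (auto intro!: derivative_eq_intros simp: algebra_simps)
    from DERIV_power_Suc[OF this, of n] show ?thesis by (simp add: algebra_simps)
   qed
   then have "((%t. (((y + t) / (1 + t * y)) ^ Suc n - y ^ Suc n) / t) \<longlongrightarrow> of_nat (Suc n) * (y ^ n - y ^ Suc (Suc n))) (at 0)"
    by (simp add: DERIV_def)
   moreover have "filterlim (%k. complex_of_real (?t k)) (at 0) sequentially"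
    unfolding filterlim_at by (intro conjI t0 always_eventually allI UNIV_I tn)
   ultimately have "(%k. (((y + of_real (?t k)) / (1 + of_real (?t k) * y)) ^ Suc n - y ^ Suc n) / of_real (?t k))
     \<longlonglongrightarrow> of_nat (Suc n) * (y ^ n - y ^ Suc (Suc n))" by (rule filterlim_compose)
   moreover have "ap (shift k * g) x = (y + of_real (?t k)) / (1 + of_real (?t k) * y)" for k
    using x apply_shift[OF y, of k] by (simp only: apply_mult y_def)
   ultimately show "(%k. (ap (shift k * g) x ^ Suc n - ap g x ^ Suc n) / of_real (?t k))
    \<longlonglongrightarrow> of_nat (Suc n) * (ap g x ^ n - ap g x ^ Suc (Suc n))" unfolding y_def by simp
  qed
  show "AE x in mu. norm ((ap (shift k * g) x ^ Suc n - ap g x ^ Suc n) / of_real (?t k)) \<le> 4 * real (Suc n)" for k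
  proof (rule AE_I2)
   fix x assume "x \<in> space mu"
   then have x: "norm x = 1" by (simp add: sp)
   define y where "y = ap g x"
   define t where "t = ?t k"
   have t: "0 < t" "t \<le> 1 / 2" by (auto simp: t_def field_simps)
   have y: "norm y = 1" using x by (simp add: y_def norm_apply_circle)
   have d: "1 / 2 \<le> norm (1 + of_real t * y)"
    using norm_triangle_ineq2[of 1 "- (of_real t * y)"] t y by (simp add: norm_mult)
   then have nz: "1 + of_real t * y \<noteq> 0" by auto
   have "(y + of_real t) / (1 + of_real t * y) - y = of_real t * (1 - y * y) / (1 + of_real t * y)"
    using nz by (simp add: field_simps)
   then have "norm ((y + of_real t) / (1 + of_real t * y) - y) = t * norm (1 - y * y) / norm (1 + of_real t * y)"
    using t by (simp add: norm_divide norm_mult)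
   also have "\<dots> \<le> t * 2 / (1 / 2)"
    using d t norm_triangle_ineq4[of 1 "y * y"] y by (intro frac_le mult_left_mono) (auto simp: norm_mult)
   finally have 1: "norm ((y + of_real t) / (1 + of_real t * y) - y) \<le> 4 * t" by simp
   have 2: "ap (shift k * g) x = (y + of_real t) / (1 + of_real t * y)"
    using x apply_shift[OF y, of k] by (simp only: apply_mult y_def t_def)
   have "norm (ap (shift k * g) x ^ Suc n - y ^ Suc n) \<le> real (Suc n) * norm (ap (shift k * g) x - y)"
    using x y by (intro norm_power_diff norm_apply_le) auto
   also have "\<dots> \<le> real (Suc n) * (4 * t)" using 1 unfolding 2 by (intro mult_left_mono) auto
   also have "\<dots> = 4 * real (Suc n) * t" by simp
   finally have "norm (ap (shift k * g) x ^ Suc n - y ^ Suc n) / t \<le> 4 * real (Suc n)"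
    unfolding pos_divide_le_eq[OF t(1)] .
   then show "norm ((ap (shift k * g) x ^ Suc n - ap g x ^ Suc n) / of_real (?t k)) \<le> 4 * real (Suc n)"
    using t unfolding y_def t_def norm_divide norm_of_real by simp
  qed
 qed simp
 moreover have "(LINT x|mu. (ap (shift k * g) x ^ Suc n - ap g x ^ Suc n) / of_real (?t k))
   = (moment mu (shift k * g) (Suc n) - moment mu g (Suc n)) / of_real (?t k)" for k
  unfolding moment_def by (simp only: integral_divide_zero Bochner_Integration.integral_diff[OF apply_power_integrable[OF mu] apply_power_integrable[OF mu]])
 moreover have "(LINT x|mu. of_nat (Suc n) * (ap g x ^ n - ap g x ^ Suc (Suc n)))
   = of_nat (Suc n) * (moment mu g n - moment mu g (Suc (Suc n)))"
  unfolding moment_def by (simp only: integral_mult_right_zero Bochner_Integration.integral_diff[OF apply_power_integrable[OF mu] apply_power_integrable[OF mu]])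
 ultimately show ?thesis by (simp only:)
qed

text \<open>The derivative along the shifts gives the moment of order n minus that of order n + 2.
  The same relation at rot \<i> * g gives their sum, because \<i>^(n + 2) = - \<i>^n; difference and
  sum together yield both moments.\<close>

lemma moment_step:
 assumes mu: "mu \<in> probs" and nu: "nu \<in> probs"
  and eq: "AE g in haar. moment mu g (Suc n) = moment nu g (Suc n)"
 shows "AE g in haar. moment mu g n = moment nu g n" "AE g in haar. moment mu g (Suc (Suc n)) = moment nu g (Suc (Suc n))"
proof -
 have "AE g in haar. \<forall>k. moment mu (shift k * g) (Suc n) = moment nu (shift k * g) (Suc n)"
  unfolding AE_all_countable by (intro allI AE_haar_left eq)
 with eq have D: "AE g in haar. moment mu g n - moment mu g (Suc (Suc n)) = moment nu g n - moment nu g (Suc (Suc n))"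
 proof eventually_elim
  case (elim g)
  have "of_nat (Suc n) * (moment mu g n - moment mu g (Suc (Suc n))) = of_nat (Suc n) * (moment nu g n - moment nu g (Suc (Suc n)))"
   using moment_derivative[OF mu, of g n] moment_derivative[OF nu, of g n]
   unfolding elim(1) spec[OF elim(2)] by (rule LIMSEQ_unique)
  then show ?case unfolding mult_cancel_left by (simp del: of_nat_Suc)
 qed
 have "AE g in haar. moment mu (rot \<i> * g) n - moment mu (rot \<i> * g) (Suc (Suc n)) = moment nu (rot \<i> * g) n - moment nu (rot \<i> * g) (Suc (Suc n))"
  by (rule AE_haar_left[OF D])
 then have S: "AE g in haar. moment mu g n + moment mu g (Suc (Suc n)) = moment nu g n + moment nu g (Suc (Suc n))"
 proof eventually_elim
  case (elim g)
  have "\<i> ^ n * (moment mu g n + moment mu g (Suc (Suc n))) = \<i> ^ n * (moment nu g n + moment nu g (Suc (Suc n)))"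
   using elim by (simp add: moment_rot[OF mu] moment_rot[OF nu] algebra_simps)
  then show ?case unfolding mult_cancel_left by simp
 qed
 show "AE g in haar. moment mu g n = moment nu g n"
  using D S
 proof eventually_elim
  case (elim g)
  have "2 * moment mu g n = 2 * moment nu g n" using arg_cong2[OF elim, of "(+)"] by (simp add: algebra_simps)
  then show ?case by simp
 qed
 show "AE g in haar. moment mu g (Suc (Suc n)) = moment nu g (Suc (Suc n))"
  using D S
 proof eventually_elim
  case (elim g)
  have "2 * moment mu g (Suc (Suc n)) = 2 * moment nu g (Suc (Suc n))"
   using arg_cong2[OF elim(2,1), of "(-)"] by (simp add: algebra_simps)
  then show ?case by simp
 qed
qed

lemma AE_haar_ex: assumes "AE g in haar. P g" shows "\<exists>g. P g"
proof (rule ccontr)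
 assume "\<nexists>g. P g"
 then have "AE g in haar. False" using assms by simp
 then have "emeasure haar UNIV = 0" by (simp add: AE_iff_null null_sets_def)
 then show False using haar_open_pos[of UNIV] by simp
qed

text \<open>From order n one descends to order 1 and climbs from there through all orders. Almost
  every g then has all its moments equal, and one such g gives push g mu = push g nu.\<close>

lemma moments_eq:
 assumes mu: "mu \<in> probs" and nu: "nu \<in> probs" and n: "n > 0"
  and eq: "AE g in haar. moment mu g n = moment nu g n"
 shows "mu = nu"
proof -
 let ?P = "%n. AE g in haar. moment mu g n = moment nu g n"
 have down: "?P (Suc 0)" if "?P (Suc m)" for m
  using that
 proof (induction m)
  case (Suc m)
  show ?case by (rule Suc.IH[OF moment_step(1)[OF mu nu Suc.prems]])
 qed
 obtain m where m: "n = Suc m" using n by (cases n) auto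
 have P1: "?P (Suc 0)" by (rule down[OF eq[unfolded m]])
 have up: "?P (Suc m)" for m
 proof (induction m)
  case (Suc m)
  show ?case by (rule moment_step(2)[OF mu nu Suc.IH])
 qed (rule P1)
 have "AE g in haar. \<forall>m. moment mu g m = moment nu g m"
  unfolding AE_all_countable by (intro allI moment_step(1)[OF mu nu up])
 then obtain g where g: "\<And>m. moment mu g m = moment nu g m" using AE_haar_ex by blast
 have pm: "(LINT x|push g ka. x ^ k) = moment ka g k" if "ka \<in> probs" for ka k
  unfolding moment_def by (rule integral_push[OF that]) (intro borel_circ_cont continuous_intros)
 have "push g mu = push g nu"
  by (rule probs_eqI[OF push_in[OF mu] push_in[OF nu]]) (simp add: pm mu nu g)
 then have "push (ginv g) (push g mu) = push (ginv g) (push g nu)" by simp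
 moreover have "push (ginv g) (push g ka) = ka" if "ka \<in> probs" for ka
 proof -
  note G = G_system_D[OF G_system_prob[OF G_system_circ], unfolded topspace_prob_topology]
  show ?thesis by (simp only: G(6)[OF that, symmetric] ginv G(5)[OF that])
 qed
 ultimately show ?thesis using mu nu by simp
qed

section \<open>Fourier coefficients along rotations and injectivity of the embedding\<close>

context boundary_function
begin

lemma fourier_rotate:
 assumes y: "norm y = 1"
 shows "(LINT om|arc. of_real (u (om * y)) * om ^ n) = cnj y ^ n * (LINT x|arc. of_real (u x) * x ^ n)"
proof -
 have fm: "(%x. complex_of_real (u x) * x ^ n) \<in> borel_measurable (borel_of circ)" by (rule measurable_borel_circ) measurable
 have "(LINT x|arc. of_real (u x) * x ^ n) = (LINT x|push (rot y) arc. of_real (u x) * x ^ n)" by (simp add: push_rot_arc[OF y])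
 also have "\<dots> = (LINT x|arc. of_real (u (ap (rot y) x)) * ap (rot y) x ^ n)" by (rule integral_push[OF arc_in fm])
 also have "\<dots> = (LINT om|arc. y ^ n * (of_real (u (om * y)) * om ^ n))"
  by (rule Bochner_Integration.integral_cong) (auto simp: space_arc apply_rot y power_mult_distrib mult_ac)
 finally have "cnj y ^ n * (LINT x|arc. of_real (u x) * x ^ n) = (cnj y * y) ^ n * (LINT om|arc. of_real (u (om * y)) * om ^ n)"
  by (simp add: power_mult_distrib)
 moreover have "cnj y * y = 1" using y complex_norm_square[of y] by (simp add: mult.commute)
 ultimately show ?thesis by simp
qed

text \<open>As a function of om, u (om * y) has n-th coefficient cnj y^n times that of u, so
  integrating over y = g(x) by Fubini factors the coefficient of u from a moment of mu.\<close>

lemma average_fourier: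
 assumes mu: "mu \<in> probs"
 shows "(LINT om|arc. of_real (average mu (rot om * g)) * om ^ n) = (LINT x|arc. of_real (u x) * x ^ n) * cnj (moment mu g n)"
proof -
 interpret M: prob_space mu using probsD(1)[OF mu] .
 interpret pair_prob_space arc mu ..
 have sp: "space mu = circle" using probsD(2)[OF mu] by simp
 let ?F = "%p. complex_of_real (u (fst p * ap g (snd p))) * fst p ^ n"
 have gm: "ap g \<in> mu \<rightarrow>\<^sub>M borel"
  by (intro circle_measurable[OF mu] borel_circ_cont continuous_intros) auto
 have fsm: "fst \<in> arc \<Otimes>\<^sub>M mu \<rightarrow>\<^sub>M borel"
  using measurable_compose[OF measurable_fst[of arc mu] measurable_prob_id[OF arc_in]] by simp
 have snm: "(%p. ap g (snd p)) \<in> arc \<Otimes>\<^sub>M mu \<rightarrow>\<^sub>M borel"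
  by (rule measurable_compose[OF measurable_snd gm])
 have "(%p. complex_of_real (u (fst p * ap g (snd p)))) \<in> borel_measurable (arc \<Otimes>\<^sub>M mu)"
  by (rule measurable_compose[OF borel_measurable_times[OF fsm snm]]) measurable
 then have m: "?F \<in> borel_measurable (arc \<Otimes>\<^sub>M mu)"
  by (intro borel_measurable_times borel_measurable_power fsm)
 have "integrable (arc \<Otimes>\<^sub>M mu) ?F"
 proof (rule P.integrable_const_bound[OF AE_I2 m])
  fix p assume "p \<in> space (arc \<Otimes>\<^sub>M mu)"
  then have "norm (fst p) = 1" by (auto simp: space_pair_measure space_arc)
  then show "norm (?F p) \<le> B" using u_bounded by (simp add: norm_mult norm_power)
 qed
 then have "integrable (arc \<Otimes>\<^sub>M mu) (%(om, x). complex_of_real (u (om * ap g x)) * om ^ n)"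
  unfolding case_prod_beta .
 from Fubini_integral[OF this]
 have F: "(LINT x|mu. LINT om|arc. complex_of_real (u (om * ap g x)) * om ^ n)
   = (LINT om|arc. LINT x|mu. complex_of_real (u (om * ap g x)) * om ^ n)" .
 have "(LINT om|arc. of_real (average mu (rot om * g)) * om ^ n) = (LINT om|arc. LINT x|mu. complex_of_real (u (om * ap g x)) * om ^ n)"
 proof (rule Bochner_Integration.integral_cong[OF refl])
  fix om assume "om \<in> space arc"
  then have om: "norm om = 1" by (simp add: space_arc)
  have "average mu (rot om * g) = (LINT x|mu. u (om * ap g x))"
   unfolding average_def by (rule Bochner_Integration.integral_cong) (auto simp: sp apply_mult apply_rot om norm_apply_circle)
  then show "of_real (average mu (rot om * g)) * om ^ n = (LINT x|mu. complex_of_real (u (om * ap g x)) * om ^ n)" by simp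
 qed
 also have "\<dots> = (LINT x|mu. cnj (ap g x ^ n) * (LINT x|arc. of_real (u x) * x ^ n))"
  unfolding F[symmetric]
  by (rule Bochner_Integration.integral_cong) (auto simp: sp fourier_rotate norm_apply_circle)
 also have "\<dots> = cnj (moment mu g n) * (LINT x|arc. of_real (u x) * x ^ n)"
  unfolding moment_def by (simp only: integral_mult_left_zero Bochner_Integration.integral_cnj)
 finally show ?thesis by (simp add: mult.commute)
qed

lemma embed_inj:
 assumes nc: "\<not> (\<exists>c. AE x in arc. u x = c)" and mu: "mu \<in> probs" and nu: "nu \<in> probs" and eq: "embed mu = embed nu"
 shows "mu = nu"
proof -
 have A: "AE g in haar. average mu g = average nu g"
  using rep_abs_linf[OF linf_rel_average[OF mu]]
   rep_abs_linf[OF linf_rel_average[OF nu], folded embed_def, folded eq, unfolded embed_def]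
  by eventually_elim simp
 interpret pair_sigma_finite arc haar by standard
 have rm: "rot \<in> borel_measurable arc" by (rule circle_measurable[OF arc_in borel_circ_cont[OF continuous_on_rot]])
 have sm: "snd \<in> arc \<Otimes>\<^sub>M haar \<rightarrow>\<^sub>M borel" using measurable_snd[of arc haar] measurable_cong_sets[OF refl sets_haar] by blast
 have pm: "(%p. rot (fst p) * snd p) \<in> borel_measurable (arc \<Otimes>\<^sub>M haar)"
  by (rule measurable_mult_moebius[OF measurable_compose[OF measurable_fst rm] sm])
 \<comment> \<open>For every rotation the averages agree at almost every g. Measurability of the set
   of agreement allows Fubini to exchange the quantifiers, so that for almost every g they agree
   along almost all rotations.\<close>
 have "{p \<in> space (arc \<Otimes>\<^sub>M haar). average mu (rot (fst p) * snd p) = average nu (rot (fst p) * snd p)} \<in> sets (arc \<Otimes>\<^sub>M haar)"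
  by (intro borel_measurable_eq measurable_compose[OF pm] average_measurable mu nu)
 from AE_commute[OF this]
 have "AE g in haar. AE om in arc. average mu (rot om * g) = average nu (rot om * g)"
  using AE_haar_left[OF A] by simp
 then have E: "AE g in haar. moment mu g n = moment nu g n" if c: "(LINT x|arc. of_real (u x) * x ^ n) \<noteq> (0 :: complex)" for n
 proof eventually_elim
  case (elim g)
  have mm: "(%om. complex_of_real (average ka (rot om * g)) * om ^ n) \<in> borel_measurable arc" if ka: "ka \<in> probs" for ka
  proof -
   have "(%om. rot om * g) \<in> borel_measurable arc" by (rule measurable_mult_moebius[OF rm borel_measurable_const])
   from measurable_compose[OF this average_measurable[OF ka]]
   have "(%om. complex_of_real (average ka (rot om * g))) \<in> borel_measurable arc" by measurable
   then show ?thesis by (intro borel_measurable_times borel_measurable_power measurable_prob_id[OF arc_in])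
  qed
  have "(LINT om|arc. of_real (average mu (rot om * g)) * om ^ n) = (LINT om|arc. complex_of_real (average nu (rot om * g)) * om ^ n)"
   by (rule integral_cong_AE[OF mm[OF mu] mm[OF nu]]) (use elim in \<open>eventually_elim, simp\<close>)
  then have "cnj (moment mu g n) = cnj (moment nu g n)" using c unfolding average_fourier[OF mu] average_fourier[OF nu] mult_cancel_left by simp
  then show ?case by simp
 qed
 obtain n where "n > 0" "(LINT x|arc. of_real (u x) * x ^ n) \<noteq> (0 :: complex)"
  by (rule nonconstant_moment[OF u_measurable u_bounded nc]) (rule that)
 then show ?thesis using moments_eq[OF mu nu] E by blast
qed

lemma compact_embed: "compactin weak_star (embed ` probs)"
proof (rule image_compactin[OF _ continuous_embed])
 show "compactin (prob_topology circ) probs"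
  using compact_prob_topology[OF compact_circ Hausdorff_circ] by (simp add: compact_space_def)
qed

lemma closed_embed: "closedin weak_star (embed ` probs)"
 by (rule compactin_imp_closedin[OF Hausdorff_weak_star compact_embed])

lemma convex_embed: "convex (embed ` probs)"
 unfolding convex_alt
proof (intro ballI allI impI, elim imageE)
 fix F G mu nu and t :: real
 assume "F = embed mu" "mu \<in> probs" "G = embed nu" "nu \<in> probs" "0 \<le> t \<and> t \<le> 1"
 then show "(1 - t) *\<^sub>R F + t *\<^sub>R G \<in> embed ` probs"
  using embed_mix[of mu nu t] mix_measure(1)[OF Hausdorff_circ, of mu nu t] by (auto intro: image_eqI[of _ _ "mix_measure t mu nu"])
qed

lemma invariant_embed: "F \<in> embed ` probs ==> linf_act g F \<in> embed ` probs"
proof (elim imageE)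
 fix mu assume mu: "F = embed mu" "mu \<in> probs"
 show ?thesis unfolding mu(1) embed_push[OF mu(2), symmetric] by (intro imageI push_in mu(2))
qed

text \<open>The preimage of C under \<open>embed\<close> is a nonempty closed convex invariant set
  of measures, hence contains all of them. Both the irreducibility of the image and its
  identification with given subsystems come from this.\<close>

lemma embed_minimal:
 assumes C: "closedin weak_star C" "convex C" "\<And>g F. F \<in> C ==> linf_act g F \<in> C" and ne: "ka \<in> probs" "embed ka \<in> C"
 shows "embed ` probs \<subseteq> C"
proof -
 let ?S = "{mu \<in> topspace (prob_topology circ). embed mu \<in> C}"
 have "?S = probs"
 proof (rule irreducible_probs)
  show "?S \<noteq> {}" using ne by auto
  show "closedin (prob_topology circ) ?S" by (rule closedin_continuous_map_preimage[OF continuous_embed C(1)])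
  show "mix_closed ?S"
   unfolding mix_closed_def
   using mix_measure(1)[OF Hausdorff_circ] embed_mix convexD_alt[OF C(2)] by auto
  show "push g mu \<in> ?S" if "mu \<in> ?S" for g mu using that push_in embed_push C(3) by auto
 qed
 then show ?thesis by auto
qed

text \<open>A continuous injection from a compact space into a Hausdorff space is a closed map onto
  its image.\<close>

lemma embed_homeomorphic:
 assumes inj: "inj_on embed probs"
 shows "homeomorphic_map (prob_topology circ) (subtopology weak_star (embed ` probs)) embed"
proof (rule bijective_closed_imp_homeomorphic_map)
 let ?Y = "subtopology weak_star (embed ` probs)"
 show c: "continuous_map (prob_topology circ) ?Y embed"
  unfolding continuous_map_in_subtopology using continuous_embed by auto
 show "closed_map (prob_topology circ) ?Y embed"
  unfolding closed_map_def
 proof (intro allI impI)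
  fix U assume "closedin (prob_topology circ) U"
  then have "compactin (prob_topology circ) U"
   by (rule closedin_compact_space[OF compact_prob_topology[OF compact_circ Hausdorff_circ]])
  then have "compactin ?Y (embed ` U)" by (rule image_compactin[OF _ c])
  then show "closedin ?Y (embed ` U)"
   by (rule compactin_imp_closedin[OF Hausdorff_space_subtopology[OF Hausdorff_weak_star]])
 qed
 show "embed ` topspace (prob_topology circ) = topspace ?Y" by simp
 show "inj_on embed (topspace (prob_topology circ))" using inj by simp
qed

end

section \<open>The correspondence\<close>

locale nonconstant_boundary = boundary_function +
 assumes nonconst: "\<not> (\<exists>c. AE x in arc. u x = c)"
begin

lemma inj_embed: "inj_on embed probs"
 using embed_inj[OF nonconst] by (intro inj_onI) blast

lemma irreducible_embed: "irreducible_affine (linf_system (embed ` probs))"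
 unfolding irreducible_affine_def vector_system_def affine_structure.simps
proof (intro allI impI, elim conjE)
 fix C assume C: "C \<noteq> {}" "closedin (subtopology weak_star (embed ` probs)) C"
  "\<forall>t\<in>{0..1}. \<forall>x\<in>C. \<forall>y\<in>C. (1 - t) *\<^sub>R x + t *\<^sub>R y \<in> C" "\<forall>g. \<forall>x\<in>C. linf_act g x \<in> C"
 have cl: "closedin weak_star C" by (rule closedin_trans_full[OF C(2) closed_embed])
 have sub: "C \<subseteq> embed ` probs" by (rule closedin_imp_subset[OF C(2)])
 then obtain ka where "ka \<in> probs" "embed ka \<in> C" using C(1) by blast
 moreover have "convex C" unfolding convex_alt using C(3) by auto
 ultimately have "embed ` probs \<subseteq> C" using embed_minimal[OF cl] C(4) by blast
 then show "C = topspace (subtopology weak_star (embed ` probs))" using sub by simp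
qed

lemma nontrivial_irreducible_embed: "nontrivial_irreducible_subsystem (embed ` probs)"
 unfolding nontrivial_irreducible_subsystem_def affine_subsystem_def
proof (intro conjI irreducible_embed compact_embed convex_embed allI ballI invariant_embed)
 have d: "dirac 1 \<in> probs" "dirac (- 1) \<in> probs" by (auto intro: dirac_in)
 show "embed ` probs \<noteq> {}" using d by blast
 have "dirac 1 \<noteq> dirac (- 1)"
 proof
  assume "dirac 1 = dirac (- 1)"
  then have "(1 :: complex) = - 1" by (intro return_inj[OF compact_circ Hausdorff_circ]) auto
  then show False by simp
 qed
 then have "embed (dirac 1) \<noteq> embed (dirac (- 1))" using inj_embed d by (auto dest: inj_onD)
 then show "\<exists>F\<in>embed ` probs. \<exists>F'\<in>embed ` probs. F \<noteq> F'" using d by blast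
qed

lemma K_invariant_arc: "K_invariant (embed arc)"
 unfolding K_invariant_def rotations_eq
 by (auto simp: embed_push[OF arc_in, symmetric] push_rot_arc)

lemma K_invariant_unique:
 assumes F: "F \<in> embed ` probs" "K_invariant F" shows "F = embed arc"
proof -
 obtain mu where mu: "mu \<in> probs" "F = embed mu" using F(1) by blast
 have "push (rot om) mu = mu" if "norm om = 1" for om
 proof (rule embed_inj[OF nonconst push_in[OF mu(1)] mu(1)])
  show "embed (push (rot om) mu) = embed mu"
   using F(2) that unfolding K_invariant_def rotations_eq embed_push[OF mu(1)] mu(2) by simp
 qed
 then show ?thesis using rotation_invariant_arc[OF mu(1)] mu(2) by simp
qed

lemma isomorphic_embed: "affine_isomorphic (linf_system (embed ` probs)) circle_measures_system"
proof -
 let ?Q = "embed ` probs"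
 obtain Psi where Psi: "homeomorphic_maps (prob_topology circ) (subtopology weak_star ?Q) embed Psi"
  using embed_homeomorphic[OF inj_embed] homeomorphic_map_maps by blast
 then have M: "homeomorphic_map (subtopology weak_star ?Q) (prob_topology circ) Psi"
  and inv: "Psi (embed mu) = mu" if "mu \<in> probs" for mu
  using that unfolding homeomorphic_maps_map by auto
 have hm: "homeomorphic_map (subtopology weak_star ?Q) (prob_topology circ) Psi"
  using Psi unfolding homeomorphic_maps_map by blast
 show ?thesis
  unfolding affine_isomorphic_def affine_hom_def circle_sys_sel vector_system_def affine_structure.simps
 proof (intro exI[of _ Psi] conjI allI ballI)
  show "continuous_map (subtopology weak_star ?Q) (prob_topology circ) Psi" by (rule homeomorphic_imp_continuous_map[OF hm])
  show "homeomorphic_map (subtopology weak_star ?Q) (prob_topology circ) Psi" by (rule hm)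
  fix g F assume "F \<in> topspace (subtopology weak_star ?Q)"
  then obtain mu where mu: "mu \<in> probs" "F = embed mu" by auto
  show "Psi (linf_act g F) = push g (Psi F)"
   by (simp only: mu(2) embed_push[OF mu(1), symmetric] inv[OF push_in[OF mu(1)]] inv[OF mu(1)])
 next
  fix t :: real and F G
  assume t: "t \<in> {0..1}" and "F \<in> topspace (subtopology weak_star ?Q)" "G \<in> topspace (subtopology weak_star ?Q)"
  then obtain mu nu where mu: "mu \<in> probs" "F = embed mu" and nu: "nu \<in> probs" "G = embed nu" by auto
  show "Psi ((1 - t) *\<^sub>R F + t *\<^sub>R G) = mix_measure t (Psi F) (Psi G)"
   by (simp only: mu(2) nu(2) embed_mix[OF mu(1) nu(1) t, symmetric] inv[OF mu(1)] inv[OF nu(1)]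
     inv[OF mix_measure(1)[OF Hausdorff_circ mu(1) nu(1) t]])
 qed
qed

text \<open>The image of \<open>embed\<close> is closed, convex, invariant and contains the lift,
  hence contains its orbit hull; conversely the hull is closed, convex, invariant and contains
  \<open>embed arc\<close>, so \<open>embed_minimal\<close> applies to it.\<close>

lemma Q_of_embed:
 assumes h: "\<And>g. h (ap g 0) = (LINT x|arc. u (ap g x))"
 shows "lift_to_G h = embed arc" "Q_of h = embed ` probs"
proof -
 show l: "lift_to_G h = embed arc" unfolding lift_to_G_def embed_def average_def[abs_def] h ..
 let ?O = "convex hull (range (%g. linf_act g (embed arc)))"
 have Q: "Q_of h = weak_star closure_of ?O" by (simp add: Q_of_def l)
 have O: "range (%g. linf_act g (embed arc)) \<subseteq> ?O" by (rule hull_subset)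
 have inv: "linf_act g F \<in> ?O" if "F \<in> ?O" for g F
 proof -
  have "?O \<subseteq> {F. linf_act g F \<in> ?O}"
  proof (rule hull_minimal)
   show "range (%g. linf_act g (embed arc)) \<subseteq> {F. linf_act g F \<in> ?O}"
    using O by (auto simp: linf_act_mult[symmetric])
   show "convex {F. linf_act g F \<in> ?O}"
    by (rule convexI) (simp add: linf_act_mix convexD[OF convex_convex_hull])
  qed
  then show ?thesis using that by blast
 qed
 have inv': "linf_act g F \<in> weak_star closure_of ?O" if "F \<in> weak_star closure_of ?O" for g F
 proof -
  have "closedin weak_star {F \<in> topspace weak_star. linf_act g F \<in> weak_star closure_of ?O}"
   by (rule closedin_continuous_map_preimage[OF continuous_linf_act closedin_closure_of])
  moreover have "?O \<subseteq> {F \<in> topspace weak_star. linf_act g F \<in> weak_star closure_of ?O}"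
   using inv closure_of_subset[of ?O weak_star] by auto
  ultimately have "weak_star closure_of ?O \<subseteq> {F \<in> topspace weak_star. linf_act g F \<in> weak_star closure_of ?O}"
   by (rule closure_of_minimal[rotated])
  then show ?thesis using that by blast
 qed
 show "Q_of h = embed ` probs"
 proof
  have "?O \<subseteq> embed ` probs"
   by (rule hull_minimal) (use arc_in invariant_embed convex_embed in auto)
  then show "Q_of h \<subseteq> embed ` probs" unfolding Q by (rule closure_of_minimal[OF _ closed_embed])
  have "linf_act 1 (embed arc) = embed arc" by (simp add: linf_act_def)
  then have "embed arc \<in> ?O" using O by (metis rangeI subsetD)
  then have "embed arc \<in> weak_star closure_of ?O" using closure_of_subset[of ?O weak_star] by auto
  then show "embed ` probs \<subseteq> Q_of h"
   unfolding Q using inv' arc_in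
   by (intro embed_minimal[of _ arc] closedin_closure_of tvs_closure_convex[OF tvs_weak_star] convex_convex_hull)
 qed
qed

end

section \<open>From harmonic functions to subsystems and back\<close>

lemma harmonic_boundary:
 assumes h: "h \<in> bounded_nonconstant_harmonic"
 obtains u B where "nonconstant_boundary u B" "\<And>g. h (ap g 0) = (LINT x|arc. u (ap g x))"
proof -
 have H: "harmonic_on_disk h" "bounded (h ` disk)" "\<not> h constant_on disk" using h by (auto simp: bounded_nonconstant_harmonic_def)
 obtain u B where u: "u \<in> borel_measurable borel" "\<And>x. \<bar>u x\<bar> \<le> B" "\<And>g. h (ap g 0) = (LINT x|arc. u (ap g x))"
  by (rule fatou[OF H(1,2)]) (rule that)
 have "\<not> (\<exists>c. AE x in arc. u x = c)"
 proof
  assume "\<exists>c. AE x in arc. u x = c"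
  then obtain c where c: "AE x in arc. u x = c" by blast
  have "h z = c" if z: "z \<in> disk" for z
  proof -
   obtain g where g: "ap g 0 = z" using ex_apply_zero[of z] z by auto
   have "h z = (LINT x|arc. poisson z x * u x)"
    using u(3)[of g] integral_push_arc_poisson[OF measurable_borel_circ[OF u(1)], of g] by (simp add: g)
   also have "\<dots> = (LINT x|arc. poisson z x * c)"
   proof (rule integral_cong_AE)
    show "AE x in arc. poisson z x * u x = poisson z x * c" using c by eventually_elim simp
    have "poisson z \<in> borel_measurable arc"
     using z by (intro circle_measurable[OF arc_in] borel_circ_cont poisson_continuous) simp
    then show "(%x. poisson z x * u x) \<in> borel_measurable arc" "(%x. poisson z x * c) \<in> borel_measurable arc"
     using circle_measurable[OF arc_in measurable_borel_circ[OF u(1)]] by simp_all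
   qed
   also have "\<dots> = c" using z integral_poisson[of z] by simp
   finally show ?thesis .
  qed
  then show False using H(3) unfolding constant_on_def by blast
 qed
 then have "nonconstant_boundary u B" using u(1,2) by unfold_locales auto
 then show ?thesis using that u(3) by blast
qed

text \<open>Equality of the classes gives equality almost everywhere on the group; both lifts are
  continuous and nonempty open sets have positive Haar measure, so they agree everywhere.\<close>

lemma lift_inj:
 assumes h: "continuous_on disk h" "h \<in> extensional disk" and h': "continuous_on disk h'" "h' \<in> extensional disk"
  and rel: "linf_rel (%g. h (ap g 0)) (%g. h (ap g 0))"
   "linf_rel (%g. h' (ap g 0)) (%g. h' (ap g 0))"
  and eq: "lift_to_G h = lift_to_G h'"
 shows "h = h'"
proof (rule extensionalityI[OF h(2) h'(2)])
 fix z :: complex assume z: "z \<in> disk"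
 let ?D = "{g. h (ap g 0) \<noteq> h' (ap g 0)}"
 have c: "continuous_on UNIV (%g. f (ap g 0))" if "continuous_on disk f" for f :: "complex => real"
  by (rule continuous_on_compose2[OF that]) (auto intro!: continuous_intros)
 have o: "open ?D" by (rule open_Collect_neq[OF c[OF h(1)] c[OF h'(1)]])
 have "AE g in haar. h (ap g 0) = h' (ap g 0)"
  using rep_abs_linf[OF rel(1)] rep_abs_linf[OF rel(2), folded lift_to_G_def, folded eq, unfolded lift_to_G_def]
  by eventually_elim simp
 then have "emeasure haar ?D = 0" using o by (subst (asm) AE_iff_measurable[of ?D]) auto
 then have "?D = {}" using haar_open_pos[OF o] by blast
 moreover obtain g where "ap g 0 = z" using ex_apply_zero[of z] z by auto
 ultimately show "h z = h' z" by auto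
qed

text \<open>The subsystem determines its rotation invariant point, which is the lift, and the lift
  determines h.\<close>

lemma inj_Q_of: "inj_on Q_of bounded_nonconstant_harmonic"
proof (rule inj_onI)
 fix h h' assume h: "h \<in> bounded_nonconstant_harmonic" and h': "h' \<in> bounded_nonconstant_harmonic" and eq: "Q_of h = Q_of h'"
 obtain u B where u: "nonconstant_boundary u B" "\<And>g. h (ap g 0) = (LINT x|arc. u (ap g x))"
  by (rule harmonic_boundary[OF h]) (rule that)
 obtain u' B' where u': "nonconstant_boundary u' B'" "\<And>g. h' (ap g 0) = (LINT x|arc. u' (ap g x))"
  by (rule harmonic_boundary[OF h']) (rule that)
 interpret U: nonconstant_boundary u B by (rule u(1))
 interpret U': nonconstant_boundary u' B' by (rule u'(1))
 note q = U.Q_of_embed[of h, OF u(2)] and q' = U'.Q_of_embed[of h', OF u'(2)]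
 have "U.embed arc = U'.embed arc"
 proof (rule U'.K_invariant_unique)
  show "U.embed arc \<in> U'.embed ` probs" using eq arc_in unfolding q(2) q'(2) by blast
 qed (rule U.K_invariant_arc)
 then have l: "lift_to_G h = lift_to_G h'" by (simp add: q(1) q'(1))
 have r: "linf_rel (%g. h (ap g 0)) (%g. h (ap g 0))"
  using U.linf_rel_average[OF arc_in] unfolding U.average_def[abs_def] u(2) .
 have r': "linf_rel (%g. h' (ap g 0)) (%g. h' (ap g 0))"
  using U'.linf_rel_average[OF arc_in] unfolding U'.average_def[abs_def] u'(2) .
 show "h = h'"
  using h h' by (intro lift_inj[OF _ _ _ _ r r' l]) (auto simp: bounded_nonconstant_harmonic_def harmonic_on_disk_def)
qed

text \<open>A function invariant under the stabilizer \<open>P\<close> of \<open>1\<close> factors through \<open>g \<mapsto> g(1)\<close>. Since it is only invariant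
 almost everywhere for each element of \<open>P\<close>, its value is averaged over the elements \<open>p\<close> of \<open>P\<close> obtained from \<open>g = k p\<close>.\<close>

lemma stabilizer_invariant_function:
 assumes inv: "\<And>p. ap p 1 = 1 ==> linf_act p F = F"
 obtains u B where "boundary_function u B" "F = abs_linf (%g. u (ap g 1))"
proof -
 obtain B0 where B0: "AE x in haar. \<bar>rep_linf F x\<bar> \<le> B0" by (rule rep_linf_bounded)
 define B where "B = max 0 B0"
 \<comment> \<open>A representative bounded at every point, so that the averages below are defined
   and bounded everywhere.\<close>
 define f where "f x = max (- B) (min B (rep_linf F x))" for x
 have fm [measurable]: "f \<in> borel_measurable borel" unfolding f_def by measurable
 have fb: "\<bar>f x\<bar> \<le> B" for x by (auto simp: f_def B_def)
 have fF: "AE x in haar. f x = rep_linf F x"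
  using B0
 proof eventually_elim
  case (elim x)
  then show ?case unfolding f_def B_def by linarith
 qed
 have f_inv: "AE x in haar. f (x * p) = f x" if p: "ap p 1 = 1" for p
  using fF AE_haar_right[OF fF, of p] rep_linf_act[of p F] unfolding inv[OF p] by eventually_elim simp
 \<comment> \<open>The stabilizer part of y in the factorisation y = rot (ap y 1) * p y.\<close>
 define p where "p y = ginv (rot (ap y 1)) * y" for y
 have a1: "norm (ap y 1) = 1" for y by (simp add: norm_apply_circle)
 have p1: "ap (p y) 1 = 1" for y
 proof -
  have "ap (p y) 1 = cnj (ap y 1) * ap y 1"
   unfolding p_def using a1[of y] by (simp add: apply_mult ginv_rot apply_rot)
  also have "\<dots> = 1" using a1[of y] complex_norm_square[of "ap y 1"] by (simp add: mult.commute)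
  finally show ?thesis .
 qed
 have g1: "ap (ginv q) 1 = 1" if "ap q 1 = 1" for q
  using apply_mult[of 1 "ginv q" q] that by (simp add: ginv apply_one)
 have pq: "p (y * q) = p y * q" if "ap q 1 = 1" for y q using that by (simp add: p_def apply_mult mult.assoc)
 have rm: "(%y. rot (ap y 1)) \<in> borel_measurable borel"
  by (rule measurable_compose[OF measurable_apply_boundary borel_circ_cont[OF continuous_on_rot]]) simp
 have pm [measurable]: "p \<in> borel_measurable borel"
  unfolding p_def using rm by (intro measurable_mult_moebius measurable_compose[OF _ measurable_ginv] measurable_ident_sets[OF refl])
 have gpm: "(%y. ginv (p y)) \<in> borel_measurable borel" by (rule measurable_compose[OF pm measurable_ginv])
 interpret HH: pair_sigma_finite haar haar by standard
 have "AE x in haar. AE y in haar. f (x * ginv (p y)) = f x"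
 proof (rule HH.AE_commute[THEN iffD2])
  have fm1: "fst \<in> borel_measurable (haar \<Otimes>\<^sub>M haar)" "snd \<in> borel_measurable (haar \<Otimes>\<^sub>M haar)"
   using measurable_fst[of haar haar] measurable_snd[of haar haar] measurable_cong_sets[OF refl sets_haar] by blast+
  have "(%z. fst z * ginv (p (snd z))) \<in> borel_measurable (haar \<Otimes>\<^sub>M haar)"
   by (rule measurable_mult_moebius[OF fm1(1) measurable_compose[OF fm1(2) gpm]])
  then show "{z \<in> space (haar \<Otimes>\<^sub>M haar). f (fst z * ginv (p (snd z))) = f (fst z)} \<in> sets (haar \<Otimes>\<^sub>M haar)"
   by (intro borel_measurable_eq measurable_compose[OF _ fm] fm1(1))
  show "AE y in haar. AE x in haar. f (x * ginv (p y)) = f x" by (intro AE_I2 f_inv g1 p1)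
 qed
 \<comment> \<open>Right translation of y by p x preserves null sets and replaces p y by p y * p x.
   The argument x * ginv (p y) becomes rot (ap x 1) * ginv (p y), which involves x only through
   x(1).\<close>
 then have key: "AE x in haar. AE y in haar. f (rot (ap x 1) * ginv (p y)) = f x"
 proof eventually_elim
  case (elim x)
  have e: "x * ginv (p (y * p x)) = rot (ap x 1) * ginv (p y)" for y
   unfolding pq[OF p1] ginv_mult by (simp add: p_def ginv_mult mult.assoc[symmetric] ginv)
  show ?case using AE_haar_right[OF elim, of "p x"] unfolding e .
 qed
 define w where "w = measure haar (mball (1 / 2))"
 have w: "w > 0"
  using haar_ball_pos[of "1 / 2"] haar_ball_finite[of "1 / 2"]
  unfolding w_def by (simp add: emeasure_eq_ennreal_measure less_le)
 have ib: "integrable haar (indicator (mball (1 / 2)) :: moebius => real)"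
  using haar_ball_finite[of "1 / 2"] by (intro integrable_real_indicator) auto
 have iw: "(LINT y|haar. indicator (mball (1 / 2)) y) = w" by (simp add: w_def)
 \<comment> \<open>By \<open>key\<close> the integrand is constant in y for almost every x with z =
   x(1), so its mean over a set of finite positive measure recovers f x while being a measurable
   function of z alone.\<close>
 define v where "v z = (LINT y|haar. f (rot z * ginv (p y)) * indicator (mball (1 / 2)) y) / w" for z
 define u where "u z = (if z \<in> circle then v z else 0)" for z
 have vm: "v \<in> borel_measurable (borel_of circ)"
  unfolding v_def
 proof (intro borel_measurable_divide borel_measurable_const haar.borel_measurable_lebesgue_integral)
  have sm: "snd \<in> borel_measurable (borel_of circ \<Otimes>\<^sub>M haar)"
   using measurable_snd[of "borel_of circ" haar] measurable_cong_sets[OF refl sets_haar] by blast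
  have "(%z. rot (fst z) * ginv (p (snd z))) \<in> borel_measurable (borel_of circ \<Otimes>\<^sub>M haar)"
   by (rule measurable_mult_moebius[OF measurable_compose[OF measurable_fst borel_circ_cont[OF continuous_on_rot]] measurable_compose[OF sm gpm]])
  from borel_measurable_times[OF measurable_compose[OF this fm] measurable_compose[OF sm borel_measurable_indicator[OF mball_sets, of "1 / 2"]]]
  show "(%(z, y). f (rot z * ginv (p y)) * indicator (mball (1 / 2)) y) \<in> borel_measurable (borel_of circ \<Otimes>\<^sub>M haar)"
   by (simp add: case_prod_beta)
 qed
 have ub: "\<bar>u z\<bar> \<le> B" for z
 proof -
  have "\<bar>v z\<bar> \<le> B" if z: "norm z = 1"
  proof -
   have m: "(%y. f (rot z * ginv (p y))) \<in> borel_measurable borel"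
    by (rule measurable_compose[OF measurable_mult_moebius[OF borel_measurable_const gpm] fm])
   have i: "integrable haar (%y. f (rot z * ginv (p y)) * indicator (mball (1 / 2)) y)"
   proof (rule Bochner_Integration.integrable_bound[of _ "%y. B * indicator (mball (1 / 2)) y"])
    show "AE y in haar. norm (f (rot z * ginv (p y)) * indicator (mball (1 / 2)) y) \<le> norm (B * indicator (mball (1 / 2)) y)"
     by (intro AE_I2) (use fb[of "rot z * ginv (p _)"] in \<open>auto split: split_indicator intro: order_trans[OF fb]\<close>)
   qed (use ib m in simp, use m in measurable)
   have "\<bar>LINT y|haar. f (rot z * ginv (p y)) * indicator (mball (1 / 2)) y\<bar>
     \<le> (LINT y|haar. \<bar>f (rot z * ginv (p y)) * indicator (mball (1 / 2)) y\<bar>)" by (rule integral_abs_bound)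
   also have "\<dots> \<le> (LINT y|haar. B * indicator (mball (1 / 2)) y)"
    using i ib fb by (intro integral_mono) (auto split: split_indicator)
   also have "\<dots> = B * w" using iw by simp
   finally show ?thesis using w by (simp add: v_def divide_le_eq)
  qed
  then show ?thesis by (auto simp: u_def B_def)
 qed
 have bf: "boundary_function u B"
 proof
  show "u \<in> borel_measurable borel" unfolding u_def by (rule measurable_extend_circle[OF vm])
 qed (rule ub)
 interpret boundary_function u B by (rule bf)
 have "AE x in haar. u (ap x 1) = f x"
  using key
 proof eventually_elim
  case (elim x)
  have "(LINT y|haar. f (rot (ap x 1) * ginv (p y)) * indicator (mball (1 / 2)) y)
    = (LINT y|haar. f x * indicator (mball (1 / 2)) y)"
  proof (rule integral_cong_AE)
   have m: "(%y. f (rot (ap x 1) * ginv (p y))) \<in> borel_measurable borel"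
    by (rule measurable_compose[OF measurable_mult_moebius[OF borel_measurable_const gpm] fm])
   then show "(%y. f (rot (ap x 1) * ginv (p y)) * indicator (mball (1 / 2)) y) \<in> borel_measurable haar" by measurable
   show "AE y in haar. f (rot (ap x 1) * ginv (p y)) * indicator (mball (1 / 2)) y = f x * indicator (mball (1 / 2)) y"
    using elim by eventually_elim simp
  qed measurable
  also have "\<dots> = f x * w" using iw by simp
  finally show ?case using w a1[of x] by (simp add: u_def v_def)
 qed
 then have "AE x in haar. rep_linf F x = u (ap x 1)" using fF by eventually_elim simp
 moreover have "linf_rel (%g. u (ap g 1)) (%g. u (ap g 1))"
  by (rule linf_relI[OF measurable_u_apply AE_I2]) (auto intro: ub)
 ultimately have "abs_linf (rep_linf F) = abs_linf (%g. u (ap g 1))" by (intro abs_linf_eqI linf_rel_rep)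
 then show ?thesis using that[OF bf] by simp
qed

lemma surj_Q_of:
 assumes Q: "nontrivial_irreducible_subsystem Q"
 shows "\<exists>h\<in>bounded_nonconstant_harmonic. Q_of h = Q"
proof -
 have Q1: "Q \<noteq> {}" "compactin weak_star Q" "convex Q" and Qi: "\<And>g F. F \<in> Q ==> linf_act g F \<in> Q"
  and Q2: "irreducible_affine (linf_system Q)" and Q3: "\<exists>F\<in>Q. \<exists>F'\<in>Q. F \<noteq> F'"
  using Q by (auto simp: nontrivial_irreducible_subsystem_def affine_subsystem_def)
 have Qc: "closedin weak_star Q" by (rule compactin_imp_closedin[OF Hausdorff_weak_star Q1(2)])
 have irr: "C = Q" if C: "C \<noteq> {}" "C \<subseteq> Q" "closedin weak_star C" "convex C" "\<And>g F. F \<in> C ==> linf_act g F \<in> C" for C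
 proof -
  have "closedin (subtopology weak_star Q) C" using C(2,3) closedin_closed_subtopology[OF Qc] by blast
  moreover have "\<forall>t\<in>{0..1}. \<forall>x\<in>C. \<forall>y\<in>C. (1 - t) *\<^sub>R x + t *\<^sub>R y \<in> C" using convexD_alt[OF C(4)] by auto
  ultimately have "C = topspace (subtopology weak_star Q)"
   using Q2 C(1,5) unfolding irreducible_affine_def vector_system_def affine_structure.simps by blast
  then show ?thesis by simp
 qed
 have "\<exists>F\<in>Q. \<forall>p. ap p 1 = 1 \<longrightarrow> linf_act p F = F"
 proof (rule stabilizer_fixed_point[where T = weak_star and act = linf_act, OF tvs_weak_star Q1(2,3,1) Qi])
  show "continuous_map (subtopology weak_star Q) weak_star (linf_act g)" for g
   by (rule continuous_map_from_subtopology[OF continuous_linf_act])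
  show "affine_on Q (linf_act g)" for g unfolding affine_on_def[OF tvs_weak_star] by (simp add: linf_act_mix)
  show "linf_act (g * h) F = linf_act g (linf_act h F)" for g h F by (rule linf_act_mult)
 qed
 then obtain F where F: "F \<in> Q" "\<And>p. ap p 1 = 1 ==> linf_act p F = F" by blast
 obtain u B where u: "boundary_function u B" "F = abs_linf (%g. u (ap g 1))"
  by (rule stabilizer_invariant_function[OF F(2)]) (assumption | rule that)+
 interpret boundary_function u B by (rule u(1))
 have d1: "dirac 1 \<in> probs" by (rule dirac_in) simp
 have Fd: "embed (dirac 1) = F" unfolding u(2) by (rule embed_dirac) simp
 have "embed ` probs \<subseteq> Q" by (rule embed_minimal[OF Qc Q1(3) Qi d1]) (auto simp: Fd F(1))
 then have EQ: "embed ` probs = Q"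
  using d1 by (intro irr closed_embed convex_embed invariant_embed) auto
 \<comment> \<open>Otherwise all point masses would have the same image, {F} would be an invariant
   closed convex set, and irreducibility would reduce Q to one point.\<close>
 have nonconst: "\<not> (\<exists>c. AE x in arc. u x = c)"
 proof
  assume "\<exists>c. AE x in arc. u x = c"
  then obtain c where c: "AE x in arc. u x = c" by blast
  have e: "embed (dirac z) = abs_linf (%_. c)" if z: "norm z = 1" for z
   unfolding embed_dirac[OF z]
  proof (rule abs_linf_eqI)
   show "linf_rel (%g. u (ap g z)) (%g. u (ap g z))"
    by (rule linf_relI[OF measurable_u_apply[OF z] AE_I2]) (rule u_bounded)
   show "linf_rel (%_. c) (%_. c)" by (rule linf_relI[of _ "\<bar>c\<bar>"]) auto
   show "AE x in haar. u (ap x z) = c" by (rule AE_arc_haar[OF c z])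
  qed
  have "{F} = Q"
  proof (rule irr)
   show "closedin weak_star {F}" by (rule compactin_imp_closedin[OF Hausdorff_weak_star]) simp
   show "linf_act g G \<in> {F}" if "G \<in> {F}" for g G
   proof -
    have "linf_act g F = embed (dirac (ap g 1))"
     unfolding Fd[symmetric] embed_push[OF d1, symmetric] by (simp add: push_dirac)
    also have "\<dots> = F" using e[of "ap g 1"] e[of 1] Fd by (simp add: norm_apply_circle)
    finally show ?thesis using that by simp
   qed
  qed (use F(1) in auto)
  then show False using Q3 by blast
 qed
 interpret nonconstant_boundary u B by unfold_locales (rule nonconst)
 define h where "h = restrict (%z. LINT x|arc. poisson z x * u x) disk"
 note H = poisson_harmonic[OF u_measurable u_bounded, folded h_def]
 \<comment> \<open>If h were constant, injectivity of \<open>embed\<close> would make arc length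
   invariant under the whole group, although its first moment moves to g(0).\<close>
 have "\<not> h constant_on disk"
 proof
  assume "h constant_on disk"
  then obtain c where c: "\<And>z. norm z < 1 ==> h z = c" unfolding constant_on_def by auto
  have av: "average arc g = c" for g unfolding average_def H(3)[symmetric] by (rule c) simp
  have "push g arc = arc" for g
  proof (rule embed_inj[OF nonconst push_in[OF arc_in] arc_in])
   have "average arc = (%_. c)" using av by blast
   then show "embed (push g arc) = embed arc"
    unfolding embed_push[OF arc_in] unfolding embed_def unfolding linf_act_abs[OF linf_rel_average[OF arc_in]] by simp
  qed
  then have "ap g 0 = 0" for g using moment_push_arc[of g 1] moment_arc[of 1] by simp
  then show False using ex_apply_zero[of "1 / 2"] by auto
 qed
 moreover have "bounded (h ` disk)" unfolding bounded_iff by (rule exI[of _ B]) (use H(2) in auto)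
 ultimately have "h \<in> bounded_nonconstant_harmonic"
  using H(1) by (auto simp: bounded_nonconstant_harmonic_def h_def)
 moreover have "Q_of h = Q" using Q_of_embed(2)[OF H(3)] EQ by simp
 ultimately show ?thesis by blast
qed

lemma Q_of_harmonic:
 assumes h: "h \<in> bounded_nonconstant_harmonic"
 shows "nontrivial_irreducible_subsystem (Q_of h)" "lift_to_G h \<in> Q_of h" "K_invariant (lift_to_G h)"
  "F \<in> Q_of h ==> K_invariant F ==> F = lift_to_G h" "affine_isomorphic (linf_system (Q_of h)) circle_measures_system"
proof -
 obtain u B where u: "nonconstant_boundary u B" "\<And>g. h (ap g 0) = (LINT x|arc. u (ap g x))"
  by (rule harmonic_boundary[OF h]) (rule that)
 interpret nonconstant_boundary u B by (rule u(1))
 note q = Q_of_embed[of h, OF u(2)]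
 show "nontrivial_irreducible_subsystem (Q_of h)" "K_invariant (lift_to_G h)" "affine_isomorphic (linf_system (Q_of h)) circle_measures_system"
  unfolding q by (rule nontrivial_irreducible_embed K_invariant_arc isomorphic_embed)+
 show "lift_to_G h \<in> Q_of h" unfolding q using arc_in by blast
 show "F \<in> Q_of h ==> K_invariant F ==> F = lift_to_G h" unfolding q by (rule K_invariant_unique)
qed

theorem theorem3p1:
  shows "(\<forall>h\<in>bounded_nonconstant_harmonic.
            nontrivial_irreducible_subsystem (Q_of h)
            \<and> lift_to_G h \<in> Q_of h \<and> K_invariant (lift_to_G h)
            \<and> (\<forall>F\<in>Q_of h. K_invariant F \<longrightarrow> F = lift_to_G h)
            \<and> affine_isomorphic (linf_system (Q_of h)) circle_measures_system)
       \<and> bij_betw Q_of bounded_nonconstant_harmonic {Q. nontrivial_irreducible_subsystem Q}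
       \<and> universal_irreducible_affine TYPE('v::real_vector) circle_measures_system
       \<and> universal_minimal_strongly_proximal TYPE('y) (top_of_set circle) moebius_apply"
proof (intro conjI universal_circle_measures universal_circle ballI impI)
 show "bij_betw Q_of bounded_nonconstant_harmonic {Q. nontrivial_irreducible_subsystem Q}"
  unfolding bij_betw_def
 proof (intro conjI inj_Q_of subset_antisym subsetI)
  fix Q assume "Q \<in> {Q. nontrivial_irreducible_subsystem Q}"
  then show "Q \<in> Q_of ` bounded_nonconstant_harmonic" using surj_Q_of[of Q] by auto
 qed (use Q_of_harmonic(1) in auto)
qed (rule Q_of_harmonic; assumption)+

end
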